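(* Let $k$ be a commutative ring and let $A$ be a (not necessarily commutative) $k$-algebra. Then the following five categories are isomorphic: the category $\underline{\mathrm{Desc}}(A/k)$ of descent data, the category $\mathcal{YD}^{A^e}$ of right Yetter-Drinfeld $A^e$-modules, the category $\mathcal{M}^{A\otimes A}$ of right comodules over the Sweedler canonical coring $A\otimes A$, the weak right center $\mathcal{W}_r({}_A\mathcal{M}_A)$ and the right center $\mathcal{Z}_r({}_A\mathcal{M}_A)$ of the monoidal category of $A$-bimodules. If moreover $A$ is faithfully flat over $k$, then these isomorphic categories are equivalent to the category of $k$-modules.
   Context: Conventions: $\otimes=\otimes_k$; algebras are associative and unital; $A$-bimodules are $k$-central, i.e. they are modules over $A^e=A\otimes A^{\rm op}$. The category ${}_A\mathcal{M}_A$ of $A$-bimodules is monoidal with tensor product $\otimes_A$ and unit object $A$ (treated as if strict). Comodules. An object of $\mathcal{M}^{A\otimes A}$ is a right $A$-module $V$ with a $k$-linear map $\rho: V\to V\otimes A$, written $\rho(v)=v_{[0]}\otimes v_{[1]}$ (summation understood), such that for all $v\in V$, $a\in A$: (1) $v_{[0]}v_{[1]}=v$; (2) $\rho(v_{[0]})\otimes v_{[1]}=v_{[0]}\otimes 1\otimes v_{[1]}$ in $V\otimes A\otimes A$; (3) $\rho(va)=v_{[0]}\otimes v_{[1]}a$. Morphisms are right $A$-linear maps $f$ with $\rho'\circ f=(f\otimes A)\circ\rho$. Yetter-Drinfeld modules. An object of $\mathcal{YD}^{A^e}$ is a pair $(V,\rho)$ with $V$ an $A$-bimodule and $(V,\rho)\in\mathcal{M}^{A\otimes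 A}$ (for the right $A$-module structure of $V$) such that for all $a\in A$, $v\in V$: (4) $\rho(av)=v_{[0]}\otimes av_{[1]}$; (5) $av_{[0]}\otimes v_{[1]}=v_{[0]}a\otimes v_{[1]}$. Morphisms are $A$-bimodule maps that are also $A\otimes A$-comodule maps. Descent data. For an $A$-bimodule $V$, regard $A\otimes V$ and $V\otimes A$ as $A\otimes A$-bimodules factorwise, i.e. $(a\otimes b)(x\otimes v)(c\otimes d)=axc\otimes bvd$ and $(a\otimes b)(v\otimes x)(c\otimes d)=avc\otimes bxd$. For an $A\otimes A$-bimodule map $g:A\otimes V\to V\otimes A$, write $g(a\otimes v)=\sum_i v_i\otimes a_i$ and define $g_1:A\otimes A\otimes V\to A\otimes V\otimes A$, $g_1(b\otimes a\otimes v)=\sum_i b\otimes v_i\otimes a_i$; $g_2:A\otimes A\otimes V\to V\otimes A\otimes A$, $g_2(a\otimes b\otimes v)=\sum_i v_i\otimes b\otimes a_i$; $g_3:A\otimes V\otimes A\to V\otimes A\otimes A$, $g_3(a\otimes v\otimes b)=\sum_i v_i\otimes a_i\otimes b$. An object of $\underline{\mathrm{Desc}}(A/k)$ is a pair $(V,g)$, $V$ an $A$-bimodule and $g:A\otimes V\to V\otimes A$ an $A\otimes A$-bimodule map, with $g_2=g_3\circ g_1$ and $\psi(g(1\otimes v))=v$ for all $v\in V$, where $\psi:V\otimes A\to V$, $\psi(v\otimes a)=va$. A morphism $(V,g)\to(V',g')$ is an $A$-bimodule map $f:V\to V'$ with $(f\otimes A)\circ g=g'\circ(A\otimes f)$.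 Centers. For a monoidal category $(\mathcal{C},\otimes,I)$, the weak right center $\mathcal{W}_r(\mathcal{C})$ has as objects the pairs $(V,c_{-,V})$ with $V\in\mathcal{C}$ and $c_{-,V}:-\otimes V\to V\otimes -$ a natural transformation such that $c_{I,V}$ is the canonical isomorphism $I\otimes V\cong V\otimes I$ and $c_{X\otimes Y,V}=(c_{X,V}\otimes Y)\circ(X\otimes c_{Y,V})$ for all $X,Y\in\mathcal{C}$; a morphism $(V,c_{-,V})\to(V',c_{-,V'})$ is a morphism $f:V\to V'$ in $\mathcal{C}$ with $(f\otimes X)\circ c_{X,V}=c_{X,V'}\circ(X\otimes f)$ for all $X$. The right center $\mathcal{Z}_r(\mathcal{C})$ is the full subcategory of those $(V,c_{-,V})$ for which $c_{-,V}$ is a natural isomorphism. *)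

theory Defs
  imports
    "HOL-Algebra.Module"
    "HOL-Algebra.Generated_Groups"
    "HOL-Algebra.Free_Abelian_Groups"
    "HOL-Library.Infinite_Typeclass"
begin

section \<open>Categories, isomorphism and equivalence of categories\<close>

text \<open>
  Hom-sets are indexed by their source and target and need not be disjoint; this is why
  composition takes the three objects as arguments.
\<close>

record ('o, 'm) cat =
  Obj :: "'o set"
  Hom :: "'o \<Rightarrow> 'o \<Rightarrow> 'm set"
  Cmp :: "'o \<Rightarrow> 'o \<Rightarrow> 'o \<Rightarrow> 'm \<Rightarrow> 'm \<Rightarrow> 'm"
  Idn :: "'o \<Rightarrow> 'm"

locale category =
  fixes C :: "('o, 'm, 'z) cat_scheme"
  assumes Idn_in_Hom: "X \<in> Obj C \<Longrightarrow> Idn C X \<in> Hom C X X"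
    and Cmp_in_Hom:
      "\<lbrakk>X \<in> Obj C; Y \<in> Obj C; Z \<in> Obj C; f \<in> Hom C X Y; g \<in> Hom C Y Z\<rbrakk>
        \<Longrightarrow> Cmp C X Y Z g f \<in> Hom C X Z"
    and Cmp_Idn_left:
      "\<lbrakk>X \<in> Obj C; Y \<in> Obj C; f \<in> Hom C X Y\<rbrakk> \<Longrightarrow> Cmp C X Y Y (Idn C Y) f = f"
    and Cmp_Idn_right:
      "\<lbrakk>X \<in> Obj C; Y \<in> Obj C; f \<in> Hom C X Y\<rbrakk> \<Longrightarrow> Cmp C X X Y f (Idn C X) = f"
    and Cmp_assoc:
      "\<lbrakk>W \<in> Obj C; X \<in> Obj C; Y \<in> Obj C; Z \<in> Obj C;
        f \<in> Hom C W X; g \<in> Hom C X Y; h \<in> Hom C Y Z\<rbrakk>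
        \<Longrightarrow> Cmp C W Y Z h (Cmp C W X Y g f) = Cmp C W X Z (Cmp C X Y Z h g) f"

definition inverse_arrows ::
  "('o, 'm, 'z) cat_scheme \<Rightarrow> 'o \<Rightarrow> 'o \<Rightarrow> 'm \<Rightarrow> 'm \<Rightarrow> bool" where
  "inverse_arrows C X Y f g \<longleftrightarrow>
     f \<in> Hom C X Y \<and> g \<in> Hom C Y X \<and>
     Cmp C X Y X g f = Idn C X \<and> Cmp C Y X Y f g = Idn C Y"

definition iso_arrow :: "('o, 'm, 'z) cat_scheme \<Rightarrow> 'o \<Rightarrow> 'o \<Rightarrow> 'm \<Rightarrow> bool" where
  "iso_arrow C X Y f \<longleftrightarrow> (\<exists>g. inverse_arrows C X Y f g)"

definition inv_arrow :: "('o, 'm, 'z) cat_scheme \<Rightarrow> 'o \<Rightarrow> 'o \<Rightarrow> 'm \<Rightarrow> 'm" where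
  "inv_arrow C X Y f = (THE g. inverse_arrows C X Y f g)"

locale cat_functor = C: category C + D: category D
  for C :: "('o, 'm, 'z) cat_scheme" and D :: "('p, 'n, 'y) cat_scheme" +
  fixes Fo :: "'o \<Rightarrow> 'p" and Fm :: "'o \<Rightarrow> 'o \<Rightarrow> 'm \<Rightarrow> 'n"
  assumes Fo_in_Obj: "X \<in> Obj C \<Longrightarrow> Fo X \<in> Obj D"
    and Fm_in_Hom:
      "\<lbrakk>X \<in> Obj C; Y \<in> Obj C; f \<in> Hom C X Y\<rbrakk> \<Longrightarrow> Fm X Y f \<in> Hom D (Fo X) (Fo Y)"
    and Fm_Idn: "X \<in> Obj C \<Longrightarrow> Fm X X (Idn C X) = Idn D (Fo X)"
    and Fm_Cmp:
      "\<lbrakk>X \<in> Obj C; Y \<in> Obj C; Z \<in> Obj C; f \<in> Hom C X Y; g \<in> Hom C Y Z\<rbrakk>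
        \<Longrightarrow> Fm X Z (Cmp C X Y Z g f) = Cmp D (Fo X) (Fo Y) (Fo Z) (Fm Y Z g) (Fm X Y f)"

text \<open>Isomorphism (not merely equivalence) of categories: two strictly inverse functors.\<close>

definition isomorphic_categories ::
  "('o, 'm, 'z) cat_scheme \<Rightarrow> ('p, 'n, 'y) cat_scheme \<Rightarrow> bool" where
  "isomorphic_categories C D \<longleftrightarrow>
     (\<exists>Fo Fm Go Gm. cat_functor C D Fo Fm \<and> cat_functor D C Go Gm \<and>
        (\<forall>X\<in>Obj C. Go (Fo X) = X) \<and>
        (\<forall>Y\<in>Obj D. Fo (Go Y) = Y) \<and>
        (\<forall>X\<in>Obj C. \<forall>X'\<in>Obj C. \<forall>f\<in>Hom C X X'. Gm (Fo X) (Fo X') (Fm X X' f) = f) \<and>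
        (\<forall>Y\<in>Obj D. \<forall>Y'\<in>Obj D. \<forall>g\<in>Hom D Y Y'. Fm (Go Y) (Go Y') (Gm Y Y' g) = g))"

definition natural_isomorphism ::
  "('o, 'm, 'z) cat_scheme \<Rightarrow> ('p, 'n, 'y) cat_scheme \<Rightarrow>
   ('o \<Rightarrow> 'p) \<Rightarrow> ('o \<Rightarrow> 'o \<Rightarrow> 'm \<Rightarrow> 'n) \<Rightarrow> ('o \<Rightarrow> 'p) \<Rightarrow> ('o \<Rightarrow> 'o \<Rightarrow> 'm \<Rightarrow> 'n) \<Rightarrow>
   ('o \<Rightarrow> 'n) \<Rightarrow> bool" where
  "natural_isomorphism C D Fo Fm Go Gm \<eta> \<longleftrightarrow>
     (\<forall>X\<in>Obj C. iso_arrow D (Fo X) (Go X) (\<eta> X)) \<and>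
     (\<forall>X\<in>Obj C. \<forall>Y\<in>Obj C. \<forall>f\<in>Hom C X Y.
        Cmp D (Fo X) (Go X) (Go Y) (Gm X Y f) (\<eta> X) =
        Cmp D (Fo X) (Fo Y) (Go Y) (\<eta> Y) (Fm X Y f))"

definition equivalent_categories ::
  "('o, 'm, 'z) cat_scheme \<Rightarrow> ('p, 'n, 'y) cat_scheme \<Rightarrow> bool" where
  "equivalent_categories C D \<longleftrightarrow>
     (\<exists>Fo Fm Go Gm \<eta> \<epsilon>. cat_functor C D Fo Fm \<and> cat_functor D C Go Gm \<and>
        natural_isomorphism C C (\<lambda>X. X) (\<lambda>X Y f. f)
          (\<lambda>X. Go (Fo X)) (\<lambda>X Y f. Gm (Fo X) (Fo Y) (Fm X Y f)) \<eta> \<and>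
        natural_isomorphism D D
          (\<lambda>Y. Fo (Go Y)) (\<lambda>X Y g. Fm (Go X) (Go Y) (Gm X Y g)) (\<lambda>Y. Y) (\<lambda>X Y g. g) \<epsilon>)"

text \<open>Categories of structured sets whose morphisms are extensional functions.\<close>

definition concrete_cat ::
  "'o set \<Rightarrow> ('o \<Rightarrow> 'o \<Rightarrow> ('u \<Rightarrow> 'u) set) \<Rightarrow> ('o \<Rightarrow> 'u set) \<Rightarrow> ('o, 'u \<Rightarrow> 'u) cat" where
  "concrete_cat Ob Hm U =
     \<lparr> Obj = Ob, Hom = Hm,
       Cmp = (\<lambda>X Y Z g f. compose (U X) g f),
       Idn = (\<lambda>X. \<lambda>x\<in>U X. x) \<rparr>"


section \<open>Centers of monoidal categories\<close>

text \<open>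
  \<open>tensM M X X' Y Y' f g\<close> is \<open>f \<otimes> g : X \<otimes> Y \<rightarrow> X' \<otimes> Y'\<close>;
  \<open>assoc M X Y Z : (X \<otimes> Y) \<otimes> Z \<rightarrow> X \<otimes> (Y \<otimes> Z)\<close>;
  \<open>lunit M X : I \<otimes> X \<rightarrow> X\<close> and \<open>runit M X : X \<otimes> I \<rightarrow> X\<close>.
\<close>

record ('o, 'm) moncat = "('o, 'm) cat" +
  tensO :: "'o \<Rightarrow> 'o \<Rightarrow> 'o"
  tensM :: "'o \<Rightarrow> 'o \<Rightarrow> 'o \<Rightarrow> 'o \<Rightarrow> 'm \<Rightarrow> 'm \<Rightarrow> 'm"
  unitO :: "'o"
  assoc :: "'o \<Rightarrow> 'o \<Rightarrow> 'o \<Rightarrow> 'm"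
  lunit :: "'o \<Rightarrow> 'm"
  runit :: "'o \<Rightarrow> 'm"

text \<open>
  The objects \<open>(V, c)\<close> of the weak right center. As the tensor product is not strictly
  associative, \<open>c\<^bsub>X\<otimes>Y,V\<^esub> = (c\<^bsub>X,V\<^esub> \<otimes> Y) \<circ> (X \<otimes> c\<^bsub>Y,V\<^esub>)\<close> is written with the
  constraints:
  \<open>(X\<otimes>Y)\<otimes>V \<rightarrow> X\<otimes>(Y\<otimes>V) \<rightarrow> X\<otimes>(V\<otimes>Y) \<rightarrow> (X\<otimes>V)\<otimes>Y \<rightarrow> (V\<otimes>X)\<otimes>Y \<rightarrow> V\<otimes>(X\<otimes>Y)\<close>.
  The family \<open>c\<close> is extensional, so that it carries no information besides its components.
\<close>

definition weak_half_braidings ::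
  "('o, 'm, 'z) moncat_scheme \<Rightarrow> 'o \<Rightarrow> ('o \<Rightarrow> 'm) set" where
  "weak_half_braidings M V =
     {c \<in> (\<Pi>\<^sub>E X\<in>Obj M. Hom M (tensO M X V) (tensO M V X)).
        (\<forall>X\<in>Obj M. \<forall>Y\<in>Obj M. \<forall>f\<in>Hom M X Y.
           Cmp M (tensO M X V) (tensO M V X) (tensO M V Y)
             (tensM M V V X Y (Idn M V) f) (c X) =
           Cmp M (tensO M X V) (tensO M Y V) (tensO M V Y)
             (c Y) (tensM M X Y V V f (Idn M V))) \<and>
        c (unitO M) =
          Cmp M (tensO M (unitO M) V) V (tensO M V (unitO M))
            (inv_arrow M (tensO M V (unitO M)) V (runit M V)) (lunit M V) \<and>
        (\<forall>X\<in>Obj M. \<forall>Y\<in>Obj M.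
           c (tensO M X Y) =
             (let S0 = tensO M (tensO M X Y) V;
                  S1 = tensO M X (tensO M Y V);
                  S2 = tensO M X (tensO M V Y);
                  S3 = tensO M (tensO M X V) Y;
                  S4 = tensO M (tensO M V X) Y;
                  S5 = tensO M V (tensO M X Y)
              in Cmp M S0 S4 S5 (assoc M V X Y)
                  (Cmp M S0 S3 S4 (tensM M (tensO M X V) (tensO M V X) Y Y (c X) (Idn M Y))
                    (Cmp M S0 S2 S3 (inv_arrow M S3 S2 (assoc M X V Y))
                      (Cmp M S0 S1 S2 (tensM M X X (tensO M Y V) (tensO M V Y) (Idn M X) (c Y))
                        (assoc M X Y V))))))}"

definition weak_right_center ::
  "('o, 'm, 'z) moncat_scheme \<Rightarrow> ('o \<times> ('o \<Rightarrow> 'm), 'm) cat" where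
  "weak_right_center M =
     \<lparr> Obj = {(V, c). V \<in> Obj M \<and> c \<in> weak_half_braidings M V},
       Hom = (\<lambda>(V, c) (V', c').
         {f \<in> Hom M V V'. \<forall>X\<in>Obj M.
            Cmp M (tensO M X V) (tensO M V X) (tensO M V' X)
              (tensM M V V' X X f (Idn M X)) (c X) =
            Cmp M (tensO M X V) (tensO M X V') (tensO M V' X)
              (c' X) (tensM M X X V V' (Idn M X) f)}),
       Cmp = (\<lambda>P Q R. Cmp M (fst P) (fst Q) (fst R)),
       Idn = (\<lambda>P. Idn M (fst P)) \<rparr>"

definition right_center ::
  "('o, 'm, 'z) moncat_scheme \<Rightarrow> ('o \<times> ('o \<Rightarrow> 'm), 'm) cat" where
  "right_center M =
     (weak_right_center M)
       \<lparr> Obj := {(V, c) \<in> Obj (weak_right_center M).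
                   \<forall>X\<in>Obj M. iso_arrow M (tensO M X V) (tensO M V X) (c X)} \<rparr>"


section \<open>Tensor products\<close>

text \<open>
  The carriers of all modules lie in one infinite type \<open>'u\<close>, which serves as universe. The
  balanced tensor product of \<open>X\<close> (with right action \<open>ra\<close>) and \<open>Y\<close> (with left action \<open>la\<close>)
  over the set \<open>S\<close> of scalars is the usual quotient of the free abelian group on
  \<open>carrier X \<times> carrier Y\<close>. Since \<open>'u\<close> is infinite, this quotient is equipotent to a subset
  of \<open>'u\<close>; the tensor product is its copy along a chosen injection into \<open>'u\<close>.
\<close>

definition tensor_relators ::
  "'r set \<Rightarrow> ('u, 'm) ring_scheme \<Rightarrow> ('u \<Rightarrow> 'r \<Rightarrow> 'u) \<Rightarrow>
   ('u, 'n) ring_scheme \<Rightarrow> ('r \<Rightarrow> 'u \<Rightarrow> 'u) \<Rightarrow> ('u \<times> 'u \<Rightarrow>\<^sub>0 int) set" where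
  "tensor_relators S X ra Y la =
     {frag_of (x \<oplus>\<^bsub>X\<^esub> x', y) - frag_of (x, y) - frag_of (x', y) | x x' y.
        x \<in> carrier X \<and> x' \<in> carrier X \<and> y \<in> carrier Y} \<union>
     {frag_of (x, y \<oplus>\<^bsub>Y\<^esub> y') - frag_of (x, y) - frag_of (x, y') | x y y'.
        x \<in> carrier X \<and> y \<in> carrier Y \<and> y' \<in> carrier Y} \<union>
     {frag_of (ra x r, y) - frag_of (x, la r y) | x r y.
        x \<in> carrier X \<and> r \<in> S \<and> y \<in> carrier Y}"

definition tensor_kernel ::
  "'r set \<Rightarrow> ('u, 'm) ring_scheme \<Rightarrow> ('u \<Rightarrow> 'r \<Rightarrow> 'u) \<Rightarrow>
   ('u, 'n) ring_scheme \<Rightarrow> ('r \<Rightarrow> 'u \<Rightarrow> 'u) \<Rightarrow> ('u \<times> 'u \<Rightarrow>\<^sub>0 int) set" where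
  "tensor_kernel S X ra Y la =
     generate (free_Abelian_group (carrier X \<times> carrier Y)) (tensor_relators S X ra Y la)"

definition tensor_quotient ::
  "'r set \<Rightarrow> ('u, 'm) ring_scheme \<Rightarrow> ('u \<Rightarrow> 'r \<Rightarrow> 'u) \<Rightarrow>
   ('u, 'n) ring_scheme \<Rightarrow> ('r \<Rightarrow> 'u \<Rightarrow> 'u) \<Rightarrow> ('u \<times> 'u \<Rightarrow>\<^sub>0 int) set monoid" where
  "tensor_quotient S X ra Y la =
     free_Abelian_group (carrier X \<times> carrier Y) Mod tensor_kernel S X ra Y la"

definition tensor_code ::
  "'r set \<Rightarrow> ('u::infinite, 'm) ring_scheme \<Rightarrow> ('u \<Rightarrow> 'r \<Rightarrow> 'u) \<Rightarrow>
   ('u, 'n) ring_scheme \<Rightarrow> ('r \<Rightarrow> 'u \<Rightarrow> 'u) \<Rightarrow> ('u \<times> 'u \<Rightarrow>\<^sub>0 int) set \<Rightarrow> 'u" where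
  "tensor_code S X ra Y la =
     (SOME e. inj_on e (carrier (tensor_quotient S X ra Y la)))"

text \<open>The fields \<open>mult\<close> and \<open>one\<close> play no role for modules and are set to \<open>undefined\<close>.\<close>

definition tensor_group ::
  "'r set \<Rightarrow> ('u::infinite, 'm) ring_scheme \<Rightarrow> ('u \<Rightarrow> 'r \<Rightarrow> 'u) \<Rightarrow>
   ('u, 'n) ring_scheme \<Rightarrow> ('r \<Rightarrow> 'u \<Rightarrow> 'u) \<Rightarrow> 'u ring" where
  "tensor_group S X ra Y la =
     (let Q = tensor_quotient S X ra Y la;
          e = tensor_code S X ra Y la;
          T = e ` carrier Q;
          d = inv_into (carrier Q) e
      in \<lparr> carrier = T, mult = undefined, one = undefined,
           ring.zero = e \<one>\<^bsub>Q\<^esub>, ring.add = (\<lambda>s\<in>T. \<lambda>t\<in>T. e (d s \<otimes>\<^bsub>Q\<^esub> d t)) \<rparr>)"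

definition pure_tensor ::
  "'r set \<Rightarrow> ('u::infinite, 'm) ring_scheme \<Rightarrow> ('u \<Rightarrow> 'r \<Rightarrow> 'u) \<Rightarrow>
   ('u, 'n) ring_scheme \<Rightarrow> ('r \<Rightarrow> 'u \<Rightarrow> 'u) \<Rightarrow> 'u \<Rightarrow> 'u \<Rightarrow> 'u" where
  "pure_tensor S X ra Y la x y =
     tensor_code S X ra Y la
       (tensor_kernel S X ra Y la #>\<^bsub>free_Abelian_group (carrier X \<times> carrier Y)\<^esub> frag_of (x, y))"

text \<open>The additive map on a tensor product with prescribed values \<open>\<phi> x y\<close> on pure tensors.\<close>

definition tensor_lift ::
  "'r set \<Rightarrow> ('u::infinite, 'm) ring_scheme \<Rightarrow> ('u \<Rightarrow> 'r \<Rightarrow> 'u) \<Rightarrow>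
   ('u, 'n) ring_scheme \<Rightarrow> ('r \<Rightarrow> 'u \<Rightarrow> 'u) \<Rightarrow>
   ('u, 'p) ring_scheme \<Rightarrow> ('u \<Rightarrow> 'u \<Rightarrow> 'u) \<Rightarrow> 'u \<Rightarrow> 'u" where
  "tensor_lift S X ra Y la Z \<phi> =
     (THE h. h \<in> extensional (carrier (tensor_group S X ra Y la)) \<and>
             h \<in> hom (add_monoid (tensor_group S X ra Y la)) (add_monoid Z) \<and>
             (\<forall>x\<in>carrier X. \<forall>y\<in>carrier Y. h (pure_tensor S X ra Y la x y) = \<phi> x y))"


section \<open>Modules and algebras over a commutative ring\<close>

locale assoc_algebra = Module.module k A + ring A
  for k :: "('k, 'c) ring_scheme" (structure) and A :: "('k, 'u) module" (structure) +
  assumes smult_mult_left: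
      "\<lbrakk>c \<in> carrier k; a \<in> carrier A; b \<in> carrier A\<rbrakk>
        \<Longrightarrow> (c \<odot>\<^bsub>A\<^esub> a) \<otimes>\<^bsub>A\<^esub> b = c \<odot>\<^bsub>A\<^esub> (a \<otimes>\<^bsub>A\<^esub> b)"
    and smult_mult_right:
      "\<lbrakk>c \<in> carrier k; a \<in> carrier A; b \<in> carrier A\<rbrakk>
        \<Longrightarrow> a \<otimes>\<^bsub>A\<^esub> (c \<odot>\<^bsub>A\<^esub> b) = c \<odot>\<^bsub>A\<^esub> (a \<otimes>\<^bsub>A\<^esub> b)"

definition klinear ::
  "('k, 'c) ring_scheme \<Rightarrow> ('k, 'u) module \<Rightarrow> ('k, 'u) module \<Rightarrow> ('u \<Rightarrow> 'u) set" where
  "klinear k M N =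
     {f \<in> hom (add_monoid M) (add_monoid N) \<inter> extensional (carrier M).
        \<forall>c\<in>carrier k. \<forall>x\<in>carrier M. f (c \<odot>\<^bsub>M\<^esub> x) = c \<odot>\<^bsub>N\<^esub> f x}"

definition module_category ::
  "('k, 'c) ring_scheme \<Rightarrow> (('k, 'u) module, 'u \<Rightarrow> 'u) cat" where
  "module_category k = concrete_cat {M. Module.module k M} (klinear k) carrier"

definition ktens ::
  "('k, 'c) ring_scheme \<Rightarrow> ('k, 'u::infinite) module \<Rightarrow> ('k, 'u) module \<Rightarrow> 'u \<Rightarrow> 'u \<Rightarrow> 'u" where
  "ktens k M N = pure_tensor (carrier k) M (\<lambda>x c. c \<odot>\<^bsub>M\<^esub> x) N (smult N)"

definition klift ::
  "('k, 'c) ring_scheme \<Rightarrow> ('k, 'u::infinite) module \<Rightarrow> ('k, 'u) module \<Rightarrow>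
   ('u, 'p) ring_scheme \<Rightarrow> ('u \<Rightarrow> 'u \<Rightarrow> 'u) \<Rightarrow> 'u \<Rightarrow> 'u" where
  "klift k M N = tensor_lift (carrier k) M (\<lambda>x c. c \<odot>\<^bsub>M\<^esub> x) N (smult N)"

definition ktensor ::
  "('k, 'c) ring_scheme \<Rightarrow> ('k, 'u::infinite) module \<Rightarrow> ('k, 'u) module \<Rightarrow> ('k, 'u) module" where
  "ktensor k M N =
     (let T = tensor_group (carrier k) M (\<lambda>x c. c \<odot>\<^bsub>M\<^esub> x) N (smult N)
      in \<lparr> carrier = carrier T, mult = mult T, one = one T, ring.zero = ring.zero T, ring.add = ring.add T,
           smult = (\<lambda>c\<in>carrier k. klift k M N T (\<lambda>x y. ktens k M N (c \<odot>\<^bsub>M\<^esub> x) y)) \<rparr>)"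

definition ktensor_map ::
  "('k, 'c) ring_scheme \<Rightarrow> ('k, 'u::infinite) module \<Rightarrow> ('k, 'u) module \<Rightarrow>
   ('k, 'u) module \<Rightarrow> ('k, 'u) module \<Rightarrow> ('u \<Rightarrow> 'u) \<Rightarrow> ('u \<Rightarrow> 'u) \<Rightarrow> 'u \<Rightarrow> 'u" where
  "ktensor_map k M M' N N' f g =
     klift k M N (ktensor k M' N') (\<lambda>x y. ktens k M' N' (f x) (g y))"

definition exact_at ::
  "('u, 'm) ring_scheme \<Rightarrow> ('u, 'n) ring_scheme \<Rightarrow> ('u, 'p) ring_scheme \<Rightarrow>
   ('u \<Rightarrow> 'u) \<Rightarrow> ('u \<Rightarrow> 'u) \<Rightarrow> bool" where
  "exact_at L M N f g \<longleftrightarrow> f ` carrier L = {x \<in> carrier M. g x = \<zero>\<^bsub>N\<^esub>}"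

text \<open>
  The test modules range over the universe \<open>'u\<close>. If \<open>k\<close> embeds into \<open>'u\<close>, this is full
  faithful flatness, because the ideals of \<open>k\<close> and the quotients by them are then among the
  test modules (up to isomorphism); in general it is implied by full faithful flatness.
\<close>

definition faithfully_flat ::
  "('k, 'c) ring_scheme \<Rightarrow> ('k, 'u::infinite) module \<Rightarrow> bool" where
  "faithfully_flat k A \<longleftrightarrow>
     Module.module k A \<and>
     (\<forall>(L :: ('k, 'u) module) (M :: ('k, 'u) module) (N :: ('k, 'u) module) f g.
        Module.module k L \<longrightarrow> Module.module k M \<longrightarrow> Module.module k N \<longrightarrow>
        f \<in> klinear k L M \<longrightarrow> g \<in> klinear k M N \<longrightarrow>
        (exact_at L M N f g \<longleftrightarrow>
         exact_at (ktensor k L A) (ktensor k M A) (ktensor k N A)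
           (ktensor_map k L M A A f (\<lambda>a. a)) (ktensor_map k M N A A g (\<lambda>a. a))))"


section \<open>Modules and bimodules over an algebra\<close>

record 'u rmod = "'u ring" +
  ract :: "'u \<Rightarrow> 'u \<Rightarrow> 'u"

record 'u bimod = "'u rmod" +
  lact :: "'u \<Rightarrow> 'u \<Rightarrow> 'u"

locale right_module = ring A + V: abelian_group V
  for A :: "('u, 'm) ring_scheme" (structure) and V :: "('u, 'n) rmod_scheme" +
  assumes ract_closed: "\<lbrakk>v \<in> carrier V; a \<in> carrier A\<rbrakk> \<Longrightarrow> ract V v a \<in> carrier V"
    and ract_add_left:
      "\<lbrakk>v \<in> carrier V; w \<in> carrier V; a \<in> carrier A\<rbrakk>
        \<Longrightarrow> ract V (v \<oplus>\<^bsub>V\<^esub> w) a = ract V v a \<oplus>\<^bsub>V\<^esub> ract V w a"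
    and ract_add_right:
      "\<lbrakk>v \<in> carrier V; a \<in> carrier A; b \<in> carrier A\<rbrakk>
        \<Longrightarrow> ract V v (a \<oplus>\<^bsub>A\<^esub> b) = ract V v a \<oplus>\<^bsub>V\<^esub> ract V v b"
    and ract_mult:
      "\<lbrakk>v \<in> carrier V; a \<in> carrier A; b \<in> carrier A\<rbrakk>
        \<Longrightarrow> ract V v (a \<otimes>\<^bsub>A\<^esub> b) = ract V (ract V v a) b"
    and ract_one: "v \<in> carrier V \<Longrightarrow> ract V v \<one>\<^bsub>A\<^esub> = v"

locale bimodule = assoc_algebra k A + right_module A V
  for k :: "('k, 'c) ring_scheme" and A :: "('k, 'u) module" and V :: "('u, 'n) bimod_scheme" +
  assumes lact_closed: "\<lbrakk>a \<in> carrier A; v \<in> carrier V\<rbrakk> \<Longrightarrow> lact V a v \<in> carrier V"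
    and lact_add_right:
      "\<lbrakk>a \<in> carrier A; v \<in> carrier V; w \<in> carrier V\<rbrakk>
        \<Longrightarrow> lact V a (v \<oplus>\<^bsub>V\<^esub> w) = lact V a v \<oplus>\<^bsub>V\<^esub> lact V a w"
    and lact_add_left:
      "\<lbrakk>a \<in> carrier A; b \<in> carrier A; v \<in> carrier V\<rbrakk>
        \<Longrightarrow> lact V (a \<oplus>\<^bsub>A\<^esub> b) v = lact V a v \<oplus>\<^bsub>V\<^esub> lact V b v"
    and lact_mult:
      "\<lbrakk>a \<in> carrier A; b \<in> carrier A; v \<in> carrier V\<rbrakk>
        \<Longrightarrow> lact V (a \<otimes>\<^bsub>A\<^esub> b) v = lact V a (lact V b v)"
    and lact_one: "v \<in> carrier V \<Longrightarrow> lact V \<one>\<^bsub>A\<^esub> v = v"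
    and lact_ract:
      "\<lbrakk>a \<in> carrier A; v \<in> carrier V; b \<in> carrier A\<rbrakk>
        \<Longrightarrow> ract V (lact V a v) b = lact V a (ract V v b)"
    and central:
      "\<lbrakk>c \<in> carrier k; v \<in> carrier V\<rbrakk>
        \<Longrightarrow> lact V (c \<odot>\<^bsub>A\<^esub> \<one>\<^bsub>A\<^esub>) v = ract V v (c \<odot>\<^bsub>A\<^esub> \<one>\<^bsub>A\<^esub>)"

text \<open>
  Isomorphism of categories is sensitive to the values of the operations outside the carriers.
  The normal forms pin these values down, so that an object is determined by the actual
  (bi)module structure.
\<close>

definition normal_rmod :: "('u, 'm) ring_scheme \<Rightarrow> ('u, 'n) rmod_scheme \<Rightarrow> bool" where
  "normal_rmod A V \<longleftrightarrow>
     mult V = undefined \<and> one V = undefined \<and>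
     ring.add V \<in> carrier V \<rightarrow>\<^sub>E carrier V \<rightarrow>\<^sub>E carrier V \<and>
     ract V \<in> carrier V \<rightarrow>\<^sub>E carrier A \<rightarrow>\<^sub>E carrier V"

definition right_modules :: "('u, 'm) ring_scheme \<Rightarrow> 'u rmod set" where
  "right_modules A = {V. right_module A V \<and> normal_rmod A V}"

definition bimodules :: "('k, 'c) ring_scheme \<Rightarrow> ('k, 'u) module \<Rightarrow> 'u bimod set" where
  "bimodules k A =
     {V. bimodule k A V \<and> normal_rmod A V \<and>
         lact V \<in> carrier A \<rightarrow>\<^sub>E carrier V \<rightarrow>\<^sub>E carrier V}"

definition rmod_hom ::
  "('u, 'm) ring_scheme \<Rightarrow> ('u, 'n) rmod_scheme \<Rightarrow> ('u, 'n) rmod_scheme \<Rightarrow> ('u \<Rightarrow> 'u) set" where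
  "rmod_hom A V W =
     {f \<in> hom (add_monoid V) (add_monoid W) \<inter> extensional (carrier V).
        \<forall>v\<in>carrier V. \<forall>a\<in>carrier A. f (ract V v a) = ract W (f v) a}"

definition bimod_hom ::
  "('u, 'm) ring_scheme \<Rightarrow> 'u bimod \<Rightarrow> 'u bimod \<Rightarrow> ('u \<Rightarrow> 'u) set" where
  "bimod_hom A V W =
     {f \<in> rmod_hom A V W. \<forall>a\<in>carrier A. \<forall>v\<in>carrier V. f (lact V a v) = lact W a (f v)}"

text \<open>
  The \<open>k\<close>-module underlying a right \<open>A\<close>-module. For a bimodule the left action induces the same
  \<open>k\<close>-module structure, by centrality.
\<close>

definition kmod :: "('k, 'u) module \<Rightarrow> ('u, 'n) rmod_scheme \<Rightarrow> ('k, 'u) module" where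
  "kmod A V =
     \<lparr> carrier = carrier V, mult = undefined, one = undefined, ring.zero = ring.zero V, ring.add = ring.add V,
       smult = (\<lambda>c v. ract V v (c \<odot>\<^bsub>A\<^esub> \<one>\<^bsub>A\<^esub>)) \<rparr>"


section \<open>The monoidal category of bimodules\<close>

definition regular_bimod :: "('k, 'u) module \<Rightarrow> 'u bimod" where
  "regular_bimod A =
     \<lparr> carrier = carrier A, mult = undefined, one = undefined, ring.zero = \<zero>\<^bsub>A\<^esub>,
       ring.add = (\<lambda>a\<in>carrier A. \<lambda>b\<in>carrier A. a \<oplus>\<^bsub>A\<^esub> b),
       ract = (\<lambda>a\<in>carrier A. \<lambda>b\<in>carrier A. a \<otimes>\<^bsub>A\<^esub> b),
       lact = (\<lambda>a\<in>carrier A. \<lambda>b\<in>carrier A. a \<otimes>\<^bsub>A\<^esub> b) \<rparr>"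

definition btens ::
  "('u::infinite, 'm) ring_scheme \<Rightarrow> 'u bimod \<Rightarrow> 'u bimod \<Rightarrow> 'u \<Rightarrow> 'u \<Rightarrow> 'u" where
  "btens A X Y = pure_tensor (carrier A) X (ract X) Y (lact Y)"

definition blift ::
  "('u::infinite, 'm) ring_scheme \<Rightarrow> 'u bimod \<Rightarrow> 'u bimod \<Rightarrow>
   ('u, 'p) ring_scheme \<Rightarrow> ('u \<Rightarrow> 'u \<Rightarrow> 'u) \<Rightarrow> 'u \<Rightarrow> 'u" where
  "blift A X Y = tensor_lift (carrier A) X (ract X) Y (lact Y)"

definition btensor ::
  "('u::infinite, 'm) ring_scheme \<Rightarrow> 'u bimod \<Rightarrow> 'u bimod \<Rightarrow> 'u bimod" where
  "btensor A X Y =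
     (let T = tensor_group (carrier A) X (ract X) Y (lact Y)
      in \<lparr> carrier = carrier T, mult = mult T, one = one T, ring.zero = ring.zero T, ring.add = ring.add T,
           ract = (\<lambda>t\<in>carrier T. \<lambda>a\<in>carrier A.
                     blift A X Y T (\<lambda>x y. btens A X Y x (ract Y y a)) t),
           lact = (\<lambda>a\<in>carrier A. \<lambda>t\<in>carrier T.
                     blift A X Y T (\<lambda>x y. btens A X Y (lact X a x) y) t) \<rparr>)"

definition bimod_moncat ::
  "('k, 'c) ring_scheme \<Rightarrow> ('k, 'u::infinite) module \<Rightarrow> ('u bimod, 'u \<Rightarrow> 'u) moncat" where
  "bimod_moncat k A =
     cat.extend (concrete_cat (bimodules k A) (bimod_hom A) carrier)
       (moncat.fields
          (btensor A)
          (\<lambda>X X' Y Y' f g.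
             blift A X Y (btensor A X' Y') (\<lambda>x y. btens A X' Y' (f x) (g y)))
          (regular_bimod A)
          (\<lambda>X Y Z.
             blift A (btensor A X Y) Z (btensor A X (btensor A Y Z))
               (\<lambda>t z. blift A X Y (btensor A X (btensor A Y Z))
                        (\<lambda>x y. btens A X (btensor A Y Z) x (btens A Y Z y z)) t))
          (\<lambda>X. blift A (regular_bimod A) X X (\<lambda>a x. lact X a x))
          (\<lambda>X. blift A X (regular_bimod A) X (\<lambda>x a. ract X x a)))"


section \<open>Comodules, Yetter-Drinfeld modules and descent data\<close>

text \<open>
  The coaction axioms; \<open>v\<^sub>[\<^sub>0\<^sub>] \<otimes> v\<^sub>[\<^sub>1\<^sub>]\<close> stands for \<open>\<rho> v\<close>, and \<open>V \<otimes> A \<otimes> A\<close>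
  is bracketed as \<open>(V \<otimes> A) \<otimes> A\<close>.
\<close>

definition coactions ::
  "('k, 'c) ring_scheme \<Rightarrow> ('k, 'u::infinite) module \<Rightarrow> ('u, 'n) rmod_scheme \<Rightarrow> ('u \<Rightarrow> 'u) set" where
  "coactions k A V =
     (let M = kmod A V; MA = ktensor k M A; MAA = ktensor k MA A in
      {\<rho> \<in> klinear k M MA.
         (\<forall>v\<in>carrier V. klift k M A V (\<lambda>w a. ract V w a) (\<rho> v) = v) \<and>
         (\<forall>v\<in>carrier V.
            klift k M A MAA (\<lambda>w a. ktens k MA A (\<rho> w) a) (\<rho> v) =
            klift k M A MAA (\<lambda>w a. ktens k MA A (ktens k M A w \<one>\<^bsub>A\<^esub>) a) (\<rho> v)) \<and>
         (\<forall>v\<in>carrier V. \<forall>a\<in>carrier A.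
            \<rho> (ract V v a) = klift k M A MA (\<lambda>w b. ktens k M A w (b \<otimes>\<^bsub>A\<^esub> a)) (\<rho> v))})"

definition preserves_coaction ::
  "('k, 'c) ring_scheme \<Rightarrow> ('k, 'u::infinite) module \<Rightarrow>
   ('u, 'n) rmod_scheme \<times> ('u \<Rightarrow> 'u) \<Rightarrow> ('u, 'n) rmod_scheme \<times> ('u \<Rightarrow> 'u) \<Rightarrow>
   ('u \<Rightarrow> 'u) \<Rightarrow> bool" where
  "preserves_coaction k A = (\<lambda>(V, \<rho>) (V', \<rho>') f.
     \<forall>v\<in>carrier V. \<rho>' (f v) = ktensor_map k (kmod A V) (kmod A V') A A f (\<lambda>a. a) (\<rho> v))"

definition comodule_category ::
  "('k, 'c) ring_scheme \<Rightarrow> ('k, 'u::infinite) module \<Rightarrow>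
   ('u rmod \<times> ('u \<Rightarrow> 'u), 'u \<Rightarrow> 'u) cat" where
  "comodule_category k A =
     concrete_cat {(V, \<rho>). V \<in> right_modules A \<and> \<rho> \<in> coactions k A V}
       (\<lambda>P Q. {f \<in> rmod_hom A (fst P) (fst Q). preserves_coaction k A P Q f})
       (\<lambda>P. carrier (fst P))"

definition yetter_drinfeld_coactions ::
  "('k, 'c) ring_scheme \<Rightarrow> ('k, 'u::infinite) module \<Rightarrow> 'u bimod \<Rightarrow> ('u \<Rightarrow> 'u) set" where
  "yetter_drinfeld_coactions k A V =
     (let M = kmod A V; MA = ktensor k M A in
      {\<rho> \<in> coactions k A V.
         (\<forall>a\<in>carrier A. \<forall>v\<in>carrier V.
            \<rho> (lact V a v) = klift k M A MA (\<lambda>w b. ktens k M A w (a \<otimes>\<^bsub>A\<^esub> b)) (\<rho> v)) \<and>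
         (\<forall>a\<in>carrier A. \<forall>v\<in>carrier V.
            klift k M A MA (\<lambda>w b. ktens k M A (lact V a w) b) (\<rho> v) =
            klift k M A MA (\<lambda>w b. ktens k M A (ract V w a) b) (\<rho> v))})"

definition yetter_drinfeld_category ::
  "('k, 'c) ring_scheme \<Rightarrow> ('k, 'u::infinite) module \<Rightarrow>
   ('u bimod \<times> ('u \<Rightarrow> 'u), 'u \<Rightarrow> 'u) cat" where
  "yetter_drinfeld_category k A =
     concrete_cat {(V, \<rho>). V \<in> bimodules k A \<and> \<rho> \<in> yetter_drinfeld_coactions k A V}
       (\<lambda>P Q. {f \<in> bimod_hom A (fst P) (fst Q). preserves_coaction k A P Q f})
       (\<lambda>P. carrier (fst P))"

text \<open>
  The sandwich actions \<open>t \<mapsto> (a \<otimes> b) t (c \<otimes> d)\<close> on \<open>A \<otimes> V\<close> and on \<open>V \<otimes> A\<close>. As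
  \<open>A \<otimes> A\<close> is additively generated by its pure tensors, an additive map is \<open>A \<otimes> A\<close>-bilinear
  iff it commutes with all of them.
\<close>

definition act_AV ::
  "('k, 'c) ring_scheme \<Rightarrow> ('k, 'u::infinite) module \<Rightarrow> 'u bimod \<Rightarrow>
   'u \<Rightarrow> 'u \<Rightarrow> 'u \<Rightarrow> 'u \<Rightarrow> 'u \<Rightarrow> 'u" where
  "act_AV k A V a b c d =
     klift k A (kmod A V) (ktensor k A (kmod A V))
       (\<lambda>x v. ktens k A (kmod A V) (a \<otimes>\<^bsub>A\<^esub> x \<otimes>\<^bsub>A\<^esub> c) (ract V (lact V b v) d))"

definition act_VA ::
  "('k, 'c) ring_scheme \<Rightarrow> ('k, 'u::infinite) module \<Rightarrow> 'u bimod \<Rightarrow>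
   'u \<Rightarrow> 'u \<Rightarrow> 'u \<Rightarrow> 'u \<Rightarrow> 'u \<Rightarrow> 'u" where
  "act_VA k A V a b c d =
     klift k (kmod A V) A (ktensor k (kmod A V) A)
       (\<lambda>v x. ktens k (kmod A V) A (ract V (lact V a v) c) (b \<otimes>\<^bsub>A\<^esub> x \<otimes>\<^bsub>A\<^esub> d))"

definition AA_bimodule_maps ::
  "('k, 'c) ring_scheme \<Rightarrow> ('k, 'u::infinite) module \<Rightarrow> 'u bimod \<Rightarrow> ('u \<Rightarrow> 'u) set" where
  "AA_bimodule_maps k A V =
     {g \<in> klinear k (ktensor k A (kmod A V)) (ktensor k (kmod A V) A).
        \<forall>a\<in>carrier A. \<forall>b\<in>carrier A. \<forall>c\<in>carrier A. \<forall>d\<in>carrier A.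
        \<forall>t\<in>carrier (ktensor k A (kmod A V)).
          g (act_AV k A V a b c d t) = act_VA k A V a b c d (g t)}"

text \<open>
  The maps \<open>g\<^sub>1\<close>, \<open>g\<^sub>2\<close>, \<open>g\<^sub>3\<close>, with the triple tensor products bracketed as
  \<open>A \<otimes> (A \<otimes> V)\<close>, \<open>(A \<otimes> V) \<otimes> A\<close> and \<open>(V \<otimes> A) \<otimes> A\<close>.
\<close>

definition desc1 ::
  "('k, 'c) ring_scheme \<Rightarrow> ('k, 'u::infinite) module \<Rightarrow> 'u bimod \<Rightarrow> ('u \<Rightarrow> 'u) \<Rightarrow> 'u \<Rightarrow> 'u" where
  "desc1 k A V g =
     (let M = kmod A V; AM = ktensor k A M; AMA = ktensor k AM A in
      klift k A AM AMA (\<lambda>b t. klift k M A AMA (\<lambda>w x. ktens k AM A (ktens k A M b w) x) (g t)))"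

definition desc2 ::
  "('k, 'c) ring_scheme \<Rightarrow> ('k, 'u::infinite) module \<Rightarrow> 'u bimod \<Rightarrow> ('u \<Rightarrow> 'u) \<Rightarrow> 'u \<Rightarrow> 'u" where
  "desc2 k A V g =
     (let M = kmod A V; AM = ktensor k A M; MA = ktensor k M A; MAA = ktensor k MA A in
      klift k A AM MAA
        (\<lambda>a. klift k A M MAA
           (\<lambda>b v. klift k M A MAA
              (\<lambda>w x. ktens k MA A (ktens k M A w b) x) (g (ktens k A M a v)))))"

definition desc3 ::
  "('k, 'c) ring_scheme \<Rightarrow> ('k, 'u::infinite) module \<Rightarrow> 'u bimod \<Rightarrow> ('u \<Rightarrow> 'u) \<Rightarrow> 'u \<Rightarrow> 'u" where
  "desc3 k A V g =
     (let M = kmod A V; AM = ktensor k A M; MA = ktensor k M A; MAA = ktensor k MA A in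
      klift k AM A MAA (\<lambda>t b. ktens k MA A (g t) b))"

definition descent_data ::
  "('k, 'c) ring_scheme \<Rightarrow> ('k, 'u::infinite) module \<Rightarrow> 'u bimod \<Rightarrow> ('u \<Rightarrow> 'u) set" where
  "descent_data k A V =
     (let M = kmod A V in
      {g \<in> AA_bimodule_maps k A V.
         (\<forall>t\<in>carrier (ktensor k A (ktensor k A M)).
            desc2 k A V g t = desc3 k A V g (desc1 k A V g t)) \<and>
         (\<forall>v\<in>carrier V.
            klift k M A V (\<lambda>w a. ract V w a) (g (ktens k A M \<one>\<^bsub>A\<^esub> v)) = v)})"

definition descent_category ::
  "('k, 'c) ring_scheme \<Rightarrow> ('k, 'u::infinite) module \<Rightarrow>
   ('u bimod \<times> ('u \<Rightarrow> 'u), 'u \<Rightarrow> 'u) cat" where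
  "descent_category k A =
     concrete_cat {(V, g). V \<in> bimodules k A \<and> g \<in> descent_data k A V}
       (\<lambda>(V, g) (V', g').
          {f \<in> bimod_hom A V V'.
             \<forall>t\<in>carrier (ktensor k A (kmod A V)).
               ktensor_map k (kmod A V) (kmod A V') A A f (\<lambda>a. a) (g t) =
               g' (ktensor_map k A A (kmod A V) (kmod A V') (\<lambda>a. a) f t)})
       (\<lambda>P. carrier (fst P))"

end

theory Submission
  imports Defs
begin

text \<open>
  A coaction \<open>\<rho> v = v\<^sub>[\<^sub>0\<^sub>] \<otimes> v\<^sub>[\<^sub>1\<^sub>]\<close> determines all the other structures: the left action is
  \<open>a v = v\<^sub>[\<^sub>0\<^sub>] a v\<^sub>[\<^sub>1\<^sub>]\<close>, the descent datum is \<open>g (a \<otimes> v) = a v\<^sub>[\<^sub>0\<^sub>] \<otimes> v\<^sub>[\<^sub>1\<^sub>]\<close>, and the half-braiding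
  is \<open>c (x \<otimes> v) = v\<^sub>[\<^sub>0\<^sub>] \<otimes> x v\<^sub>[\<^sub>1\<^sub>]\<close>, with inverse \<open>v \<otimes> x \<mapsto> v\<^sub>[\<^sub>1\<^sub>] x \<otimes> v\<^sub>[\<^sub>0\<^sub>]\<close>. Conversely
  \<open>\<rho> v = g (1 \<otimes> v)\<close>, and \<open>\<rho>\<close> is recovered from the component of \<open>c\<close> at the free bimodule
  \<open>A \<otimes> A\<close>. Each of these correspondences is the identity on morphisms.
  For faithfully flat \<open>A\<close>, the functor \<open>N \<mapsto> N \<otimes> A\<close> from \<open>k\<close>-modules to comodules is quasi-inverse to
  taking coinvariants: tensored with \<open>A\<close>, the exact sequence defining the coinvariants becomes the
  split sequence \<open>V \<rightarrow> V \<otimes> A \<rightarrow> V \<otimes> A \<otimes> A\<close>.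
\<close>

section \<open>Additive and balanced maps\<close>

text \<open>Elements of a tensor product are codes in the universe type, chosen by
  \<open>SOME\<close>, so nothing can be computed with them directly: additive maps are compared on
  pure tensors and produced only by lifting balanced expressions. A Sweedler expression such as v[0]
  a v[1] is therefore the lift of (w, b) -> w a b evaluated at \<rho> v, and the axioms of a
  coaction become rewriting rules for such lifts: right linearity moves a factor into the last slot,
  and coassociativity replaces the middle slot of v[0][0], v[0][1], v[1] by 1. The latter rule does
  most of the work. It makes v[0] a v[1] a left action compatible with \<rho>, and it is what the
  descent identity, the multiplicativity of the half-braiding and its invertibility come down to. In
  the other direction the axioms of a coaction are read off from linearity, balance and coherence.
  Isomorphism of categories requires equality of objects, hence the care for extensional operations
  and for evaluating every definite description.\<close>

abbreviation addhom ::
  "('a, 'm) ring_scheme \<Rightarrow> ('b, 'n) ring_scheme \<Rightarrow> ('a \<Rightarrow> 'b) set" where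
  "addhom M N \<equiv> hom (add_monoid M) (add_monoid N)"

lemma addhomI:
  assumes "\<And>x. x \<in> carrier M \<Longrightarrow> f x \<in> carrier N"
    and "\<And>x y. \<lbrakk>x \<in> carrier M; y \<in> carrier M\<rbrakk> \<Longrightarrow> f (x \<oplus>\<^bsub>M\<^esub> y) = f x \<oplus>\<^bsub>N\<^esub> f y"
  shows "f \<in> addhom M N"
  using assms by (auto simp: hom_def)

lemma addhom_closed: "\<lbrakk>f \<in> addhom M N; x \<in> carrier M\<rbrakk> \<Longrightarrow> f x \<in> carrier N"
  by (auto simp: hom_def)

lemma addhom_add:
  "\<lbrakk>f \<in> addhom M N; x \<in> carrier M; y \<in> carrier M\<rbrakk> \<Longrightarrow> f (x \<oplus>\<^bsub>M\<^esub> y) = f x \<oplus>\<^bsub>N\<^esub> f y"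
  by (auto simp: hom_def)

lemma addhom_zero:
  assumes "abelian_group M" "abelian_group N" "f \<in> addhom M N"
  shows "f \<zero>\<^bsub>M\<^esub> = \<zero>\<^bsub>N\<^esub>"
  using hom_one[OF assms(3)] assms(1,2)
  by (auto intro: abelian_group.a_group)

lemma addhom_minus:
  assumes "abelian_group M" "abelian_group N" "f \<in> addhom M N" "x \<in> carrier M" "y \<in> carrier M"
  shows "f (x \<ominus>\<^bsub>M\<^esub> y) = f x \<ominus>\<^bsub>N\<^esub> f y"
proof -
  interpret M: abelian_group M by fact
  interpret N: abelian_group N by fact
  have "f (x \<ominus>\<^bsub>M\<^esub> y) \<oplus>\<^bsub>N\<^esub> f y = f (x \<ominus>\<^bsub>M\<^esub> y \<oplus>\<^bsub>M\<^esub> y)"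
    using assms by (simp add: addhom_add)
  also have "\<dots> = f x"
    using assms by (simp add: M.minus_eq M.a_assoc M.l_neg)
  finally show ?thesis
    using assms addhom_closed[OF assms(3)]
    by (metis M.minus_closed N.minus_eq N.a_assoc N.r_neg N.r_zero N.a_inv_closed)
qed

lemma (in abelian_group) eq_minusI:
  "\<lbrakk>z \<oplus> v = u; z \<in> carrier G; v \<in> carrier G\<rbrakk> \<Longrightarrow> z = u \<ominus> v"
  by (auto simp: minus_eq a_assoc r_neg)

lemma (in abelian_group) add_minus_minus:
  assumes "a \<in> carrier G" "b \<in> carrier G"
  shows "a \<oplus> b \<ominus> a \<ominus> b = \<zero>"
proof -
  have "a \<oplus> b \<ominus> a \<ominus> b = (a \<oplus> b) \<oplus> \<ominus> (a \<oplus> b)"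
    using assms by (simp add: minus_eq a_assoc minus_add)
  then show ?thesis using assms by (simp add: r_neg)
qed

section \<open>Balanced maps and the universal property of the coded tensor product\<close>

definition balanced ::
  "'r set \<Rightarrow> ('a, 'm) ring_scheme \<Rightarrow> ('a \<Rightarrow> 'r \<Rightarrow> 'a) \<Rightarrow> ('b, 'n) ring_scheme \<Rightarrow>
   ('r \<Rightarrow> 'b \<Rightarrow> 'b) \<Rightarrow> ('c, 'p) ring_scheme \<Rightarrow> ('a \<Rightarrow> 'b \<Rightarrow> 'c) \<Rightarrow> bool" where
  "balanced S X ra Y la Z \<phi> \<longleftrightarrow>
     (\<forall>x\<in>carrier X. \<forall>y\<in>carrier Y. \<phi> x y \<in> carrier Z) \<and>
     (\<forall>x\<in>carrier X. \<forall>x'\<in>carrier X. \<forall>y\<in>carrier Y. \<phi> (x \<oplus>\<^bsub>X\<^esub> x') y = \<phi> x y \<oplus>\<^bsub>Z\<^esub> \<phi> x' y) \<and>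
     (\<forall>x\<in>carrier X. \<forall>y\<in>carrier Y. \<forall>y'\<in>carrier Y. \<phi> x (y \<oplus>\<^bsub>Y\<^esub> y') = \<phi> x y \<oplus>\<^bsub>Z\<^esub> \<phi> x y') \<and>
     (\<forall>x\<in>carrier X. \<forall>r\<in>S. \<forall>y\<in>carrier Y. \<phi> (ra x r) y = \<phi> x (la r y))"

text \<open>The scalars form a bare set acting on either factor, so that one development serves both
  the tensor product over \<open>k\<close> and the one over \<open>A\<close>, where the right action
  of the first factor meets the left action of the second.\<close>

locale tensor_factors =
  fixes S :: "'r set"
    and X :: "('u::infinite, 'm) ring_scheme" and ra :: "'u \<Rightarrow> 'r \<Rightarrow> 'u"
    and Y :: "('u, 'n) ring_scheme" and la :: "'r \<Rightarrow> 'u \<Rightarrow> 'u"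
  assumes X: "abelian_group X" and Y: "abelian_group Y"
    and ra_closed: "\<lbrakk>x \<in> carrier X; r \<in> S\<rbrakk> \<Longrightarrow> ra x r \<in> carrier X"
    and la_closed: "\<lbrakk>r \<in> S; y \<in> carrier Y\<rbrakk> \<Longrightarrow> la r y \<in> carrier Y"
begin

abbreviation "F \<equiv> free_Abelian_group (carrier X \<times> carrier Y)"
abbreviation "K \<equiv> tensor_kernel S X ra Y la"
abbreviation "Q \<equiv> tensor_quotient S X ra Y la"
abbreviation "T \<equiv> tensor_group S X ra Y la"
abbreviation "code \<equiv> tensor_code S X ra Y la"
abbreviation "pure \<equiv> pure_tensor S X ra Y la"

sublocale X: abelian_group X by (rule X)
sublocale Y: abelian_group Y by (rule Y)
sublocale F: comm_group F by (rule abelian_free_Abelian_group)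

lemma keys_diff_subset:
  fixes a b :: "'c \<Rightarrow>\<^sub>0 int"
  assumes "Poly_Mapping.keys a \<subseteq> U" "Poly_Mapping.keys b \<subseteq> U"
  shows "Poly_Mapping.keys (a - b) \<subseteq> U"
  using assms keys_diff[of a b] by blast

lemma relators_in_F: "tensor_relators S X ra Y la \<subseteq> carrier F"
  unfolding tensor_relators_def
  by (auto dest!: keys_diff[THEN subsetD] simp: ra_closed la_closed)

lemma kernel_normal: "K \<lhd> F"
  unfolding tensor_kernel_def
  by (metis F.generate_is_subgroup relators_in_F F.subgroup_imp_normal)

lemma Q_comm_group: "comm_group Q"
  unfolding tensor_quotient_def using kernel_normal
  by (simp add: F.abelian_FactGroup normal_imp_subgroup)

sublocale Q: comm_group Q by (rule Q_comm_group)

text \<open>A cardinality count: the quotient is an image of a free abelian group whose basis lies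
  in \<open>'u \<times> 'u\<close>, the free abelian group on an infinite basis has the size of that
  basis, and \<open>'u \<times> 'u\<close> has the size of \<open>'u\<close>. Hence the
  \<open>SOME\<close> in \<open>tensor_code\<close> really picks an injection.\<close>

lemma code_inj: "inj_on code (carrier Q)"
proof -
  have "carrier Q \<lesssim> carrier F"
    unfolding tensor_quotient_def carrier_FactGroup by (rule image_lepoll)
  also have "carrier F \<lesssim> carrier (free_Abelian_group (UNIV :: ('u \<times> 'u) set))"
    by (rule subset_imp_lepoll) (use carrier_free_Abelian_group_iff in auto)
  also have "\<dots> \<approx> (UNIV :: ('u \<times> 'u) set)"
    by (rule eqpoll_free_Abelian_group_infinite) (simp add: finite_prod infinite_UNIV)
  also have "(UNIV :: ('u \<times> 'u) set) \<approx> (UNIV :: 'u set)"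
    unfolding eqpoll_iff_card_of_ordIso
    using card_of_Times_same_infinite[OF infinite_UNIV] by simp
  finally obtain e :: "('u \<times> 'u \<Rightarrow>\<^sub>0 int) set \<Rightarrow> 'u" where "inj_on e (carrier Q)"
    unfolding lepoll_def by blast
  then show ?thesis
    unfolding tensor_code_def by (rule someI[where P = "\<lambda>e. inj_on e (carrier Q)"])
qed

lemma T_carrier: "carrier T = code ` carrier Q"
  by (simp add: tensor_group_def Let_def)

lemma T_zero: "\<zero>\<^bsub>T\<^esub> = code \<one>\<^bsub>Q\<^esub>"
  by (simp add: tensor_group_def Let_def)

lemma T_add:
  "\<lbrakk>p \<in> carrier Q; q \<in> carrier Q\<rbrakk> \<Longrightarrow> code p \<oplus>\<^bsub>T\<^esub> code q = code (p \<otimes>\<^bsub>Q\<^esub> q)"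
  by (simp add: tensor_group_def Let_def inv_into_f_f[OF code_inj])

lemma T_normal: "mult T = undefined" "one T = undefined"
    "ring.add T \<in> carrier T \<rightarrow>\<^sub>E carrier T \<rightarrow>\<^sub>E carrier T"
proof -
  show "mult T = undefined" "one T = undefined"
    by (simp_all add: tensor_group_def Let_def)
  have "s \<oplus>\<^bsub>T\<^esub> t \<in> carrier T" if "s \<in> carrier T" "t \<in> carrier T" for s t
    using that by (auto simp: T_carrier T_add)
  then show "ring.add T \<in> carrier T \<rightarrow>\<^sub>E carrier T \<rightarrow>\<^sub>E carrier T"
    by (fastforce simp: tensor_group_def Let_def PiE_def extensional_def)
qed

lemma T_abelian: "abelian_group T"
proof (rule abelian_groupI)
  fix x assume "x \<in> carrier T"
  then obtain p where "p \<in> carrier Q" "x = code p" by (auto simp: T_carrier)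
  then show "\<exists>y\<in>carrier T. y \<oplus>\<^bsub>T\<^esub> x = \<zero>\<^bsub>T\<^esub>"
    by (intro bexI[of _ "code (inv\<^bsub>Q\<^esub> p)"]) (auto simp: T_carrier T_add T_zero Q.l_inv)
qed (auto simp: T_carrier T_zero T_add Q.m_ac)

lemma code_addhom: "code \<in> hom Q (add_monoid T)"
  by (auto simp: hom_def T_carrier T_add)

lemma pure_eq: "pure x y = code (K #>\<^bsub>F\<^esub> frag_of (x, y))"
  by (simp add: pure_tensor_def)

lemma proj_hom: "(\<lambda>w. code (K #>\<^bsub>F\<^esub> w)) \<in> hom F (add_monoid T)"
proof -
  have "(\<lambda>w. K #>\<^bsub>F\<^esub> w) \<in> hom F Q"
    unfolding tensor_quotient_def by (rule normal.r_coset_hom_Mod[OF kernel_normal])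
  from hom_compose[OF this code_addhom] show ?thesis
    by (simp add: o_def)
qed

lemma proj_relator:
  assumes "r \<in> tensor_relators S X ra Y la"
  shows "code (K #>\<^bsub>F\<^esub> r) = \<zero>\<^bsub>T\<^esub>"
proof -
  have "r \<in> K"
    unfolding tensor_kernel_def using assms by (rule generate.incl)
  then have "K #>\<^bsub>F\<^esub> r = K"
    using F.coset_join2[OF _ normal_imp_subgroup[OF kernel_normal]] relators_in_F assms by blast
  then show ?thesis
    unfolding T_zero tensor_quotient_def by simp
qed

text \<open>Relators are written as differences; this turns the vanishing of their classes into
  equations between classes, from which the laws of pure tensors follow.\<close>

lemma proj_diff:
  assumes "a \<in> carrier F" "b \<in> carrier F" "code (K #>\<^bsub>F\<^esub> (a - b)) = \<zero>\<^bsub>T\<^esub>"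
  shows "code (K #>\<^bsub>F\<^esub> a) = code (K #>\<^bsub>F\<^esub> b)"
proof -
  interpret T: abelian_group T by (rule T_abelian)
  have ab: "a - b \<in> carrier F" using assms(1,2)
    by (metis carrier_free_Abelian_group_iff keys_diff_subset)
  have "code (K #>\<^bsub>F\<^esub> a) = code (K #>\<^bsub>F\<^esub> ((a - b) \<otimes>\<^bsub>F\<^esub> b))" by simp
  also have "\<dots> = code (K #>\<^bsub>F\<^esub> (a - b)) \<oplus>\<^bsub>T\<^esub> code (K #>\<^bsub>F\<^esub> b)"
    using hom_mult[OF proj_hom ab assms(2)] by simp
  also have "\<dots> = code (K #>\<^bsub>F\<^esub> b)"
    using hom_in_carrier[OF proj_hom assms(2)] assms(3) by simp
  finally show ?thesis .
qed

lemma proj_add: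
  assumes "a \<in> carrier F" "b \<in> carrier F"
  shows "code (K #>\<^bsub>F\<^esub> (a + b)) = code (K #>\<^bsub>F\<^esub> a) \<oplus>\<^bsub>T\<^esub> code (K #>\<^bsub>F\<^esub> b)"
  using hom_mult[OF proj_hom assms] by simp

lemma pure_closed: "\<lbrakk>x \<in> carrier X; y \<in> carrier Y\<rbrakk> \<Longrightarrow> pure x y \<in> carrier T"
  using hom_in_carrier[OF proj_hom] by (simp add: pure_eq)

lemma pure_add_left:
  assumes "x \<in> carrier X" "x' \<in> carrier X" "y \<in> carrier Y"
  shows "pure (x \<oplus>\<^bsub>X\<^esub> x') y = pure x y \<oplus>\<^bsub>T\<^esub> pure x' y"
proof -
  have r: "frag_of (x \<oplus>\<^bsub>X\<^esub> x', y) - frag_of (x, y) - frag_of (x', y) \<in> tensor_relators S X ra Y la"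
    unfolding tensor_relators_def using assms by blast
  show ?thesis
    using assms proj_diff[of "frag_of (x \<oplus>\<^bsub>X\<^esub> x', y)" "frag_of (x, y) + frag_of (x', y)"]
      proj_relator[OF r] proj_add[of "frag_of (x, y)" "frag_of (x', y)"]
      keys_add[of "frag_of (x, y)" "frag_of (x', y)"]
    by (auto simp: pure_eq diff_diff_eq)
qed

lemma pure_add_right:
  assumes "x \<in> carrier X" "y \<in> carrier Y" "y' \<in> carrier Y"
  shows "pure x (y \<oplus>\<^bsub>Y\<^esub> y') = pure x y \<oplus>\<^bsub>T\<^esub> pure x y'"
proof -
  have r: "frag_of (x, y \<oplus>\<^bsub>Y\<^esub> y') - frag_of (x, y) - frag_of (x, y') \<in> tensor_relators S X ra Y la"
    unfolding tensor_relators_def using assms by blast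
  show ?thesis
    using assms proj_diff[of "frag_of (x, y \<oplus>\<^bsub>Y\<^esub> y')" "frag_of (x, y) + frag_of (x, y')"]
      proj_relator[OF r] proj_add[of "frag_of (x, y)" "frag_of (x, y')"]
      keys_add[of "frag_of (x, y)" "frag_of (x, y')"]
    by (auto simp: pure_eq diff_diff_eq)
qed

lemma pure_balanced:
  assumes "x \<in> carrier X" "r \<in> S" "y \<in> carrier Y"
  shows "pure (ra x r) y = pure x (la r y)"
proof -
  have r: "frag_of (ra x r, y) - frag_of (x, la r y) \<in> tensor_relators S X ra Y la"
    unfolding tensor_relators_def using assms by blast
  show ?thesis
    using assms proj_diff[of "frag_of (ra x r, y)" "frag_of (x, la r y)"] proj_relator[OF r]
    by (simp add: pure_eq ra_closed la_closed)
qed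

text \<open>Every element is a nonempty sum of pure tensors: the negative of x \<otimes> y is (-x)
  \<otimes> y, and zero is 0 \<otimes> 0. So the induction has neither a zero case nor a negation
  case.\<close>

lemma tensor_induct [consumes 1, case_names pure add]:
  assumes t: "t \<in> carrier T"
    and pure: "\<And>x y. \<lbrakk>x \<in> carrier X; y \<in> carrier Y\<rbrakk> \<Longrightarrow> P (pure x y)"
    and add: "\<And>s t. \<lbrakk>s \<in> carrier T; t \<in> carrier T; P s; P t\<rbrakk> \<Longrightarrow> P (s \<oplus>\<^bsub>T\<^esub> t)"
  shows "P t"
proof -
  interpret T: abelian_group T by (rule T_abelian)
  obtain w where w: "Poly_Mapping.keys w \<subseteq> carrier X \<times> carrier Y" "t = code (K #>\<^bsub>F\<^esub> w)"
    using t by (auto simp: T_carrier tensor_quotient_def carrier_FactGroup)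
  have zero_left: "pure \<zero>\<^bsub>X\<^esub> y = \<zero>\<^bsub>T\<^esub>" if "y \<in> carrier Y" for y
    using pure_add_left[of "\<zero>\<^bsub>X\<^esub>" "\<zero>\<^bsub>X\<^esub>" y] that pure_closed[of "\<zero>\<^bsub>X\<^esub>" y]
      T.add.l_cancel_one'[of "pure \<zero>\<^bsub>X\<^esub> y" "pure \<zero>\<^bsub>X\<^esub> y"] by simp
  have neg: "pure (\<ominus>\<^bsub>X\<^esub> x) y = \<ominus>\<^bsub>T\<^esub> pure x y" if "x \<in> carrier X" "y \<in> carrier Y" for x y
    using pure_add_left[of "\<ominus>\<^bsub>X\<^esub> x" x y] that zero_left[of y]
    by (metis T.minus_equality X.a_inv_closed X.l_neg pure_closed)
  \<comment> \<open>Induction over the free abelian group proceeds by differences, so the claim is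
    carried for an element together with its negative.\<close>
  have "P (code (K #>\<^bsub>F\<^esub> w)) \<and> P (\<ominus>\<^bsub>T\<^esub> code (K #>\<^bsub>F\<^esub> w))
      \<and> code (K #>\<^bsub>F\<^esub> w) \<in> carrier T \<and> w \<in> carrier F"
    using w(1)
  proof (induction w rule: frag_induction)
    case zero
    have "code (K #>\<^bsub>F\<^esub> 0) = \<zero>\<^bsub>T\<^esub>"
      using hom_one[OF proj_hom] T.a_group by simp
    have minus_zero: "\<ominus>\<^bsub>T\<^esub> \<zero>\<^bsub>T\<^esub> = \<zero>\<^bsub>T\<^esub>"
      by (rule T.minus_equality) simp_all
    with \<open>code (K #>\<^bsub>F\<^esub> 0) = \<zero>\<^bsub>T\<^esub>\<close> show ?case
      using pure[of "\<zero>\<^bsub>X\<^esub>" "\<zero>\<^bsub>Y\<^esub>"] zero_left[of "\<zero>\<^bsub>Y\<^esub>"]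
      by (simp add: minus_zero)
  next
    case (one p)
    then obtain x y where p: "p = (x, y)" "x \<in> carrier X" "y \<in> carrier Y" by auto
    then show ?case
      using pure[of x y] pure[of "\<ominus>\<^bsub>X\<^esub> x" y] neg[of x y] pure_closed[of x y]
      by (simp add: pure_eq)
  next
    case (diff a b)
    define u v z where "u = code (K #>\<^bsub>F\<^esub> a)" and "v = code (K #>\<^bsub>F\<^esub> b)"
      and "z = code (K #>\<^bsub>F\<^esub> (a - b))"
    note uvz = u_def[symmetric] v_def[symmetric] z_def[symmetric]
    have ab: "a - b \<in> carrier F"
      using diff by (metis carrier_free_Abelian_group_iff keys_diff_subset)
    have P: "P u" "P (\<ominus>\<^bsub>T\<^esub> u)" "u \<in> carrier T" "P v" "P (\<ominus>\<^bsub>T\<^esub> v)" "v \<in> carrier T"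
      using diff by (simp_all add: uvz)
    have z: "z \<in> carrier T"
      using hom_in_carrier[OF proj_hom ab] by (simp add: z_def)
    have "z \<oplus>\<^bsub>T\<^esub> v = u"
      using proj_add[OF ab, of b] diff by (simp add: uvz)
    then have 1: "z = u \<oplus>\<^bsub>T\<^esub> \<ominus>\<^bsub>T\<^esub> v"
      using P z by (auto simp: T.a_assoc T.r_neg)
    have 2: "\<ominus>\<^bsub>T\<^esub> z = \<ominus>\<^bsub>T\<^esub> u \<oplus>\<^bsub>T\<^esub> v"
      using P by (simp add: 1 T.minus_add)
    have "P z" unfolding 1 using P by (intro add) auto
    moreover have "P (\<ominus>\<^bsub>T\<^esub> z)" unfolding 2 using P by (intro add) auto
    ultimately show ?case using z ab by (simp add: uvz)
  qed
  then show ?thesis using w(2) by simp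
qed

lemma addhom_eqI:
  assumes "f \<in> addhom T Z" "g \<in> addhom T Z"
    and "\<And>x y. \<lbrakk>x \<in> carrier X; y \<in> carrier Y\<rbrakk> \<Longrightarrow> f (pure x y) = g (pure x y)"
    and "t \<in> carrier T"
  shows "f t = g t"
  using assms(4) by (induction rule: tensor_induct) (simp_all add: assms(3) addhom_add[OF assms(1)] addhom_add[OF assms(2)])

text \<open>The function extends to the free abelian group, balancedness makes it vanish on the
  relators and therefore on the subgroup they generate, and the induced map on the quotient is read
  back through the code.\<close>

lemma lift_exists:
  assumes Z: "abelian_group Z" and bal: "balanced S X ra Y la Z \<phi>"
  shows "\<exists>h. h \<in> extensional (carrier T) \<and> h \<in> addhom T Z \<and>
           (\<forall>x\<in>carrier X. \<forall>y\<in>carrier Y. h (pure x y) = \<phi> x y)"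
proof -
  interpret Z: abelian_group Z by fact
  have "case_prod \<phi> ` (carrier X \<times> carrier Y) \<subseteq> carrier (add_monoid Z)"
    using bal by (auto simp: balanced_def)
  then obtain h0 where h0: "h0 \<in> hom F (add_monoid Z)"
    and h0_frag: "\<And>p. p \<in> carrier X \<times> carrier Y \<Longrightarrow> h0 (frag_of p) = case_prod \<phi> p"
    using comm_group.free_Abelian_group_universal[OF Z.a_comm_group] by blast
  interpret h0: group_hom F "add_monoid Z" h0
    by unfold_locales (rule h0)
  have diff: "h0 (a - b) = h0 a \<ominus>\<^bsub>Z\<^esub> h0 b" "a - b \<in> carrier F"
    if "a \<in> carrier F" "b \<in> carrier F" for a b
  proof -
    show ab: "a - b \<in> carrier F"
      using that by (metis carrier_free_Abelian_group_iff keys_diff_subset)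
    have "h0 (a - b) \<oplus>\<^bsub>Z\<^esub> h0 b = h0 a"
      using h0.hom_mult[OF ab that(2)] by simp
    then show "h0 (a - b) = h0 a \<ominus>\<^bsub>Z\<^esub> h0 b"
      using h0.hom_closed[OF ab] h0.hom_closed[OF that(1)] h0.hom_closed[OF that(2)]
      by (intro Z.eq_minusI) simp_all
  qed
  have frag: "frag_of (x, y) \<in> carrier F" "h0 (frag_of (x, y)) = \<phi> x y" "\<phi> x y \<in> carrier Z"
    if "x \<in> carrier X" "y \<in> carrier Y" for x y
    using that h0_frag[of "(x, y)"] bal by (auto simp: balanced_def)
  have "tensor_relators S X ra Y la \<subseteq> kernel F (add_monoid Z) h0"
  proof
    fix w assume w: "w \<in> tensor_relators S X ra Y la"
    consider
      (left) x x' y where "w = frag_of (x \<oplus>\<^bsub>X\<^esub> x', y) - frag_of (x, y) - frag_of (x', y)"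
        "x \<in> carrier X" "x' \<in> carrier X" "y \<in> carrier Y"
      | (right) x y y' where "w = frag_of (x, y \<oplus>\<^bsub>Y\<^esub> y') - frag_of (x, y) - frag_of (x, y')"
        "x \<in> carrier X" "y \<in> carrier Y" "y' \<in> carrier Y"
      | (middle) x r y where "w = frag_of (ra x r, y) - frag_of (x, la r y)"
        "x \<in> carrier X" "r \<in> S" "y \<in> carrier Y"
      using w unfolding tensor_relators_def by blast
    then have "h0 w = \<zero>\<^bsub>Z\<^esub>"
    proof cases
      case left
      have "\<phi> (x \<oplus>\<^bsub>X\<^esub> x') y = \<phi> x y \<oplus>\<^bsub>Z\<^esub> \<phi> x' y"
        using bal left by (auto simp: balanced_def)
      then show ?thesis
        using left Z.add_minus_minus[OF frag(3) frag(3)] by (simp only: left diff frag X.add.m_closed)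
    next
      case right
      have "\<phi> x (y \<oplus>\<^bsub>Y\<^esub> y') = \<phi> x y \<oplus>\<^bsub>Z\<^esub> \<phi> x y'"
        using bal right by (auto simp: balanced_def)
      then show ?thesis
        using right Z.add_minus_minus[OF frag(3) frag(3)] by (simp only: right diff frag Y.add.m_closed)
    next
      case middle
      have "\<phi> (ra x r) y = \<phi> x (la r y)"
        using bal middle by (auto simp: balanced_def)
      then show ?thesis
        using middle Z.r_neg[OF frag(3), folded Z.minus_eq]
        by (simp only: middle diff frag ra_closed la_closed)
    qed
    then show "w \<in> kernel F (add_monoid Z) h0"
      using relators_in_F w unfolding kernel_def
        by (auto simp del: carrier_free_Abelian_group_iff)
  qed
  then have K: "K \<subseteq> kernel F (add_monoid Z) h0"
    unfolding tensor_kernel_def by (rule F.generate_subgroup_incl[OF _ h0.subgroup_kernel])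
  obtain g where g: "g \<in> hom Q (add_monoid Z)"
      "\<And>w. w \<in> carrier F \<Longrightarrow> g (K #>\<^bsub>F\<^esub> w) = h0 w"
    by (rule h0.FactGroup_universal_kernel[OF kernel_normal K, folded tensor_quotient_def]) (rule that)
  define h where "h = (\<lambda>t\<in>carrier T. g (inv_into (carrier Q) code t))"
  have h_ext: "h \<in> extensional (carrier T)"
    unfolding h_def by (rule restrict_extensional)
  have h_code: "h (code p) = g p" if "p \<in> carrier Q" for p
  proof -
    have "code p \<in> carrier T" using that unfolding T_carrier by (rule imageI)
    then show ?thesis
      unfolding h_def by (simp only: restrict_apply' inv_into_f_f[OF code_inj that])
  qed
  have h_hom: "h \<in> addhom T Z"
  proof (rule addhomI)
    fix s assume "s \<in> carrier T"
    then obtain p where p: "p \<in> carrier Q" "s = code p" unfolding T_carrier by blast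
    then show "h s \<in> carrier Z"
      using hom_in_carrier[OF g(1) p(1)] by (simp add: h_code)
    fix t assume "t \<in> carrier T"
    then obtain q where q: "q \<in> carrier Q" "t = code q" unfolding T_carrier by blast
    show "h (s \<oplus>\<^bsub>T\<^esub> t) = h s \<oplus>\<^bsub>Z\<^esub> h t"
      using hom_mult[OF g(1) p(1) q(1)] p q by (simp add: T_add h_code)
  qed
  have h_pure: "h (pure x y) = \<phi> x y" if "x \<in> carrier X" "y \<in> carrier Y" for x y
  proof -
    have "K #>\<^bsub>F\<^esub> frag_of (x, y) \<in> carrier Q"
      unfolding tensor_quotient_def carrier_FactGroup using frag that by blast
    then show ?thesis
      using that frag by (simp add: pure_eq h_code g(2))
  qed
  show ?thesis
    by (intro exI[of _ h] conjI ballI h_ext h_hom h_pure)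
qed

text \<open>Additive maps agreeing on pure tensors agree on the carrier, and extensionality fixes
  the remaining values; so the description in \<open>tensor_lift\<close> has exactly one
  solution.\<close>

lemma
  assumes "abelian_group Z" "balanced S X ra Y la Z \<phi>"
  shows lift_extensional: "tensor_lift S X ra Y la Z \<phi> \<in> extensional (carrier T)"
    and lift_addhom: "tensor_lift S X ra Y la Z \<phi> \<in> addhom T Z"
    and lift_pure: "\<lbrakk>x \<in> carrier X; y \<in> carrier Y\<rbrakk> \<Longrightarrow> tensor_lift S X ra Y la Z \<phi> (pure x y) = \<phi> x y"
proof -
  obtain h where ext: "h \<in> extensional (carrier T)" and hom: "h \<in> addhom T Z"
    and pure: "\<forall>x\<in>carrier X. \<forall>y\<in>carrier Y. h (pure x y) = \<phi> x y"
    using lift_exists[OF assms] by (elim exE conjE)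
  have lift: "tensor_lift S X ra Y la Z \<phi> = h"
    unfolding tensor_lift_def
  proof (rule the_equality, intro conjI ext hom pure, elim conjE)
    fix h' assume h': "h' \<in> extensional (carrier T)" "h' \<in> addhom T Z"
      "\<forall>x\<in>carrier X. \<forall>y\<in>carrier Y. h' (pure x y) = \<phi> x y"
    show "h' = h"
    proof (rule extensionalityI[OF h'(1) ext])
      fix t assume "t \<in> carrier T"
      then show "h' t = h t"
        by (rule addhom_eqI[OF h'(2) hom, rotated]) (simp add: h'(3) pure)
    qed
  qed
  show "tensor_lift S X ra Y la Z \<phi> \<in> extensional (carrier T)"
    unfolding lift by (rule ext)
  show "tensor_lift S X ra Y la Z \<phi> \<in> addhom T Z"
    unfolding lift by (rule hom)
  show "tensor_lift S X ra Y la Z \<phi> (pure x y) = \<phi> x y" if "x \<in> carrier X" "y \<in> carrier Y"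
    unfolding lift using pure that by blast
qed

lemma lift_closed:
  "\<lbrakk>abelian_group Z; balanced S X ra Y la Z \<phi>; t \<in> carrier T\<rbrakk>
    \<Longrightarrow> tensor_lift S X ra Y la Z \<phi> t \<in> carrier Z"
  using addhom_closed[OF lift_addhom] by blast

lemma lift_add:
  "\<lbrakk>abelian_group Z; balanced S X ra Y la Z \<phi>; s \<in> carrier T; t \<in> carrier T\<rbrakk>
    \<Longrightarrow> tensor_lift S X ra Y la Z \<phi> (s \<oplus>\<^bsub>T\<^esub> t) =
       tensor_lift S X ra Y la Z \<phi> s \<oplus>\<^bsub>Z\<^esub> tensor_lift S X ra Y la Z \<phi> t"
  using addhom_add[OF lift_addhom] by blast

lemma lift_eqI:
  assumes "abelian_group Z" "balanced S X ra Y la Z \<phi>" "f \<in> addhom T Z"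
    and "\<And>x y. \<lbrakk>x \<in> carrier X; y \<in> carrier Y\<rbrakk> \<Longrightarrow> f (pure x y) = \<phi> x y"
    and "t \<in> carrier T"
  shows "f t = tensor_lift S X ra Y la Z \<phi> t"
  using addhom_eqI[OF assms(3) lift_addhom[OF assms(1,2)] _ assms(5)]
  by (simp add: assms(4) lift_pure[OF assms(1,2)])

text \<open>In Sweedler notation, this applies an additive map under the summation sign.\<close>

lemma lift_comp:
  assumes "abelian_group Z" "abelian_group W" "h \<in> addhom Z W"
    and bal: "balanced S X ra Y la Z \<phi>" and "t \<in> carrier T"
  shows "h (tensor_lift S X ra Y la Z \<phi> t) = tensor_lift S X ra Y la W (\<lambda>x y. h (\<phi> x y)) t"
proof (rule lift_eqI)
  show "balanced S X ra Y la W (\<lambda>x y. h (\<phi> x y))"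
    using bal addhom_closed[OF assms(3)] addhom_add[OF assms(3)] by (auto simp: balanced_def)
  show "(\<lambda>t. h (tensor_lift S X ra Y la Z \<phi> t)) \<in> addhom T W"
    using addhom_closed[OF assms(3)] addhom_add[OF assms(3)] lift_closed[OF assms(1) bal]
      lift_add[OF assms(1) bal] by (intro addhomI) auto
qed (use assms lift_pure[OF assms(1) bal] in auto)

lemma lift_plus:
  assumes Z: "abelian_group Z" and "balanced S X ra Y la Z \<phi>" "balanced S X ra Y la Z \<psi>"
    and "t \<in> carrier T"
  shows "tensor_lift S X ra Y la Z (\<lambda>x y. \<phi> x y \<oplus>\<^bsub>Z\<^esub> \<psi> x y) t =
           tensor_lift S X ra Y la Z \<phi> t \<oplus>\<^bsub>Z\<^esub> tensor_lift S X ra Y la Z \<psi> t"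
proof -
  interpret Z: abelian_group Z by fact
  show ?thesis
  proof (rule lift_eqI[symmetric])
    show "balanced S X ra Y la Z (\<lambda>x y. \<phi> x y \<oplus>\<^bsub>Z\<^esub> \<psi> x y)"
      using assms(2,3) by (auto simp: balanced_def Z.a_ac)
    show "(\<lambda>t. tensor_lift S X ra Y la Z \<phi> t \<oplus>\<^bsub>Z\<^esub> tensor_lift S X ra Y la Z \<psi> t) \<in> addhom T Z"
      using assms by (intro addhomI) (auto simp: lift_closed lift_add Z.a_ac)
  qed (simp_all add: assms lift_pure)
qed

lemma lift_cong:
  assumes "\<And>x y. \<lbrakk>x \<in> carrier X; y \<in> carrier Y\<rbrakk> \<Longrightarrow> \<phi> x y = \<psi> x y"
  shows "tensor_lift S X ra Y la Z \<phi> = tensor_lift S X ra Y la Z \<psi>"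
  using assms unfolding tensor_lift_def by (simp cong: ball_cong)

end

section \<open>Tensor products over the ground ring\<close>

abbreviation kbalanced ::
  "('k, 'c) ring_scheme \<Rightarrow> ('k, 'u) module \<Rightarrow> ('k, 'u) module \<Rightarrow> ('u, 'p) ring_scheme \<Rightarrow>
   ('u \<Rightarrow> 'u \<Rightarrow> 'u) \<Rightarrow> bool" where
  "kbalanced k M N Z \<phi> \<equiv> balanced (carrier k) M (\<lambda>x c. c \<odot>\<^bsub>M\<^esub> x) N (smult N) Z \<phi>"

lemma module_abelian_group: "Module.module k M \<Longrightarrow> abelian_group M"
  by (simp add: Module.module_def)

lemma kbalancedI:
  assumes "\<And>x y. \<lbrakk>x \<in> carrier M; y \<in> carrier N\<rbrakk> \<Longrightarrow> \<phi> x y \<in> carrier Z"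
    and "\<And>x x' y. \<lbrakk>x \<in> carrier M; x' \<in> carrier M; y \<in> carrier N\<rbrakk>
        \<Longrightarrow> \<phi> (x \<oplus>\<^bsub>M\<^esub> x') y = \<phi> x y \<oplus>\<^bsub>Z\<^esub> \<phi> x' y"
    and "\<And>x y y'. \<lbrakk>x \<in> carrier M; y \<in> carrier N; y' \<in> carrier N\<rbrakk>
        \<Longrightarrow> \<phi> x (y \<oplus>\<^bsub>N\<^esub> y') = \<phi> x y \<oplus>\<^bsub>Z\<^esub> \<phi> x y'"
    and "\<And>x c y. \<lbrakk>x \<in> carrier M; c \<in> carrier k; y \<in> carrier N\<rbrakk>
        \<Longrightarrow> \<phi> (c \<odot>\<^bsub>M\<^esub> x) y = \<phi> x (c \<odot>\<^bsub>N\<^esub> y)"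
  shows "kbalanced k M N Z \<phi>"
  using assms by (simp add: balanced_def)

lemma tensor_factors_k:
  fixes M N :: "('k, 'u::infinite) module"
  assumes "Module.module k M" "Module.module k N"
  shows "tensor_factors (carrier k) M (\<lambda>x c. c \<odot>\<^bsub>M\<^esub> x) N (smult N)"
  using assms by (simp add: tensor_factors_def module_abelian_group Module.module.smult_closed)

lemma
  shows ktensor_carrier: "carrier (ktensor k M N) = carrier (tensor_group (carrier k) M (\<lambda>x c. c \<odot>\<^bsub>M\<^esub> x) N (smult N))"
    and ktensor_add: "ring.add (ktensor k M N) = ring.add (tensor_group (carrier k) M (\<lambda>x c. c \<odot>\<^bsub>M\<^esub> x) N (smult N))"
    and ktensor_zero: "ring.zero (ktensor k M N) = ring.zero (tensor_group (carrier k) M (\<lambda>x c. c \<odot>\<^bsub>M\<^esub> x) N (smult N))"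
  by (simp_all add: ktensor_def Let_def)

lemmas ktensor_simps = ktensor_carrier ktensor_add ktensor_zero

text \<open>The same group occurs inside several record types with different further fields. Being
  an additive map depends only on carriers and additions, and this carries facts from one record to
  another.\<close>

lemma addhom_cong:
  assumes "carrier M = carrier M'" "ring.add M = ring.add M'"
    and "carrier N = carrier N'" "ring.add N = ring.add N'"
  shows "addhom M N = addhom M' N'"
  using assms by (simp add: hom_def)

lemma addhom_ktensor:
  "addhom (ktensor k M N) Z = addhom (tensor_group (carrier k) M (\<lambda>x c. c \<odot>\<^bsub>M\<^esub> x) N (smult N)) Z"
  by (rule addhom_cong) (simp_all add: ktensor_simps)

lemma abelian_group_cong:
  assumes "carrier M = carrier N" "ring.add M = ring.add N" "ring.zero M = ring.zero N"
  shows "abelian_group M \<longleftrightarrow> abelian_group N"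
  using assms
  by (simp add: abelian_group_def abelian_monoid_def abelian_group_axioms_def comm_group_def comm_monoid_def
     comm_monoid_axioms_def monoid_def group_def group_axioms_def Units_def)

context
  fixes k :: "('k, 'c) ring_scheme" and M N :: "('k, 'u::infinite) module"
  assumes M: "Module.module k M" and N: "Module.module k N"
begin

interpretation tensor_factors "carrier k" M "\<lambda>x c. c \<odot>\<^bsub>M\<^esub> x" N "smult N"
  by (rule tensor_factors_k[OF M N])

interpretation M: Module.module k M by (rule M)
interpretation N: Module.module k N by (rule N)

lemma ktensor_abelian_group: "abelian_group (ktensor k M N)"
  using T_abelian abelian_group_cong[of "ktensor k M N" T] by (simp add: ktensor_simps)

lemma ktensor_add_PiE:
  "ring.add (ktensor k M N) \<in>
     carrier (ktensor k M N) \<rightarrow>\<^sub>E carrier (ktensor k M N) \<rightarrow>\<^sub>E carrier (ktensor k M N)"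
  using T_normal(3) by (simp add: ktensor_simps)

lemma ktens_closed [simp]:
  "\<lbrakk>x \<in> carrier M; y \<in> carrier N\<rbrakk> \<Longrightarrow> ktens k M N x y \<in> carrier (ktensor k M N)"
  by (simp add: ktens_def ktensor_simps pure_closed)

lemma ktens_add_left:
  "\<lbrakk>x \<in> carrier M; x' \<in> carrier M; y \<in> carrier N\<rbrakk> \<Longrightarrow>
    ktens k M N (x \<oplus>\<^bsub>M\<^esub> x') y = ktens k M N x y \<oplus>\<^bsub>ktensor k M N\<^esub> ktens k M N x' y"
  by (simp add: ktens_def ktensor_simps pure_add_left)

lemma ktens_add_right:
  "\<lbrakk>x \<in> carrier M; y \<in> carrier N; y' \<in> carrier N\<rbrakk> \<Longrightarrow>
    ktens k M N x (y \<oplus>\<^bsub>N\<^esub> y') = ktens k M N x y \<oplus>\<^bsub>ktensor k M N\<^esub> ktens k M N x y'"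
  by (simp add: ktens_def ktensor_simps pure_add_right)

lemma ktens_balanced:
  "\<lbrakk>x \<in> carrier M; c \<in> carrier k; y \<in> carrier N\<rbrakk> \<Longrightarrow>
    ktens k M N (c \<odot>\<^bsub>M\<^esub> x) y = ktens k M N x (c \<odot>\<^bsub>N\<^esub> y)"
  by (simp add: ktens_def pure_balanced)

lemma ktensor_induct [consumes 1, case_names tens add]:
  assumes "t \<in> carrier (ktensor k M N)"
    and "\<And>x y. \<lbrakk>x \<in> carrier M; y \<in> carrier N\<rbrakk> \<Longrightarrow> P (ktens k M N x y)"
    and "\<And>s t. \<lbrakk>s \<in> carrier (ktensor k M N); t \<in> carrier (ktensor k M N); P s; P t\<rbrakk>
        \<Longrightarrow> P (s \<oplus>\<^bsub>ktensor k M N\<^esub> t)"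
  shows "P t"
  using tensor_induct[of t P] assms by (simp add: ktensor_simps ktens_def)

lemma ktensor_addhom_eqI:
  assumes "t \<in> carrier (ktensor k M N)"
    and "f \<in> addhom (ktensor k M N) Z" "g \<in> addhom (ktensor k M N) Z"
    and "\<And>x y. \<lbrakk>x \<in> carrier M; y \<in> carrier N\<rbrakk> \<Longrightarrow> f (ktens k M N x y) = g (ktens k M N x y)"
  shows "f t = g t"
  by (rule addhom_eqI[OF assms(2,3)[unfolded addhom_ktensor] _ assms(1)[unfolded ktensor_carrier]])
    (simp add: assms(4) ktens_def[symmetric])

context
  fixes Z :: "('u, 'p) ring_scheme" and \<phi>
  assumes Z: "abelian_group Z" and bal: "kbalanced k M N Z \<phi>"
begin

lemma klift_extensional: "klift k M N Z \<phi> \<in> extensional (carrier (ktensor k M N))"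
  using lift_extensional[OF Z bal] by (simp add: klift_def ktensor_simps)

lemma klift_addhom: "klift k M N Z \<phi> \<in> addhom (ktensor k M N) Z"
  using lift_addhom[OF Z bal] by (simp add: klift_def addhom_ktensor)

lemma klift_ktens [simp]:
  "\<lbrakk>x \<in> carrier M; y \<in> carrier N\<rbrakk> \<Longrightarrow> klift k M N Z \<phi> (ktens k M N x y) = \<phi> x y"
  using lift_pure[OF Z bal] by (simp add: klift_def ktens_def)

lemma klift_closed [simp]: "t \<in> carrier (ktensor k M N) \<Longrightarrow> klift k M N Z \<phi> t \<in> carrier Z"
  using lift_closed[OF Z bal] by (simp add: klift_def ktensor_simps)

lemma klift_add:
  "\<lbrakk>s \<in> carrier (ktensor k M N); t \<in> carrier (ktensor k M N)\<rbrakk> \<Longrightarrow>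
    klift k M N Z \<phi> (s \<oplus>\<^bsub>ktensor k M N\<^esub> t) = klift k M N Z \<phi> s \<oplus>\<^bsub>Z\<^esub> klift k M N Z \<phi> t"
  using lift_add[OF Z bal] by (simp add: klift_def ktensor_simps)

lemma klift_eqI:
  assumes "t \<in> carrier (ktensor k M N)" "f \<in> addhom (ktensor k M N) Z"
    and "\<And>x y. \<lbrakk>x \<in> carrier M; y \<in> carrier N\<rbrakk> \<Longrightarrow> f (ktens k M N x y) = \<phi> x y"
  shows "f t = klift k M N Z \<phi> t"
  by (rule ktensor_addhom_eqI[OF assms(1,2) klift_addhom]) (simp add: assms)

lemma klift_comp:
  assumes "abelian_group W" "h \<in> addhom Z W" "t \<in> carrier (ktensor k M N)"
  shows "h (klift k M N Z \<phi> t) = klift k M N W (\<lambda>x y. h (\<phi> x y)) t"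
  using lift_comp[OF Z assms(1,2) bal] assms(3) by (simp add: klift_def ktensor_simps)

lemma klift_plus:
  assumes "kbalanced k M N Z \<psi>" "t \<in> carrier (ktensor k M N)"
  shows "klift k M N Z (\<lambda>x y. \<phi> x y \<oplus>\<^bsub>Z\<^esub> \<psi> x y) t = klift k M N Z \<phi> t \<oplus>\<^bsub>Z\<^esub> klift k M N Z \<psi> t"
  using lift_plus[OF Z bal assms(1)] assms(2) by (simp add: klift_def ktensor_simps)

end

lemma klift_cong:
  assumes "\<And>x y. \<lbrakk>x \<in> carrier M; y \<in> carrier N\<rbrakk> \<Longrightarrow> \<phi> x y = \<psi> x y"
  shows "klift k M N Z \<phi> = klift k M N Z \<psi>"
  unfolding klift_def by (rule lift_cong) (rule assms)

lemma ktens_is_balanced: "kbalanced k M N (ktensor k M N) (ktens k M N)"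
  by (rule kbalancedI) (simp_all add: ktens_add_left ktens_add_right ktens_balanced)

lemma klift_ktens_id: "t \<in> carrier (ktensor k M N) \<Longrightarrow> klift k M N (ktensor k M N) (ktens k M N) t = t"
  by (rule klift_eqI[OF ktensor_abelian_group ktens_is_balanced, where f = "\<lambda>t. t", symmetric])
    (auto intro: addhomI)

lemma ktens_smult_balanced:
  assumes "c \<in> carrier k"
  shows "kbalanced k M N (ktensor k M N) (\<lambda>x y. ktens k M N (c \<odot>\<^bsub>M\<^esub> x) y)"
  by (rule kbalancedI)
    (use assms in \<open>simp_all add: ktens_add_left ktens_add_right M.smult_r_distr ktens_balanced[symmetric]
       M.smult_assoc1[symmetric] M.R.m_comm\<close>)

text \<open>\<open>ktensor\<close> defines its scalar action by lifting into the bare group of the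
  tensor product, whereas the rules speak of lifts into \<open>ktensor\<close> itself. A lift sees
  only the carrier and the addition of its target.\<close>

lemma klift_target_cong:
  assumes "carrier Z = carrier Z'" "ring.add Z = ring.add Z'"
  shows "klift k M N Z \<phi> = klift k M N Z' \<phi>"
proof -
  have "addhom T Z = addhom T Z'"
    by (rule addhom_cong) (use assms in auto)
  then show ?thesis
    by (simp add: klift_def tensor_lift_def)
qed

lemma ktensor_smult:
  assumes "c \<in> carrier k"
  shows "c \<odot>\<^bsub>ktensor k M N\<^esub> t = klift k M N (ktensor k M N) (\<lambda>x y. ktens k M N (c \<odot>\<^bsub>M\<^esub> x) y) t"
proof -
  have "klift k M N (ktensor k M N) = klift k M N T"
    by (rule ext, rule klift_target_cong) (simp_all add: ktensor_simps)
  then show ?thesis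
    using assms by (simp add: ktensor_def[of k M N] Let_def)
qed

lemma ktens_smult_left:
  "\<lbrakk>c \<in> carrier k; x \<in> carrier M; y \<in> carrier N\<rbrakk> \<Longrightarrow>
    ktens k M N (c \<odot>\<^bsub>M\<^esub> x) y = c \<odot>\<^bsub>ktensor k M N\<^esub> ktens k M N x y"
  by (simp add: ktensor_smult klift_ktens[OF ktensor_abelian_group ktens_smult_balanced])

lemma ktens_smult_right:
  "\<lbrakk>c \<in> carrier k; x \<in> carrier M; y \<in> carrier N\<rbrakk> \<Longrightarrow>
    ktens k M N x (c \<odot>\<^bsub>N\<^esub> y) = c \<odot>\<^bsub>ktensor k M N\<^esub> ktens k M N x y"
  using ktens_smult_left[of c x y] ktens_balanced[of x c y] by simp

text \<open>Multiplication by a fixed scalar is a lift and hence additive; the remaining laws are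
  checked on pure tensors, where the scalar sits on the left factor.\<close>

lemma ktensor_module: "Module.module k (ktensor k M N)"
proof (rule Module.moduleI)
  interpret KT: abelian_group "ktensor k M N" by (rule ktensor_abelian_group)
  note smult_simps = ktensor_smult klift_add[OF ktensor_abelian_group ktens_smult_balanced]
    klift_closed[OF ktensor_abelian_group ktens_smult_balanced]
  show closed: "c \<odot>\<^bsub>ktensor k M N\<^esub> t \<in> carrier (ktensor k M N)"
    if "c \<in> carrier k" "t \<in> carrier (ktensor k M N)" for c t
    using that by (simp add: smult_simps)
  show add: "c \<odot>\<^bsub>ktensor k M N\<^esub> (s \<oplus>\<^bsub>ktensor k M N\<^esub> t) =
      c \<odot>\<^bsub>ktensor k M N\<^esub> s \<oplus>\<^bsub>ktensor k M N\<^esub> c \<odot>\<^bsub>ktensor k M N\<^esub> t"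
    if "c \<in> carrier k" "s \<in> carrier (ktensor k M N)" "t \<in> carrier (ktensor k M N)" for c s t
    using that by (simp add: smult_simps)
  show "(c \<oplus>\<^bsub>k\<^esub> d) \<odot>\<^bsub>ktensor k M N\<^esub> t =
      c \<odot>\<^bsub>ktensor k M N\<^esub> t \<oplus>\<^bsub>ktensor k M N\<^esub> d \<odot>\<^bsub>ktensor k M N\<^esub> t"
    if "t \<in> carrier (ktensor k M N)" and cd: "c \<in> carrier k" "d \<in> carrier k" for c d t
    using that(1)
  proof (induction rule: ktensor_induct)
    case (tens x y)
    then show ?case
      using cd by (simp add: ktens_smult_left[symmetric] M.smult_l_distr ktens_add_left)
  next
    case (add s t)
    then show ?case
      using cd by (simp add: add closed \<open>\<And>t s c. _ \<Longrightarrow> _ \<Longrightarrow> _ \<Longrightarrow> c \<odot>\<^bsub>ktensor k M N\<^esub> (s \<oplus>\<^bsub>ktensor k M N\<^esub> t) = _\<close> KT.a_ac)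
  qed
  show "(c \<otimes>\<^bsub>k\<^esub> d) \<odot>\<^bsub>ktensor k M N\<^esub> t = c \<odot>\<^bsub>ktensor k M N\<^esub> (d \<odot>\<^bsub>ktensor k M N\<^esub> t)"
    if "t \<in> carrier (ktensor k M N)" and cd: "c \<in> carrier k" "d \<in> carrier k" for c d t
    using that(1)
  proof (induction rule: ktensor_induct)
    case (tens x y)
    then show ?case
      using cd by (simp add: ktens_smult_left[symmetric] M.smult_assoc1)
  next
    case (add s t)
    then show ?case
      using cd by (simp add: closed \<open>\<And>t s c. _ \<Longrightarrow> _ \<Longrightarrow> _ \<Longrightarrow> c \<odot>\<^bsub>ktensor k M N\<^esub> (s \<oplus>\<^bsub>ktensor k M N\<^esub> t) = _\<close>)
  qed
  show "\<one>\<^bsub>k\<^esub> \<odot>\<^bsub>ktensor k M N\<^esub> t = t" if "t \<in> carrier (ktensor k M N)" for t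
    using that
  proof (induction rule: ktensor_induct)
    case (tens x y)
    then show ?case by (simp add: ktens_smult_left[symmetric])
  next
    case (add s t)
    then show ?case
      by (simp add: \<open>\<And>t s c. _ \<Longrightarrow> _ \<Longrightarrow> _ \<Longrightarrow> c \<odot>\<^bsub>ktensor k M N\<^esub> (s \<oplus>\<^bsub>ktensor k M N\<^esub> t) = _\<close>)
  qed
qed (use M.R.is_cring ktensor_abelian_group in auto)

interpretation KT: Module.module k "ktensor k M N" by (rule ktensor_module)

text \<open>The target is only an abelian group, so a scalar cannot be pulled out of the lift; it is
  pushed into the first argument of \<phi> instead.\<close>

lemma klift_smult:
  assumes Z: "abelian_group Z" and bal: "kbalanced k M N Z \<phi>"
    and c: "c \<in> carrier k" and t: "t \<in> carrier (ktensor k M N)"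
  shows "klift k M N Z \<phi> (c \<odot>\<^bsub>ktensor k M N\<^esub> t) = klift k M N Z (\<lambda>x y. \<phi> (c \<odot>\<^bsub>M\<^esub> x) y) t"
proof -
  have "klift k M N Z \<phi> (klift k M N (ktensor k M N) (\<lambda>x y. ktens k M N (c \<odot>\<^bsub>M\<^esub> x) y) t)
     = klift k M N Z (\<lambda>x y. klift k M N Z \<phi> (ktens k M N (c \<odot>\<^bsub>M\<^esub> x) y)) t"
    by (rule klift_comp[OF ktensor_abelian_group ktens_smult_balanced[OF c] Z klift_addhom[OF Z bal] t])
  also have "\<dots> = klift k M N Z (\<lambda>x y. \<phi> (c \<odot>\<^bsub>M\<^esub> x) y) t"
    by (rule fun_cong[OF klift_cong]) (simp add: c klift_ktens[OF Z bal])
  finally show ?thesis using c by (simp add: ktensor_smult)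
qed

lemma klift_klinear:
  assumes Z: "Module.module k Z" and bal: "kbalanced k M N Z \<phi>"
    and lin: "\<And>c x y. \<lbrakk>c \<in> carrier k; x \<in> carrier M; y \<in> carrier N\<rbrakk> \<Longrightarrow> \<phi> (c \<odot>\<^bsub>M\<^esub> x) y = c \<odot>\<^bsub>Z\<^esub> \<phi> x y"
  shows "klift k M N Z \<phi> \<in> klinear k (ktensor k M N) Z"
proof -
  interpret Z: Module.module k Z by fact
  have ab: "abelian_group Z" by unfold_locales
  have "klift k M N Z \<phi> (c \<odot>\<^bsub>ktensor k M N\<^esub> t) = c \<odot>\<^bsub>Z\<^esub> klift k M N Z \<phi> t"
    if c: "c \<in> carrier k" and t: "t \<in> carrier (ktensor k M N)" for c t
  proof -
    have h: "smult Z c \<in> addhom Z Z" using c by (intro addhomI) (auto simp: Z.smult_r_distr)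
    have "klift k M N Z \<phi> (c \<odot>\<^bsub>ktensor k M N\<^esub> t) = klift k M N Z (\<lambda>x y. c \<odot>\<^bsub>Z\<^esub> \<phi> x y) t"
      unfolding klift_smult[OF ab bal c t] by (rule fun_cong[OF klift_cong]) (simp add: lin c)
    also have "\<dots> = c \<odot>\<^bsub>Z\<^esub> klift k M N Z \<phi> t"
      using klift_comp[OF ab bal ab h t] by simp
    finally show ?thesis .
  qed
  then show ?thesis
    using klift_addhom[OF ab bal] klift_extensional[OF ab bal] by (simp add: klinear_def)
qed

end

lemma klinearD:
  assumes "f \<in> klinear k M N"
  shows "f \<in> addhom M N" "f \<in> extensional (carrier M)"
    "x \<in> carrier M \<Longrightarrow> f x \<in> carrier N"
    "\<lbrakk>x \<in> carrier M; y \<in> carrier M\<rbrakk> \<Longrightarrow> f (x \<oplus>\<^bsub>M\<^esub> y) = f x \<oplus>\<^bsub>N\<^esub> f y"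
    "\<lbrakk>c \<in> carrier k; x \<in> carrier M\<rbrakk> \<Longrightarrow> f (c \<odot>\<^bsub>M\<^esub> x) = c \<odot>\<^bsub>N\<^esub> f x"
  using assms by (auto simp: klinear_def hom_def)

lemma klinearI:
  assumes "f \<in> extensional (carrier M)"
    and "\<And>x. x \<in> carrier M \<Longrightarrow> f x \<in> carrier N"
    and "\<And>x y. \<lbrakk>x \<in> carrier M; y \<in> carrier M\<rbrakk> \<Longrightarrow> f (x \<oplus>\<^bsub>M\<^esub> y) = f x \<oplus>\<^bsub>N\<^esub> f y"
    and "\<And>c x. \<lbrakk>c \<in> carrier k; x \<in> carrier M\<rbrakk> \<Longrightarrow> f (c \<odot>\<^bsub>M\<^esub> x) = c \<odot>\<^bsub>N\<^esub> f x"
  shows "f \<in> klinear k M N"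
  using assms by (auto simp: klinear_def intro: addhomI)

context
  fixes k :: "('k, 'c) ring_scheme" and M M' N N' :: "('k, 'u::infinite) module"
  assumes mods: "Module.module k M" "Module.module k M'" "Module.module k N" "Module.module k N'"
begin

lemma ktensor_map_balanced:
  assumes "f \<in> klinear k M M'"
    and "\<And>y. y \<in> carrier N \<Longrightarrow> g y \<in> carrier N'"
    and "\<And>y y'. \<lbrakk>y \<in> carrier N; y' \<in> carrier N\<rbrakk> \<Longrightarrow> g (y \<oplus>\<^bsub>N\<^esub> y') = g y \<oplus>\<^bsub>N'\<^esub> g y'"
    and "\<And>c y. \<lbrakk>c \<in> carrier k; y \<in> carrier N\<rbrakk> \<Longrightarrow> g (c \<odot>\<^bsub>N\<^esub> y) = c \<odot>\<^bsub>N'\<^esub> g y"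
  shows "kbalanced k M N (ktensor k M' N') (\<lambda>x y. ktens k M' N' (f x) (g y))"
  by (rule kbalancedI)
    (use assms klinearD[OF assms(1)] mods in
      \<open>simp_all add: ktens_add_left ktens_add_right ktens_balanced\<close>)

end

lemma ktensor_map_id_right:
  fixes k :: "('k, 'c) ring_scheme" and M M' N :: "('k, 'u::infinite) module"
  assumes M: "Module.module k M" and M': "Module.module k M'" and N: "Module.module k N" and f: "f \<in> klinear k M M'"
  shows ktensor_map_klinear:
      "ktensor_map k M M' N N f (\<lambda>a. a) \<in> klinear k (ktensor k M N) (ktensor k M' N)"
    and ktensor_map_ktens:
      "\<lbrakk>x \<in> carrier M; y \<in> carrier N\<rbrakk> \<Longrightarrow>
        ktensor_map k M M' N N f (\<lambda>a. a) (ktens k M N x y) = ktens k M' N (f x) y"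
    and ktensor_map_eq:
      "ktensor_map k M M' N N f (\<lambda>a. a) = klift k M N (ktensor k M' N) (\<lambda>x y. ktens k M' N (f x) y)"
    and ktensor_map_kbalanced: "kbalanced k M N (ktensor k M' N) (\<lambda>x y. ktens k M' N (f x) y)"
proof -
  show bal: "kbalanced k M N (ktensor k M' N) (\<lambda>x y. ktens k M' N (f x) y)"
    by (rule ktensor_map_balanced) (use assms in auto)
  show "ktensor_map k M M' N N f (\<lambda>a. a) = klift k M N (ktensor k M' N) (\<lambda>x y. ktens k M' N (f x) y)"
    by (simp add: ktensor_map_def)
  show "ktensor_map k M M' N N f (\<lambda>a. a) \<in> klinear k (ktensor k M N) (ktensor k M' N)"
    unfolding ktensor_map_def
    by (rule klift_klinear[OF M N ktensor_module[OF M' N] bal])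
      (simp add: klinearD[OF f] M' N ktens_smult_left)
  show "ktensor_map k M M' N N f (\<lambda>a. a) (ktens k M N x y) = ktens k M' N (f x) y"
    if "x \<in> carrier M" "y \<in> carrier N"
    unfolding ktensor_map_def
    using that by (simp add: klift_ktens[OF M N ktensor_abelian_group[OF M' N] bal])
qed

section \<open>Isomorphic and equivalent categories\<close>

context
  fixes C :: "('o, 'm, 'z) cat_scheme" and D :: "('p, 'm, 'y) cat_scheme" and Fo Go
  assumes C: "category C"
    and Fo: "\<And>X. X \<in> Obj C \<Longrightarrow> Fo X \<in> Obj D" and Go: "\<And>Y. Y \<in> Obj D \<Longrightarrow> Go Y \<in> Obj C"
    and GF: "\<And>X. X \<in> Obj C \<Longrightarrow> Go (Fo X) = X" and FG: "\<And>Y. Y \<in> Obj D \<Longrightarrow> Fo (Go Y) = Y"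
    and Hom: "\<And>X X'. \<lbrakk>X \<in> Obj C; X' \<in> Obj C\<rbrakk> \<Longrightarrow> Hom D (Fo X) (Fo X') = Hom C X X'"
    and Cmp: "\<And>X Y Z f g. \<lbrakk>X \<in> Obj C; Y \<in> Obj C; Z \<in> Obj C; f \<in> Hom C X Y; g \<in> Hom C Y Z\<rbrakk>
      \<Longrightarrow> Cmp D (Fo X) (Fo Y) (Fo Z) g f = Cmp C X Y Z g f"
    and Idn: "\<And>X. X \<in> Obj C \<Longrightarrow> Idn D (Fo X) = Idn C X"
begin

interpretation C: category C by (rule C)

lemma Hom_transport: "\<lbrakk>Y \<in> Obj D; Y' \<in> Obj D\<rbrakk> \<Longrightarrow> Hom C (Go Y) (Go Y') = Hom D Y Y'"
  using Hom[of "Go Y" "Go Y'"] by (simp add: Go FG)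

lemma Cmp_transport:
  "\<lbrakk>X \<in> Obj D; Y \<in> Obj D; Z \<in> Obj D; f \<in> Hom D X Y; g \<in> Hom D Y Z\<rbrakk>
    \<Longrightarrow> Cmp D X Y Z g f = Cmp C (Go X) (Go Y) (Go Z) g f"
  using Cmp[of "Go X" "Go Y" "Go Z" f g] by (simp add: Go FG Hom_transport)

lemma Idn_transport: "X \<in> Obj D \<Longrightarrow> Idn D X = Idn C (Go X)"
  using Idn[of "Go X"] by (simp add: Go FG)

text \<open>The category axioms of \<open>D\<close> are pulled back along the bijection on objects.
  Thus descent data, Yetter-Drinfeld modules and the weak center obtain them from an isomorphic
  category instead of by direct verification.\<close>

lemma category_transport: "category D"
proof
  fix X assume X: "X \<in> Obj D"
  then show Idn: "Idn D X \<in> Hom D X X"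
    using C.Idn_in_Hom[of "Go X"] by (simp add: Idn_transport Go Hom_transport)
next
  fix X Y Z f g assume XYZ: "X \<in> Obj D" "Y \<in> Obj D" "Z \<in> Obj D"
    and "f \<in> Hom D X Y" "g \<in> Hom D Y Z"
  then show "Cmp D X Y Z g f \<in> Hom D X Z"
    using C.Cmp_in_Hom[of "Go X" "Go Y" "Go Z" f g] by (simp add: Cmp_transport Go Hom_transport)
next
  fix X Y f assume XY: "X \<in> Obj D" "Y \<in> Obj D" "f \<in> Hom D X Y"
  have "Idn D X \<in> Hom D X X" "Idn D Y \<in> Hom D Y Y"
    using XY C.Idn_in_Hom by (simp_all add: Idn_transport Go Hom_transport[symmetric])
  with XY show "Cmp D X Y Y (Idn D Y) f = f" "Cmp D X X Y f (Idn D X) = f"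
    using C.Cmp_Idn_left[of "Go X" "Go Y" f] C.Cmp_Idn_right[of "Go X" "Go Y" f]
    by (simp_all add: Cmp_transport) (simp_all add: Idn_transport Go Hom_transport)
next
  fix W X Y Z f g h assume WXYZ: "W \<in> Obj D" "X \<in> Obj D" "Y \<in> Obj D" "Z \<in> Obj D"
    and fgh: "f \<in> Hom D W X" "g \<in> Hom D X Y" "h \<in> Hom D Y Z"
  have "Cmp D W X Y g f \<in> Hom D W Y" "Cmp D X Y Z h g \<in> Hom D X Z"
    using WXYZ fgh C.Cmp_in_Hom
    by (simp_all add: Cmp_transport Go Hom_transport[symmetric])
  then show "Cmp D W Y Z h (Cmp D W X Y g f) = Cmp D W X Z (Cmp D X Y Z h g) f"
    using WXYZ fgh C.Cmp_assoc[of "Go W" "Go X" "Go Y" "Go Z" f g h]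
    by (simp add: Cmp_transport) (simp add: Go Hom_transport)
qed

text \<open>As the correspondences fix morphisms, both functors are the identity on arrows, and
  functoriality is the agreement of hom-sets, composites and identities.\<close>

lemma isomorphic_transport: "isomorphic_categories C D"
  unfolding isomorphic_categories_def
proof (intro exI conjI ballI)
  show "cat_functor C D Fo (\<lambda>X Y f. f)"
    unfolding cat_functor_def cat_functor_axioms_def
    by (simp add: C category_transport Fo Hom Cmp Idn)
  show "cat_functor D C Go (\<lambda>X Y f. f)"
    unfolding cat_functor_def cat_functor_axioms_def
    by (simp add: C category_transport Go Hom_transport Cmp_transport Idn_transport)
qed (simp_all add: GF FG)

end

lemma isomorphic_categories_refl: "category C \<Longrightarrow> isomorphic_categories C C"
  by (rule isomorphic_transport[where Fo = "\<lambda>X. X" and Go = "\<lambda>X. X"]) simp_all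

lemma isomorphic_categories_sym: "isomorphic_categories C D \<Longrightarrow> isomorphic_categories D C"
  unfolding isomorphic_categories_def by blast

lemma cat_functor_comp:
  assumes "cat_functor C D Fo Fm" "cat_functor D E Go Gm"
  shows "cat_functor C E (\<lambda>X. Go (Fo X)) (\<lambda>X Y f. Gm (Fo X) (Fo Y) (Fm X Y f))"
proof -
  interpret F: cat_functor C D Fo Fm by fact
  interpret G: cat_functor D E Go Gm by fact
  show ?thesis
    by unfold_locales
      (simp_all add: F.Fo_in_Obj G.Fo_in_Obj F.Fm_in_Hom G.Fm_in_Hom F.Fm_Idn G.Fm_Idn F.Fm_Cmp G.Fm_Cmp)
qed

lemma isomorphic_categories_trans:
  assumes "isomorphic_categories C D" "isomorphic_categories D E"
  shows "isomorphic_categories C E"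
proof -
  obtain Fo Fm Go Gm where F: "cat_functor C D Fo Fm" and G: "cat_functor D C Go Gm"
    and FG: "\<forall>X\<in>Obj C. Go (Fo X) = X" "\<forall>Y\<in>Obj D. Fo (Go Y) = Y"
      "\<forall>X\<in>Obj C. \<forall>X'\<in>Obj C. \<forall>f\<in>Hom C X X'. Gm (Fo X) (Fo X') (Fm X X' f) = f"
      "\<forall>Y\<in>Obj D. \<forall>Y'\<in>Obj D. \<forall>g\<in>Hom D Y Y'. Fm (Go Y) (Go Y') (Gm Y Y' g) = g"
    using assms(1) unfolding isomorphic_categories_def by (elim exE conjE)
  obtain Ho Hm Ko Km where H: "cat_functor D E Ho Hm" and K: "cat_functor E D Ko Km"
    and HK: "\<forall>X\<in>Obj D. Ko (Ho X) = X" "\<forall>Y\<in>Obj E. Ho (Ko Y) = Y"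
      "\<forall>X\<in>Obj D. \<forall>X'\<in>Obj D. \<forall>f\<in>Hom D X X'. Km (Ho X) (Ho X') (Hm X X' f) = f"
      "\<forall>Y\<in>Obj E. \<forall>Y'\<in>Obj E. \<forall>g\<in>Hom E Y Y'. Hm (Ko Y) (Ko Y') (Km Y Y' g) = g"
    using assms(2) unfolding isomorphic_categories_def by (elim exE conjE)
  show ?thesis
    unfolding isomorphic_categories_def
  proof (intro exI conjI)
    show "cat_functor C E (\<lambda>X. Ho (Fo X)) (\<lambda>X Y f. Hm (Fo X) (Fo Y) (Fm X Y f))"
      by (rule cat_functor_comp[OF F H])
    show "cat_functor E C (\<lambda>X. Go (Ko X)) (\<lambda>X Y f. Gm (Ko X) (Ko Y) (Km X Y f))"
      by (rule cat_functor_comp[OF K G])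
  qed (simp_all add: FG HK cat_functor.Fo_in_Obj[OF F] cat_functor.Fm_in_Hom[OF F]
      cat_functor.Fo_in_Obj[OF K] cat_functor.Fm_in_Hom[OF K])
qed

lemma (in category) inverse_arrows_unique:
  assumes "X \<in> Obj C" "Y \<in> Obj C" "inverse_arrows C X Y f g" "inverse_arrows C X Y f g'"
  shows "g = g'"
proof -
  have "g = Cmp C Y Y X g (Cmp C Y X Y f g')"
    using assms Cmp_Idn_right[of Y X g] by (simp add: inverse_arrows_def)
  also have "\<dots> = Cmp C Y X X (Cmp C X Y X g f) g'"
    using assms Cmp_assoc[of Y X Y X g' f g] by (simp add: inverse_arrows_def)
  also have "\<dots> = g'"
    using assms Cmp_Idn_left[of Y X g'] by (simp add: inverse_arrows_def)
  finally show ?thesis .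
qed

text \<open>Uniqueness of inverses lets \<open>inv_arrow\<close> be evaluated. This gives explicit
  values to the inverse constraints in the definition of half-braidings.\<close>

lemma (in category) inv_arrow_eqI:
  assumes "X \<in> Obj C" "Y \<in> Obj C" "inverse_arrows C X Y f g"
  shows "inv_arrow C X Y f = g"
  unfolding inv_arrow_def using inverse_arrows_unique[OF assms(1,2)] assms(3) by blast

lemma functor_inverse_arrows:
  assumes F: "cat_functor C D Fo Fm" and "X \<in> Obj C" "Y \<in> Obj C" "inverse_arrows C X Y f g"
  shows "inverse_arrows D (Fo X) (Fo Y) (Fm X Y f) (Fm Y X g)"
proof -
  interpret cat_functor C D Fo Fm by fact
  show ?thesis
    using assms(2-) Fm_Cmp[of X Y X f g] Fm_Cmp[of Y X Y g f]
    by (simp add: inverse_arrows_def Fm_in_Hom Fm_Idn)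
qed

text \<open>Exchanging the two categories in \<open>equivalent_categories\<close> reverses the
  direction of unit and counit. The componentwise inverses are again natural, by composing the
  naturality square with them on both sides.\<close>

lemma natural_isomorphism_inverse:
  assumes F: "cat_functor C D Fo Fm" and G: "cat_functor C D Go Gm"
    and nat: "natural_isomorphism C D Fo Fm Go Gm \<eta>"
  shows "\<exists>\<theta>. natural_isomorphism C D Go Gm Fo Fm \<theta>"
proof -
  interpret F: cat_functor C D Fo Fm by fact
  interpret G: cat_functor C D Go Gm by fact
  have "\<forall>X\<in>Obj C. \<exists>g. inverse_arrows D (Fo X) (Go X) (\<eta> X) g"
    using nat by (simp add: natural_isomorphism_def iso_arrow_def)
  then obtain \<theta> where \<theta>: "\<And>X. X \<in> Obj C \<Longrightarrow> inverse_arrows D (Fo X) (Go X) (\<eta> X) (\<theta> X)"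
    by metis
  note ia = \<theta>[unfolded inverse_arrows_def]
  have "natural_isomorphism C D Go Gm Fo Fm \<theta>"
    unfolding natural_isomorphism_def
  proof (intro conjI ballI)
    fix X assume "X \<in> Obj C"
    then show "iso_arrow D (Go X) (Fo X) (\<theta> X)"
      using ia unfolding iso_arrow_def inverse_arrows_def by blast
  next
    fix X Y f assume X: "X \<in> Obj C" and Y: "Y \<in> Obj C" and f: "f \<in> Hom C X Y"
    note obj = F.Fo_in_Obj[OF X] F.Fo_in_Obj[OF Y] G.Fo_in_Obj[OF X] G.Fo_in_Obj[OF Y]
    note hom = F.Fm_in_Hom[OF X Y f] G.Fm_in_Hom[OF X Y f]
    have nat': "Cmp D (Fo X) (Go X) (Go Y) (Gm X Y f) (\<eta> X) =
        Cmp D (Fo X) (Fo Y) (Go Y) (\<eta> Y) (Fm X Y f)"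
      using nat X Y f by (simp add: natural_isomorphism_def)
    have "Cmp D (Go X) (Fo X) (Fo Y) (Fm X Y f) (\<theta> X) =
        Cmp D (Go X) (Fo X) (Fo Y)
          (Cmp D (Fo X) (Go Y) (Fo Y) (\<theta> Y) (Cmp D (Fo X) (Fo Y) (Go Y) (\<eta> Y) (Fm X Y f))) (\<theta> X)"
      using ia[OF X] ia[OF Y] obj hom by (simp add: F.D.Cmp_assoc F.D.Cmp_Idn_left)
    also have "\<dots> = Cmp D (Go X) (Go Y) (Fo Y) (\<theta> Y)
        (Cmp D (Go X) (Fo X) (Go Y) (Cmp D (Fo X) (Go X) (Go Y) (Gm X Y f) (\<eta> X)) (\<theta> X))"
      using ia[OF X] ia[OF Y] obj hom
      by (simp add: nat'[symmetric] F.D.Cmp_assoc F.D.Cmp_in_Hom)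
    also have "\<dots> = Cmp D (Go X) (Go Y) (Fo Y) (\<theta> Y) (Gm X Y f)"
      using ia[OF X] ia[OF Y] obj hom
      by (simp add: F.D.Cmp_assoc[symmetric] F.D.Cmp_Idn_right)
    finally show "Cmp D (Go X) (Fo X) (Fo Y) (Fm X Y f) (\<theta> X) =
        Cmp D (Go X) (Go Y) (Fo Y) (\<theta> Y) (Gm X Y f)" .
  qed
  then show ?thesis by (rule exI[of _ \<theta>])
qed

lemma cat_functor_id: "category C \<Longrightarrow> cat_functor C C (\<lambda>X. X) (\<lambda>X Y f. f)"
  by (simp add: cat_functor_def cat_functor_axioms_def)

lemma equivalent_categories_sym:
  assumes "equivalent_categories C D"
  shows "equivalent_categories D C"
proof -
  obtain Fo Fm Go Gm \<eta> \<epsilon> where F: "cat_functor C D Fo Fm" and G: "cat_functor D C Go Gm"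
    and \<eta>: "natural_isomorphism C C (\<lambda>X. X) (\<lambda>X Y f. f)
          (\<lambda>X. Go (Fo X)) (\<lambda>X Y f. Gm (Fo X) (Fo Y) (Fm X Y f)) \<eta>"
    and \<epsilon>: "natural_isomorphism D D
          (\<lambda>Y. Fo (Go Y)) (\<lambda>X Y g. Fm (Go X) (Go Y) (Gm X Y g)) (\<lambda>Y. Y) (\<lambda>X Y g. g) \<epsilon>"
    using assms unfolding equivalent_categories_def by (elim exE conjE)
  have cats: "category C" "category D"
    using F by (simp_all add: cat_functor_def)
  show ?thesis
    using natural_isomorphism_inverse[OF cat_functor_id[OF cats(1)] cat_functor_comp[OF F G] \<eta>]
      natural_isomorphism_inverse[OF cat_functor_comp[OF G F] cat_functor_id[OF cats(2)] \<epsilon>]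
    unfolding equivalent_categories_def
    by (elim exE, intro exI[of _ Go] exI[of _ Gm] exI[of _ Fo] exI[of _ Fm]) (auto simp: F G)
qed

lemma isomorphic_equivalent_categories:
  assumes "isomorphic_categories D C" "equivalent_categories C E"
  shows "equivalent_categories D E"
proof -
  obtain Ho Hm Ko Km where H: "cat_functor D C Ho Hm" and K: "cat_functor C D Ko Km"
    and HK: "\<forall>X\<in>Obj D. Ko (Ho X) = X" "\<forall>Y\<in>Obj C. Ho (Ko Y) = Y"
      "\<forall>X\<in>Obj D. \<forall>X'\<in>Obj D. \<forall>f\<in>Hom D X X'. Km (Ho X) (Ho X') (Hm X X' f) = f"
      "\<forall>Y\<in>Obj C. \<forall>Y'\<in>Obj C. \<forall>g\<in>Hom C Y Y'. Hm (Ko Y) (Ko Y') (Km Y Y' g) = g"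
    using assms(1) unfolding isomorphic_categories_def by (elim exE conjE)
  obtain Fo Fm Go Gm \<eta> \<epsilon> where F: "cat_functor C E Fo Fm" and G: "cat_functor E C Go Gm"
    and \<eta>: "natural_isomorphism C C (\<lambda>X. X) (\<lambda>X Y f. f)
          (\<lambda>X. Go (Fo X)) (\<lambda>X Y f. Gm (Fo X) (Fo Y) (Fm X Y f)) \<eta>"
    and \<epsilon>: "natural_isomorphism E E
          (\<lambda>Y. Fo (Go Y)) (\<lambda>X Y g. Fm (Go X) (Go Y) (Gm X Y g)) (\<lambda>Y. Y) (\<lambda>X Y g. g) \<epsilon>"
    using assms(2) unfolding equivalent_categories_def by (elim exE conjE)
  interpret H: cat_functor D C Ho Hm by fact
  interpret K: cat_functor C D Ko Km by fact
  interpret F: cat_functor C E Fo Fm by fact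
  interpret G: cat_functor E C Go Gm by fact
  show ?thesis
    unfolding equivalent_categories_def
  proof (intro exI conjI)
    show FH: "cat_functor D E (\<lambda>X. Fo (Ho X)) (\<lambda>X Y f. Fm (Ho X) (Ho Y) (Hm X Y f))"
      by (rule cat_functor_comp[OF H F])
    show KG: "cat_functor E D (\<lambda>X. Ko (Go X)) (\<lambda>X Y f. Km (Go X) (Go Y) (Gm X Y f))"
      by (rule cat_functor_comp[OF G K])
    \<comment> \<open>The unit is \<eta> at \<open>Ho X\<close> carried back along the isomorphism;
      its source \<open>Ko (Ho X)\<close> equals \<open>X\<close>, so it has the right type without
      further correction.\<close>
    show "natural_isomorphism D D (\<lambda>X. X) (\<lambda>X Y f. f) (\<lambda>X. Ko (Go (Fo (Ho X))))
        (\<lambda>X Y f. Km (Go (Fo (Ho X))) (Go (Fo (Ho Y)))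
           (Gm (Fo (Ho X)) (Fo (Ho Y)) (Fm (Ho X) (Ho Y) (Hm X Y f))))
        (\<lambda>X. Km (Ho X) (Go (Fo (Ho X))) (\<eta> (Ho X)))"
      unfolding natural_isomorphism_def
    proof (intro conjI ballI)
      fix X assume X: "X \<in> Obj D"
      obtain g where "inverse_arrows C (Ho X) (Go (Fo (Ho X))) (\<eta> (Ho X)) g"
        using \<eta> H.Fo_in_Obj[OF X] by (auto simp: natural_isomorphism_def iso_arrow_def)
      from functor_inverse_arrows[OF K _ _ this]
      show "iso_arrow D X (Ko (Go (Fo (Ho X)))) (Km (Ho X) (Go (Fo (Ho X))) (\<eta> (Ho X)))"
        using X HK(1) by (auto simp: iso_arrow_def H.Fo_in_Obj F.Fo_in_Obj G.Fo_in_Obj)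
    next
      fix X Y f assume X: "X \<in> Obj D" and Y: "Y \<in> Obj D" and f: "f \<in> Hom D X Y"
      note obj = H.Fo_in_Obj[OF X] H.Fo_in_Obj[OF Y]
      note obj' = G.Fo_in_Obj[OF F.Fo_in_Obj[OF obj(1)]] G.Fo_in_Obj[OF F.Fo_in_Obj[OF obj(2)]]
      note h = H.Fm_in_Hom[OF X Y f]
      note h' = G.Fm_in_Hom[OF F.Fo_in_Obj[OF obj(1)] F.Fo_in_Obj[OF obj(2)] F.Fm_in_Hom[OF obj h]]
      have e: "\<eta> (Ho X) \<in> Hom C (Ho X) (Go (Fo (Ho X)))" "\<eta> (Ho Y) \<in> Hom C (Ho Y) (Go (Fo (Ho Y)))"
        using \<eta> obj by (auto simp: natural_isomorphism_def iso_arrow_def inverse_arrows_def)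
      have nat: "Cmp C (Ho X) (Go (Fo (Ho X))) (Go (Fo (Ho Y)))
            (Gm (Fo (Ho X)) (Fo (Ho Y)) (Fm (Ho X) (Ho Y) (Hm X Y f))) (\<eta> (Ho X)) =
          Cmp C (Ho X) (Ho Y) (Go (Fo (Ho Y))) (\<eta> (Ho Y)) (Hm X Y f)"
        using \<eta> obj h by (simp add: natural_isomorphism_def)
      have f': "Km (Ho X) (Ho Y) (Hm X Y f) = f"
        using HK X Y f by simp
      show "Cmp D X (Ko (Go (Fo (Ho X)))) (Ko (Go (Fo (Ho Y))))
          (Km (Go (Fo (Ho X))) (Go (Fo (Ho Y)))
            (Gm (Fo (Ho X)) (Fo (Ho Y)) (Fm (Ho X) (Ho Y) (Hm X Y f))))
          (Km (Ho X) (Go (Fo (Ho X))) (\<eta> (Ho X))) =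
        Cmp D X Y (Ko (Go (Fo (Ho Y)))) (Km (Ho Y) (Go (Fo (Ho Y))) (\<eta> (Ho Y))) f"
        using K.Fm_Cmp[OF obj(1) obj' e(1) h'] K.Fm_Cmp[OF obj obj'(2) h e(2)] HK(1) X Y
        by (simp add: nat f')
    qed
    \<comment> \<open>Since \<open>Ho\<close> undoes \<open>Ko\<close> on objects and
      \<open>Hm\<close> undoes \<open>Km\<close> on arrows, the given \<epsilon> serves
      unchanged.\<close>
    show "natural_isomorphism E E (\<lambda>Y. Fo (Ho (Ko (Go Y))))
        (\<lambda>X Y g. Fm (Ho (Ko (Go X))) (Ho (Ko (Go Y)))
           (Hm (Ko (Go X)) (Ko (Go Y)) (Km (Go X) (Go Y) (Gm X Y g))))
        (\<lambda>Y. Y) (\<lambda>X Y g. g) \<epsilon>"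
      using \<epsilon> HK(2,4) by (simp add: natural_isomorphism_def G.Fo_in_Obj G.Fm_in_Hom)
  qed
qed

lemma concrete_category:
  assumes "\<And>X Y f. \<lbrakk>X \<in> Ob; Y \<in> Ob; f \<in> Hm X Y\<rbrakk> \<Longrightarrow> f \<in> U X \<rightarrow>\<^sub>E U Y"
    and "\<And>X. X \<in> Ob \<Longrightarrow> (\<lambda>x\<in>U X. x) \<in> Hm X X"
    and "\<And>X Y Z f g. \<lbrakk>X \<in> Ob; Y \<in> Ob; Z \<in> Ob; f \<in> Hm X Y; g \<in> Hm Y Z\<rbrakk> \<Longrightarrow> compose (U X) g f \<in> Hm X Z"
  shows "category (concrete_cat Ob Hm U)"
proof
  fix W X Y Z f g h
  assume "W \<in> Obj (concrete_cat Ob Hm U)" "X \<in> Obj (concrete_cat Ob Hm U)"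
    "f \<in> Hom (concrete_cat Ob Hm U) W X"
  then have "f \<in> U W \<rightarrow> U X"
    using assms(1)[of W X f] by (auto simp: concrete_cat_def)
  then show "Cmp (concrete_cat Ob Hm U) W Y Z h (Cmp (concrete_cat Ob Hm U) W X Y g f) =
      Cmp (concrete_cat Ob Hm U) W X Z (Cmp (concrete_cat Ob Hm U) X Y Z h g) f"
    by (auto simp: concrete_cat_def compose_def fun_eq_iff restrict_def Pi_iff)
next
  fix X Y f
  assume "X \<in> Obj (concrete_cat Ob Hm U)" "Y \<in> Obj (concrete_cat Ob Hm U)"
    "f \<in> Hom (concrete_cat Ob Hm U) X Y"
  then have f: "f \<in> U X \<rightarrow>\<^sub>E U Y"
    using assms(1)[of X Y f] by (auto simp: concrete_cat_def)
  then show "Cmp (concrete_cat Ob Hm U) X Y Y (Idn (concrete_cat Ob Hm U) Y) f = f"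
    "Cmp (concrete_cat Ob Hm U) X X Y f (Idn (concrete_cat Ob Hm U) X) = f"
    by (auto simp: concrete_cat_def compose_def fun_eq_iff restrict_def PiE_def extensional_def Pi_iff)
qed (use assms in \<open>auto simp: concrete_cat_def\<close>)

lemma concrete_cat_simps [simp]:
  "Obj (concrete_cat Ob Hm U) = Ob" "Hom (concrete_cat Ob Hm U) = Hm"
  "Cmp (concrete_cat Ob Hm U) X Y Z g f = compose (U X) g f"
  "Idn (concrete_cat Ob Hm U) X = (\<lambda>x\<in>U X. x)"
  by (simp_all add: concrete_cat_def)

section \<open>Coactions\<close>

lemma kmod_simps [simp]:
  "carrier (kmod A V) = carrier V" "ring.add (kmod A V) = ring.add V"
  "ring.zero (kmod A V) = ring.zero V"
  by (simp_all add: kmod_def)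

locale alg_right_module = assoc_algebra k A + right_module A V
  for k :: "('k, 'c) ring_scheme" and A :: "('k, 'u::infinite) module" and V :: "('u, 'n) rmod_scheme"
begin

lemma A_module [simp]: "Module.module k A" by unfold_locales
lemma V_abelian [simp]: "abelian_group V" by unfold_locales

lemma kmod_smult: "c \<odot>\<^bsub>kmod A V\<^esub> v = ract V v (c \<odot>\<^bsub>A\<^esub> \<one>\<^bsub>A\<^esub>)"
  by (simp add: kmod_def)

lemma kmod_module [simp]: "Module.module k (kmod A V)"
proof (rule Module.moduleI)
  show "abelian_group (kmod A V)"
    using V_abelian abelian_group_cong[of "kmod A V" V] by simp
  show "(c \<otimes>\<^bsub>k\<^esub> d) \<odot>\<^bsub>kmod A V\<^esub> v = c \<odot>\<^bsub>kmod A V\<^esub> (d \<odot>\<^bsub>kmod A V\<^esub> v)"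
    if "c \<in> carrier k" "d \<in> carrier k" "v \<in> carrier (kmod A V)" for c d v
    using that by (simp add: kmod_smult ract_mult[symmetric] smult_mult_right smult_assoc1)
qed (auto simp: kmod_smult ract_closed ract_add_left smult_l_distr ract_add_right ract_one
    intro: R.is_cring)

sublocale M: Module.module k "kmod A V" by (rule kmod_module)

lemma ract_smult_left:
  "\<lbrakk>c \<in> carrier k; v \<in> carrier V; a \<in> carrier A\<rbrakk> \<Longrightarrow>
    ract V (c \<odot>\<^bsub>kmod A V\<^esub> v) a = c \<odot>\<^bsub>kmod A V\<^esub> ract V v a"
  by (simp add: kmod_smult ract_mult[symmetric] smult_mult_left smult_mult_right)

lemma ract_smult_right:
  "\<lbrakk>c \<in> carrier k; v \<in> carrier V; a \<in> carrier A\<rbrakk> \<Longrightarrow>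
    ract V v (c \<odot>\<^bsub>A\<^esub> a) = c \<odot>\<^bsub>kmod A V\<^esub> ract V v a"
  by (simp add: kmod_smult ract_mult[symmetric] smult_mult_left smult_mult_right)

abbreviation MA where "MA \<equiv> ktensor k (kmod A V) A"
abbreviation MAA where "MAA \<equiv> ktensor k MA A"

abbreviation tens (infixl "\<boxtimes>" 70) where "v \<boxtimes> a \<equiv> ktens k (kmod A V) A v a"

lemma MA_module [simp]: "Module.module k MA" by (simp add: ktensor_module)
lemma MA_abelian [simp]: "abelian_group MA" by (simp add: ktensor_abelian_group)
lemma MAA_abelian [simp]: "abelian_group MAA" by (simp add: ktensor_abelian_group)

lemma tens_closed [simp]: "\<lbrakk>v \<in> carrier V; a \<in> carrier A\<rbrakk> \<Longrightarrow> v \<boxtimes> a \<in> carrier MA"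
  by simp

lemma tens_add_left:
  "\<lbrakk>v \<in> carrier V; w \<in> carrier V; a \<in> carrier A\<rbrakk> \<Longrightarrow> (v \<oplus>\<^bsub>V\<^esub> w) \<boxtimes> a = v \<boxtimes> a \<oplus>\<^bsub>MA\<^esub> w \<boxtimes> a"
  using ktens_add_left[of k "kmod A V" A v w a] by simp

lemmas tens_simps = tens_add_left ktens_add_left ktens_add_right ktens_smult_left ktens_smult_right
lemmas ract_simps = ract_closed ract_add_left ract_add_right ract_smult_left ract_smult_right
lemmas mult_simps = l_distr r_distr smult_mult_left smult_mult_right

text \<open>\<open>sw Z \<phi> t\<close> is Sweedler's \<open>\<phi> v\<^sub>[\<^sub>0\<^sub>] v\<^sub>[\<^sub>1\<^sub>]\<close> when \<open>t = \<rho> v\<close>.\<close>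

abbreviation bal where "bal Z \<phi> \<equiv> kbalanced k (kmod A V) A Z \<phi>"
abbreviation sw where "sw Z \<phi> t \<equiv> klift k (kmod A V) A Z \<phi> t"

lemma sw_cong:
  assumes "\<And>w b. \<lbrakk>w \<in> carrier V; b \<in> carrier A\<rbrakk> \<Longrightarrow> \<phi> w b = \<psi> w b"
  shows "sw Z \<phi> t = sw Z \<psi> t"
  by (rule fun_cong[OF klift_cong]) (use assms in auto)

lemma balI:
  assumes "\<And>w b. \<lbrakk>w \<in> carrier V; b \<in> carrier A\<rbrakk> \<Longrightarrow> \<phi> w b \<in> carrier Z"
    and "\<And>w w' b. \<lbrakk>w \<in> carrier V; w' \<in> carrier V; b \<in> carrier A\<rbrakk>
        \<Longrightarrow> \<phi> (w \<oplus>\<^bsub>V\<^esub> w') b = \<phi> w b \<oplus>\<^bsub>Z\<^esub> \<phi> w' b"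
    and "\<And>w b b'. \<lbrakk>w \<in> carrier V; b \<in> carrier A; b' \<in> carrier A\<rbrakk>
        \<Longrightarrow> \<phi> w (b \<oplus>\<^bsub>A\<^esub> b') = \<phi> w b \<oplus>\<^bsub>Z\<^esub> \<phi> w b'"
    and "\<And>w c b. \<lbrakk>w \<in> carrier V; c \<in> carrier k; b \<in> carrier A\<rbrakk>
        \<Longrightarrow> \<phi> (c \<odot>\<^bsub>kmod A V\<^esub> w) b = \<phi> w (c \<odot>\<^bsub>A\<^esub> b)"
  shows "bal Z \<phi>"
  by (rule kbalancedI) (use assms in auto)

lemma ract_bal [simp]: "bal V (\<lambda>w b. ract V w b)"
  by (rule balI) (auto simp: ract_closed ract_add_left ract_add_right ract_smult_left ract_smult_right)

lemma tens_mult_bal [simp]: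
  "\<lbrakk>a \<in> carrier A\<rbrakk> \<Longrightarrow> bal MA (\<lambda>w b. w \<boxtimes> (b \<otimes>\<^bsub>A\<^esub> a))"
  "\<lbrakk>a \<in> carrier A\<rbrakk> \<Longrightarrow> bal MA (\<lambda>w b. w \<boxtimes> (a \<otimes>\<^bsub>A\<^esub> b))"
  "\<lbrakk>a \<in> carrier A\<rbrakk> \<Longrightarrow> bal MA (\<lambda>w b. ract V w a \<boxtimes> b)"
  by (auto intro!: balI simp: tens_simps ract_simps mult_simps)

text \<open>The admissible arguments of Sweedler expressions of depth two.\<close>

definition trilinear :: "('u, 'q) ring_scheme \<Rightarrow> ('u \<Rightarrow> 'u \<Rightarrow> 'u \<Rightarrow> 'u) \<Rightarrow> bool" where
  "trilinear Z \<chi> \<longleftrightarrow>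
     (\<forall>w\<in>carrier V. \<forall>a\<in>carrier A. \<forall>b\<in>carrier A. \<chi> w a b \<in> carrier Z) \<and>
     (\<forall>w\<in>carrier V. \<forall>w'\<in>carrier V. \<forall>a\<in>carrier A. \<forall>b\<in>carrier A.
        \<chi> (w \<oplus>\<^bsub>V\<^esub> w') a b = \<chi> w a b \<oplus>\<^bsub>Z\<^esub> \<chi> w' a b) \<and>
     (\<forall>w\<in>carrier V. \<forall>a\<in>carrier A. \<forall>a'\<in>carrier A. \<forall>b\<in>carrier A.
        \<chi> w (a \<oplus>\<^bsub>A\<^esub> a') b = \<chi> w a b \<oplus>\<^bsub>Z\<^esub> \<chi> w a' b) \<and>
     (\<forall>w\<in>carrier V. \<forall>a\<in>carrier A. \<forall>b\<in>carrier A. \<forall>b'\<in>carrier A.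
        \<chi> w a (b \<oplus>\<^bsub>A\<^esub> b') = \<chi> w a b \<oplus>\<^bsub>Z\<^esub> \<chi> w a b') \<and>
     (\<forall>c\<in>carrier k. \<forall>w\<in>carrier V. \<forall>a\<in>carrier A. \<forall>b\<in>carrier A.
        \<chi> (c \<odot>\<^bsub>kmod A V\<^esub> w) a b = \<chi> w (c \<odot>\<^bsub>A\<^esub> a) b \<and>
        \<chi> w (c \<odot>\<^bsub>A\<^esub> a) b = \<chi> w a (c \<odot>\<^bsub>A\<^esub> b))"

lemma trilinear_bal:
  assumes "trilinear Z \<chi>" "b \<in> carrier A"
  shows "bal Z (\<lambda>w a. \<chi> w a b)"
  using assms by (intro balI) (auto simp: trilinear_def)

text \<open>Lifting in the first two variables and then in the third makes \<chi> a map on (V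
  \<otimes> A) \<otimes> A, the module in which coassociativity is stated.\<close>

lemma trilinear_sw_balanced:
  assumes Z: "abelian_group Z" and tri: "trilinear Z \<chi>"
  shows "kbalanced k MA A Z (\<lambda>t b. sw Z (\<lambda>w a. \<chi> w a b) t)"
proof (rule kbalancedI)
  fix t b b' assume t: "t \<in> carrier MA" and b: "b \<in> carrier A" "b' \<in> carrier A"
  have "sw Z (\<lambda>w a. \<chi> w a (b \<oplus>\<^bsub>A\<^esub> b')) t = sw Z (\<lambda>w a. \<chi> w a b \<oplus>\<^bsub>Z\<^esub> \<chi> w a b') t"
    by (rule sw_cong) (use tri b in \<open>auto simp: trilinear_def\<close>)
  then show "sw Z (\<lambda>w a. \<chi> w a (b \<oplus>\<^bsub>A\<^esub> b')) t = sw Z (\<lambda>w a. \<chi> w a b) t \<oplus>\<^bsub>Z\<^esub> sw Z (\<lambda>w a. \<chi> w a b') t"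
    using t b by (simp add: klift_plus Z trilinear_bal[OF tri])
next
  fix t c b assume t: "t \<in> carrier MA" and b: "b \<in> carrier A" and c: "c \<in> carrier k"
  have "sw Z (\<lambda>w a. \<chi> (c \<odot>\<^bsub>kmod A V\<^esub> w) a b) t = sw Z (\<lambda>w a. \<chi> w a (c \<odot>\<^bsub>A\<^esub> b)) t"
    by (rule sw_cong) (use tri b c in \<open>auto simp: trilinear_def\<close>)
  then show "sw Z (\<lambda>w a. \<chi> w a b) (c \<odot>\<^bsub>MA\<^esub> t) = sw Z (\<lambda>w a. \<chi> w a (c \<odot>\<^bsub>A\<^esub> b)) t"
    using t b c by (simp add: klift_smult Z trilinear_bal[OF tri])
qed (use Z trilinear_bal[OF tri] in \<open>simp_all add: klift_add\<close>)

end

section \<open>Sweedler calculus for a coaction and the left action it determines\<close>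

locale coaction = alg_right_module k A V
  for k :: "('k, 'c) ring_scheme" and A :: "('k, 'u::infinite) module" and V :: "('u, 'n) rmod_scheme" +
  fixes \<rho> assumes coaction: "\<rho> \<in> coactions k A V"
begin

lemma rho_klinear: "\<rho> \<in> klinear k (kmod A V) MA"
  using coaction by (simp add: coactions_def Let_def)

lemma rho_closed [simp]: "v \<in> carrier V \<Longrightarrow> \<rho> v \<in> carrier MA"
  using klinearD(3)[OF rho_klinear] by simp

lemma rho_add: "\<lbrakk>v \<in> carrier V; w \<in> carrier V\<rbrakk> \<Longrightarrow> \<rho> (v \<oplus>\<^bsub>V\<^esub> w) = \<rho> v \<oplus>\<^bsub>MA\<^esub> \<rho> w"
  using klinearD(4)[OF rho_klinear] by simp

lemma rho_smult: "\<lbrakk>c \<in> carrier k; v \<in> carrier V\<rbrakk> \<Longrightarrow> \<rho> (c \<odot>\<^bsub>kmod A V\<^esub> v) = c \<odot>\<^bsub>MA\<^esub> \<rho> v"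
  using klinearD(5)[OF rho_klinear] by simp

lemma rho_extensional: "\<rho> \<in> extensional (carrier V)"
  using klinearD(2)[OF rho_klinear] by simp

lemma counit: "v \<in> carrier V \<Longrightarrow> sw V (\<lambda>w a. ract V w a) (\<rho> v) = v"
  using coaction by (simp add: coactions_def Let_def)

lemma tens_one_tens_bal: "bal MAA (\<lambda>w a. ktens k MA A (w \<boxtimes> \<one>\<^bsub>A\<^esub>) a)"
  by (rule balI) (auto simp: tens_simps)

lemma rho_tens_bal: "bal MAA (\<lambda>w a. ktens k MA A (\<rho> w) a)"
  by (rule balI) (auto simp: tens_simps rho_add rho_smult)

lemma rho_ract:
  assumes "v \<in> carrier V" "a \<in> carrier A"
  shows "\<rho> (ract V v a) = sw MA (\<lambda>w b. w \<boxtimes> (b \<otimes>\<^bsub>A\<^esub> a)) (\<rho> v)"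
  using coaction assms by (simp add: coactions_def Let_def)

text \<open>Right linearity of \<rho>, in the form needed inside an arbitrary Sweedler expression: a
  factor acting on v reappears behind v[1].\<close>

lemma sw_ract:
  assumes Z: "abelian_group Z" and bal: "bal Z \<phi>" and v: "v \<in> carrier V" and a: "a \<in> carrier A"
  shows "sw Z \<phi> (\<rho> (ract V v a)) = sw Z (\<lambda>w b. \<phi> w (b \<otimes>\<^bsub>A\<^esub> a)) (\<rho> v)"
proof -
  have "sw Z \<phi> (\<rho> (ract V v a)) = sw Z (\<lambda>w b. sw Z \<phi> (w \<boxtimes> (b \<otimes>\<^bsub>A\<^esub> a))) (\<rho> v)"
    unfolding rho_ract[OF v a]
    by (rule klift_comp) (use Z bal v a in \<open>auto intro!: klift_addhom\<close>)
  also have "\<dots> = sw Z (\<lambda>w b. \<phi> w (b \<otimes>\<^bsub>A\<^esub> a)) (\<rho> v)"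
    by (rule sw_cong) (use Z bal a in auto)
  finally show ?thesis .
qed

text \<open>The coassociativity axiom is pushed through the additive map on (V \<otimes> A)
  \<otimes> A induced by \<chi>. The resulting rule reads \<chi>(v[0][0], v[0][1], v[1]) =
  \<chi>(v[0], 1, v[1]).\<close>

lemma sw_coassoc:
  assumes Z: "abelian_group Z" and tri: "trilinear Z \<chi>" and v: "v \<in> carrier V"
  shows "sw Z (\<lambda>w b. sw Z (\<lambda>w' a. \<chi> w' a b) (\<rho> w)) (\<rho> v) = sw Z (\<lambda>w b. \<chi> w \<one>\<^bsub>A\<^esub> b) (\<rho> v)"
proof -
  let ?h = "klift k MA A Z (\<lambda>t b. sw Z (\<lambda>w a. \<chi> w a b) t)"
  note hb = trilinear_sw_balanced[OF Z tri]
  have h: "?h \<in> addhom MAA Z"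
    by (rule klift_addhom) (simp_all add: Z hb)
  have "sw Z (\<lambda>w b. sw Z (\<lambda>w' a. \<chi> w' a b) (\<rho> w)) (\<rho> v) =
      sw Z (\<lambda>w b. ?h (ktens k MA A (\<rho> w) b)) (\<rho> v)"
    by (rule sw_cong) (simp add: Z hb)
  also have "\<dots> = ?h (sw MAA (\<lambda>w b. ktens k MA A (\<rho> w) b) (\<rho> v))"
    by (rule klift_comp[symmetric]) (use Z h v rho_tens_bal in auto)
  also have "\<dots> = ?h (sw MAA (\<lambda>w b. ktens k MA A (w \<boxtimes> \<one>\<^bsub>A\<^esub>) b) (\<rho> v))"
    using coaction v by (simp add: coactions_def Let_def)
  also have "\<dots> = sw Z (\<lambda>w b. ?h (ktens k MA A (w \<boxtimes> \<one>\<^bsub>A\<^esub>) b)) (\<rho> v)"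
    by (rule klift_comp) (use Z h v tens_one_tens_bal in auto)
  also have "\<dots> = sw Z (\<lambda>w b. \<chi> w \<one>\<^bsub>A\<^esub> b) (\<rho> v)"
    by (rule sw_cong) (simp add: Z hb trilinear_bal[OF tri])
  finally show ?thesis .
qed

lemma sw_comp:
  assumes "abelian_group Z" "abelian_group W" "h \<in> addhom Z W" "bal Z \<phi>" "v \<in> carrier V"
  shows "h (sw Z \<phi> (\<rho> v)) = sw W (\<lambda>w b. h (\<phi> w b)) (\<rho> v)"
  by (rule klift_comp) (use assms in auto)

lemma rho_eq_sw: "v \<in> carrier V \<Longrightarrow> sw MA (\<lambda>w b. w \<boxtimes> b) (\<rho> v) = \<rho> v"
  by (rule klift_ktens_id) auto

lemma sw_closed:
  "\<lbrakk>abelian_group Z; bal Z \<phi>; v \<in> carrier V\<rbrakk> \<Longrightarrow> sw Z \<phi> (\<rho> v) \<in> carrier Z"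
  by (rule klift_closed) auto

lemma sw_rho_add:
  "\<lbrakk>abelian_group Z; bal Z \<phi>; v \<in> carrier V; w \<in> carrier V\<rbrakk> \<Longrightarrow>
    sw Z \<phi> (\<rho> (v \<oplus>\<^bsub>V\<^esub> w)) = sw Z \<phi> (\<rho> v) \<oplus>\<^bsub>Z\<^esub> sw Z \<phi> (\<rho> w)"
  by (simp add: rho_add klift_add)

text \<open>The left action that axiom (4) forces upon \<open>V\<close>.\<close>

definition la :: "'u \<Rightarrow> 'u \<Rightarrow> 'u" where
  "la a v = sw V (\<lambda>w b. ract V w (a \<otimes>\<^bsub>A\<^esub> b)) (\<rho> v)"

lemma ract_mult_bal [simp]: "a \<in> carrier A \<Longrightarrow> bal V (\<lambda>w b. ract V w (a \<otimes>\<^bsub>A\<^esub> b))"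
  by (rule balI) (auto simp: ract_closed ract_add_left ract_add_right r_distr ract_smult_left
      ract_smult_right smult_mult_right)

lemma la_closed [simp]: "\<lbrakk>a \<in> carrier A; v \<in> carrier V\<rbrakk> \<Longrightarrow> la a v \<in> carrier V"
  unfolding la_def by (rule sw_closed) auto

lemma la_add_right:
  "\<lbrakk>a \<in> carrier A; v \<in> carrier V; w \<in> carrier V\<rbrakk> \<Longrightarrow> la a (v \<oplus>\<^bsub>V\<^esub> w) = la a v \<oplus>\<^bsub>V\<^esub> la a w"
  unfolding la_def by (rule sw_rho_add) auto

lemma la_add_left:
  assumes "a \<in> carrier A" "b \<in> carrier A" "v \<in> carrier V"
  shows "la (a \<oplus>\<^bsub>A\<^esub> b) v = la a v \<oplus>\<^bsub>V\<^esub> la b v"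
proof -
  have "la (a \<oplus>\<^bsub>A\<^esub> b) v = sw V (\<lambda>w c. ract V w (a \<otimes>\<^bsub>A\<^esub> c) \<oplus>\<^bsub>V\<^esub> ract V w (b \<otimes>\<^bsub>A\<^esub> c)) (\<rho> v)"
    unfolding la_def by (rule sw_cong) (use assms in \<open>auto simp: l_distr ract_add_right\<close>)
  then show ?thesis
    unfolding la_def using assms by (simp add: klift_plus)
qed

lemma la_smult_left:
  assumes "c \<in> carrier k" "a \<in> carrier A" "v \<in> carrier V"
  shows "la (c \<odot>\<^bsub>A\<^esub> a) v = c \<odot>\<^bsub>kmod A V\<^esub> la a v"
proof -
  have "smult (kmod A V) c \<in> addhom V V"
    using assms M.smult_r_distr[of c] M.smult_closed[of c] by (intro addhomI) auto
  then have "c \<odot>\<^bsub>kmod A V\<^esub> la a v = sw V (\<lambda>w b. c \<odot>\<^bsub>kmod A V\<^esub> ract V w (a \<otimes>\<^bsub>A\<^esub> b)) (\<rho> v)"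
    unfolding la_def using assms sw_comp[of V V "smult (kmod A V) c"] by simp
  then show ?thesis
    unfolding la_def using assms by (auto intro!: sw_cong simp: ract_simps mult_simps)
qed

lemma la_smult_right:
  assumes "c \<in> carrier k" "a \<in> carrier A" "v \<in> carrier V"
  shows "la a (c \<odot>\<^bsub>kmod A V\<^esub> v) = c \<odot>\<^bsub>kmod A V\<^esub> la a v"
proof -
  have "la a (c \<odot>\<^bsub>kmod A V\<^esub> v) = sw V (\<lambda>w b. ract V (c \<odot>\<^bsub>kmod A V\<^esub> w) (a \<otimes>\<^bsub>A\<^esub> b)) (\<rho> v)"
    unfolding la_def using assms by (simp add: rho_smult klift_smult)
  also have "\<dots> = la (c \<odot>\<^bsub>A\<^esub> a) v"
    unfolding la_def using assms by (auto intro!: sw_cong simp: ract_simps mult_simps)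
  finally show ?thesis using assms by (simp add: la_smult_left)
qed

lemmas la_simps = la_add_right la_add_left la_smult_left la_smult_right

text \<open>Left linearity \<rho>(a v) = v[0] \<otimes> a v[1] for the action just defined: a v is
  v[0] (a v[1]), right linearity gives its coaction as v[0][0] \<otimes> v[0][1] (a v[1]), and
  coassociativity turns the factor v[0][1] into 1.\<close>

lemma sw_la:
  assumes Z: "abelian_group Z" and bal: "bal Z \<phi>" and v: "v \<in> carrier V" and a: "a \<in> carrier A"
  shows "sw Z \<phi> (\<rho> (la a v)) = sw Z (\<lambda>w b. \<phi> w (a \<otimes>\<^bsub>A\<^esub> b)) (\<rho> v)"
proof -
  have "sw Z \<phi> (\<rho> (la a v)) = sw Z (\<lambda>w b. sw Z \<phi> (\<rho> (ract V w (a \<otimes>\<^bsub>A\<^esub> b)))) (\<rho> v)"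
    unfolding la_def
  proof (rule sw_comp[where h = "\<lambda>v. sw Z \<phi> (\<rho> v)"])
    show "(\<lambda>v. sw Z \<phi> (\<rho> v)) \<in> addhom V Z"
      by (rule addhomI) (simp_all add: sw_closed sw_rho_add Z bal)
  qed (use Z v a in simp_all)
  also have "\<dots> = sw Z (\<lambda>w b. sw Z (\<lambda>w' d. \<phi> w' (d \<otimes>\<^bsub>A\<^esub> (a \<otimes>\<^bsub>A\<^esub> b))) (\<rho> w)) (\<rho> v)"
    by (rule sw_cong) (simp add: sw_ract Z bal a)
  also have "\<dots> = sw Z (\<lambda>w b. \<phi> w (\<one>\<^bsub>A\<^esub> \<otimes>\<^bsub>A\<^esub> (a \<otimes>\<^bsub>A\<^esub> b))) (\<rho> v)"
    by (rule sw_coassoc[OF Z _ v])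
      (use bal a in \<open>simp add: trilinear_def balanced_def mult_simps\<close>)
  finally show ?thesis
    using a by (simp cong: klift_cong)
qed

text \<open>The exchange law a v[0] \<otimes> v[1] = v[0] a \<otimes> v[1]: expanding the left side
  gives v[0][0] (a v[0][1]) \<otimes> v[1], and coassociativity sets v[0][1] to 1.\<close>

lemma sw_la_left:
  assumes Z: "abelian_group Z" and bal: "bal Z \<phi>" and v: "v \<in> carrier V" and a: "a \<in> carrier A"
  shows "sw Z (\<lambda>w b. \<phi> (la a w) b) (\<rho> v) = sw Z (\<lambda>w b. \<phi> (ract V w a) b) (\<rho> v)"
proof -
  have "sw Z (\<lambda>w b. \<phi> (la a w) b) (\<rho> v) = sw Z (\<lambda>w b. sw Z (\<lambda>w' d. \<phi> (ract V w' (a \<otimes>\<^bsub>A\<^esub> d)) b) (\<rho> w)) (\<rho> v)"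
  proof (rule sw_cong)
    fix w b assume "w \<in> carrier V" "b \<in> carrier A"
    moreover from this have "(\<lambda>w. \<phi> w b) \<in> addhom V Z"
      using bal by (intro addhomI) (auto simp: balanced_def)
    ultimately show "\<phi> (la a w) b = sw Z (\<lambda>w' d. \<phi> (ract V w' (a \<otimes>\<^bsub>A\<^esub> d)) b) (\<rho> w)"
      unfolding la_def using Z a sw_comp[of V Z "\<lambda>w. \<phi> w b"] by simp
  qed
  also have "\<dots> = sw Z (\<lambda>w b. \<phi> (ract V w (a \<otimes>\<^bsub>A\<^esub> \<one>\<^bsub>A\<^esub>)) b) (\<rho> v)"
    by (rule sw_coassoc[OF Z _ v])
      (use bal a in \<open>simp add: trilinear_def balanced_def mult_simps ract_simps\<close>)
  finally show ?thesis using a by simp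
qed

text \<open>By \<open>sw_la\<close> the coaction of b v is v[0] \<otimes> b v[1], so a (b v) = v[0]
  (a (b v[1])), and associativity of A finishes.\<close>

lemma la_mult:
  assumes "a \<in> carrier A" "b \<in> carrier A" "v \<in> carrier V"
  shows "la (a \<otimes>\<^bsub>A\<^esub> b) v = la a (la b v)"
proof -
  have "la a (la b v) = sw V (\<lambda>w d. ract V w (a \<otimes>\<^bsub>A\<^esub> (b \<otimes>\<^bsub>A\<^esub> d))) (\<rho> v)"
    unfolding la_def[of a "la b v"] using assms by (simp add: sw_la)
  then show ?thesis
    unfolding la_def using assms by (auto intro!: sw_cong simp: m_assoc)
qed

lemma la_one: "v \<in> carrier V \<Longrightarrow> la \<one>\<^bsub>A\<^esub> v = v"
  unfolding la_def
  by (rule trans[OF sw_cong counit[of v]]) simp_all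

lemma la_ract:
  assumes "a \<in> carrier A" "v \<in> carrier V" "b \<in> carrier A"
  shows "ract V (la a v) b = la a (ract V v b)"
proof -
  have "(\<lambda>w. ract V w b) \<in> addhom V V"
    using assms by (intro addhomI) (auto simp: ract_simps)
  then have "ract V (la a v) b = sw V (\<lambda>w d. ract V (ract V w (a \<otimes>\<^bsub>A\<^esub> d)) b) (\<rho> v)"
    unfolding la_def using assms sw_comp[of V V "\<lambda>w. ract V w b"] by simp
  then show ?thesis
    unfolding la_def using assms by (simp add: sw_ract) (auto intro!: sw_cong simp: ract_mult[symmetric] m_assoc)
qed

lemma la_central:
  assumes "c \<in> carrier k" "v \<in> carrier V"
  shows "la (c \<odot>\<^bsub>A\<^esub> \<one>\<^bsub>A\<^esub>) v = ract V v (c \<odot>\<^bsub>A\<^esub> \<one>\<^bsub>A\<^esub>)"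
  using assms by (simp add: la_smult_left la_one kmod_smult)

end

text \<open>Currying for threefold tensors L \<otimes> (M \<otimes> N): scalars act on M \<otimes> N
  through M, so balance between L and M \<otimes> N only has to be known between L and M.\<close>

lemma kbalanced_nest:
  fixes k :: "('k, 'c) ring_scheme" and L M N :: "('k, 'u::infinite) module"
    and Z :: "('u, 'p) ring_scheme"
  assumes mods: "Module.module k M" "Module.module k N" and Z: "abelian_group Z"
    and bal: "\<And>x. x \<in> carrier L \<Longrightarrow> kbalanced k M N Z (\<phi> x)"
    and add: "\<And>x x' y z. \<lbrakk>x \<in> carrier L; x' \<in> carrier L; y \<in> carrier M; z \<in> carrier N\<rbrakk>
        \<Longrightarrow> \<phi> (x \<oplus>\<^bsub>L\<^esub> x') y z = \<phi> x y z \<oplus>\<^bsub>Z\<^esub> \<phi> x' y z"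
    and smult: "\<And>c x y z. \<lbrakk>c \<in> carrier k; x \<in> carrier L; y \<in> carrier M; z \<in> carrier N\<rbrakk>
        \<Longrightarrow> \<phi> (c \<odot>\<^bsub>L\<^esub> x) y z = \<phi> x (c \<odot>\<^bsub>M\<^esub> y) z"
  shows "kbalanced k L (ktensor k M N) Z (\<lambda>x t. klift k M N Z (\<phi> x) t)"
proof (rule kbalancedI)
  fix x x' t assume x: "x \<in> carrier L" "x' \<in> carrier L" and t: "t \<in> carrier (ktensor k M N)"
  have "klift k M N Z (\<phi> (x \<oplus>\<^bsub>L\<^esub> x')) t = klift k M N Z (\<lambda>y z. \<phi> x y z \<oplus>\<^bsub>Z\<^esub> \<phi> x' y z) t"
    by (rule fun_cong[OF klift_cong]) (use mods x add in auto)
  then show "klift k M N Z (\<phi> (x \<oplus>\<^bsub>L\<^esub> x')) t = klift k M N Z (\<phi> x) t \<oplus>\<^bsub>Z\<^esub> klift k M N Z (\<phi> x') t"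
    using klift_plus[OF mods Z bal bal t] x by simp
next
  fix x c t assume x: "x \<in> carrier L" and c: "c \<in> carrier k" and t: "t \<in> carrier (ktensor k M N)"
  have "klift k M N Z (\<phi> (c \<odot>\<^bsub>L\<^esub> x)) t = klift k M N Z (\<lambda>y z. \<phi> x (c \<odot>\<^bsub>M\<^esub> y) z) t"
    by (rule fun_cong[OF klift_cong]) (use mods x c smult in auto)
  then show "klift k M N Z (\<phi> (c \<odot>\<^bsub>L\<^esub> x)) t = klift k M N Z (\<phi> x) (c \<odot>\<^bsub>ktensor k M N\<^esub> t)"
    using klift_smult[OF mods Z bal c t] x by simp
qed (use mods Z bal in \<open>simp_all add: klift_add\<close>)

lemma kbalanced_comp_right:
  assumes "kbalanced k L N Z \<psi>" "g \<in> klinear k M N"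
  shows "kbalanced k L M Z (\<lambda>x t. \<psi> x (g t))"
  using assms(1) klinearD[OF assms(2)] by (auto simp: balanced_def)

section \<open>Comodules and Yetter-Drinfeld modules\<close>

lemma rmod_homD:
  assumes "f \<in> rmod_hom A V W"
  shows "f \<in> addhom V W" "f \<in> extensional (carrier V)"
    "v \<in> carrier V \<Longrightarrow> f v \<in> carrier W"
    "\<lbrakk>v \<in> carrier V; w \<in> carrier V\<rbrakk> \<Longrightarrow> f (v \<oplus>\<^bsub>V\<^esub> w) = f v \<oplus>\<^bsub>W\<^esub> f w"
    "\<lbrakk>v \<in> carrier V; a \<in> carrier A\<rbrakk> \<Longrightarrow> f (ract V v a) = ract W (f v) a"
  using assms by (auto simp: rmod_hom_def hom_def)

lemma rmod_homI:
  assumes "f \<in> extensional (carrier V)"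
    and "\<And>v. v \<in> carrier V \<Longrightarrow> f v \<in> carrier W"
    and "\<And>v w. \<lbrakk>v \<in> carrier V; w \<in> carrier V\<rbrakk> \<Longrightarrow> f (v \<oplus>\<^bsub>V\<^esub> w) = f v \<oplus>\<^bsub>W\<^esub> f w"
    and "\<And>v a. \<lbrakk>v \<in> carrier V; a \<in> carrier A\<rbrakk> \<Longrightarrow> f (ract V v a) = ract W (f v) a"
  shows "f \<in> rmod_hom A V W"
  using assms by (auto simp: rmod_hom_def intro: addhomI)

lemma rmod_hom_klinear:
  assumes "alg_right_module k A V" "alg_right_module k A W" "f \<in> rmod_hom A V W"
  shows "f \<in> klinear k (kmod A V) (kmod A W)"
proof -
  interpret V: alg_right_module k A V by fact
  interpret W: alg_right_module k A W by fact
  show ?thesis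
    by (rule klinearI) (use rmod_homD[OF assms(3)] in \<open>auto simp: V.kmod_smult W.kmod_smult\<close>)
qed

lemma preserves_coaction_alt:
  assumes "alg_right_module k A V" "alg_right_module k A W" "f \<in> rmod_hom A V W"
  shows "preserves_coaction k A (V, \<rho>) (W, \<rho>') f \<longleftrightarrow>
    (\<forall>v\<in>carrier V. \<rho>' (f v) =
       klift k (kmod A V) A (ktensor k (kmod A W) A) (\<lambda>w b. ktens k (kmod A W) A (f w) b) (\<rho> v))"
  by (simp add: preserves_coaction_def ktensor_map_def)

locale coaction_hom = V: coaction k A V \<rho> + W: coaction k A W \<rho>'
  for k :: "('k, 'c) ring_scheme" and A :: "('k, 'u::infinite) module"
    and V :: "('u, 'n) rmod_scheme" and \<rho> and W :: "('u, 'n) rmod_scheme" and \<rho>' +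
  fixes f assumes hom: "f \<in> rmod_hom A V W" and pres: "preserves_coaction k A (V, \<rho>) (W, \<rho>') f"
begin

lemma f_klinear: "f \<in> klinear k (kmod A V) (kmod A W)"
  by (rule rmod_hom_klinear) (auto simp: hom V.alg_right_module_axioms W.alg_right_module_axioms)

lemmas f_simps = rmod_homD(3-5)[OF hom]

lemma f_smult: "\<lbrakk>c \<in> carrier k; v \<in> carrier V\<rbrakk> \<Longrightarrow> f (c \<odot>\<^bsub>kmod A V\<^esub> v) = c \<odot>\<^bsub>kmod A W\<^esub> f v"
  using klinearD(5)[OF f_klinear] by simp

lemma bal_f: "W.bal Z \<phi> \<Longrightarrow> V.bal Z (\<lambda>w b. \<phi> (f w) b)"
  by (auto simp: balanced_def f_simps f_smult)

text \<open>Being a comodule map, in the form needed inside an arbitrary Sweedler expression: the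
  coaction of f v is replaced by f(v[0]) \<otimes> v[1].\<close>

lemma sw_f:
  assumes Z: "abelian_group Z" and bal: "W.bal Z \<phi>" and v: "v \<in> carrier V"
  shows "W.sw Z \<phi> (\<rho>' (f v)) = V.sw Z (\<lambda>w b. \<phi> (f w) b) (\<rho> v)"
proof -
  have "W.sw Z \<phi> (\<rho>' (f v)) = W.sw Z \<phi> (V.sw W.MA (\<lambda>w b. ktens k (kmod A W) A (f w) b) (\<rho> v))"
    using pres v by (simp add: preserves_coaction_def ktensor_map_def)
  also have "\<dots> = V.sw Z (\<lambda>w b. W.sw Z \<phi> (ktens k (kmod A W) A (f w) b)) (\<rho> v)"
    by (rule V.sw_comp) (use Z bal v bal_f[OF ktens_is_balanced] in \<open>auto intro!: klift_addhom\<close>)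
  also have "\<dots> = V.sw Z (\<lambda>w b. \<phi> (f w) b) (\<rho> v)"
    by (rule V.sw_cong) (simp add: Z bal f_simps)
  finally show ?thesis .
qed

text \<open>The left action is expressed by the coaction and the right action, both of which f
  respects. Hence comodule maps are bimodule maps for the induced actions, and no morphism is lost
  when the left action is added.\<close>

lemma f_la:
  assumes "a \<in> carrier A" "v \<in> carrier V"
  shows "f (V.la a v) = W.la a (f v)"
proof -
  have "f (V.la a v) = V.sw W (\<lambda>w b. f (ract V w (a \<otimes>\<^bsub>A\<^esub> b))) (\<rho> v)"
    unfolding V.la_def using assms rmod_homD(1)[OF hom] by (intro V.sw_comp) auto
  also have "\<dots> = V.sw W (\<lambda>w b. ract W (f w) (a \<otimes>\<^bsub>A\<^esub> b)) (\<rho> v)"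
    by (rule V.sw_cong) (use assms in \<open>simp add: f_simps\<close>)
  also have "\<dots> = W.la a (f v)"
    unfolding W.la_def using assms by (simp add: sw_f)
  finally show ?thesis .
qed

end

text \<open>A right module and a bimodule extending it belong to different record types; this and
  the following congruences carry module structure, coactions, induced actions and maps from one to
  the other.\<close>

lemma right_module_cong:
  assumes "carrier V = carrier W" "ring.add V = ring.add W" "ring.zero V = ring.zero W" "ract V = ract W"
  shows "right_module A V \<longleftrightarrow> right_module A W"
  using assms abelian_group_cong[of V W] by (simp add: right_module_def right_module_axioms_def)

lemma kmod_cong:
  assumes "carrier V = carrier W" "ring.add V = ring.add W" "ring.zero V = ring.zero W" "ract V = ract W"
  shows "kmod A V = kmod A W"
  using assms by (simp add: kmod_def)

lemma tensor_lift_target_cong: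
  assumes "carrier Z = carrier Z'" "ring.add Z = ring.add Z'"
  shows "tensor_lift S X ra Y la Z \<phi> = tensor_lift S X ra Y la Z' \<phi>"
  using addhom_cong[OF refl refl assms, of "tensor_group S X ra Y la"] by (simp add: tensor_lift_def)

lemma coactions_cong:
  assumes "carrier V = carrier W" "ring.add V = ring.add W" "ring.zero V = ring.zero W" "ract V = ract W"
  shows "coactions k A V = coactions k A W"
proof -
  have "klift k M A V = klift k M A W" for M
    unfolding klift_def by (intro ext tensor_lift_target_cong) (use assms in auto)
  then show ?thesis
    using assms kmod_cong[of V W A] by (simp add: coactions_def)
qed

lemma la_cong:
  assumes "carrier V = carrier W" "ring.add V = ring.add W" "ring.zero V = ring.zero W" "ract V = ract W"
    and "coaction k A V \<rho>" "coaction k A W \<rho>"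
  shows "coaction.la k A V \<rho> = coaction.la k A W \<rho>"
proof -
  have "klift k M A V = klift k M A W" for M
    unfolding klift_def by (intro ext tensor_lift_target_cong) (use assms in auto)
  then show ?thesis
    using assms kmod_cong[of V W A] by (intro ext) (simp add: coaction.la_def[OF assms(5)] coaction.la_def[OF assms(6)])
qed

lemma rmod_hom_cong:
  assumes "carrier V = carrier V'" "ring.add V = ring.add V'" "ract V = ract V'"
    and "carrier W = carrier W'" "ring.add W = ring.add W'" "ract W = ract W'"
  shows "rmod_hom A V W = rmod_hom A V' W'"
  using assms addhom_cong[of V V' W W'] by (simp add: rmod_hom_def)

locale yetter_drinfeld = bimodule k A V + coaction k A V \<rho>
  for k :: "('k, 'c) ring_scheme" and A :: "('k, 'u::infinite) module" and V :: "'u bimod" and \<rho> +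
  assumes yd: "\<rho> \<in> yetter_drinfeld_coactions k A V"
begin

lemma rho_lact:
  "\<lbrakk>a \<in> carrier A; v \<in> carrier V\<rbrakk> \<Longrightarrow> \<rho> (lact V a v) = sw MA (\<lambda>w b. w \<boxtimes> (a \<otimes>\<^bsub>A\<^esub> b)) (\<rho> v)"
  using yd by (simp add: yetter_drinfeld_coactions_def Let_def)

text \<open>The counit at a v followed by left linearity of \<rho> gives a v = (a v)[0] (a v)[1] =
  v[0] (a v[1]). So the left action of a Yetter-Drinfeld module carries no information beyond its
  comodule.\<close>

lemma lact_eq_la:
  assumes "a \<in> carrier A" "v \<in> carrier V"
  shows "lact V a v = la a v"
proof -
  have "lact V a v = sw V (\<lambda>w b. ract V w b) (sw MA (\<lambda>w b. w \<boxtimes> (a \<otimes>\<^bsub>A\<^esub> b)) (\<rho> v))"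
    using assms counit[of "lact V a v"] by (simp add: lact_closed rho_lact)
  also have "\<dots> = sw V (\<lambda>w b. sw V (\<lambda>w b. ract V w b) (w \<boxtimes> (a \<otimes>\<^bsub>A\<^esub> b))) (\<rho> v)"
    by (rule sw_comp) (use assms in \<open>auto intro!: klift_addhom\<close>)
  also have "\<dots> = la a v"
    unfolding la_def by (rule sw_cong) (use assms in simp)
  finally show ?thesis .
qed

lemma sw_lact:
  "\<lbrakk>abelian_group Z; bal Z \<phi>; v \<in> carrier V; a \<in> carrier A\<rbrakk> \<Longrightarrow>
    sw Z \<phi> (\<rho> (lact V a v)) = sw Z (\<lambda>w b. \<phi> w (a \<otimes>\<^bsub>A\<^esub> b)) (\<rho> v)"
  by (simp add: lact_eq_la sw_la)

lemma sw_lact_left: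
  assumes "abelian_group Z" "bal Z \<phi>" "v \<in> carrier V" "a \<in> carrier A"
  shows "sw Z (\<lambda>w b. \<phi> (lact V a w) b) (\<rho> v) = sw Z (\<lambda>w b. \<phi> (ract V w a) b) (\<rho> v)"
proof -
  have "sw Z (\<lambda>w b. \<phi> (lact V a w) b) (\<rho> v) = sw Z (\<lambda>w b. \<phi> (la a w) b) (\<rho> v)"
    by (rule sw_cong) (use assms in \<open>simp add: lact_eq_la\<close>)
  then show ?thesis using assms by (simp add: sw_la_left)
qed

end

lemma bimodule_alg_right_module:
  fixes A :: "('k, 'u::infinite) module"
  shows "bimodule k A V \<Longrightarrow> alg_right_module k A V"
  by (simp add: bimodule_def alg_right_module_def)

lemma coactionI:
  fixes A :: "('k, 'u::infinite) module"
  shows "\<lbrakk>alg_right_module k A V; \<rho> \<in> coactions k A V\<rbrakk> \<Longrightarrow> coaction k A V \<rho>"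
  by (simp add: coaction_def coaction_axioms_def)

lemma yetter_drinfeldI:
  fixes A :: "('k, 'u::infinite) module"
  assumes "V \<in> bimodules k A" "\<rho> \<in> yetter_drinfeld_coactions k A V"
  shows "yetter_drinfeld k A V \<rho>"
  using assms
  by (auto simp: yetter_drinfeld_def yetter_drinfeld_axioms_def bimodules_def
      yetter_drinfeld_coactions_def Let_def intro!: coactionI bimodule_alg_right_module)

lemma right_modules_alg:
  fixes A :: "('k, 'u::infinite) module"
  shows "assoc_algebra k A \<Longrightarrow> V \<in> right_modules A \<Longrightarrow> alg_right_module k A V"
  by (simp add: right_modules_def alg_right_module_def)

lemma comodule_coaction:
  fixes A :: "('k, 'u::infinite) module"
  shows "\<lbrakk>assoc_algebra k A; V \<in> right_modules A; \<rho> \<in> coactions k A V\<rbrakk> \<Longrightarrow> coaction k A V \<rho>"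
  by (rule coactionI) (simp_all add: right_modules_alg)

text \<open>Among the five categories, this is the one whose category axioms are verified directly;
  the others receive them by transport.\<close>

lemma comodule_category:
  fixes k :: "('k, 'c) ring_scheme" and A :: "('k, 'u::infinite) module"
  assumes "assoc_algebra k A"
  shows "category (comodule_category k A)"
proof -
  interpret assoc_algebra k A by fact
  show ?thesis
    unfolding comodule_category_def
  proof (rule concrete_category; clarsimp)
    fix V W :: "'u rmod" and f
    assume "f \<in> rmod_hom A V W"
    then show "f \<in> carrier V \<rightarrow>\<^sub>E carrier W"
      by (simp add: PiE_def rmod_homD)
  next
    fix V :: "'u rmod" and \<rho> assume V: "V \<in> right_modules A" "\<rho> \<in> coactions k A V"
    interpret coaction k A V \<rho> by (rule comodule_coaction[OF assoc_algebra_axioms V])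
    have hom: "(\<lambda>x\<in>carrier V. x) \<in> rmod_hom A V V"
      by (rule rmod_homI) (auto simp: ract_closed)
    have "sw MA (\<lambda>w b. tens ((\<lambda>x\<in>carrier V. x) w) b) (\<rho> v) = \<rho> v" if "v \<in> carrier V" for v
      using that by (subst (2) rho_eq_sw[symmetric]) (auto intro!: sw_cong)
    then show "(\<lambda>x\<in>carrier V. x) \<in> rmod_hom A V V \<and>
        preserves_coaction k A (V, \<rho>) (V, \<rho>) (\<lambda>x\<in>carrier V. x)"
      using hom preserves_coaction_alt[OF alg_right_module_axioms alg_right_module_axioms hom] by auto
  next
    fix V W U :: "'u rmod" and \<rho> \<rho>' \<rho>'' f g
    assume V: "V \<in> right_modules A" "\<rho> \<in> coactions k A V"
      and W: "W \<in> right_modules A" "\<rho>' \<in> coactions k A W"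
      and U: "U \<in> right_modules A" "\<rho>'' \<in> coactions k A U"
      and f: "f \<in> rmod_hom A V W" "preserves_coaction k A (V, \<rho>) (W, \<rho>') f"
      and g: "g \<in> rmod_hom A W U" "preserves_coaction k A (W, \<rho>') (U, \<rho>'') g"
    interpret f: coaction_hom k A V \<rho> W \<rho>' f
      by (simp add: coaction_hom_def coaction_hom_axioms_def comodule_coaction assoc_algebra_axioms V W f)
    interpret g: coaction_hom k A W \<rho>' U \<rho>'' g
      by (simp add: coaction_hom_def coaction_hom_axioms_def comodule_coaction assoc_algebra_axioms U W g)
    have hom: "compose (carrier V) g f \<in> rmod_hom A V U"
      by (rule rmod_homI) (auto simp: compose_def f.f_simps g.f_simps f.V.ract_closed)
    have "\<rho>'' (g (f v)) = f.V.sw g.W.MA (\<lambda>w b. ktens k (kmod A U) A (compose (carrier V) g f w) b) (\<rho> v)"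
      if v: "v \<in> carrier V" for v
    proof -
      have "\<rho>'' (g (f v)) = g.W.sw g.W.MA (ktens k (kmod A U) A) (\<rho>'' (g (f v)))"
        using v by (simp add: klift_ktens_id f.f_simps g.f_simps)
      also have "\<dots> = f.V.sw g.W.MA (\<lambda>w b. ktens k (kmod A U) A (g (f w)) b) (\<rho> v)"
        using v by (simp add: g.sw_f f.sw_f f.f_simps g.f_simps ktens_is_balanced g.bal_f)
      also have "\<dots> = f.V.sw g.W.MA (\<lambda>w b. ktens k (kmod A U) A (compose (carrier V) g f w) b) (\<rho> v)"
        by (rule f.V.sw_cong) (simp add: compose_def)
      finally show ?thesis .
    qed
    then show "compose (carrier V) g f \<in> rmod_hom A V U \<and>
        preserves_coaction k A (V, \<rho>) (U, \<rho>'') (compose (carrier V) g f)"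
      using hom preserves_coaction_alt[OF f.V.alg_right_module_axioms g.W.alg_right_module_axioms hom]
      by (simp add: compose_def)
  qed
qed

text \<open>The action is restricted to the carriers because \<open>bimodules\<close> demands
  extensional operations; only so does forgetting and rebuilding it return the same object.\<close>

definition yd_of_comodule ::
  "('k, 'c) ring_scheme \<Rightarrow> ('k, 'u::infinite) module \<Rightarrow> 'u rmod \<times> ('u \<Rightarrow> 'u) \<Rightarrow> 'u bimod \<times> ('u \<Rightarrow> 'u)" where
  "yd_of_comodule k A = (\<lambda>(V, \<rho>).
     (rmod.extend V (bimod.fields (\<lambda>a\<in>carrier A. \<lambda>v\<in>carrier V. coaction.la k A V \<rho> a v)), \<rho>))"

lemma comodule_yetter_drinfeld_iso:
  fixes k :: "('k, 'c) ring_scheme" and A :: "('k, 'u::infinite) module"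
  assumes A: "assoc_algebra k A"
  shows "isomorphic_categories (comodule_category k A) (yetter_drinfeld_category k A)"
    and "category (yetter_drinfeld_category k A)"
proof -
  interpret assoc_algebra k A by fact
  let ?Fo = "yd_of_comodule k A"
  let ?Go = "\<lambda>(V :: 'u bimod, \<rho>). (rmod.truncate V, \<rho>)"
  let ?e = "\<lambda>V \<rho>. rmod.extend V (bimod.fields (\<lambda>a\<in>carrier A. \<lambda>v\<in>carrier V. coaction.la k A V \<rho> a v))"
  have ext: "carrier (?e V \<rho>) = carrier V" "ring.add (?e V \<rho>) = ring.add V" "ring.zero (?e V \<rho>) = ring.zero V"
    "ract (?e V \<rho>) = ract V" "mult (?e V \<rho>) = mult V" "one (?e V \<rho>) = one V"
    "lact (?e V \<rho>) = (\<lambda>a\<in>carrier A. \<lambda>v\<in>carrier V. coaction.la k A V \<rho> a v)" for V :: "'u rmod" and \<rho>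
    by (simp_all add: rmod.defs bimod.defs)
  have tr: "carrier (rmod.truncate V) = carrier V" "ring.add (rmod.truncate V) = ring.add V"
    "ring.zero (rmod.truncate V) = ring.zero V"
    "ract (rmod.truncate V) = ract V" "mult (rmod.truncate V) = mult V" "one (rmod.truncate V) = one V"
    for V :: "'u bimod"
    by (simp_all add: rmod.defs)
  have Fo: "?Fo P \<in> Obj (yetter_drinfeld_category k A)" if P: "P \<in> Obj (comodule_category k A)" for P
  proof -
    obtain V \<rho> where P_eq: "P = (V, \<rho>)" and V: "V \<in> right_modules A" "\<rho> \<in> coactions k A V"
      using P by (auto simp: comodule_category_def)
    interpret coaction k A V \<rho> by (rule comodule_coaction[OF assoc_algebra_axioms V])
    have V': "right_module A V" "normal_rmod A V" using V by (simp_all add: right_modules_def)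
    have "right_module A (?e V \<rho>)"
      using V'(1) right_module_cong[of "?e V \<rho>" V A] by (simp add: ext)
    then have "bimodule k A (?e V \<rho>)"
      by (simp add: bimodule_def bimodule_axioms_def assoc_algebra_axioms ext la_add_right la_add_left
          la_mult la_one la_ract la_central ract_closed)
    then have bim: "?e V \<rho> \<in> bimodules k A"
      using V'(2) by (auto simp: bimodules_def normal_rmod_def ext)
    have km: "kmod A (?e V \<rho>) = kmod A V"
      by (rule kmod_cong) (simp_all add: ext)
    have co: "\<rho> \<in> coactions k A (?e V \<rho>)"
      using V(2) coactions_cong[of "?e V \<rho>" V k A] by (simp add: ext)
    have "\<rho> \<in> yetter_drinfeld_coactions k A (?e V \<rho>)"
      unfolding yetter_drinfeld_coactions_def Let_def km
    proof (intro CollectI conjI ballI co)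
      fix a v assume a: "a \<in> carrier A" and "v \<in> carrier (?e V \<rho>)"
      then have v: "v \<in> carrier V" by (simp add: ext)
      show "\<rho> (lact (?e V \<rho>) a v) = sw MA (\<lambda>w b. tens w (a \<otimes>\<^bsub>A\<^esub> b)) (\<rho> v)"
        using sw_la[OF _ ktens_is_balanced, of v a] a v by (simp add: klift_ktens_id ext)
      have "sw MA (\<lambda>w b. tens (lact (?e V \<rho>) a w) b) (\<rho> v) = sw MA (\<lambda>w b. tens (la a w) b) (\<rho> v)"
        by (rule sw_cong) (simp add: ext a)
      also have "\<dots> = sw MA (\<lambda>w b. tens (ract V w a) b) (\<rho> v)"
        using sw_la_left[OF _ ktens_is_balanced, of v a] a v by simp
      finally show "sw MA (\<lambda>w b. tens (lact (?e V \<rho>) a w) b) (\<rho> v) =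
          sw MA (\<lambda>w b. tens (ract (?e V \<rho>) w a) b) (\<rho> v)"
        by (simp add: ext)
    qed
    then show ?thesis
      using bim by (simp add: yetter_drinfeld_category_def P_eq yd_of_comodule_def)
  qed
  have Go: "?Go P \<in> Obj (comodule_category k A)" "?Fo (?Go P) = P"
    if P: "P \<in> Obj (yetter_drinfeld_category k A)" for P
  proof -
    obtain V \<rho> where P_eq: "P = (V, \<rho>)" and V: "V \<in> bimodules k A" "\<rho> \<in> yetter_drinfeld_coactions k A V"
      using P by (auto simp: yetter_drinfeld_category_def)
    interpret yetter_drinfeld k A V \<rho> by (rule yetter_drinfeldI[OF V])
    have "right_module A (rmod.truncate V)"
      using right_module_cong[of "rmod.truncate V" V A] right_module_axioms by (simp add: tr)
    moreover from this have co_tr: "coaction k A (rmod.truncate V) \<rho>"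
      using coaction coactions_cong[of "rmod.truncate V" V k A]
      by (intro coactionI) (simp_all add: tr alg_right_module_def assoc_algebra_axioms)
    moreover have "normal_rmod A (rmod.truncate V)"
      using V by (simp add: bimodules_def normal_rmod_def tr)
    moreover have "\<rho> \<in> coactions k A (rmod.truncate V)"
      using coaction coactions_cong[of "rmod.truncate V" V k A] by (simp add: tr)
    ultimately show "?Go P \<in> Obj (comodule_category k A)"
      by (simp add: P_eq comodule_category_def right_modules_def)
    have "coaction.la k A (rmod.truncate V) \<rho> = la"
      by (rule la_cong) (simp_all add: tr coaction_axioms co_tr)
    \<comment> \<open>The two left actions agree on the carriers by \<open>lact_eq_la\<close>, and
      they agree elsewhere because both are extensional in each argument; so the rebuilt record
      equals the original one.\<close>
    moreover have "(\<lambda>a\<in>carrier A. \<lambda>v\<in>carrier V. la a v) = lact V"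
    proof (rule extensionalityI)
      show "lact V \<in> extensional (carrier A)"
        using V by (simp add: bimodules_def PiE_def)
      fix a assume a: "a \<in> carrier A"
      show "(\<lambda>a\<in>carrier A. \<lambda>v\<in>carrier V. la a v) a = lact V a"
      proof (rule extensionalityI)
        show "lact V a \<in> extensional (carrier V)"
          using V a by (auto simp: bimodules_def PiE_def Pi_def)
      qed (use a in \<open>auto simp: lact_eq_la\<close>)
    qed auto
    ultimately show "?Fo (?Go P) = P"
      by (simp add: P_eq yd_of_comodule_def tr) (simp add: rmod.defs bimod.defs)
  qed
  have GF: "?Go (?Fo P) = P" for P :: "'u rmod \<times> ('u \<Rightarrow> 'u)"
    by (cases P) (simp add: yd_of_comodule_def rmod.defs bimod.defs)
  have Hom: "Hom (yetter_drinfeld_category k A) (?Fo P) (?Fo Q) = Hom (comodule_category k A) P Q"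
    if PQ: "P \<in> Obj (comodule_category k A)" "Q \<in> Obj (comodule_category k A)" for P Q
  proof -
    obtain V \<rho> where P: "P = (V, \<rho>)" and V: "V \<in> right_modules A" "\<rho> \<in> coactions k A V"
      using PQ by (auto simp: comodule_category_def)
    obtain W \<rho>' where Q: "Q = (W, \<rho>')" and W: "W \<in> right_modules A" "\<rho>' \<in> coactions k A W"
      using PQ by (auto simp: comodule_category_def)
    interpret V: coaction k A V \<rho> by (rule comodule_coaction[OF assoc_algebra_axioms V])
    interpret W: coaction k A W \<rho>' by (rule comodule_coaction[OF assoc_algebra_axioms W])
    have km: "kmod A (?e V \<rho>) = kmod A V" "kmod A (?e W \<rho>') = kmod A W"
      by (rule kmod_cong; simp add: ext)+
    have pres: "preserves_coaction k A (?e V \<rho>, \<rho>) (?e W \<rho>', \<rho>') f \<longleftrightarrow> preserves_coaction k A (V, \<rho>) (W, \<rho>') f" for f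
      by (simp add: preserves_coaction_def km ext)
    have hom: "rmod_hom A (?e V \<rho>) (?e W \<rho>') = rmod_hom A V W"
      by (rule rmod_hom_cong) (simp_all add: ext)
    \<comment> \<open>Left linearity is automatic, so the bimodule condition cuts out nothing from
      the comodule maps.\<close>
    have "f (V.la a v) = W.la a (f v)"
      if "f \<in> rmod_hom A V W" "preserves_coaction k A (V, \<rho>) (W, \<rho>') f" "a \<in> carrier A" "v \<in> carrier V" for f a v
    proof -
      interpret coaction_hom k A V \<rho> W \<rho>' f
        by unfold_locales (use that in auto)
      show ?thesis by (rule f_la) fact+
    qed
    then show ?thesis
      by (auto simp: P Q yetter_drinfeld_category_def comodule_category_def yd_of_comodule_def pres hom bimod_hom_def ext rmod_homD)
  qed
  note tr = isomorphic_transport[where C = "comodule_category k A" and D = "yetter_drinfeld_category k A" and Fo = ?Fo and Go = ?Go]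
    category_transport[where C = "comodule_category k A" and D = "yetter_drinfeld_category k A" and Fo = ?Fo and Go = ?Go]
  show "isomorphic_categories (comodule_category k A) (yetter_drinfeld_category k A)"
    by (rule tr(1)[OF comodule_category[OF A] Fo Go(1) GF Go(2) Hom])
      (auto simp: yetter_drinfeld_category_def comodule_category_def yd_of_comodule_def ext)
  show "category (yetter_drinfeld_category k A)"
    by (rule tr(2)[OF comodule_category[OF A] Fo Go(1) GF Go(2) Hom])
      (auto simp: yetter_drinfeld_category_def comodule_category_def yd_of_comodule_def ext)
qed

section \<open>Descent data\<close>

locale alg_bimodule = bimodule k A V + alg_right_module k A V
  for k :: "('k, 'c) ring_scheme" and A :: "('k, 'u::infinite) module" and V :: "'u bimod"
begin

lemma lact_smult_left:
  assumes "c \<in> carrier k" "a \<in> carrier A" "v \<in> carrier V"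
  shows "lact V (c \<odot>\<^bsub>A\<^esub> a) v = c \<odot>\<^bsub>kmod A V\<^esub> lact V a v"
proof -
  have "lact V (c \<odot>\<^bsub>A\<^esub> a) v = lact V ((c \<odot>\<^bsub>A\<^esub> \<one>\<^bsub>A\<^esub>) \<otimes>\<^bsub>A\<^esub> a) v"
    using assms by (simp add: smult_mult_left)
  then show ?thesis
    using assms by (simp add: lact_mult central lact_closed kmod_smult)
qed

lemma lact_smult_right:
  assumes "c \<in> carrier k" "a \<in> carrier A" "v \<in> carrier V"
  shows "lact V a (c \<odot>\<^bsub>kmod A V\<^esub> v) = c \<odot>\<^bsub>kmod A V\<^esub> lact V a v"
  using assms by (simp add: kmod_smult lact_ract)

lemmas lact_simps = lact_closed lact_add_left lact_add_right lact_smult_left lact_smult_right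

abbreviation AM where "AM \<equiv> ktensor k A (kmod A V)"
abbreviation AAM where "AAM \<equiv> ktensor k A AM"
abbreviation AMA where "AMA \<equiv> ktensor k AM A"
abbreviation tensl where "tensl x v \<equiv> ktens k A (kmod A V) x v"
abbreviation kbal where "kbal M N Z \<phi> \<equiv> kbalanced k M N Z \<phi>"

lemma AM_module [simp]: "Module.module k AM" by (simp add: ktensor_module)
lemma AM_abelian [simp]: "abelian_group AM" "abelian_group AAM" "abelian_group AMA"
  by (simp_all add: ktensor_abelian_group)

lemma tensl_add_right:
  "\<lbrakk>v \<in> carrier V; w \<in> carrier V; a \<in> carrier A\<rbrakk> \<Longrightarrow>
    tensl a (v \<oplus>\<^bsub>V\<^esub> w) = tensl a v \<oplus>\<^bsub>AM\<^esub> tensl a w"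
  using ktens_add_right[of k A "kmod A V" a v w] by simp

lemmas all_simps = tens_simps tensl_add_right ract_simps lact_simps mult_simps

lemma smult_ract_lact:
  "\<lbrakk>c \<in> carrier k; v \<in> carrier V\<rbrakk> \<Longrightarrow> c \<odot>\<^bsub>kmod A V\<^esub> v \<in> carrier V"
  using M.smult_closed[of c v] by simp

context
  fixes a b c d assumes abcd [simp]: "a \<in> carrier A" "b \<in> carrier A" "c \<in> carrier A" "d \<in> carrier A"
begin

lemma act_AV_bal: "kbal A (kmod A V) AM (\<lambda>x v. tensl (a \<otimes>\<^bsub>A\<^esub> x \<otimes>\<^bsub>A\<^esub> c) (ract V (lact V b v) d))"
  by (rule kbalancedI) (auto simp: all_simps)

lemma act_VA_bal: "bal MA (\<lambda>v x. tens (ract V (lact V a v) c) (b \<otimes>\<^bsub>A\<^esub> x \<otimes>\<^bsub>A\<^esub> d))"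
  by (rule balI) (auto simp: all_simps)

lemma act_AV_tensl:
  "\<lbrakk>x \<in> carrier A; v \<in> carrier V\<rbrakk> \<Longrightarrow>
    act_AV k A V a b c d (tensl x v) = tensl (a \<otimes>\<^bsub>A\<^esub> x \<otimes>\<^bsub>A\<^esub> c) (ract V (lact V b v) d)"
  by (simp add: act_AV_def act_AV_bal)

lemma act_AV_addhom: "act_AV k A V a b c d \<in> addhom AM AM"
  unfolding act_AV_def by (rule klift_addhom) (simp_all add: act_AV_bal)

lemma act_VA_tens:
  "\<lbrakk>v \<in> carrier V; x \<in> carrier A\<rbrakk> \<Longrightarrow>
    act_VA k A V a b c d (tens v x) = tens (ract V (lact V a v) c) (b \<otimes>\<^bsub>A\<^esub> x \<otimes>\<^bsub>A\<^esub> d)"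
  by (simp add: act_VA_def act_VA_bal)

lemma act_VA_addhom: "act_VA k A V a b c d \<in> addhom MA MA"
  unfolding act_VA_def by (rule klift_addhom) (simp_all add: act_VA_bal)

end

text \<open>With three of the four elements equal to 1 the sandwich action becomes one of the four
  single actions, and these are the operations that occur in right linearity, left linearity and the
  two sides of the exchange law.\<close>

lemma act_VA_alt:
  "a \<in> carrier A \<Longrightarrow> act_VA k A V a \<one>\<^bsub>A\<^esub> \<one>\<^bsub>A\<^esub> \<one>\<^bsub>A\<^esub> t = sw MA (\<lambda>w x. tens (lact V a w) x) t"
  "b \<in> carrier A \<Longrightarrow> act_VA k A V \<one>\<^bsub>A\<^esub> b \<one>\<^bsub>A\<^esub> \<one>\<^bsub>A\<^esub> t = sw MA (\<lambda>w x. tens w (b \<otimes>\<^bsub>A\<^esub> x)) t"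
  "a \<in> carrier A \<Longrightarrow> act_VA k A V \<one>\<^bsub>A\<^esub> \<one>\<^bsub>A\<^esub> a \<one>\<^bsub>A\<^esub> t = sw MA (\<lambda>w x. tens (ract V w a) x) t"
  "b \<in> carrier A \<Longrightarrow> act_VA k A V \<one>\<^bsub>A\<^esub> \<one>\<^bsub>A\<^esub> \<one>\<^bsub>A\<^esub> b t = sw MA (\<lambda>w x. tens w (x \<otimes>\<^bsub>A\<^esub> b)) t"
  unfolding act_VA_def by (auto intro!: sw_cong simp: ract_one lact_one ract_closed lact_closed)

end

lemma alg_bimoduleI:
  fixes A :: "('k, 'u::infinite) module" and V :: "'u bimod"
  shows "V \<in> bimodules k A \<Longrightarrow> alg_bimodule k A V"
  by (simp add: bimodules_def alg_bimodule_def bimodule_alg_right_module)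

sublocale yetter_drinfeld \<subseteq> alg_bimodule
  by unfold_locales

section \<open>From descent data to coactions\<close>

locale AA_map = alg_bimodule k A V
  for k :: "('k, 'c) ring_scheme" and A :: "('k, 'u::infinite) module" and V :: "'u bimod" +
  fixes g assumes g: "g \<in> AA_bimodule_maps k A V"
begin

lemma g_klinear: "g \<in> klinear k AM MA"
  using g by (simp add: AA_bimodule_maps_def)

lemma g_closed [simp]: "t \<in> carrier AM \<Longrightarrow> g t \<in> carrier MA"
  by (rule klinearD(3)[OF g_klinear])

lemma g_add: "\<lbrakk>s \<in> carrier AM; t \<in> carrier AM\<rbrakk> \<Longrightarrow> g (s \<oplus>\<^bsub>AM\<^esub> t) = g s \<oplus>\<^bsub>MA\<^esub> g t"
  by (rule klinearD(4)[OF g_klinear])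

lemma g_smult: "\<lbrakk>c \<in> carrier k; t \<in> carrier AM\<rbrakk> \<Longrightarrow> g (c \<odot>\<^bsub>AM\<^esub> t) = c \<odot>\<^bsub>MA\<^esub> g t"
  by (rule klinearD(5)[OF g_klinear])

lemma g_act:
  "\<lbrakk>a \<in> carrier A; b \<in> carrier A; c \<in> carrier A; d \<in> carrier A; t \<in> carrier AM\<rbrakk> \<Longrightarrow>
    g (act_AV k A V a b c d t) = act_VA k A V a b c d (g t)"
  using g by (simp add: AA_bimodule_maps_def)

text \<open>Since a \<otimes> v is (a \<otimes> 1) (1 \<otimes> v), bilinearity makes
  \<open>g\<close> determined by its values at 1 \<otimes> v, that is, by the coaction.\<close>

lemma g_tensl:
  assumes "a \<in> carrier A" "v \<in> carrier V"
  shows "g (tensl a v) = sw MA (\<lambda>w b. tens (lact V a w) b) (g (tensl \<one>\<^bsub>A\<^esub> v))"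
  using assms g_act[of a "\<one>\<^bsub>A\<^esub>" "\<one>\<^bsub>A\<^esub>" "\<one>\<^bsub>A\<^esub>" "tensl \<one>\<^bsub>A\<^esub> v"]
  by (simp add: act_AV_tensl act_VA_alt ract_one lact_one)

lemma g_tensl_klinear: "a \<in> carrier A \<Longrightarrow> (\<lambda>v\<in>carrier V. g (tensl a v)) \<in> klinear k (kmod A V) MA"
  by (rule klinearI) (simp_all add: tensl_add_right tens_simps g_add g_smult smult_ract_lact)

lemma desc1_bal:
  "kbal A AM AMA (\<lambda>b t. sw AMA (\<lambda>w x. ktens k AM A (tensl b w) x) (g t))"
proof (rule kbalanced_comp_right[OF _ g_klinear])
  show "kbal A MA AMA (\<lambda>b. sw AMA (\<lambda>w x. ktens k AM A (tensl b w) x))"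
    by (rule kbalanced_nest) (auto intro!: balI simp: all_simps)
qed

lemma desc1_tensl:
  assumes "b \<in> carrier A" "t \<in> carrier AM"
  shows "desc1 k A V g (ktens k A AM b t) = sw AMA (\<lambda>w x. ktens k AM A (tensl b w) x) (g t)"
  unfolding desc1_def Let_def using assms by (simp add: desc1_bal)

lemma desc1_inner_bal:
  "b \<in> carrier A \<Longrightarrow> bal AMA (\<lambda>w x. ktens k AM A (tensl b w) x)"
  by (rule balI) (auto simp: all_simps)

lemma desc2_inner_bal:
  "b \<in> carrier A \<Longrightarrow> bal MAA (\<lambda>w x. ktens k MA A (tens w b) x)"
  by (rule balI) (auto simp: all_simps)

lemma desc2_middle_bal:
  assumes a: "a \<in> carrier A"
  shows "kbal A (kmod A V) MAA (\<lambda>b v. sw MAA (\<lambda>w x. ktens k MA A (tens w b) x) (g (tensl a v)))"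
proof -
  have "kbal A MA MAA (\<lambda>b. sw MAA (\<lambda>w x. ktens k MA A (tens w b) x))"
    by (rule kbalanced_nest) (auto intro!: balI simp: all_simps)
  from kbalanced_comp_right[OF this g_tensl_klinear[OF a]] show ?thesis
    by (simp add: balanced_def smult_ract_lact)
qed

lemma desc2_bal:
  "kbal A AM MAA (\<lambda>a. klift k A (kmod A V) MAA
     (\<lambda>b v. sw MAA (\<lambda>w x. ktens k MA A (tens w b) x) (g (tensl a v))))"
proof (rule kbalanced_nest)
  show "sw MAA (\<lambda>w x. ktens k MA A (tens w y) x) (g (tensl (c \<odot>\<^bsub>A\<^esub> a) z)) =
      sw MAA (\<lambda>w x. ktens k MA A (tens w (c \<odot>\<^bsub>A\<^esub> y)) x) (g (tensl a z))"
    if "c \<in> carrier k" "a \<in> carrier A" "y \<in> carrier A" "z \<in> carrier (kmod A V)" for c a y z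
  proof -
    \<comment> \<open>The scalar leaves \<open>g\<close> by linearity, acts on the factor
      \<open>w\<close>, and crosses from there to the inserted element \<open>y\<close>.\<close>
    have "sw MAA (\<lambda>w x. ktens k MA A (tens (c \<odot>\<^bsub>kmod A V\<^esub> w) y) x) (g (tensl a z)) =
        sw MAA (\<lambda>w x. ktens k MA A (tens w (c \<odot>\<^bsub>A\<^esub> y)) x) (g (tensl a z))"
      by (rule sw_cong) (use that in \<open>simp add: tens_simps\<close>)
    then show ?thesis
      using that by (simp add: ktens_smult_left g_smult klift_smult desc2_inner_bal)
  qed
qed (auto simp: desc2_middle_bal g_add tens_simps klift_add desc2_inner_bal)

lemma desc2_tensl:
  assumes "a \<in> carrier A" "b \<in> carrier A" "v \<in> carrier V"
  shows "desc2 k A V g (ktens k A AM a (tensl b v)) =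
    sw MAA (\<lambda>w x. ktens k MA A (tens w b) x) (g (tensl a v))"
  unfolding desc2_def Let_def using assms by (simp add: desc2_bal desc2_middle_bal)

lemma desc3_tens:
  assumes "t \<in> carrier AM" "b \<in> carrier A"
  shows "desc3 k A V g (ktens k AM A t b) = ktens k MA A (g t) b"
  unfolding desc3_def Let_def using assms
  by (simp add: ktensor_map_kbalanced[OF _ _ _ g_klinear])

lemma desc3_addhom: "desc3 k A V g \<in> addhom AMA MAA"
  unfolding desc3_def Let_def
  by (rule klift_addhom) (simp_all add: ktensor_map_kbalanced[OF _ _ _ g_klinear])

lemma desc_addhom: "desc1 k A V g \<in> addhom AAM AMA" "desc2 k A V g \<in> addhom AAM MAA"
  unfolding desc1_def desc2_def Let_def
  by (rule klift_addhom; simp add: desc1_bal desc2_bal)+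

lemma desc31_tensl:
  assumes "b \<in> carrier A" "t \<in> carrier AM"
  shows "desc3 k A V g (desc1 k A V g (ktens k A AM b t)) = sw MAA (\<lambda>w x. ktens k MA A (g (tensl b w)) x) (g t)"
proof -
  have "desc3 k A V g (desc1 k A V g (ktens k A AM b t)) =
      sw MAA (\<lambda>w x. desc3 k A V g (ktens k AM A (tensl b w) x)) (g t)"
    unfolding desc1_tensl[OF assms]
    by (rule klift_comp) (use assms desc1_inner_bal desc3_addhom in auto)
  also have "\<dots> = sw MAA (\<lambda>w x. ktens k MA A (g (tensl b w)) x) (g t)"
    by (rule sw_cong) (use assms in \<open>simp add: desc3_tens\<close>)
  finally show ?thesis .
qed

end

locale descent = AA_map k A V g
  for k :: "('k, 'c) ring_scheme" and A :: "('k, 'u::infinite) module" and V :: "'u bimod" and g +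
  assumes descent: "g \<in> descent_data k A V"
begin

definition coact where "coact = (\<lambda>v\<in>carrier V. g (tensl \<one>\<^bsub>A\<^esub> v))"

lemma coact_tens: "v \<in> carrier V \<Longrightarrow> coact v = g (tensl \<one>\<^bsub>A\<^esub> v)"
  by (simp add: coact_def)

text \<open>The tensor a \<otimes> v equals both (a \<otimes> 1) (1 \<otimes> v) and (1 \<otimes> v)
  (a \<otimes> 1), and comparing the images under \<open>g\<close> gives the exchange law. The
  actions of 1 \<otimes> a on the left and on the right give left and right linearity, the
  normalization of \<open>g\<close> is the counit, and the descent identity at 1 \<otimes> 1
  \<otimes> v is coassociativity.\<close>

lemma coact_yd: "coact \<in> yetter_drinfeld_coactions k A V"
proof -
  have klin: "coact \<in> klinear k (kmod A V) MA"
    unfolding coact_def by (rule g_tensl_klinear) simp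
  have coassoc: "sw MAA (\<lambda>w a. ktens k MA A (coact w) a) (coact v) =
      sw MAA (\<lambda>w a. ktens k MA A (tens w \<one>\<^bsub>A\<^esub>) a) (coact v)" if v: "v \<in> carrier V" for v
  proof -
    have "ktens k A AM \<one>\<^bsub>A\<^esub> (tensl \<one>\<^bsub>A\<^esub> v) \<in> carrier AAM" using v by simp
    then have "desc2 k A V g (ktens k A AM \<one>\<^bsub>A\<^esub> (tensl \<one>\<^bsub>A\<^esub> v)) =
        desc3 k A V g (desc1 k A V g (ktens k A AM \<one>\<^bsub>A\<^esub> (tensl \<one>\<^bsub>A\<^esub> v)))"
      using descent unfolding descent_data_def Let_def by blast
    then have "sw MAA (\<lambda>w x. ktens k MA A (tens w \<one>\<^bsub>A\<^esub>) x) (coact v) =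
       sw MAA (\<lambda>w x. ktens k MA A (g (tensl \<one>\<^bsub>A\<^esub> w)) x) (coact v)"
      using v by (simp add: desc2_tensl desc31_tensl coact_tens)
    also have "\<dots> = sw MAA (\<lambda>w a. ktens k MA A (coact w) a) (coact v)"
      by (rule sw_cong) (simp add: coact_tens)
    finally show ?thesis by simp
  qed
  have "coact \<in> coactions k A V"
    unfolding coactions_def Let_def
  proof (intro CollectI conjI ballI klin coassoc)
    fix v assume v: "v \<in> carrier V"
    show "sw V (\<lambda>w a. ract V w a) (coact v) = v"
      using descent v by (simp add: descent_data_def Let_def coact_tens)
    fix a assume a: "a \<in> carrier A"
    show "coact (ract V v a) = sw MA (\<lambda>w b. tens w (b \<otimes>\<^bsub>A\<^esub> a)) (coact v)"
      using v a g_act[of "\<one>\<^bsub>A\<^esub>" "\<one>\<^bsub>A\<^esub>" "\<one>\<^bsub>A\<^esub>" a "tensl \<one>\<^bsub>A\<^esub> v"]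
      by (simp add: act_AV_tensl act_VA_alt lact_one coact_tens ract_closed)
  qed
  then show ?thesis
    unfolding yetter_drinfeld_coactions_def Let_def
  proof (intro CollectI conjI ballI)
    fix a v assume a: "a \<in> carrier A" and v: "v \<in> carrier V"
    show "coact (lact V a v) = sw MA (\<lambda>w b. tens w (a \<otimes>\<^bsub>A\<^esub> b)) (coact v)"
      using v a g_act[of "\<one>\<^bsub>A\<^esub>" a "\<one>\<^bsub>A\<^esub>" "\<one>\<^bsub>A\<^esub>" "tensl \<one>\<^bsub>A\<^esub> v"]
      by (simp add: act_AV_tensl act_VA_alt ract_one coact_tens lact_closed)
    show "sw MA (\<lambda>w b. tens (lact V a w) b) (coact v) = sw MA (\<lambda>w b. tens (ract V w a) b) (coact v)"
      using v a g_act[of "\<one>\<^bsub>A\<^esub>" "\<one>\<^bsub>A\<^esub>" a "\<one>\<^bsub>A\<^esub>" "tensl \<one>\<^bsub>A\<^esub> v"] g_tensl[of a v]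
      by (simp add: act_AV_tensl act_VA_alt ract_one lact_one coact_tens)
  qed
qed

end

section \<open>From Yetter-Drinfeld modules to descent data\<close>

context yetter_drinfeld
begin

definition dsc :: "'u \<Rightarrow> 'u" where
  "dsc = klift k A (kmod A V) MA (\<lambda>a v. sw MA (\<lambda>w b. tens (lact V a w) b) (\<rho> v))"

lemma dsc_inner_bal: "a \<in> carrier A \<Longrightarrow> bal MA (\<lambda>w b. tens (lact V a w) b)"
  by (rule balI) (auto simp: all_simps)

lemma dsc_bal: "kbal A (kmod A V) MA (\<lambda>a v. sw MA (\<lambda>w b. tens (lact V a w) b) (\<rho> v))"
proof (rule kbalanced_comp_right[OF _ rho_klinear])
  show "kbal A MA MA (\<lambda>a. sw MA (\<lambda>w b. tens (lact V a w) b))"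
    by (rule kbalanced_nest) (auto intro!: balI simp: all_simps)
qed

lemma dsc_tensl:
  "\<lbrakk>a \<in> carrier A; v \<in> carrier V\<rbrakk> \<Longrightarrow> dsc (tensl a v) = sw MA (\<lambda>w b. tens (lact V a w) b) (\<rho> v)"
  by (simp add: dsc_def dsc_bal)

lemma dsc_one: "v \<in> carrier V \<Longrightarrow> dsc (tensl \<one>\<^bsub>A\<^esub> v) = \<rho> v"
  by (subst rho_eq_sw[symmetric]) (auto intro!: sw_cong simp: lact_one dsc_tensl)

lemma sw_tens_smult:
  assumes "c \<in> carrier k" "bal MA \<phi>" "v \<in> carrier V"
  shows "c \<odot>\<^bsub>MA\<^esub> sw MA \<phi> (\<rho> v) = sw MA (\<lambda>w b. c \<odot>\<^bsub>MA\<^esub> \<phi> w b) (\<rho> v)"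
proof (rule sw_comp)
  interpret MA: Module.module k MA by simp
  show "smult MA c \<in> addhom MA MA"
    by (rule addhomI) (simp_all add: assms MA.smult_r_distr)
qed (use assms in auto)

lemma dsc_klinear: "dsc \<in> klinear k AM MA"
  unfolding dsc_def
proof (rule klift_klinear)
  fix c a v assume c: "c \<in> carrier k" and a: "a \<in> carrier A" and v: "v \<in> carrier (kmod A V)"
  have "sw MA (\<lambda>w b. tens (lact V (c \<odot>\<^bsub>A\<^esub> a) w) b) (\<rho> v) = sw MA (\<lambda>w b. c \<odot>\<^bsub>MA\<^esub> tens (lact V a w) b) (\<rho> v)"
    by (rule sw_cong) (use c a in \<open>simp add: all_simps\<close>)
  then show "sw MA (\<lambda>w b. tens (lact V (c \<odot>\<^bsub>A\<^esub> a) w) b) (\<rho> v) = c \<odot>\<^bsub>MA\<^esub> sw MA (\<lambda>w b. tens (lact V a w) b) (\<rho> v)"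
    using c a v by (simp add: sw_tens_smult dsc_inner_bal)
qed (simp_all add: dsc_bal)

lemma dsc_AA: "dsc \<in> AA_bimodule_maps k A V"
  unfolding AA_bimodule_maps_def
proof (intro CollectI conjI ballI dsc_klinear)
  fix a b c d t
  assume abcd: "a \<in> carrier A" "b \<in> carrier A" "c \<in> carrier A" "d \<in> carrier A" and t: "t \<in> carrier AM"
  have *: "dsc (act_AV k A V a b c d (tensl x v)) = act_VA k A V a b c d (dsc (tensl x v))"
    if x: "x \<in> carrier A" and v: "v \<in> carrier V" for x v
  proof -
    have 1: "bal MA (\<lambda>w e. tens (lact V (a \<otimes>\<^bsub>A\<^esub> x) w) (b \<otimes>\<^bsub>A\<^esub> e \<otimes>\<^bsub>A\<^esub> d))"
      by (rule balI) (use abcd x in \<open>auto simp: all_simps\<close>)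
    have 2: "bal MA (\<lambda>w e. tens (lact V (a \<otimes>\<^bsub>A\<^esub> x \<otimes>\<^bsub>A\<^esub> c) w) (e \<otimes>\<^bsub>A\<^esub> d))"
      by (rule balI) (use abcd x in \<open>auto simp: all_simps\<close>)
    have "dsc (act_AV k A V a b c d (tensl x v)) =
        sw MA (\<lambda>w e. tens (lact V (a \<otimes>\<^bsub>A\<^esub> x \<otimes>\<^bsub>A\<^esub> c) w) e) (\<rho> (ract V (lact V b v) d))"
      using abcd x v by (simp add: act_AV_tensl dsc_tensl ract_closed lact_closed)
    also have "\<dots> = sw MA (\<lambda>w e. tens (lact V (a \<otimes>\<^bsub>A\<^esub> x \<otimes>\<^bsub>A\<^esub> c) w) (b \<otimes>\<^bsub>A\<^esub> e \<otimes>\<^bsub>A\<^esub> d)) (\<rho> v)"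
      using abcd x v by (simp add: sw_ract dsc_inner_bal lact_closed sw_lact 2)
    also have "\<dots> = sw MA (\<lambda>w e. tens (lact V (a \<otimes>\<^bsub>A\<^esub> x) (lact V c w)) (b \<otimes>\<^bsub>A\<^esub> e \<otimes>\<^bsub>A\<^esub> d)) (\<rho> v)"
      by (rule sw_cong) (use abcd x in \<open>simp add: lact_mult m_assoc lact_closed\<close>)
    \<comment> \<open>The exchange law: on A \<otimes> V the element \<open>c\<close> multiplies A
      from the right and so becomes the innermost left factor on v[0], whereas on V \<otimes> A it
      has to act on v[0] from the right.\<close>
    also have "\<dots> = sw MA (\<lambda>w e. tens (lact V (a \<otimes>\<^bsub>A\<^esub> x) (ract V w c)) (b \<otimes>\<^bsub>A\<^esub> e \<otimes>\<^bsub>A\<^esub> d)) (\<rho> v)"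
      by (rule sw_lact_left[OF _ 1]) (use abcd v in auto)
    also have "\<dots> = sw MA (\<lambda>w e. act_VA k A V a b c d (tens (lact V x w) e)) (\<rho> v)"
      by (rule sw_cong) (use abcd x in \<open>simp add: act_VA_tens lact_closed lact_mult lact_ract ract_closed\<close>)
    also have "\<dots> = act_VA k A V a b c d (dsc (tensl x v))"
      unfolding dsc_tensl[OF x v]
      by (rule sw_comp[symmetric]) (use abcd x v in \<open>auto simp: act_VA_addhom dsc_inner_bal\<close>)
    finally show ?thesis .
  qed
  show "dsc (act_AV k A V a b c d t) = act_VA k A V a b c d (dsc t)"
  proof (rule ktensor_addhom_eqI[of k A "kmod A V" t "\<lambda>t. dsc (act_AV k A V a b c d t)" MA])
    show "(\<lambda>t. dsc (act_AV k A V a b c d t)) \<in> addhom AM MA"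
      using hom_compose[OF act_AV_addhom[OF abcd] klinearD(1)[OF dsc_klinear]] by (simp add: o_def)
    show "(\<lambda>t. act_VA k A V a b c d (dsc t)) \<in> addhom AM MA"
      using hom_compose[OF klinearD(1)[OF dsc_klinear] act_VA_addhom[OF abcd]] by (simp add: o_def)
  qed (use t * in auto)
qed

sublocale dsc: AA_map k A V dsc
  by unfold_locales (rule dsc_AA)

text \<open>At a \<otimes> b \<otimes> v one side of the descent identity is a v[0] \<otimes> b
  \<otimes> v[1]. The other is a (b v[0])[0] \<otimes> (b v[0])[1] \<otimes> v[1], which left
  linearity rewrites as a v[0][0] \<otimes> b v[0][1] \<otimes> v[1], and coassociativity identifies
  the two.\<close>

lemma dsc_descent: "dsc \<in> descent_data k A V"
  unfolding descent_data_def Let_def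
proof (intro CollectI conjI ballI dsc_AA)
  \<comment> \<open>A threefold tensor is reduced to pure tensors in two stages, here the inner one
    with the outer element fixed.\<close>
  have *: "desc2 k A V dsc (ktens k A AM a t) = desc3 k A V dsc (desc1 k A V dsc (ktens k A AM a t))"
    if a: "a \<in> carrier A" and t: "t \<in> carrier AM" for a t
  proof (rule ktensor_addhom_eqI[of k A "kmod A V" t "\<lambda>t. desc2 k A V dsc (ktens k A AM a t)" MAA])
    have tens: "ktens k A AM a \<in> addhom AM AAM"
      by (rule addhomI) (use a in \<open>simp_all add: ktens_add_right\<close>)
    show "(\<lambda>t. desc2 k A V dsc (ktens k A AM a t)) \<in> addhom AM MAA"
      using hom_compose[OF tens dsc.desc_addhom(2)] by (simp add: o_def)
    show "(\<lambda>t. desc3 k A V dsc (desc1 k A V dsc (ktens k A AM a t))) \<in> addhom AM MAA"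
      using hom_compose[OF hom_compose[OF tens dsc.desc_addhom(1)] dsc.desc3_addhom] by (simp add: o_def)
  next
    fix b v assume b: "b \<in> carrier A" and "v \<in> carrier (kmod A V)"
    then have v: "v \<in> carrier V" by simp
    have 1: "bal MAA (\<lambda>w x. ktens k MA A (dsc (tensl a w)) x)"
      by (rule balI) (use a in \<open>auto simp: all_simps dsc.g_add dsc.g_smult\<close>)
    have 2: "bal MAA (\<lambda>w x. ktens k MA A (tens w b) x)"
      by (rule dsc.desc2_inner_bal[OF b])
    have h: "(\<lambda>t. ktens k MA A t x) \<in> addhom MA MAA" if "x \<in> carrier A" for x
      by (rule addhomI) (use that in \<open>simp_all add: ktens_add_left\<close>)
    have comp: "h (dsc (tensl a' v')) = sw MAA (\<lambda>w b. h (tens (lact V a' w) b)) (\<rho> v')"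
      if "h \<in> addhom MA MAA" "a' \<in> carrier A" "v' \<in> carrier V" for h a' v'
      unfolding dsc_tensl[OF that(2,3)]
      by (rule sw_comp) (use that in \<open>auto simp: dsc_inner_bal\<close>)
    have 3: "bal MA (\<lambda>w y. tens (lact V a w) (b \<otimes>\<^bsub>A\<^esub> y))"
      by (rule balI) (use a b in \<open>auto simp: all_simps\<close>)
    have tri: "trilinear MAA (\<lambda>w y x. ktens k MA A (tens (lact V a w) (b \<otimes>\<^bsub>A\<^esub> y)) x)"
      using a b by (simp add: trilinear_def all_simps)
    have "desc2 k A V dsc (ktens k A AM a (tensl b v)) =
        sw MAA (\<lambda>w x. sw MAA (\<lambda>w x. ktens k MA A (tens w b) x) (tens (lact V a w) x)) (\<rho> v)"
      using a b v by (simp add: dsc.desc2_tensl comp[of "sw MAA (\<lambda>w x. ktens k MA A (tens w b) x)"] klift_addhom 2)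
    \<comment> \<open>The factor 1 is written in so that coassociativity can be read from right to
      left, replacing 1 by v[0][1].\<close>
    also have "\<dots> = sw MAA (\<lambda>w x. ktens k MA A (tens (lact V a w) (b \<otimes>\<^bsub>A\<^esub> \<one>\<^bsub>A\<^esub>)) x) (\<rho> v)"
      by (rule sw_cong) (use a b 2 in \<open>simp add: lact_closed\<close>)
    also have "\<dots> = sw MAA (\<lambda>w x. sw MAA (\<lambda>w' y. ktens k MA A (tens (lact V a w') (b \<otimes>\<^bsub>A\<^esub> y)) x) (\<rho> w)) (\<rho> v)"
      by (rule sw_coassoc[OF _ tri v, symmetric]) simp
    also have "\<dots> = sw MAA (\<lambda>w x. ktens k MA A (dsc (tensl a (lact V b w))) x) (\<rho> v)"
    proof (rule sw_cong)
      fix w x assume w: "w \<in> carrier V" and x: "x \<in> carrier A"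
      have "dsc (tensl a (lact V b w)) = sw MA (\<lambda>w y. tens (lact V a w) (b \<otimes>\<^bsub>A\<^esub> y)) (\<rho> w)"
        using a b w by (simp add: dsc_tensl lact_closed sw_lact dsc_inner_bal)
      then show "sw MAA (\<lambda>w' y. ktens k MA A (tens (lact V a w') (b \<otimes>\<^bsub>A\<^esub> y)) x) (\<rho> w) =
          ktens k MA A (dsc (tensl a (lact V b w))) x"
        using sw_comp[OF _ _ h[OF x] 3 w] by simp
    qed
    also have "\<dots> = sw MAA (\<lambda>w x. sw MAA (\<lambda>w x. ktens k MA A (dsc (tensl a w)) x) (tens (lact V b w) x)) (\<rho> v)"
      by (rule sw_cong) (use b 1 in \<open>simp add: lact_closed\<close>)
    also have "\<dots> = desc3 k A V dsc (desc1 k A V dsc (ktens k A AM a (tensl b v)))"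
      using a b v by (simp add: dsc.desc31_tensl comp[of "sw MAA (\<lambda>w x. ktens k MA A (dsc (tensl a w)) x)"] klift_addhom 1)
    finally show "desc2 k A V dsc (ktens k A AM a (tensl b v)) =
        desc3 k A V dsc (desc1 k A V dsc (ktens k A AM a (tensl b v)))" .
  qed (use t in auto)
  show "desc2 k A V dsc t = desc3 k A V dsc (desc1 k A V dsc t)" if t: "t \<in> carrier AAM" for t
  proof (rule ktensor_addhom_eqI[OF _ _ t dsc.desc_addhom(2)])
    show "(\<lambda>t. desc3 k A V dsc (desc1 k A V dsc t)) \<in> addhom AAM MAA"
      using hom_compose[OF dsc.desc_addhom(1) dsc.desc3_addhom] by (simp add: o_def)
  qed (use * in auto)
  show "sw V (\<lambda>w a. ract V w a) (dsc (tensl \<one>\<^bsub>A\<^esub> v)) = v" if v: "v \<in> carrier V" for v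
    using v by (simp add: dsc_one counit)
qed

end

lemma descentI:
  fixes A :: "('k, 'u::infinite) module" and V :: "'u bimod"
  assumes "V \<in> bimodules k A" "g \<in> descent_data k A V"
  shows "descent k A V g"
  using assms by (auto simp: descent_def descent_axioms_def AA_map_def AA_map_axioms_def
      alg_bimoduleI descent_data_def Let_def)

lemma yetter_drinfeld_descent_iso:
  fixes k :: "('k, 'c) ring_scheme" and A :: "('k, 'u::infinite) module"
  assumes A: "assoc_algebra k A"
  shows "isomorphic_categories (yetter_drinfeld_category k A) (descent_category k A)"
proof (rule isomorphic_transport)
  let ?Y = "yetter_drinfeld_category k A" and ?D = "descent_category k A"
  let ?Fo = "\<lambda>(V, \<rho>). (V, yetter_drinfeld.dsc k A V \<rho>)"
  let ?Go = "\<lambda>(V, g). (V, descent.coact k A V g)"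
  show "category ?Y" by (rule comodule_yetter_drinfeld_iso(2)[OF A])
  show "?Fo P \<in> Obj ?D" "?Go (?Fo P) = P" if P: "P \<in> Obj ?Y" for P
  proof -
    obtain V \<rho> where P_eq: "P = (V, \<rho>)" and V: "V \<in> bimodules k A" "\<rho> \<in> yetter_drinfeld_coactions k A V"
      using P by (auto simp: yetter_drinfeld_category_def)
    interpret yetter_drinfeld k A V \<rho> by (rule yetter_drinfeldI[OF V])
    interpret d: descent k A V dsc by (rule descentI[OF V(1) dsc_descent])
    show "?Fo P \<in> Obj ?D"
      using V dsc_descent by (simp add: P_eq descent_category_def)
    have "d.coact = \<rho>"
    proof (rule extensionalityI)
      show "d.coact v = \<rho> v" if "v \<in> carrier V" for v
        using that by (simp add: d.coact_tens dsc_one)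
    qed (auto simp: d.coact_def rho_extensional)
    then show "?Go (?Fo P) = P" by (simp add: P_eq)
  qed
  show "?Go P \<in> Obj ?Y" "?Fo (?Go P) = P" if P: "P \<in> Obj ?D" for P
  proof -
    obtain V g where P_eq: "P = (V, g)" and V: "V \<in> bimodules k A" "g \<in> descent_data k A V"
      using P by (auto simp: descent_category_def)
    interpret descent k A V g by (rule descentI[OF V])
    interpret y: yetter_drinfeld k A V coact by (rule yetter_drinfeldI[OF V(1) coact_yd])
    show "?Go P \<in> Obj ?Y"
      using V coact_yd by (simp add: P_eq yetter_drinfeld_category_def)
    have "y.dsc = g"
    proof (rule extensionalityI[of _ "carrier AM"])
      fix t assume t: "t \<in> carrier AM"
      show "y.dsc t = g t"
      proof (rule ktensor_addhom_eqI[OF _ _ t klinearD(1)[OF y.dsc_klinear] klinearD(1)[OF g_klinear]])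
        show "y.dsc (tensl a v) = g (tensl a v)" if "a \<in> carrier A" "v \<in> carrier (kmod A V)" for a v
          using that g_tensl[of a v] by (simp add: y.dsc_tensl coact_tens)
      qed simp_all
    qed (use klinearD(2)[OF y.dsc_klinear] klinearD(2)[OF g_klinear] in auto)
    then show "?Fo (?Go P) = P" by (simp add: P_eq)
  qed
  show "Hom ?D (?Fo P) (?Fo Q) = Hom ?Y P Q" if PQ: "P \<in> Obj ?Y" "Q \<in> Obj ?Y" for P Q
  proof -
    obtain V \<rho> where P_eq: "P = (V, \<rho>)" and V: "V \<in> bimodules k A" "\<rho> \<in> yetter_drinfeld_coactions k A V"
      using PQ by (auto simp: yetter_drinfeld_category_def)
    obtain W \<sigma> where Q_eq: "Q = (W, \<sigma>)" and W: "W \<in> bimodules k A" "\<sigma> \<in> yetter_drinfeld_coactions k A W"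
      using PQ by (auto simp: yetter_drinfeld_category_def)
    interpret V: yetter_drinfeld k A V \<rho> by (rule yetter_drinfeldI[OF V])
    interpret W: yetter_drinfeld k A W \<sigma> by (rule yetter_drinfeldI[OF W])
    \<comment> \<open>At 1 \<otimes> v the descent condition is the coaction condition. Conversely
      \<open>dsc\<close> at a \<otimes> v is \<rho> v acted on by a from the left in the first
      factor, and \<open>f\<close> is left linear, so the coaction condition implies the descent
      condition on all pure tensors.\<close>
    have "(\<forall>t\<in>carrier V.AM. ktensor_map k (kmod A V) (kmod A W) A A f (\<lambda>a. a) (V.dsc t) =
               W.dsc (ktensor_map k A A (kmod A V) (kmod A W) (\<lambda>a. a) f t)) \<longleftrightarrow>
        preserves_coaction k A (V, \<rho>) (W, \<sigma>) f" if f: "f \<in> bimod_hom A V W" for f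
    proof -
      have fr: "f \<in> rmod_hom A V W"
        and fl: "\<And>a v. \<lbrakk>a \<in> carrier A; v \<in> carrier V\<rbrakk> \<Longrightarrow> f (lact V a v) = lact W a (f v)"
        using f by (simp_all add: bimod_hom_def)
      have fk: "f \<in> klinear k (kmod A V) (kmod A W)"
        by (rule rmod_hom_klinear[OF V.alg_right_module_axioms W.alg_right_module_axioms fr])
      have fc: "\<And>v. v \<in> carrier V \<Longrightarrow> f v \<in> carrier W"
        using rmod_homD(3)[OF fr] .
      let ?fA = "ktensor_map k (kmod A V) (kmod A W) A A f (\<lambda>a. a)"
      let ?Af = "ktensor_map k A A (kmod A V) (kmod A W) (\<lambda>a. a) f"
      note fA = ktensor_map_id_right[OF V.kmod_module W.kmod_module V.A_module fk]
      have Af_bal: "kbalanced k A (kmod A V) W.AM (\<lambda>a v. W.tensl a (f v))"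
        by (rule kbalancedI)
          (use klinearD[OF fk] in \<open>simp_all add: W.all_simps fc W.smult_ract_lact\<close>)
      have Af: "?Af (V.tensl a v) = W.tensl a (f v)" if "a \<in> carrier A" "v \<in> carrier V" for a v
        using that by (simp add: ktensor_map_def Af_bal)
      have Af_hom: "?Af \<in> addhom V.AM W.AM"
        unfolding ktensor_map_def by (rule klift_addhom) (simp_all add: Af_bal)
      have fA_dsc: "?fA (V.dsc (V.tensl a v)) = W.sw W.MA (\<lambda>w b. W.tens (lact W a w) b) (?fA (\<rho> v))"
        if a: "a \<in> carrier A" and v: "v \<in> carrier V" for a v
      proof -
        have "?fA (V.dsc (V.tensl a v)) = V.sw W.MA (\<lambda>w b. ?fA (V.tens (lact V a w) b)) (\<rho> v)"
          unfolding V.dsc_tensl[OF a v]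
          by (rule V.sw_comp) (use a v klinearD(1)[OF fA(1)] V.dsc_inner_bal in auto)
        also have "\<dots> = V.sw W.MA (\<lambda>w b. W.sw W.MA (\<lambda>w b. W.tens (lact W a w) b) (W.tens (f w) b)) (\<rho> v)"
          by (rule V.sw_cong) (use a in \<open>simp add: fA fl fc V.lact_closed W.dsc_inner_bal\<close>)
        also have "\<dots> = W.sw W.MA (\<lambda>w b. W.tens (lact W a w) b) (?fA (\<rho> v))"
          unfolding fA(3)
          by (rule V.sw_comp[symmetric])
            (use a v fA(4) W.dsc_inner_bal[OF a] in \<open>auto intro!: klift_addhom\<close>)
        finally show ?thesis .
      qed
      show ?thesis
      proof
        assume *: "\<forall>t\<in>carrier V.AM. ?fA (V.dsc t) = W.dsc (?Af t)"
        have "\<sigma> (f v) = ?fA (\<rho> v)" if v: "v \<in> carrier V" for v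
          using *[rule_format, of "V.tensl \<one>\<^bsub>A\<^esub> v"] v by (simp add: V.dsc_one W.dsc_one Af fc)
        then show "preserves_coaction k A (V, \<rho>) (W, \<sigma>) f"
          by (simp add: preserves_coaction_def)
      next
        assume *: "preserves_coaction k A (V, \<rho>) (W, \<sigma>) f"
        show "\<forall>t\<in>carrier V.AM. ?fA (V.dsc t) = W.dsc (?Af t)"
        proof
          fix t assume t: "t \<in> carrier V.AM"
          show "?fA (V.dsc t) = W.dsc (?Af t)"
          proof (rule ktensor_addhom_eqI[OF V.A_module V.kmod_module t, of "\<lambda>t. ?fA (V.dsc t)"])
            show "(\<lambda>t. ?fA (V.dsc t)) \<in> addhom V.AM W.MA"
              using hom_compose[OF klinearD(1)[OF V.dsc_klinear] klinearD(1)[OF fA(1)]] by (simp add: o_def)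
            show "(\<lambda>t. W.dsc (?Af t)) \<in> addhom V.AM W.MA"
              using hom_compose[OF Af_hom klinearD(1)[OF W.dsc_klinear]] by (simp add: o_def)
          next
            fix a v assume a: "a \<in> carrier A" and "v \<in> carrier (kmod A V)"
            then have v: "v \<in> carrier V" by simp
            show "?fA (V.dsc (V.tensl a v)) = W.dsc (?Af (V.tensl a v))"
              using * a v by (simp add: fA_dsc Af W.dsc_tensl fc preserves_coaction_def)
          qed
        qed
      qed
    qed
    then show ?thesis
      by (auto simp: P_eq Q_eq yetter_drinfeld_category_def descent_category_def)
  qed
qed (auto simp: yetter_drinfeld_category_def descent_category_def)

section \<open>The monoidal category of bimodules\<close>

lemma (in abelian_monoid) add_add_comm:
  "\<lbrakk>p \<in> carrier G; q \<in> carrier G; r \<in> carrier G; s \<in> carrier G\<rbrakk> \<Longrightarrow>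
    (p \<oplus> q) \<oplus> (r \<oplus> s) = (p \<oplus> r) \<oplus> (q \<oplus> s)"
  by (simp add: a_ac)

locale alg = assoc_algebra k A
  for k :: "('k, 'c) ring_scheme" and A :: "('k, 'u::infinite) module"
begin

abbreviation B where "B \<equiv> bimodules k A"

lemma bimod: "X \<in> B \<Longrightarrow> alg_bimodule k A X"
  by (rule alg_bimoduleI)

lemma bimod_abelian [simp]: "X \<in> B \<Longrightarrow> abelian_group X"
  by (drule bimod) (simp add: alg_bimodule_def alg_right_module.V_abelian[of k A])

text \<open>The bimodule laws are restated with membership in \<open>B\<close> as hypothesis because
  the coherence arguments range over several bimodules and their iterated tensor products at
  once.\<close>

lemma
  assumes "X \<in> B"
  shows b_lact_closed: "\<lbrakk>a \<in> carrier A; x \<in> carrier X\<rbrakk> \<Longrightarrow> lact X a x \<in> carrier X"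
    and b_ract_closed: "\<lbrakk>x \<in> carrier X; a \<in> carrier A\<rbrakk> \<Longrightarrow> ract X x a \<in> carrier X"
    and b_add_closed: "\<lbrakk>x \<in> carrier X; y \<in> carrier X\<rbrakk> \<Longrightarrow> x \<oplus>\<^bsub>X\<^esub> y \<in> carrier X"
    and b_lact_add_left: "\<lbrakk>a \<in> carrier A; b \<in> carrier A; x \<in> carrier X\<rbrakk>
      \<Longrightarrow> lact X (a \<oplus>\<^bsub>A\<^esub> b) x = lact X a x \<oplus>\<^bsub>X\<^esub> lact X b x"
    and b_lact_add_right: "\<lbrakk>a \<in> carrier A; x \<in> carrier X; y \<in> carrier X\<rbrakk>
      \<Longrightarrow> lact X a (x \<oplus>\<^bsub>X\<^esub> y) = lact X a x \<oplus>\<^bsub>X\<^esub> lact X a y"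
    and b_ract_add_left: "\<lbrakk>x \<in> carrier X; y \<in> carrier X; a \<in> carrier A\<rbrakk>
      \<Longrightarrow> ract X (x \<oplus>\<^bsub>X\<^esub> y) a = ract X x a \<oplus>\<^bsub>X\<^esub> ract X y a"
    and b_ract_add_right: "\<lbrakk>x \<in> carrier X; a \<in> carrier A; b \<in> carrier A\<rbrakk>
      \<Longrightarrow> ract X x (a \<oplus>\<^bsub>A\<^esub> b) = ract X x a \<oplus>\<^bsub>X\<^esub> ract X x b"
    and b_lact_mult: "\<lbrakk>a \<in> carrier A; b \<in> carrier A; x \<in> carrier X\<rbrakk>
      \<Longrightarrow> lact X (a \<otimes>\<^bsub>A\<^esub> b) x = lact X a (lact X b x)"
    and b_ract_mult: "\<lbrakk>x \<in> carrier X; a \<in> carrier A; b \<in> carrier A\<rbrakk>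
      \<Longrightarrow> ract X x (a \<otimes>\<^bsub>A\<^esub> b) = ract X (ract X x a) b"
    and b_lact_one: "x \<in> carrier X \<Longrightarrow> lact X \<one>\<^bsub>A\<^esub> x = x"
    and b_ract_one: "x \<in> carrier X \<Longrightarrow> ract X x \<one>\<^bsub>A\<^esub> = x"
    and b_lact_ract: "\<lbrakk>a \<in> carrier A; x \<in> carrier X; b \<in> carrier A\<rbrakk>
      \<Longrightarrow> ract X (lact X a x) b = lact X a (ract X x b)"
    and b_central: "\<lbrakk>c \<in> carrier k; x \<in> carrier X\<rbrakk>
      \<Longrightarrow> lact X (c \<odot>\<^bsub>A\<^esub> \<one>\<^bsub>A\<^esub>) x = ract X x (c \<odot>\<^bsub>A\<^esub> \<one>\<^bsub>A\<^esub>)"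
proof -
  interpret X: alg_bimodule k A X by (rule bimod[OF assms])
  show "\<lbrakk>a \<in> carrier A; x \<in> carrier X\<rbrakk> \<Longrightarrow> lact X a x \<in> carrier X" for a x by (rule X.lact_closed)
  show "\<lbrakk>x \<in> carrier X; a \<in> carrier A\<rbrakk> \<Longrightarrow> ract X x a \<in> carrier X" for a x by (rule X.ract_closed)
  show "\<lbrakk>x \<in> carrier X; y \<in> carrier X\<rbrakk> \<Longrightarrow> x \<oplus>\<^bsub>X\<^esub> y \<in> carrier X" for x y by simp
qed (use assms in \<open>auto simp: bimodules_def bimodule.lact_add_left bimodule.lact_add_right bimodule.lact_mult
   bimodule.lact_one bimodule.lact_ract bimodule.central bimodule_def right_module.ract_add_left
   right_module.ract_add_right right_module.ract_mult right_module.ract_one\<close>)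

lemmas b_closed [simp] = b_lact_closed b_ract_closed b_add_closed
lemmas b_adds = b_lact_add_left b_lact_add_right b_ract_add_left b_ract_add_right

abbreviation bbal where "bbal X Y Z \<phi> \<equiv> balanced (carrier A) X (ract X) Y (lact Y) Z \<phi>"
abbreviation tn (infixl "\<otimes>\<^sub>B" 70) where "X \<otimes>\<^sub>B Y \<equiv> btensor A X Y"
abbreviation lift where "lift X Y Z \<phi> \<equiv> blift A X Y Z \<phi>"

lemma bbalI:
  assumes "\<And>x y. \<lbrakk>x \<in> carrier X; y \<in> carrier Y\<rbrakk> \<Longrightarrow> \<phi> x y \<in> carrier Z"
    and "\<And>x x' y. \<lbrakk>x \<in> carrier X; x' \<in> carrier X; y \<in> carrier Y\<rbrakk>
        \<Longrightarrow> \<phi> (x \<oplus>\<^bsub>X\<^esub> x') y = \<phi> x y \<oplus>\<^bsub>Z\<^esub> \<phi> x' y"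
    and "\<And>x y y'. \<lbrakk>x \<in> carrier X; y \<in> carrier Y; y' \<in> carrier Y\<rbrakk>
        \<Longrightarrow> \<phi> x (y \<oplus>\<^bsub>Y\<^esub> y') = \<phi> x y \<oplus>\<^bsub>Z\<^esub> \<phi> x y'"
    and "\<And>x r y. \<lbrakk>x \<in> carrier X; r \<in> carrier A; y \<in> carrier Y\<rbrakk>
        \<Longrightarrow> \<phi> (ract X x r) y = \<phi> x (lact Y r y)"
  shows "bbal X Y Z \<phi>"
  using assms by (simp add: balanced_def)

lemma btensor_simps:
  "carrier (X \<otimes>\<^sub>B Y) = carrier (tensor_group (carrier A) X (ract X) Y (lact Y))"
  "ring.add (X \<otimes>\<^sub>B Y) = ring.add (tensor_group (carrier A) X (ract X) Y (lact Y))"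
  "ring.zero (X \<otimes>\<^sub>B Y) = ring.zero (tensor_group (carrier A) X (ract X) Y (lact Y))"
  "mult (X \<otimes>\<^sub>B Y) = mult (tensor_group (carrier A) X (ract X) Y (lact Y))"
  "one (X \<otimes>\<^sub>B Y) = one (tensor_group (carrier A) X (ract X) Y (lact Y))"
  by (simp_all add: btensor_def Let_def)

lemma addhom_btensor:
  "addhom (X \<otimes>\<^sub>B Y) Z = addhom (tensor_group (carrier A) X (ract X) Y (lact Y)) Z"
  by (rule addhom_cong) (simp_all add: btensor_simps)

context
  fixes X Y assumes XB: "X \<in> B" and YB: "Y \<in> B"
begin

interpretation tensor_factors "carrier A" X "ract X" Y "lact Y"
  using XB YB by (simp add: tensor_factors_def)

lemma btensor_abelian [simp]: "abelian_group (X \<otimes>\<^sub>B Y)"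
  using T_abelian abelian_group_cong[of "X \<otimes>\<^sub>B Y" T] by (simp add: btensor_simps)

lemma btens_closed [simp]:
  "\<lbrakk>x \<in> carrier X; y \<in> carrier Y\<rbrakk> \<Longrightarrow> btens A X Y x y \<in> carrier (X \<otimes>\<^sub>B Y)"
  by (simp add: btens_def btensor_simps pure_closed)

lemma btens_add_left:
  "\<lbrakk>x \<in> carrier X; x' \<in> carrier X; y \<in> carrier Y\<rbrakk> \<Longrightarrow>
    btens A X Y (x \<oplus>\<^bsub>X\<^esub> x') y = btens A X Y x y \<oplus>\<^bsub>X \<otimes>\<^sub>B Y\<^esub> btens A X Y x' y"
  by (simp add: btens_def btensor_simps pure_add_left)

lemma btens_add_right:
  "\<lbrakk>x \<in> carrier X; y \<in> carrier Y; y' \<in> carrier Y\<rbrakk> \<Longrightarrow>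
    btens A X Y x (y \<oplus>\<^bsub>Y\<^esub> y') = btens A X Y x y \<oplus>\<^bsub>X \<otimes>\<^sub>B Y\<^esub> btens A X Y x y'"
  by (simp add: btens_def btensor_simps pure_add_right)

lemma btens_balanced:
  "\<lbrakk>x \<in> carrier X; r \<in> carrier A; y \<in> carrier Y\<rbrakk> \<Longrightarrow>
    btens A X Y (ract X x r) y = btens A X Y x (lact Y r y)"
  by (simp add: btens_def pure_balanced)

lemma btensor_induct [consumes 1, case_names tens add]:
  assumes "t \<in> carrier (X \<otimes>\<^sub>B Y)"
    and "\<And>x y. \<lbrakk>x \<in> carrier X; y \<in> carrier Y\<rbrakk> \<Longrightarrow> P (btens A X Y x y)"
    and "\<And>s t. \<lbrakk>s \<in> carrier (X \<otimes>\<^sub>B Y); t \<in> carrier (X \<otimes>\<^sub>B Y); P s; P t\<rbrakk> \<Longrightarrow> P (s \<oplus>\<^bsub>X \<otimes>\<^sub>B Y\<^esub> t)"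
  shows "P t"
  using tensor_induct[of t P] assms by (simp add: btensor_simps btens_def)

lemma btensor_addhom_eqI:
  assumes "t \<in> carrier (X \<otimes>\<^sub>B Y)"
    and "f \<in> addhom (X \<otimes>\<^sub>B Y) Z" "g \<in> addhom (X \<otimes>\<^sub>B Y) Z"
    and "\<And>x y. \<lbrakk>x \<in> carrier X; y \<in> carrier Y\<rbrakk> \<Longrightarrow> f (btens A X Y x y) = g (btens A X Y x y)"
  shows "f t = g t"
  by (rule addhom_eqI[OF assms(2,3)[unfolded addhom_btensor] _ assms(1)[unfolded btensor_simps]])
    (simp add: assms(4) btens_def[symmetric])

lemma blift_cong:
  assumes "\<And>x y. \<lbrakk>x \<in> carrier X; y \<in> carrier Y\<rbrakk> \<Longrightarrow> \<phi> x y = \<psi> x y"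
  shows "lift X Y Z \<phi> = lift X Y Z \<psi>"
  unfolding blift_def by (rule lift_cong) (rule assms)

context
  fixes Z :: "('u, 'p) ring_scheme" and \<phi>
  assumes Z: "abelian_group Z" and bal: "bbal X Y Z \<phi>"
begin

lemma blift_extensional: "lift X Y Z \<phi> \<in> extensional (carrier (X \<otimes>\<^sub>B Y))"
  using lift_extensional[OF Z bal] by (simp add: blift_def btensor_simps)

lemma blift_addhom: "lift X Y Z \<phi> \<in> addhom (X \<otimes>\<^sub>B Y) Z"
  using lift_addhom[OF Z bal] by (simp add: blift_def addhom_btensor)

lemma blift_btens [simp]:
  "\<lbrakk>x \<in> carrier X; y \<in> carrier Y\<rbrakk> \<Longrightarrow> lift X Y Z \<phi> (btens A X Y x y) = \<phi> x y"
  using lift_pure[OF Z bal] by (simp add: blift_def btens_def)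

lemma blift_closed [simp]: "t \<in> carrier (X \<otimes>\<^sub>B Y) \<Longrightarrow> lift X Y Z \<phi> t \<in> carrier Z"
  using lift_closed[OF Z bal] by (simp add: blift_def btensor_simps)

lemma blift_add:
  "\<lbrakk>s \<in> carrier (X \<otimes>\<^sub>B Y); t \<in> carrier (X \<otimes>\<^sub>B Y)\<rbrakk> \<Longrightarrow>
    lift X Y Z \<phi> (s \<oplus>\<^bsub>X \<otimes>\<^sub>B Y\<^esub> t) = lift X Y Z \<phi> s \<oplus>\<^bsub>Z\<^esub> lift X Y Z \<phi> t"
  using lift_add[OF Z bal] by (simp add: blift_def btensor_simps)

lemma blift_comp:
  assumes "abelian_group W" "h \<in> addhom Z W" "t \<in> carrier (X \<otimes>\<^sub>B Y)"
  shows "h (lift X Y Z \<phi> t) = lift X Y W (\<lambda>x y. h (\<phi> x y)) t"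
  using lift_comp[OF Z assms(1,2) bal] assms(3) by (simp add: blift_def btensor_simps)

lemma blift_plus:
  assumes "bbal X Y Z \<psi>" "t \<in> carrier (X \<otimes>\<^sub>B Y)"
  shows "lift X Y Z (\<lambda>x y. \<phi> x y \<oplus>\<^bsub>Z\<^esub> \<psi> x y) t = lift X Y Z \<phi> t \<oplus>\<^bsub>Z\<^esub> lift X Y Z \<psi> t"
  using lift_plus[OF Z bal assms(1)] assms(2) by (simp add: blift_def btensor_simps)

end

lemma btens_lact_bbal: "a \<in> carrier A \<Longrightarrow> bbal X Y (X \<otimes>\<^sub>B Y) (\<lambda>x y. btens A X Y (lact X a x) y)"
  using XB YB by (intro bbalI)
    (simp_all add: b_adds btens_add_left btens_add_right b_lact_ract[symmetric] btens_balanced)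

lemma btens_ract_bbal: "a \<in> carrier A \<Longrightarrow> bbal X Y (X \<otimes>\<^sub>B Y) (\<lambda>x y. btens A X Y x (ract Y y a))"
  using XB YB by (intro bbalI)
    (simp_all add: b_adds btens_add_left btens_add_right b_lact_ract btens_balanced)

lemma blift_T: "lift X Y T = lift X Y (X \<otimes>\<^sub>B Y)"
  unfolding blift_def by (intro ext tensor_lift_target_cong) (simp_all add: btensor_simps)

lemma btensor_acts:
  "lact (X \<otimes>\<^sub>B Y) = (\<lambda>a\<in>carrier A. \<lambda>t\<in>carrier T. lift X Y T (\<lambda>x y. btens A X Y (lact X a x) y) t)"
  "ract (X \<otimes>\<^sub>B Y) = (\<lambda>t\<in>carrier T. \<lambda>a\<in>carrier A. lift X Y T (\<lambda>x y. btens A X Y x (ract Y y a)) t)"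
  by (simp_all add: btensor_def Let_def)

lemma btensor_lact:
  "\<lbrakk>a \<in> carrier A; t \<in> carrier (X \<otimes>\<^sub>B Y)\<rbrakk> \<Longrightarrow>
    lact (X \<otimes>\<^sub>B Y) a t = lift X Y (X \<otimes>\<^sub>B Y) (\<lambda>x y. btens A X Y (lact X a x) y) t"
  using btensor_acts by (simp add: btensor_simps(1) blift_T)

lemma btensor_ract:
  "\<lbrakk>a \<in> carrier A; t \<in> carrier (X \<otimes>\<^sub>B Y)\<rbrakk> \<Longrightarrow>
    ract (X \<otimes>\<^sub>B Y) t a = lift X Y (X \<otimes>\<^sub>B Y) (\<lambda>x y. btens A X Y x (ract Y y a)) t"
  using btensor_acts by (simp add: btensor_simps(1) blift_T)

lemma btensor_act_PiE:
  "ract (X \<otimes>\<^sub>B Y) \<in> extensional (carrier (X \<otimes>\<^sub>B Y))"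
  "t \<in> carrier (X \<otimes>\<^sub>B Y) \<Longrightarrow> ract (X \<otimes>\<^sub>B Y) t \<in> extensional (carrier A)"
  "lact (X \<otimes>\<^sub>B Y) \<in> extensional (carrier A)"
  "a \<in> carrier A \<Longrightarrow> lact (X \<otimes>\<^sub>B Y) a \<in> extensional (carrier (X \<otimes>\<^sub>B Y))"
  by (simp_all add: btensor_def Let_def)

lemma lact_btens:
  "\<lbrakk>a \<in> carrier A; x \<in> carrier X; y \<in> carrier Y\<rbrakk> \<Longrightarrow>
    lact (X \<otimes>\<^sub>B Y) a (btens A X Y x y) = btens A X Y (lact X a x) y"
  by (simp add: btensor_lact btens_lact_bbal)

lemma ract_btens:
  "\<lbrakk>a \<in> carrier A; x \<in> carrier X; y \<in> carrier Y\<rbrakk> \<Longrightarrow>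
    ract (X \<otimes>\<^sub>B Y) (btens A X Y x y) a = btens A X Y x (ract Y y a)"
  by (simp add: btensor_ract btens_ract_bbal)

lemma lact_btensor_closed:
  "\<lbrakk>a \<in> carrier A; t \<in> carrier (X \<otimes>\<^sub>B Y)\<rbrakk> \<Longrightarrow> lact (X \<otimes>\<^sub>B Y) a t \<in> carrier (X \<otimes>\<^sub>B Y)"
  by (simp add: btensor_lact btens_lact_bbal)

lemma ract_btensor_closed:
  "\<lbrakk>a \<in> carrier A; t \<in> carrier (X \<otimes>\<^sub>B Y)\<rbrakk> \<Longrightarrow> ract (X \<otimes>\<^sub>B Y) t a \<in> carrier (X \<otimes>\<^sub>B Y)"
  by (simp add: btensor_ract btens_ract_bbal)

lemma lact_btensor_add:
  "\<lbrakk>a \<in> carrier A; s \<in> carrier (X \<otimes>\<^sub>B Y); t \<in> carrier (X \<otimes>\<^sub>B Y)\<rbrakk> \<Longrightarrow>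
    lact (X \<otimes>\<^sub>B Y) a (s \<oplus>\<^bsub>X \<otimes>\<^sub>B Y\<^esub> t) = lact (X \<otimes>\<^sub>B Y) a s \<oplus>\<^bsub>X \<otimes>\<^sub>B Y\<^esub> lact (X \<otimes>\<^sub>B Y) a t"
  using abelian_group.axioms(1)[OF btensor_abelian]
  by (simp add: btensor_lact btens_lact_bbal blift_add abelian_monoid.a_closed)

lemma ract_btensor_add:
  "\<lbrakk>a \<in> carrier A; s \<in> carrier (X \<otimes>\<^sub>B Y); t \<in> carrier (X \<otimes>\<^sub>B Y)\<rbrakk> \<Longrightarrow>
    ract (X \<otimes>\<^sub>B Y) (s \<oplus>\<^bsub>X \<otimes>\<^sub>B Y\<^esub> t) a = ract (X \<otimes>\<^sub>B Y) s a \<oplus>\<^bsub>X \<otimes>\<^sub>B Y\<^esub> ract (X \<otimes>\<^sub>B Y) t a"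
  using abelian_group.axioms(1)[OF btensor_abelian]
  by (simp add: btensor_ract btens_ract_bbal blift_add abelian_monoid.a_closed)

text \<open>Both actions are lifts and hence additive, so the laws reduce to pure tensors; the coded
  tensor group and the restricted actions supply the normal form.\<close>

lemma btensor_bimodule [simp]: "X \<otimes>\<^sub>B Y \<in> B"
proof -
  note cl = lact_btensor_closed ract_btensor_closed lact_btensor_add ract_btensor_add
  note bt = lact_btens ract_btens
  note add4 = abelian_monoid.add_add_comm[OF abelian_group.axioms(1)[OF btensor_abelian]]
  have "right_module_axioms A (X \<otimes>\<^sub>B Y)"
  proof (rule right_module_axioms.intro, goal_cases)
    case (3 t a b)
    from 3(1) show ?case
      by (induction rule: btensor_induct) (use 3 XB YB in \<open>simp_all add: bt b_adds btens_add_right cl add4\<close>)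
  next
    case (4 t a b)
    from 4(1) show ?case
      by (induction rule: btensor_induct) (use 4 XB YB in \<open>simp_all add: bt b_ract_mult cl\<close>)
  next
    case (5 t)
    then show ?case
      by (induction rule: btensor_induct) (use XB YB in \<open>simp_all add: bt b_ract_one cl\<close>)
  qed (simp_all add: cl)
  then have rm: "right_module A (X \<otimes>\<^sub>B Y)"
    by (simp add: right_module_def ring_axioms)
  have "bimodule_axioms k A (X \<otimes>\<^sub>B Y)"
  proof (rule bimodule_axioms.intro, goal_cases)
    case (3 a b t)
    from 3(3) show ?case
      by (induction rule: btensor_induct) (use 3 XB YB in \<open>simp_all add: bt b_adds btens_add_left cl add4\<close>)
  next
    case (4 a b t)
    from 4(3) show ?case
      by (induction rule: btensor_induct) (use 4 XB YB in \<open>simp_all add: bt b_lact_mult cl\<close>)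
  next
    case (5 t)
    then show ?case
      by (induction rule: btensor_induct) (use XB YB in \<open>simp_all add: bt b_lact_one cl\<close>)
  next
    case (6 a t b)
    from 6(2) show ?case
      by (induction rule: btensor_induct) (use 6 XB YB in \<open>simp_all add: bt cl\<close>)
  next
    \<comment> \<open>The scalar travels from the far left to the far right: centrality in X,
      balancing over A, then centrality in Y.\<close>
    case (7 c t)
    from 7(2) show ?case
      by (induction rule: btensor_induct)
        (use 7 XB YB in \<open>simp_all add: bt cl b_central btens_balanced\<close>)
  qed (simp_all add: cl)
  then have "bimodule k A (X \<otimes>\<^sub>B Y)"
    using rm assoc_algebra_axioms by (simp add: bimodule_def)
  moreover have "ract (X \<otimes>\<^sub>B Y) \<in> carrier (X \<otimes>\<^sub>B Y) \<rightarrow>\<^sub>E carrier A \<rightarrow>\<^sub>E carrier (X \<otimes>\<^sub>B Y)"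
    by (intro PiE_I) (use btensor_act_PiE cl in \<open>auto simp: extensional_def\<close>)
  moreover have "lact (X \<otimes>\<^sub>B Y) \<in> carrier A \<rightarrow>\<^sub>E carrier (X \<otimes>\<^sub>B Y) \<rightarrow>\<^sub>E carrier (X \<otimes>\<^sub>B Y)"
    by (intro PiE_I) (use btensor_act_PiE cl in \<open>auto simp: extensional_def\<close>)
  ultimately show ?thesis
    using T_normal by (simp add: bimodules_def normal_rmod_def btensor_simps)
qed

lemma blift_lact:
  assumes Z: "abelian_group Z" and bal: "bbal X Y Z \<phi>" and r: "r \<in> carrier A"
    and t: "t \<in> carrier (X \<otimes>\<^sub>B Y)"
  shows "lift X Y Z \<phi> (lact (X \<otimes>\<^sub>B Y) r t) = lift X Y Z (\<lambda>x y. \<phi> (lact X r x) y) t"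
proof -
  have "lift X Y Z \<phi> (lact (X \<otimes>\<^sub>B Y) r t) = lift X Y Z (\<lambda>x y. lift X Y Z \<phi> (btens A X Y (lact X r x) y)) t"
    unfolding btensor_lact[OF r t]
    by (rule blift_comp[OF btensor_abelian btens_lact_bbal[OF r] Z blift_addhom[OF Z bal] t])
  also have "\<dots> = lift X Y Z (\<lambda>x y. \<phi> (lact X r x) y) t"
    by (rule fun_cong[OF blift_cong]) (use XB r Z bal in simp)
  finally show ?thesis .
qed

lemma blift_ract:
  assumes Z: "abelian_group Z" and bal: "bbal X Y Z \<phi>" and r: "r \<in> carrier A"
    and t: "t \<in> carrier (X \<otimes>\<^sub>B Y)"
  shows "lift X Y Z \<phi> (ract (X \<otimes>\<^sub>B Y) t r) = lift X Y Z (\<lambda>x y. \<phi> x (ract Y y r)) t"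
proof -
  have "lift X Y Z \<phi> (ract (X \<otimes>\<^sub>B Y) t r) = lift X Y Z (\<lambda>x y. lift X Y Z \<phi> (btens A X Y x (ract Y y r))) t"
    unfolding btensor_ract[OF r t]
    by (rule blift_comp[OF btensor_abelian btens_ract_bbal[OF r] Z blift_addhom[OF Z bal] t])
  also have "\<dots> = lift X Y Z (\<lambda>x y. \<phi> x (ract Y y r)) t"
    by (rule fun_cong[OF blift_cong]) (use YB r Z bal in simp)
  finally show ?thesis .
qed

end

lemma bimod_homD:
  assumes "f \<in> bimod_hom A X Y"
  shows "f \<in> addhom X Y" "f \<in> extensional (carrier X)"
    "x \<in> carrier X \<Longrightarrow> f x \<in> carrier Y"
    "\<lbrakk>x \<in> carrier X; x' \<in> carrier X\<rbrakk> \<Longrightarrow> f (x \<oplus>\<^bsub>X\<^esub> x') = f x \<oplus>\<^bsub>Y\<^esub> f x'"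
    "\<lbrakk>x \<in> carrier X; a \<in> carrier A\<rbrakk> \<Longrightarrow> f (ract X x a) = ract Y (f x) a"
    "\<lbrakk>a \<in> carrier A; x \<in> carrier X\<rbrakk> \<Longrightarrow> f (lact X a x) = lact Y a (f x)"
  using assms rmod_homD[of f A X Y] by (auto simp: bimod_hom_def)

lemma bimod_homI:
  assumes "f \<in> extensional (carrier X)" "f \<in> addhom X Y"
    and "\<And>x a. \<lbrakk>x \<in> carrier X; a \<in> carrier A\<rbrakk> \<Longrightarrow> f (ract X x a) = ract Y (f x) a"
    and "\<And>x a. \<lbrakk>x \<in> carrier X; a \<in> carrier A\<rbrakk> \<Longrightarrow> f (lact X a x) = lact Y a (f x)"
  shows "f \<in> bimod_hom A X Y"
  using assms by (auto simp: bimod_hom_def rmod_hom_def)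

lemma ract_addhom: "\<lbrakk>X \<in> B; a \<in> carrier A\<rbrakk> \<Longrightarrow> (\<lambda>x. ract X x a) \<in> addhom X X"
  by (rule addhomI) (simp_all add: b_adds)

lemma lact_addhom: "\<lbrakk>X \<in> B; a \<in> carrier A\<rbrakk> \<Longrightarrow> lact X a \<in> addhom X X"
  by (rule addhomI) (simp_all add: b_adds)

lemma blift_bimod_hom:
  assumes X: "X \<in> B" and Y: "Y \<in> B" and Z: "Z \<in> B" and bal: "bbal X Y Z \<phi>"
    and l: "\<And>a x y. \<lbrakk>a \<in> carrier A; x \<in> carrier X; y \<in> carrier Y\<rbrakk> \<Longrightarrow> \<phi> (lact X a x) y = lact Z a (\<phi> x y)"
    and r: "\<And>a x y. \<lbrakk>a \<in> carrier A; x \<in> carrier X; y \<in> carrier Y\<rbrakk> \<Longrightarrow> \<phi> x (ract Y y a) = ract Z (\<phi> x y) a"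
  shows "lift X Y Z \<phi> \<in> bimod_hom A (X \<otimes>\<^sub>B Y) Z"
proof (rule bimod_homI)
  have ab: "abelian_group Z" using Z by simp
  fix t a assume t: "t \<in> carrier (X \<otimes>\<^sub>B Y)" and a: "a \<in> carrier A"
  have "lift X Y Z \<phi> (ract (X \<otimes>\<^sub>B Y) t a) = lift X Y Z (\<lambda>x y. ract Z (\<phi> x y) a) t"
    unfolding blift_ract[OF X Y ab bal a t] by (rule fun_cong[OF blift_cong[OF X Y]]) (simp add: r a)
  then show "lift X Y Z \<phi> (ract (X \<otimes>\<^sub>B Y) t a) = ract Z (lift X Y Z \<phi> t) a"
    using blift_comp[OF X Y ab bal ab ract_addhom[OF Z a] t] by simp
  have "lift X Y Z \<phi> (lact (X \<otimes>\<^sub>B Y) a t) = lift X Y Z (\<lambda>x y. lact Z a (\<phi> x y)) t"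
    unfolding blift_lact[OF X Y ab bal a t] by (rule fun_cong[OF blift_cong[OF X Y]]) (simp add: l a)
  then show "lift X Y Z \<phi> (lact (X \<otimes>\<^sub>B Y) a t) = lact Z a (lift X Y Z \<phi> t)"
    using blift_comp[OF X Y ab bal ab lact_addhom[OF Z a] t] by simp
qed (use assms in \<open>simp_all add: blift_extensional blift_addhom\<close>)

lemma btensor_bimod_hom_eqI:
  assumes X: "X \<in> B" and Y: "Y \<in> B"
    and f: "f \<in> bimod_hom A (X \<otimes>\<^sub>B Y) Z" and g: "g \<in> bimod_hom A (X \<otimes>\<^sub>B Y) Z"
    and eq: "\<And>x y. \<lbrakk>x \<in> carrier X; y \<in> carrier Y\<rbrakk> \<Longrightarrow> f (btens A X Y x y) = g (btens A X Y x y)"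
  shows "f = g"
proof (rule extensionalityI[OF bimod_homD(2)[OF f] bimod_homD(2)[OF g]])
  show "f t = g t" if "t \<in> carrier (X \<otimes>\<^sub>B Y)" for t
    by (rule btensor_addhom_eqI[OF X Y that bimod_homD(1)[OF f] bimod_homD(1)[OF g] eq])
qed

text \<open>A acts on X \<otimes> Y from the left through X alone, so balance between W and X
  \<otimes> Y reduces to balance between W and X.\<close>

lemma bbal_nest_right:
  fixes Z :: "('u, 'p) ring_scheme"
  assumes W: "W \<in> B" and X: "X \<in> B" and Y: "Y \<in> B" and Z: "abelian_group Z"
    and bal: "\<And>w. w \<in> carrier W \<Longrightarrow> bbal X Y Z (\<phi> w)"
    and add: "\<And>w w' x y. \<lbrakk>w \<in> carrier W; w' \<in> carrier W; x \<in> carrier X; y \<in> carrier Y\<rbrakk>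
        \<Longrightarrow> \<phi> (w \<oplus>\<^bsub>W\<^esub> w') x y = \<phi> w x y \<oplus>\<^bsub>Z\<^esub> \<phi> w' x y"
    and act: "\<And>r w x y. \<lbrakk>r \<in> carrier A; w \<in> carrier W; x \<in> carrier X; y \<in> carrier Y\<rbrakk>
        \<Longrightarrow> \<phi> (ract W w r) x y = \<phi> w (lact X r x) y"
  shows "bbal W (X \<otimes>\<^sub>B Y) Z (\<lambda>w t. lift X Y Z (\<phi> w) t)"
proof (rule bbalI)
  fix w w' t assume w: "w \<in> carrier W" "w' \<in> carrier W" and t: "t \<in> carrier (X \<otimes>\<^sub>B Y)"
  have "lift X Y Z (\<phi> (w \<oplus>\<^bsub>W\<^esub> w')) t = lift X Y Z (\<lambda>x y. \<phi> w x y \<oplus>\<^bsub>Z\<^esub> \<phi> w' x y) t"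
    by (rule fun_cong[OF blift_cong[OF X Y]]) (use w add in auto)
  then show "lift X Y Z (\<phi> (w \<oplus>\<^bsub>W\<^esub> w')) t = lift X Y Z (\<phi> w) t \<oplus>\<^bsub>Z\<^esub> lift X Y Z (\<phi> w') t"
    using blift_plus[OF X Y Z bal bal t] w by simp
next
  fix w r t assume w: "w \<in> carrier W" and r: "r \<in> carrier A" and t: "t \<in> carrier (X \<otimes>\<^sub>B Y)"
  have "lift X Y Z (\<phi> (ract W w r)) t = lift X Y Z (\<lambda>x y. \<phi> w (lact X r x) y) t"
    by (rule fun_cong[OF blift_cong[OF X Y]]) (use w r act in auto)
  then show "lift X Y Z (\<phi> (ract W w r)) t = lift X Y Z (\<phi> w) (lact (X \<otimes>\<^sub>B Y) r t)"
    using blift_lact[OF X Y Z bal r t] w by simp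
qed (use X Y Z bal in \<open>simp_all add: blift_add\<close>)

text \<open>The mirror image: A acts on X \<otimes> Y from the right through Y alone.\<close>

lemma bbal_nest_left:
  fixes Z :: "('u, 'p) ring_scheme"
  assumes W: "W \<in> B" and X: "X \<in> B" and Y: "Y \<in> B" and Z: "abelian_group Z"
    and bal: "\<And>w. w \<in> carrier W \<Longrightarrow> bbal X Y Z (\<lambda>x y. \<phi> x y w)"
    and add: "\<And>w w' x y. \<lbrakk>w \<in> carrier W; w' \<in> carrier W; x \<in> carrier X; y \<in> carrier Y\<rbrakk>
        \<Longrightarrow> \<phi> x y (w \<oplus>\<^bsub>W\<^esub> w') = \<phi> x y w \<oplus>\<^bsub>Z\<^esub> \<phi> x y w'"
    and act: "\<And>r w x y. \<lbrakk>r \<in> carrier A; w \<in> carrier W; x \<in> carrier X; y \<in> carrier Y\<rbrakk>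
        \<Longrightarrow> \<phi> x (ract Y y r) w = \<phi> x y (lact W r w)"
  shows "bbal (X \<otimes>\<^sub>B Y) W Z (\<lambda>t w. lift X Y Z (\<lambda>x y. \<phi> x y w) t)"
proof (rule bbalI)
  fix w w' t assume w: "w \<in> carrier W" "w' \<in> carrier W" and t: "t \<in> carrier (X \<otimes>\<^sub>B Y)"
  have "lift X Y Z (\<lambda>x y. \<phi> x y (w \<oplus>\<^bsub>W\<^esub> w')) t = lift X Y Z (\<lambda>x y. \<phi> x y w \<oplus>\<^bsub>Z\<^esub> \<phi> x y w') t"
    by (rule fun_cong[OF blift_cong[OF X Y]]) (use w add in auto)
  then show "lift X Y Z (\<lambda>x y. \<phi> x y (w \<oplus>\<^bsub>W\<^esub> w')) t =
      lift X Y Z (\<lambda>x y. \<phi> x y w) t \<oplus>\<^bsub>Z\<^esub> lift X Y Z (\<lambda>x y. \<phi> x y w') t"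
    using blift_plus[OF X Y Z bal bal t] w by simp
next
  fix w r t assume w: "w \<in> carrier W" and r: "r \<in> carrier A" and t: "t \<in> carrier (X \<otimes>\<^sub>B Y)"
  have "lift X Y Z (\<lambda>x y. \<phi> x (ract Y y r) w) t = lift X Y Z (\<lambda>x y. \<phi> x y (lact W r w)) t"
    by (rule fun_cong[OF blift_cong[OF X Y]]) (use w r act in auto)
  then show "lift X Y Z (\<lambda>x y. \<phi> x y w) (ract (X \<otimes>\<^sub>B Y) t r) = lift X Y Z (\<lambda>x y. \<phi> x y (lact W r w)) t"
    using blift_ract[OF X Y Z bal r t] w by simp
qed (use X Y Z bal in \<open>simp_all add: blift_add\<close>)

section \<open>Structure maps of the monoidal category and their explicit inverses\<close>

lemma moncat_simps [simp]:
  "Obj (bimod_moncat k A) = B" "Hom (bimod_moncat k A) = bimod_hom A"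
  "Cmp (bimod_moncat k A) X Y Z g f = compose (carrier X) g f"
  "Idn (bimod_moncat k A) X = (\<lambda>x\<in>carrier X. x)"
  "tensO (bimod_moncat k A) = btensor A" "unitO (bimod_moncat k A) = regular_bimod A"
  by (simp_all add: bimod_moncat_def concrete_cat_def cat.defs moncat.defs)

abbreviation tm where "tm \<equiv> tensM (bimod_moncat k A)"
abbreviation asc where "asc \<equiv> assoc (bimod_moncat k A)"
abbreviation R where "R \<equiv> regular_bimod A"

lemma tm_def: "tm X X' Y Y' f g = lift X Y (X' \<otimes>\<^sub>B Y') (\<lambda>x y. btens A X' Y' (f x) (g y))"
  by (simp add: bimod_moncat_def concrete_cat_def cat.defs moncat.defs)

lemma asc_def:
  "asc X Y Z = lift (X \<otimes>\<^sub>B Y) Z (X \<otimes>\<^sub>B (Y \<otimes>\<^sub>B Z))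
     (\<lambda>t z. lift X Y (X \<otimes>\<^sub>B (Y \<otimes>\<^sub>B Z)) (\<lambda>x y. btens A X (Y \<otimes>\<^sub>B Z) x (btens A Y Z y z)) t)"
  by (simp add: bimod_moncat_def concrete_cat_def cat.defs moncat.defs)

lemma lunit_def: "lunit (bimod_moncat k A) X = lift R X X (\<lambda>a x. lact X a x)"
  by (simp add: bimod_moncat_def concrete_cat_def cat.defs moncat.defs)

lemma runit_def: "runit (bimod_moncat k A) X = lift X R X (\<lambda>x a. ract X x a)"
  by (simp add: bimod_moncat_def concrete_cat_def cat.defs moncat.defs)

lemma moncat_category: "category (bimod_moncat k A)"
proof -
  have "category (concrete_cat B (bimod_hom A) carrier)"
  proof (rule concrete_category)
    show "f \<in> carrier X \<rightarrow>\<^sub>E carrier Y" if "f \<in> bimod_hom A X Y" for X Y f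
      using bimod_homD[OF that] by (simp add: PiE_def)
    show "(\<lambda>x\<in>carrier X. x) \<in> bimod_hom A X X" if "X \<in> B" for X
      by (rule bimod_homI) (use that in \<open>auto intro: addhomI\<close>)
    show "compose (carrier X) g f \<in> bimod_hom A X Z"
      if "X \<in> B" "f \<in> bimod_hom A X Y" "g \<in> bimod_hom A Y Z" for X Y Z f g
      by (rule bimod_homI)
        (use that bimod_homD[OF that(2)] bimod_homD[OF that(3)] in \<open>auto intro: addhomI simp: compose_def\<close>)
  qed
  then show ?thesis
    by (simp add: category_def)
qed

sublocale M: category "bimod_moncat k A" by (rule moncat_category)

lemma id_hom: "X \<in> B \<Longrightarrow> (\<lambda>x\<in>carrier X. x) \<in> bimod_hom A X X"
  using M.Idn_in_Hom[of X] by simp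

lemma comp_hom:
  "\<lbrakk>X \<in> B; Y \<in> B; Z \<in> B; f \<in> bimod_hom A X Y; g \<in> bimod_hom A Y Z\<rbrakk> \<Longrightarrow> compose (carrier X) g f \<in> bimod_hom A X Z"
  using M.Cmp_in_Hom[of X Y Z f g] by simp

lemma regular_bimod_simps [simp]:
  "carrier R = carrier A"
  "\<lbrakk>a \<in> carrier A; b \<in> carrier A\<rbrakk> \<Longrightarrow> ring.add R a b = a \<oplus>\<^bsub>A\<^esub> b"
  "\<lbrakk>a \<in> carrier A; b \<in> carrier A\<rbrakk> \<Longrightarrow> lact R a b = a \<otimes>\<^bsub>A\<^esub> b"
  "\<lbrakk>a \<in> carrier A; b \<in> carrier A\<rbrakk> \<Longrightarrow> ract R a b = a \<otimes>\<^bsub>A\<^esub> b"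
  by (simp_all add: regular_bimod_def)

lemma regular_bimodule [simp]: "R \<in> B"
proof -
  have "abelian_group R"
    by (rule abelian_groupI) (auto simp: regular_bimod_def a_ac intro: l_neg)
  then have "bimodule k A R"
    by (auto simp: bimodule_def right_module_def assoc_algebra_axioms ring_axioms
        intro!: right_module_axioms.intro bimodule_axioms.intro)
      (auto simp: l_distr r_distr m_assoc smult_mult_left smult_mult_right)
  then show ?thesis
    by (auto simp: bimodules_def normal_rmod_def regular_bimod_def)
qed

lemma hom_bbal:
  assumes "X \<in> B" "Y \<in> B" "X' \<in> B" "Y' \<in> B" "f \<in> bimod_hom A X X'" "g \<in> bimod_hom A Y Y'"
  shows "bbal X Y (X' \<otimes>\<^sub>B Y') (\<lambda>x y. btens A X' Y' (f x) (g y))"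
  by (rule bbalI)
    (use assms bimod_homD[OF assms(5)] bimod_homD[OF assms(6)] in
      \<open>simp_all add: btens_add_left btens_add_right btens_balanced\<close>)

lemma tm_btens:
  assumes "X \<in> B" "Y \<in> B" "X' \<in> B" "Y' \<in> B" "f \<in> bimod_hom A X X'" "g \<in> bimod_hom A Y Y'"
    "x \<in> carrier X" "y \<in> carrier Y"
  shows "tm X X' Y Y' f g (btens A X Y x y) = btens A X' Y' (f x) (g y)"
  using assms hom_bbal[OF assms(1-6)] by (simp add: tm_def)

lemma tm_hom:
  assumes "X \<in> B" "Y \<in> B" "X' \<in> B" "Y' \<in> B" "f \<in> bimod_hom A X X'" "g \<in> bimod_hom A Y Y'"
  shows "tm X X' Y Y' f g \<in> bimod_hom A (X \<otimes>\<^sub>B Y) (X' \<otimes>\<^sub>B Y')"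
  unfolding tm_def
  by (rule blift_bimod_hom)
    (use assms hom_bbal[OF assms] bimod_homD[OF assms(5)] bimod_homD[OF assms(6)] in
      \<open>simp_all add: lact_btens ract_btens\<close>)

lemma asc_inner_bbal:
  assumes "X \<in> B" "Y \<in> B" "Z \<in> B" "z \<in> carrier Z"
  shows "bbal X Y (X \<otimes>\<^sub>B (Y \<otimes>\<^sub>B Z)) (\<lambda>x y. btens A X (Y \<otimes>\<^sub>B Z) x (btens A Y Z y z))"
  by (rule bbalI) (use assms in \<open>simp_all add: btens_add_left btens_add_right btens_balanced lact_btens\<close>)

lemma asc_bbal:
  assumes "X \<in> B" "Y \<in> B" "Z \<in> B"
  shows "bbal (X \<otimes>\<^sub>B Y) Z (X \<otimes>\<^sub>B (Y \<otimes>\<^sub>B Z))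
     (\<lambda>t z. lift X Y (X \<otimes>\<^sub>B (Y \<otimes>\<^sub>B Z)) (\<lambda>x y. btens A X (Y \<otimes>\<^sub>B Z) x (btens A Y Z y z)) t)"
  by (rule bbal_nest_left)
    (use assms asc_inner_bbal in \<open>simp_all add: btens_add_right btens_balanced\<close>)

lemma asc_btens:
  "\<lbrakk>X \<in> B; Y \<in> B; Z \<in> B; x \<in> carrier X; y \<in> carrier Y; z \<in> carrier Z\<rbrakk> \<Longrightarrow>
    asc X Y Z (btens A (X \<otimes>\<^sub>B Y) Z (btens A X Y x y) z) = btens A X (Y \<otimes>\<^sub>B Z) x (btens A Y Z y z)"
  by (simp add: asc_def asc_bbal asc_inner_bbal)

lemma asc_hom:
  assumes "X \<in> B" "Y \<in> B" "Z \<in> B"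
  shows "asc X Y Z \<in> bimod_hom A ((X \<otimes>\<^sub>B Y) \<otimes>\<^sub>B Z) (X \<otimes>\<^sub>B (Y \<otimes>\<^sub>B Z))"
  unfolding asc_def
proof (rule blift_bimod_hom)
  let ?h = "\<lambda>z. lift X Y (X \<otimes>\<^sub>B (Y \<otimes>\<^sub>B Z)) (\<lambda>x y. btens A X (Y \<otimes>\<^sub>B Z) x (btens A Y Z y z))"
  fix a t z assume a: "a \<in> carrier A" and t: "t \<in> carrier (X \<otimes>\<^sub>B Y)" and z: "z \<in> carrier Z"
  note h_hom = blift_addhom[OF assms(1,2) _ asc_inner_bbal[OF assms]]
  show "?h z (lact (X \<otimes>\<^sub>B Y) a t) = lact (X \<otimes>\<^sub>B (Y \<otimes>\<^sub>B Z)) a (?h z t)"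
    using t by (rule btensor_addhom_eqI[OF assms(1,2)])
      (use assms a z asc_inner_bbal hom_compose[OF lact_addhom h_hom[OF _ z], of a]
        hom_compose[OF h_hom[OF _ z] lact_addhom, of a] in
        \<open>simp_all add: o_def lact_btens\<close>)
  show "?h (ract Z z a) t = ract (X \<otimes>\<^sub>B (Y \<otimes>\<^sub>B Z)) (?h z t) a"
    using t by (rule btensor_addhom_eqI[OF assms(1,2)])
      (use assms a z asc_inner_bbal h_hom[of "ract Z z a"]
        hom_compose[OF h_hom[OF _ z] ract_addhom, of a] in
        \<open>simp_all add: o_def ract_btens\<close>)
qed (use assms asc_bbal in simp_all)

text \<open>The multiplicativity axiom refers to the inverse of the associativity constraint by
  description; this candidate has a known value on pure tensors.\<close>

definition asci where
  "asci X Y Z = lift X (Y \<otimes>\<^sub>B Z) ((X \<otimes>\<^sub>B Y) \<otimes>\<^sub>B Z)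
     (\<lambda>x t. lift Y Z ((X \<otimes>\<^sub>B Y) \<otimes>\<^sub>B Z) (\<lambda>y z. btens A (X \<otimes>\<^sub>B Y) Z (btens A X Y x y) z) t)"

lemma asci_inner_bbal:
  assumes "X \<in> B" "Y \<in> B" "Z \<in> B" "x \<in> carrier X"
  shows "bbal Y Z ((X \<otimes>\<^sub>B Y) \<otimes>\<^sub>B Z) (\<lambda>y z. btens A (X \<otimes>\<^sub>B Y) Z (btens A X Y x y) z)"
  by (rule bbalI) (use assms in \<open>simp_all add: btens_add_left btens_add_right btens_balanced[symmetric] ract_btens\<close>)

lemma asci_bbal:
  assumes "X \<in> B" "Y \<in> B" "Z \<in> B"
  shows "bbal X (Y \<otimes>\<^sub>B Z) ((X \<otimes>\<^sub>B Y) \<otimes>\<^sub>B Z)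
     (\<lambda>x t. lift Y Z ((X \<otimes>\<^sub>B Y) \<otimes>\<^sub>B Z) (\<lambda>y z. btens A (X \<otimes>\<^sub>B Y) Z (btens A X Y x y) z) t)"
  by (rule bbal_nest_right)
    (use assms asci_inner_bbal in \<open>simp_all add: btens_add_left btens_balanced\<close>)

lemma asci_btens:
  "\<lbrakk>X \<in> B; Y \<in> B; Z \<in> B; x \<in> carrier X; y \<in> carrier Y; z \<in> carrier Z\<rbrakk> \<Longrightarrow>
    asci X Y Z (btens A X (Y \<otimes>\<^sub>B Z) x (btens A Y Z y z)) = btens A (X \<otimes>\<^sub>B Y) Z (btens A X Y x y) z"
  by (simp add: asci_def asci_bbal asci_inner_bbal)

lemma asci_hom:
  assumes "X \<in> B" "Y \<in> B" "Z \<in> B"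
  shows "asci X Y Z \<in> bimod_hom A (X \<otimes>\<^sub>B (Y \<otimes>\<^sub>B Z)) ((X \<otimes>\<^sub>B Y) \<otimes>\<^sub>B Z)"
  unfolding asci_def
proof (rule blift_bimod_hom)
  let ?h = "\<lambda>x. lift Y Z ((X \<otimes>\<^sub>B Y) \<otimes>\<^sub>B Z) (\<lambda>y z. btens A (X \<otimes>\<^sub>B Y) Z (btens A X Y x y) z)"
  fix a x t assume a: "a \<in> carrier A" and t: "t \<in> carrier (Y \<otimes>\<^sub>B Z)" and x: "x \<in> carrier X"
  note h_hom = blift_addhom[OF assms(2,3) _ asci_inner_bbal[OF assms]]
  show "?h x (ract (Y \<otimes>\<^sub>B Z) t a) = ract ((X \<otimes>\<^sub>B Y) \<otimes>\<^sub>B Z) (?h x t) a"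
    using t by (rule btensor_addhom_eqI[OF assms(2,3)])
      (use assms a x asci_inner_bbal hom_compose[OF ract_addhom h_hom[OF _ x], of a]
        hom_compose[OF h_hom[OF _ x] ract_addhom, of a] in
        \<open>simp_all add: o_def ract_btens\<close>)
  show "?h (lact X a x) t = lact ((X \<otimes>\<^sub>B Y) \<otimes>\<^sub>B Z) a (?h x t)"
    using t by (rule btensor_addhom_eqI[OF assms(2,3)])
      (use assms a x asci_inner_bbal h_hom[of "lact X a x"]
        hom_compose[OF h_hom[OF _ x] lact_addhom, of a] in
        \<open>simp_all add: o_def lact_btens\<close>)
qed (use assms asci_bbal in simp_all)

lemma btensor3_eqI:
  assumes "X \<in> B" "Y \<in> B" "Z \<in> B"
    and f: "f \<in> bimod_hom A ((X \<otimes>\<^sub>B Y) \<otimes>\<^sub>B Z) W" and g: "g \<in> bimod_hom A ((X \<otimes>\<^sub>B Y) \<otimes>\<^sub>B Z) W"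
    and eq: "\<And>x y z. \<lbrakk>x \<in> carrier X; y \<in> carrier Y; z \<in> carrier Z\<rbrakk> \<Longrightarrow>
      f (btens A (X \<otimes>\<^sub>B Y) Z (btens A X Y x y) z) = g (btens A (X \<otimes>\<^sub>B Y) Z (btens A X Y x y) z)"
  shows "f = g"
proof (rule btensor_bimod_hom_eqI[OF _ assms(3) f g])
  fix t z assume t: "t \<in> carrier (X \<otimes>\<^sub>B Y)" and z: "z \<in> carrier Z"
  have b: "(\<lambda>t. btens A (X \<otimes>\<^sub>B Y) Z t z) \<in> addhom (X \<otimes>\<^sub>B Y) ((X \<otimes>\<^sub>B Y) \<otimes>\<^sub>B Z)"
    by (rule addhomI) (use assms z in \<open>simp_all add: btens_add_left\<close>)
  show "f (btens A (X \<otimes>\<^sub>B Y) Z t z) = g (btens A (X \<otimes>\<^sub>B Y) Z t z)"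
    using t by (rule btensor_addhom_eqI[OF assms(1,2)])
      (use hom_compose[OF b bimod_homD(1)[OF f]] hom_compose[OF b bimod_homD(1)[OF g]] eq z in
        \<open>simp_all add: o_def\<close>)
qed (use assms in simp)

lemma btensor3_eqI':
  assumes "X \<in> B" "Y \<in> B" "Z \<in> B"
    and f: "f \<in> bimod_hom A (X \<otimes>\<^sub>B (Y \<otimes>\<^sub>B Z)) W" and g: "g \<in> bimod_hom A (X \<otimes>\<^sub>B (Y \<otimes>\<^sub>B Z)) W"
    and eq: "\<And>x y z. \<lbrakk>x \<in> carrier X; y \<in> carrier Y; z \<in> carrier Z\<rbrakk> \<Longrightarrow>
      f (btens A X (Y \<otimes>\<^sub>B Z) x (btens A Y Z y z)) = g (btens A X (Y \<otimes>\<^sub>B Z) x (btens A Y Z y z))"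
  shows "f = g"
proof (rule btensor_bimod_hom_eqI[OF assms(1) _ f g])
  fix x t assume t: "t \<in> carrier (Y \<otimes>\<^sub>B Z)" and x: "x \<in> carrier X"
  have b: "btens A X (Y \<otimes>\<^sub>B Z) x \<in> addhom (Y \<otimes>\<^sub>B Z) (X \<otimes>\<^sub>B (Y \<otimes>\<^sub>B Z))"
    by (rule addhomI) (use assms x in \<open>simp_all add: btens_add_right\<close>)
  show "f (btens A X (Y \<otimes>\<^sub>B Z) x t) = g (btens A X (Y \<otimes>\<^sub>B Z) x t)"
    using t by (rule btensor_addhom_eqI[OF assms(2,3)])
      (use hom_compose[OF b bimod_homD(1)[OF f]] hom_compose[OF b bimod_homD(1)[OF g]] eq x in
        \<open>simp_all add: o_def\<close>)
qed (use assms in simp)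

lemma asc_inverse:
  assumes XYZ: "X \<in> B" "Y \<in> B" "Z \<in> B"
  shows "inverse_arrows (bimod_moncat k A) ((X \<otimes>\<^sub>B Y) \<otimes>\<^sub>B Z) (X \<otimes>\<^sub>B (Y \<otimes>\<^sub>B Z)) (asc X Y Z) (asci X Y Z)"
  unfolding inverse_arrows_def moncat_simps
proof (intro conjI asc_hom asci_hom XYZ)
  show "compose (carrier ((X \<otimes>\<^sub>B Y) \<otimes>\<^sub>B Z)) (asci X Y Z) (asc X Y Z) = (\<lambda>x\<in>carrier ((X \<otimes>\<^sub>B Y) \<otimes>\<^sub>B Z). x)"
    by (rule btensor3_eqI[OF XYZ comp_hom[OF _ _ _ asc_hom asci_hom] id_hom])
      (use XYZ in \<open>simp_all add: compose_eq asc_btens asci_btens\<close>)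
  show "compose (carrier (X \<otimes>\<^sub>B (Y \<otimes>\<^sub>B Z))) (asc X Y Z) (asci X Y Z) = (\<lambda>x\<in>carrier (X \<otimes>\<^sub>B (Y \<otimes>\<^sub>B Z)). x)"
    by (rule btensor3_eqI'[OF XYZ comp_hom[OF _ _ _ asci_hom asc_hom] id_hom])
      (use XYZ in \<open>simp_all add: compose_eq asc_btens asci_btens\<close>)
qed

lemma inv_asc:
  assumes "X \<in> B" "Y \<in> B" "Z \<in> B"
  shows "inv_arrow (bimod_moncat k A) ((X \<otimes>\<^sub>B Y) \<otimes>\<^sub>B Z) (X \<otimes>\<^sub>B (Y \<otimes>\<^sub>B Z)) (asc X Y Z) = asci X Y Z"
  by (rule M.inv_arrow_eqI[OF _ _ asc_inverse]) (use assms in simp_all)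

lemma lunit_bbal: "X \<in> B \<Longrightarrow> bbal R X X (\<lambda>a x. lact X a x)"
  by (rule bbalI) (simp_all add: b_adds b_lact_mult)

lemma runit_bbal: "X \<in> B \<Longrightarrow> bbal X R X (\<lambda>x a. ract X x a)"
  by (rule bbalI) (simp_all add: b_adds b_ract_mult)

lemma lunit_btens:
  "\<lbrakk>X \<in> B; a \<in> carrier A; x \<in> carrier X\<rbrakk> \<Longrightarrow> lunit (bimod_moncat k A) X (btens A R X a x) = lact X a x"
  by (simp add: lunit_def lunit_bbal)

lemma lunit_hom: "X \<in> B \<Longrightarrow> lunit (bimod_moncat k A) X \<in> bimod_hom A (R \<otimes>\<^sub>B X) X"
  unfolding lunit_def
  by (rule blift_bimod_hom) (simp_all add: lunit_bbal b_lact_mult b_lact_ract)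

text \<open>The inverse of the right unit constraint, to which the unit axiom of half-braidings
  refers.\<close>

definition runiti where "runiti X = (\<lambda>x\<in>carrier X. btens A X R x \<one>\<^bsub>A\<^esub>)"

lemma btens_R:
  "\<lbrakk>X \<in> B; x \<in> carrier X; a \<in> carrier A\<rbrakk> \<Longrightarrow> btens A X R x a = btens A X R (ract X x a) \<one>\<^bsub>A\<^esub>"
  by (simp add: btens_balanced)

lemma runiti_hom: "X \<in> B \<Longrightarrow> runiti X \<in> bimod_hom A X (X \<otimes>\<^sub>B R)"
  unfolding runiti_def
  by (rule bimod_homI)
    (auto intro!: addhomI simp: btens_add_left lact_btens ract_btens btens_R[symmetric])

lemma runit_inverse:
  assumes X: "X \<in> B"
  shows "inverse_arrows (bimod_moncat k A) (X \<otimes>\<^sub>B R) X (runit (bimod_moncat k A) X) (runiti X)"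
proof -
  have r: "runit (bimod_moncat k A) X \<in> bimod_hom A (X \<otimes>\<^sub>B R) X"
    unfolding runit_def by (rule blift_bimod_hom) (simp_all add: X runit_bbal b_lact_ract b_ract_mult)
  have v: "runit (bimod_moncat k A) X (btens A X R x a) = ract X x a" if "x \<in> carrier X" "a \<in> carrier A" for x a
    using that X by (simp add: runit_def runit_bbal)
  show ?thesis
    unfolding inverse_arrows_def moncat_simps
  proof (intro conjI r runiti_hom X)
    show "compose (carrier (X \<otimes>\<^sub>B R)) (runiti X) (runit (bimod_moncat k A) X) = (\<lambda>x\<in>carrier (X \<otimes>\<^sub>B R). x)"
      by (rule btensor_bimod_hom_eqI[OF _ _ comp_hom[OF _ _ _ r runiti_hom] id_hom])
        (use X in \<open>simp_all add: compose_eq v runiti_def btens_R[symmetric]\<close>)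
    show "compose (carrier X) (runit (bimod_moncat k A) X) (runiti X) = (\<lambda>x\<in>carrier X. x)"
      using X by (auto simp: compose_def fun_eq_iff restrict_def runiti_def v b_ract_one)
  qed
qed

lemma inv_runit:
  "X \<in> B \<Longrightarrow> inv_arrow (bimod_moncat k A) (X \<otimes>\<^sub>B R) X (runit (bimod_moncat k A) X) = runiti X"
  by (rule M.inv_arrow_eqI[OF _ _ runit_inverse]) simp_all

end

section \<open>Centers and Yetter-Drinfeld modules\<close>

context alg
begin

lemma A_mod [simp]: "Module.module k A" by unfold_locales

abbreviation AA where "AA \<equiv> ktensor k A A"
abbreviation tA where "tA a b \<equiv> ktens k A A a b"

lemma AA_abelian [simp]: "abelian_group AA" by (simp add: ktensor_abelian_group)

lemmas tA_simps = ktens_add_left ktens_add_right ktens_smult_left ktens_smult_right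
  l_distr r_distr smult_mult_left smult_mult_right

text \<open>\<open>A \<otimes> A\<close> with the outer actions is the free bimodule on the generator \<open>1 \<otimes> 1\<close>, so a
  half-braiding is determined by its component at this object.\<close>

definition P :: "'u bimod" where
  "P = \<lparr> carrier = carrier AA, mult = undefined, one = undefined, ring.zero = ring.zero AA,
        ring.add = ring.add AA,
        ract = (\<lambda>t\<in>carrier AA. \<lambda>c\<in>carrier A. klift k A A AA (\<lambda>a b. tA a (b \<otimes>\<^bsub>A\<^esub> c)) t),
        lact = (\<lambda>c\<in>carrier A. \<lambda>t\<in>carrier AA. klift k A A AA (\<lambda>a b. tA (c \<otimes>\<^bsub>A\<^esub> a) b) t) \<rparr>"

lemma P_simps [simp]:
  "carrier P = carrier AA" "ring.add P = ring.add AA" "ring.zero P = ring.zero AA"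
  by (simp_all add: P_def)

lemma P_bal:
  "c \<in> carrier A \<Longrightarrow> kbalanced k A A AA (\<lambda>a b. tA a (b \<otimes>\<^bsub>A\<^esub> c))"
  "c \<in> carrier A \<Longrightarrow> kbalanced k A A AA (\<lambda>a b. tA (c \<otimes>\<^bsub>A\<^esub> a) b)"
  by (rule kbalancedI; simp add: tA_simps)+

lemma P_ract: "\<lbrakk>t \<in> carrier AA; c \<in> carrier A\<rbrakk> \<Longrightarrow> ract P t c = klift k A A AA (\<lambda>a b. tA a (b \<otimes>\<^bsub>A\<^esub> c)) t"
  by (simp add: P_def)

lemma P_lact: "\<lbrakk>t \<in> carrier AA; c \<in> carrier A\<rbrakk> \<Longrightarrow> lact P c t = klift k A A AA (\<lambda>a b. tA (c \<otimes>\<^bsub>A\<^esub> a) b) t"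
  by (simp add: P_def)

lemma P_act_tA [simp]:
  "\<lbrakk>a \<in> carrier A; b \<in> carrier A; c \<in> carrier A\<rbrakk> \<Longrightarrow> ract P (tA a b) c = tA a (b \<otimes>\<^bsub>A\<^esub> c)"
  "\<lbrakk>a \<in> carrier A; b \<in> carrier A; c \<in> carrier A\<rbrakk> \<Longrightarrow> lact P c (tA a b) = tA (c \<otimes>\<^bsub>A\<^esub> a) b"
  by (simp_all add: P_ract P_lact P_bal)

lemma P_act_closed:
  "\<lbrakk>t \<in> carrier AA; c \<in> carrier A\<rbrakk> \<Longrightarrow> ract P t c \<in> carrier AA"
  "\<lbrakk>t \<in> carrier AA; c \<in> carrier A\<rbrakk> \<Longrightarrow> lact P c t \<in> carrier AA"
  by (simp_all add: P_ract P_lact P_bal)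

lemma P_act_add:
  assumes "s \<in> carrier AA" "t \<in> carrier AA" "c \<in> carrier A"
  shows "ract P (s \<oplus>\<^bsub>AA\<^esub> t) c = ract P s c \<oplus>\<^bsub>AA\<^esub> ract P t c"
    and "lact P c (s \<oplus>\<^bsub>AA\<^esub> t) = lact P c s \<oplus>\<^bsub>AA\<^esub> lact P c t"
proof -
  have "s \<oplus>\<^bsub>AA\<^esub> t \<in> carrier AA"
    using assms abelian_monoid.a_closed[OF abelian_group.axioms(1)[OF AA_abelian]] by blast
  then show "ract P (s \<oplus>\<^bsub>AA\<^esub> t) c = ract P s c \<oplus>\<^bsub>AA\<^esub> ract P t c"
    "lact P c (s \<oplus>\<^bsub>AA\<^esub> t) = lact P c s \<oplus>\<^bsub>AA\<^esub> lact P c t"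
    using assms by (simp_all add: P_ract P_lact P_bal klift_add)
qed

lemma P_bimodule [simp]: "P \<in> B"
proof -
  note cl = P_act_closed P_act_add
  note add4 = abelian_monoid.add_add_comm[OF abelian_group.axioms(1)[OF AA_abelian]]
  have ab: "abelian_group P"
    using AA_abelian abelian_group_cong[of P AA] by simp
  have "right_module_axioms A P"
  proof (rule right_module_axioms.intro, unfold P_simps, goal_cases)
    case (3 t a b)
    show ?case
      by (rule ktensor_induct[OF A_mod A_mod 3(1)]) (use 3 in \<open>simp_all add: tA_simps cl add4\<close>)
  next
    case (4 t a b)
    show ?case
      by (rule ktensor_induct[OF A_mod A_mod 4(1)]) (use 4 in \<open>simp_all add: m_assoc cl\<close>)
  next
    case (5 t)
    show ?case
      by (rule ktensor_induct[OF A_mod A_mod 5]) (simp_all add: cl)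
  qed (simp_all add: cl)
  then have rm: "right_module A P"
    using ab by (simp add: right_module_def ring_axioms)
  have "bimodule_axioms k A P"
  proof (rule bimodule_axioms.intro, unfold P_simps, goal_cases)
    case (3 a b t)
    show ?case
      by (rule ktensor_induct[OF A_mod A_mod 3(3)]) (use 3 in \<open>simp_all add: tA_simps cl add4\<close>)
  next
    case (4 a b t)
    show ?case
      by (rule ktensor_induct[OF A_mod A_mod 4(3)]) (use 4 in \<open>simp_all add: m_assoc cl\<close>)
  next
    case (5 t)
    show ?case
      by (rule ktensor_induct[OF A_mod A_mod 5]) (simp_all add: cl)
  next
    case (6 a t b)
    show ?case
      by (rule ktensor_induct[OF A_mod A_mod 6(2)]) (use 6 in \<open>simp_all add: cl\<close>)
  next
    case (7 c t)
    show ?case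
      by (rule ktensor_induct[OF A_mod A_mod 7(2)]) (use 7 in \<open>simp_all add: cl tA_simps\<close>)
  qed (simp_all add: cl)
  then have bim: "bimodule k A P"
    using rm assoc_algebra_axioms by (simp add: bimodule_def)
  have "ract P \<in> carrier P \<rightarrow>\<^sub>E carrier A \<rightarrow>\<^sub>E carrier P" "lact P \<in> carrier A \<rightarrow>\<^sub>E carrier P \<rightarrow>\<^sub>E carrier P"
    by (intro PiE_I; use P_act_closed in \<open>auto simp: P_def\<close>)+
  then show ?thesis
    using bim ktensor_add_PiE[OF A_mod A_mod] by (simp add: bimodules_def normal_rmod_def) (simp add: P_def)
qed

abbreviation uP where "uP \<equiv> tA \<one>\<^bsub>A\<^esub> \<one>\<^bsub>A\<^esub>"

lemma uP_closed: "uP \<in> carrier P" by simp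

lemma tA_uP: "\<lbrakk>a \<in> carrier A; b \<in> carrier A\<rbrakk> \<Longrightarrow> tA a b = ract P (lact P a uP) b"
  by simp

text \<open>The map a \<otimes> b -> a x b, that is, the bimodule map out of the free bimodule that
  takes the generator 1 \<otimes> 1 to x.\<close>

definition fP :: "'u bimod \<Rightarrow> 'u \<Rightarrow> 'u \<Rightarrow> 'u" where
  "fP X x = klift k A A X (\<lambda>a b. ract X (lact X a x) b)"

lemma fP_bal:
  assumes "X \<in> B" "x \<in> carrier X"
  shows "kbalanced k A A X (\<lambda>a b. ract X (lact X a x) b)"
proof -
  interpret X: alg_bimodule k A X by (rule bimod[OF assms(1)])
  show ?thesis
    by (rule kbalancedI) (use assms in \<open>simp_all add: X.all_simps\<close>)
qed

lemma fP_tA: "\<lbrakk>X \<in> B; x \<in> carrier X; a \<in> carrier A; b \<in> carrier A\<rbrakk> \<Longrightarrow> fP X x (tA a b) = ract X (lact X a x) b"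
  by (simp add: fP_def fP_bal)

lemma fP_hom:
  assumes "X \<in> B" "x \<in> carrier X"
  shows "fP X x \<in> bimod_hom A P X"
proof (rule bimod_homI)
  have ext: "fP X x \<in> extensional (carrier AA)" and hom: "fP X x \<in> addhom AA X"
    unfolding fP_def by (rule klift_extensional klift_addhom; use assms fP_bal in simp)+
  then show "fP X x \<in> extensional (carrier P)" by simp
  have "addhom AA X = addhom P X" by (rule addhom_cong) simp_all
  with hom show "fP X x \<in> addhom P X" by simp
  note add = addhom_add[OF hom] and closed = addhom_closed[OF hom]
  fix t c assume t: "t \<in> carrier P" and c: "c \<in> carrier A"
  then have t: "t \<in> carrier AA" by simp
  show "fP X x (ract P t c) = ract X (fP X x t) c"
    by (rule ktensor_induct[OF A_mod A_mod t])
      (use assms c in \<open>simp_all add: fP_tA P_act_closed P_act_add add closed b_adds b_ract_mult\<close>)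
  show "fP X x (lact P c t) = lact X c (fP X x t)"
    by (rule ktensor_induct[OF A_mod A_mod t])
      (use assms c in \<open>simp_all add: fP_tA P_act_closed P_act_add add closed b_adds b_lact_mult b_lact_ract\<close>)
qed

lemma fP_uP: "\<lbrakk>X \<in> B; x \<in> carrier X\<rbrakk> \<Longrightarrow> fP X x uP = x"
  by (simp add: fP_tA b_lact_one b_ract_one)

lemma AA_addhom_eqI:
  assumes "t \<in> carrier AA" "f \<in> addhom AA Z" "g \<in> addhom AA Z"
    and "\<And>a b. \<lbrakk>a \<in> carrier A; b \<in> carrier A\<rbrakk> \<Longrightarrow> f (tA a b) = g (tA a b)"
  shows "f t = g t"
  by (rule ktensor_addhom_eqI[OF A_mod A_mod assms])

abbreviation VA where "VA W \<equiv> ktensor k (kmod A W) A"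
abbreviation tV where "tV W w a \<equiv> ktens k (kmod A W) A w a"

text \<open>The canonical comparison from W tensored over A with A \<otimes> A to W \<otimes> A,
  taking w \<otimes> (a \<otimes> b) to w a \<otimes> b. It brings the value of a half-braiding at
  \<open>P\<close> into the module where coactions live.\<close>

definition jP :: "'u bimod \<Rightarrow> 'u \<Rightarrow> 'u" where
  "jP W = lift W P (VA W) (\<lambda>w p. klift k A A (VA W) (\<lambda>a b. tV W (ract W w a) b) p)"

lemma VA_abelian [simp]: "W \<in> B \<Longrightarrow> abelian_group (VA W)"
  by (drule bimod) (simp add: alg_bimodule_def alg_right_module.MA_abelian)

lemma jP_inner_bal:
  assumes "W \<in> B" "w \<in> carrier W"
  shows "kbalanced k A A (VA W) (\<lambda>a b. tV W (ract W w a) b)"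
proof -
  interpret W: alg_bimodule k A W by (rule bimod[OF assms(1)])
  show ?thesis
    by (rule kbalancedI) (use assms in \<open>simp_all add: W.all_simps\<close>)
qed

lemma jP_bal:
  assumes W: "W \<in> B"
  shows "bbal W P (VA W) (\<lambda>w p. klift k A A (VA W) (\<lambda>a b. tV W (ract W w a) b) p)"
proof -
  interpret W: alg_bimodule k A W by (rule bimod[OF assms(1)])
  let ?h = "\<lambda>w. klift k A A (VA W) (\<lambda>a b. tV W (ract W w a) b)"
  note inner = jP_inner_bal[OF W]
  note hom = klift_addhom[OF A_mod A_mod VA_abelian[OF W] inner]
  show ?thesis
  proof (rule bbalI)
    fix w w' p assume w: "w \<in> carrier W" "w' \<in> carrier W" and p: "p \<in> carrier P"
    have "?h (w \<oplus>\<^bsub>W\<^esub> w') p = klift k A A (VA W) (\<lambda>a b. tV W (ract W w a) b \<oplus>\<^bsub>VA W\<^esub> tV W (ract W w' a) b) p"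
      by (rule fun_cong[OF klift_cong]) (use w in \<open>simp_all add: W.all_simps\<close>)
    then show "?h (w \<oplus>\<^bsub>W\<^esub> w') p = ?h w p \<oplus>\<^bsub>VA W\<^esub> ?h w' p"
      using klift_plus[OF A_mod A_mod VA_abelian[OF W] inner inner] w p by simp
  next
    fix w r p assume w: "w \<in> carrier W" and r: "r \<in> carrier A" and p: "p \<in> carrier P"
    then have p: "p \<in> carrier AA" by simp
    have "lact P r \<in> addhom AA AA"
      by (rule addhomI) (use r in \<open>simp_all add: P_act_closed P_act_add\<close>)
    from hom_compose[OF this hom[OF w]] show "?h (ract W w r) p = ?h w (lact P r p)"
      by (intro AA_addhom_eqI[OF p hom]) (use w r inner W.ract_closed in \<open>simp_all add: o_def W.ract_mult\<close>)
  qed (use W inner in \<open>simp_all add: klift_add\<close>)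
qed

lemma jP_hom: "W \<in> B \<Longrightarrow> jP W \<in> addhom (W \<otimes>\<^sub>B P) (VA W)"
  unfolding jP_def by (rule blift_addhom) (simp_all add: jP_bal)

lemma jP_btens:
  "\<lbrakk>W \<in> B; w \<in> carrier W; a \<in> carrier A; b \<in> carrier A\<rbrakk> \<Longrightarrow> jP W (btens A W P w (tA a b)) = tV W (ract W w a) b"
  by (simp add: jP_def jP_bal jP_inner_bal)

lemma WP_addhom_eqI:
  assumes W: "W \<in> B" and t: "t \<in> carrier (W \<otimes>\<^sub>B P)" and f: "f \<in> addhom (W \<otimes>\<^sub>B P) Z" and g: "g \<in> addhom (W \<otimes>\<^sub>B P) Z"
    and eq: "\<And>w a b. \<lbrakk>w \<in> carrier W; a \<in> carrier A; b \<in> carrier A\<rbrakk> \<Longrightarrow>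
      f (btens A W P w (tA a b)) = g (btens A W P w (tA a b))"
  shows "f t = g t"
proof (rule btensor_addhom_eqI[OF W P_bimodule t f g])
  fix w p assume w: "w \<in> carrier W" and "p \<in> carrier P"
  then have p: "p \<in> carrier AA" by simp
  have b: "btens A W P w \<in> addhom AA (W \<otimes>\<^sub>B P)"
    by (rule addhomI) (use W w btens_add_right[OF W P_bimodule w] in \<open>simp_all\<close>)
  show "f (btens A W P w p) = g (btens A W P w p)"
    using p by (rule AA_addhom_eqI)
      (use hom_compose[OF b f] hom_compose[OF b g] eq w in \<open>simp_all add: o_def\<close>)
qed

text \<open>A scalar on w crosses the tensor sign as a left action on x b, and centrality of k in X
  moves it to the right, onto b.\<close>

lemma btens_kbal:
  assumes "V \<in> B" "X \<in> B" "x \<in> carrier X"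
  shows "kbalanced k (kmod A V) A (V \<otimes>\<^sub>B X) (\<lambda>w b. btens A V X w (ract X x b))"
proof -
  interpret V: alg_bimodule k A V by (rule bimod[OF assms(1)])
  interpret X: alg_bimodule k A X by (rule bimod[OF assms(2)])
  show ?thesis
  proof (rule V.balI)
    fix w c b assume w: "w \<in> carrier V" and c: "c \<in> carrier k" and b: "b \<in> carrier A"
    have "btens A V X (c \<odot>\<^bsub>kmod A V\<^esub> w) (ract X x b) = btens A V X w (lact X (c \<odot>\<^bsub>A\<^esub> \<one>\<^bsub>A\<^esub>) (ract X x b))"
      using assms w b c by (simp add: V.kmod_smult btens_balanced)
    also have "\<dots> = btens A V X w (ract X x (c \<odot>\<^bsub>A\<^esub> b))"
      using assms w b c by (simp add: X.central X.kmod_smult[symmetric] X.ract_smult_right)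
    finally show "btens A V X (c \<odot>\<^bsub>kmod A V\<^esub> w) (ract X x b) = btens A V X w (ract X x (c \<odot>\<^bsub>A\<^esub> b))" .
  qed (use assms in \<open>simp_all add: btens_add_left btens_add_right b_adds\<close>)
qed

abbreviation swV where "swV V Z \<phi> t \<equiv> klift k (kmod A V) A Z \<phi> t"

text \<open>With x = f(1 \<otimes> 1), linearity gives f(a \<otimes> b) = a x b, and w \<otimes> a x
  b = w a \<otimes> x b depends only on w a \<otimes> b. So tensoring V with \<open>f\<close>
  factors through \<open>jP\<close>, which turns naturality into a formula.\<close>

lemma jP_recover:
  assumes V: "V \<in> B" and X: "X \<in> B" and f: "f \<in> bimod_hom A P X" and t: "t \<in> carrier (V \<otimes>\<^sub>B P)"
  shows "tm V V P X (\<lambda>v\<in>carrier V. v) f t = swV V (V \<otimes>\<^sub>B X) (\<lambda>w b. btens A V X w (ract X (f uP) b)) (jP V t)"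
proof (rule WP_addhom_eqI[OF V t])
  interpret V: alg_bimodule k A V by (rule bimod[OF V])
  note fu = bimod_homD(3)[OF f uP_closed]
  note kb = btens_kbal[OF V X fu]
  show "tm V V P X (\<lambda>v\<in>carrier V. v) f \<in> addhom (V \<otimes>\<^sub>B P) (V \<otimes>\<^sub>B X)"
    by (rule bimod_homD(1)[OF tm_hom]) (use V X f id_hom in simp_all)
  have "swV V (V \<otimes>\<^sub>B X) (\<lambda>w b. btens A V X w (ract X (f uP) b)) \<in> addhom (VA V) (V \<otimes>\<^sub>B X)"
    by (rule klift_addhom) (use V X kb in simp_all)
  from hom_compose[OF jP_hom[OF V] this]
  show "(\<lambda>t. swV V (V \<otimes>\<^sub>B X) (\<lambda>w b. btens A V X w (ract X (f uP) b)) (jP V t)) \<in> addhom (V \<otimes>\<^sub>B P) (V \<otimes>\<^sub>B X)"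
    by (simp add: o_def)
  fix w a b assume w: "w \<in> carrier V" and a: "a \<in> carrier A" and b: "b \<in> carrier A"
  have "f (tA a b) = ract X (lact X a (f uP)) b"
    unfolding tA_uP[OF a b] using a b
    by (simp del: P_act_tA add: bimod_homD[OF f] P_act_closed)
  then show "tm V V P X (\<lambda>v\<in>carrier V. v) f (btens A V P w (tA a b)) =
      swV V (V \<otimes>\<^sub>B X) (\<lambda>w b. btens A V X w (ract X (f uP) b)) (jP V (btens A V P w (tA a b)))"
    using V X w a b fu kb f
    by (simp add: tm_btens id_hom jP_btens V.ract_closed btens_balanced b_lact_ract)
qed

lemma kmod_mod [simp]: "V \<in> B \<Longrightarrow> Module.module k (kmod A V)"
  by (drule bimod) (simp add: alg_bimodule_def alg_right_module.kmod_module)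

lemma swV_comp:
  "\<lbrakk>V \<in> B; abelian_group Z; abelian_group W; h \<in> addhom Z W; kbalanced k (kmod A V) A Z \<phi>;
    t \<in> carrier (VA V)\<rbrakk> \<Longrightarrow> h (swV V Z \<phi> t) = swV V W (\<lambda>w b. h (\<phi> w b)) t"
  by (rule klift_comp) simp_all

lemma swV_cong:
  assumes "V \<in> B" "\<And>w b. \<lbrakk>w \<in> carrier V; b \<in> carrier A\<rbrakk> \<Longrightarrow> \<phi> w b = \<psi> w b"
  shows "swV V Z \<phi> t = swV V Z \<psi> t"
  by (rule fun_cong[OF klift_cong]) (use assms in simp_all)

lemma btens_left_addhom:
  "\<lbrakk>X \<in> B; Y \<in> B; y \<in> carrier Y\<rbrakk> \<Longrightarrow> (\<lambda>x. btens A X Y x y) \<in> addhom X (X \<otimes>\<^sub>B Y)"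
  by (rule addhomI) (simp_all add: btens_add_left)

lemma btens_right_addhom:
  "\<lbrakk>X \<in> B; Y \<in> B; x \<in> carrier X\<rbrakk> \<Longrightarrow> btens A X Y x \<in> addhom Y (X \<otimes>\<^sub>B Y)"
  by (rule addhomI) (simp_all add: btens_add_right)

text \<open>\<open>braids V \<rho> X c\<close> says that \<open>c (x \<otimes> v) = v\<^sub>[\<^sub>0\<^sub>] \<otimes> x v\<^sub>[\<^sub>1\<^sub>]\<close>.\<close>

definition braids :: "'u bimod \<Rightarrow> ('u \<Rightarrow> 'u) \<Rightarrow> 'u bimod \<Rightarrow> ('u \<Rightarrow> 'u) \<Rightarrow> bool" where
  "braids V \<rho> X c \<longleftrightarrow> c \<in> bimod_hom A (X \<otimes>\<^sub>B V) (V \<otimes>\<^sub>B X) \<and>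
     (\<forall>x\<in>carrier X. \<forall>v\<in>carrier V.
        c (btens A X V x v) = swV V (V \<otimes>\<^sub>B X) (\<lambda>w b. btens A V X w (ract X x b)) (\<rho> v))"

text \<open>The five-step composite of the multiplicativity axiom, with \<open>asci\<close> already
  in place of the inverse associativity constraint.\<close>

definition hexagon where
  "hexagon V X Y cX cY =
     compose (carrier ((X \<otimes>\<^sub>B Y) \<otimes>\<^sub>B V)) (asc V X Y)
       (compose (carrier ((X \<otimes>\<^sub>B Y) \<otimes>\<^sub>B V))
          (tm (X \<otimes>\<^sub>B V) (V \<otimes>\<^sub>B X) Y Y cX (\<lambda>y\<in>carrier Y. y))
          (compose (carrier ((X \<otimes>\<^sub>B Y) \<otimes>\<^sub>B V)) (asci X V Y)
             (compose (carrier ((X \<otimes>\<^sub>B Y) \<otimes>\<^sub>B V))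
                (tm X X (Y \<otimes>\<^sub>B V) (V \<otimes>\<^sub>B Y) (\<lambda>x\<in>carrier X. x) cY) (asc X Y V))))"

lemma whb_iff:
  assumes V: "V \<in> B"
  shows "c \<in> weak_half_braidings (bimod_moncat k A) V \<longleftrightarrow>
     c \<in> (\<Pi>\<^sub>E X\<in>B. bimod_hom A (X \<otimes>\<^sub>B V) (V \<otimes>\<^sub>B X)) \<and>
     (\<forall>X\<in>B. \<forall>Y\<in>B. \<forall>f\<in>bimod_hom A X Y.
        compose (carrier (X \<otimes>\<^sub>B V)) (tm V V X Y (\<lambda>v\<in>carrier V. v) f) (c X) =
        compose (carrier (X \<otimes>\<^sub>B V)) (c Y) (tm X Y V V f (\<lambda>v\<in>carrier V. v))) \<and>
     c R = compose (carrier (R \<otimes>\<^sub>B V)) (runiti V) (lunit (bimod_moncat k A) V) \<and>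
     (\<forall>X\<in>B. \<forall>Y\<in>B. c (X \<otimes>\<^sub>B Y) = hexagon V X Y (c X) (c Y))"
  using V by (simp add: weak_half_braidings_def Let_def inv_runit inv_asc hexagon_def cong: ball_cong)

lemma hexagon_hom:
  assumes V: "V \<in> B" and X: "X \<in> B" and Y: "Y \<in> B"
    and "cX \<in> bimod_hom A (X \<otimes>\<^sub>B V) (V \<otimes>\<^sub>B X)" "cY \<in> bimod_hom A (Y \<otimes>\<^sub>B V) (V \<otimes>\<^sub>B Y)"
  shows "hexagon V X Y cX cY \<in> bimod_hom A ((X \<otimes>\<^sub>B Y) \<otimes>\<^sub>B V) (V \<otimes>\<^sub>B (X \<otimes>\<^sub>B Y))"
  unfolding hexagon_def
  by (rule comp_hom[OF _ _ _ comp_hom[OF _ _ _ comp_hom[OF _ _ _ comp_hom[OF _ _ _ asc_hom tm_hom] asci_hom] tm_hom] asc_hom])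
    (use assms id_hom in simp_all)

lemma hexagon_btens:
  assumes V: "V \<in> B" and X: "X \<in> B" and Y: "Y \<in> B"
    and "cX \<in> bimod_hom A (X \<otimes>\<^sub>B V) (V \<otimes>\<^sub>B X)" "cY \<in> bimod_hom A (Y \<otimes>\<^sub>B V) (V \<otimes>\<^sub>B Y)"
    and "x \<in> carrier X" "y \<in> carrier Y" "v \<in> carrier V"
  shows "hexagon V X Y cX cY (btens A (X \<otimes>\<^sub>B Y) V (btens A X Y x y) v) =
    asc V X Y (tm (X \<otimes>\<^sub>B V) (V \<otimes>\<^sub>B X) Y Y cX (\<lambda>y\<in>carrier Y. y)
      (asci X V Y (btens A X (V \<otimes>\<^sub>B Y) x (cY (btens A Y V y v)))))"
  using assms by (simp add: hexagon_def compose_eq asc_btens tm_btens id_hom)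

text \<open>Up to the last reassociation the composite takes x \<otimes> y \<otimes> v to v[0][0]
  \<otimes> x v[0][1] \<otimes> y v[1]. The additive map \<open>h\<close> is left free because two
  targets are needed: reassociation when a coaction is given, and the comparison with (V \<otimes>
  A) \<otimes> A when a half-braiding is given.\<close>

lemma hexagon_inner:
  assumes V: "V \<in> B" and X: "X \<in> B" and Y: "Y \<in> B" and Z: "abelian_group Z"
    and rho: "\<And>v. v \<in> carrier V \<Longrightarrow> \<rho> v \<in> carrier (VA V)"
    and cX: "braids V \<rho> X cX" and cY: "braids V \<rho> Y cY"
    and x: "x \<in> carrier X" and y: "y \<in> carrier Y" and v: "v \<in> carrier V"
    and h: "h \<in> addhom ((V \<otimes>\<^sub>B X) \<otimes>\<^sub>B Y) Z"
  shows "h (tm (X \<otimes>\<^sub>B V) (V \<otimes>\<^sub>B X) Y Y cX (\<lambda>y\<in>carrier Y. y)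
      (asci X V Y (btens A X (V \<otimes>\<^sub>B Y) x (cY (btens A Y V y v))))) =
    swV V Z (\<lambda>w b. swV V Z (\<lambda>w' b'. h (btens A (V \<otimes>\<^sub>B X) Y (btens A V X w' (ract X x b')) (ract Y y b))) (\<rho> w)) (\<rho> v)"
proof -
  let ?t = "tm (X \<otimes>\<^sub>B V) (V \<otimes>\<^sub>B X) Y Y cX (\<lambda>y\<in>carrier Y. y)"
  let ?g = "\<lambda>t. h (?t (asci X V Y (btens A X (V \<otimes>\<^sub>B Y) x t)))"
  have cX': "cX \<in> bimod_hom A (X \<otimes>\<^sub>B V) (V \<otimes>\<^sub>B X)" using cX by (simp add: braids_def)
  have th: "?t \<in> addhom ((X \<otimes>\<^sub>B V) \<otimes>\<^sub>B Y) ((V \<otimes>\<^sub>B X) \<otimes>\<^sub>B Y)"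
    by (rule bimod_homD(1)[OF tm_hom]) (use V X Y cX' id_hom in simp_all)
  have "btens A X (V \<otimes>\<^sub>B Y) x \<in> addhom (V \<otimes>\<^sub>B Y) (X \<otimes>\<^sub>B (V \<otimes>\<^sub>B Y))"
    by (rule btens_right_addhom) (use V X Y x in simp_all)
  from hom_compose[OF hom_compose[OF hom_compose[OF this bimod_homD(1)[OF asci_hom[OF X V Y]]] th] h]
  have g: "?g \<in> addhom (V \<otimes>\<^sub>B Y) Z" by (simp add: o_def)
  have "?g (cY (btens A Y V y v)) = ?g (swV V (V \<otimes>\<^sub>B Y) (\<lambda>w b. btens A V Y w (ract Y y b)) (\<rho> v))"
    using cY y v by (simp add: braids_def)
  also have "\<dots> = swV V Z (\<lambda>w b. ?g (btens A V Y w (ract Y y b))) (\<rho> v)"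
    by (rule swV_comp[OF V _ Z g]) (use V Y y v rho btens_kbal in simp_all)
  also have "\<dots> = swV V Z (\<lambda>w b. swV V Z (\<lambda>w' b'. h (btens A (V \<otimes>\<^sub>B X) Y (btens A V X w' (ract X x b')) (ract Y y b))) (\<rho> w)) (\<rho> v)"
  proof (rule swV_cong[OF V])
    fix w b assume w: "w \<in> carrier V" and b: "b \<in> carrier A"
    have yb: "ract Y y b \<in> carrier Y" using Y y b by simp
    have "(\<lambda>t. btens A (V \<otimes>\<^sub>B X) Y t (ract Y y b)) \<in> addhom (V \<otimes>\<^sub>B X) ((V \<otimes>\<^sub>B X) \<otimes>\<^sub>B Y)"
      by (rule btens_left_addhom) (use V X Y yb in simp_all)
    from hom_compose[OF this h]
    have h': "(\<lambda>t. h (btens A (V \<otimes>\<^sub>B X) Y t (ract Y y b))) \<in> addhom (V \<otimes>\<^sub>B X) Z" by (simp add: o_def)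
    have "?g (btens A V Y w (ract Y y b)) = h (btens A (V \<otimes>\<^sub>B X) Y (cX (btens A X V x w)) (ract Y y b))"
      using V X Y x w yb cX' by (simp add: asci_btens tm_btens id_hom)
    also have "\<dots> = h (btens A (V \<otimes>\<^sub>B X) Y (swV V (V \<otimes>\<^sub>B X) (\<lambda>w b. btens A V X w (ract X x b)) (\<rho> w)) (ract Y y b))"
      using cX x w by (simp add: braids_def)
    also have "\<dots> = swV V Z (\<lambda>w' b'. h (btens A (V \<otimes>\<^sub>B X) Y (btens A V X w' (ract X x b')) (ract Y y b))) (\<rho> w)"
      by (rule swV_comp[OF V _ Z h']) (use V X x w rho btens_kbal in simp_all)
    finally show "?g (btens A V Y w (ract Y y b)) =
        swV V Z (\<lambda>w' b'. h (btens A (V \<otimes>\<^sub>B X) Y (btens A V X w' (ract X x b')) (ract Y y b))) (\<rho> w)" .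
  qed
  finally show ?thesis .
qed

section \<open>Half-braidings from coactions\<close>

definition brd :: "'u bimod \<Rightarrow> ('u \<Rightarrow> 'u) \<Rightarrow> 'u bimod \<Rightarrow> 'u \<Rightarrow> 'u" where
  "brd V \<rho> = (\<lambda>X\<in>B. lift X V (V \<otimes>\<^sub>B X)
     (\<lambda>x v. swV V (V \<otimes>\<^sub>B X) (\<lambda>w b. btens A V X w (ract X x b)) (\<rho> v)))"

context
  fixes V \<rho> assumes VB: "V \<in> B" and rho: "\<rho> \<in> yetter_drinfeld_coactions k A V"
begin

interpretation Y: yetter_drinfeld k A V \<rho> by (rule yetter_drinfeldI[OF VB rho])

lemma brd_kbal: "\<lbrakk>X \<in> B; x \<in> carrier X\<rbrakk> \<Longrightarrow> Y.bal (V \<otimes>\<^sub>B X) (\<lambda>w b. btens A V X w (ract X x b))"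
  by (rule btens_kbal[OF VB])

text \<open>Balance over A is left linearity of \<rho>: both x a \<otimes> v and x \<otimes> a v go
  to v[0] \<otimes> x a v[1].\<close>

lemma brd_bbal:
  assumes X: "X \<in> B"
  shows "bbal X V (V \<otimes>\<^sub>B X) (\<lambda>x v. Y.sw (V \<otimes>\<^sub>B X) (\<lambda>w b. btens A V X w (ract X x b)) (\<rho> v))"
proof (rule bbalI)
  fix x x' v assume x: "x \<in> carrier X" "x' \<in> carrier X" and v: "v \<in> carrier V"
  have "Y.sw (V \<otimes>\<^sub>B X) (\<lambda>w b. btens A V X w (ract X (x \<oplus>\<^bsub>X\<^esub> x') b)) (\<rho> v) =
     Y.sw (V \<otimes>\<^sub>B X) (\<lambda>w b. btens A V X w (ract X x b) \<oplus>\<^bsub>V \<otimes>\<^sub>B X\<^esub> btens A V X w (ract X x' b)) (\<rho> v)"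
    by (rule Y.sw_cong) (use VB X x in \<open>simp add: b_adds btens_add_right\<close>)
  then show "Y.sw (V \<otimes>\<^sub>B X) (\<lambda>w b. btens A V X w (ract X (x \<oplus>\<^bsub>X\<^esub> x') b)) (\<rho> v) =
     Y.sw (V \<otimes>\<^sub>B X) (\<lambda>w b. btens A V X w (ract X x b)) (\<rho> v) \<oplus>\<^bsub>V \<otimes>\<^sub>B X\<^esub>
     Y.sw (V \<otimes>\<^sub>B X) (\<lambda>w b. btens A V X w (ract X x' b)) (\<rho> v)"
    using VB X x v by (simp add: klift_plus brd_kbal)
next
  fix x r v assume x: "x \<in> carrier X" and r: "r \<in> carrier A" and v: "v \<in> carrier V"
  have "Y.sw (V \<otimes>\<^sub>B X) (\<lambda>w b. btens A V X w (ract X x b)) (\<rho> (lact V r v)) =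
      Y.sw (V \<otimes>\<^sub>B X) (\<lambda>w b. btens A V X w (ract X x (r \<otimes>\<^bsub>A\<^esub> b))) (\<rho> v)"
    by (rule Y.sw_lact) (use VB X x r v brd_kbal in simp_all)
  then show "Y.sw (V \<otimes>\<^sub>B X) (\<lambda>w b. btens A V X w (ract X (ract X x r) b)) (\<rho> v) =
      Y.sw (V \<otimes>\<^sub>B X) (\<lambda>w b. btens A V X w (ract X x b)) (\<rho> (lact V r v))"
    using X x r by (auto intro!: Y.sw_cong simp: b_ract_mult)
qed (use VB X brd_kbal in \<open>simp_all add: Y.sw_closed Y.sw_rho_add\<close>)

lemma brd_btens:
  "\<lbrakk>X \<in> B; x \<in> carrier X; v \<in> carrier V\<rbrakk> \<Longrightarrow>
    brd V \<rho> X (btens A X V x v) = Y.sw (V \<otimes>\<^sub>B X) (\<lambda>w b. btens A V X w (ract X x b)) (\<rho> v)"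
  by (simp add: brd_def brd_bbal VB)

text \<open>Left linearity of the braiding is the exchange law, since v[0] \<otimes> a x v[1] = v[0]
  a \<otimes> x v[1]; its right linearity is right linearity of \<rho>.\<close>

lemma brd_hom:
  assumes X: "X \<in> B"
  shows "brd V \<rho> X \<in> bimod_hom A (X \<otimes>\<^sub>B V) (V \<otimes>\<^sub>B X)"
proof -
  have VX: "V \<otimes>\<^sub>B X \<in> B" "abelian_group (V \<otimes>\<^sub>B X)" using VB X by simp_all
  have "lift X V (V \<otimes>\<^sub>B X) (\<lambda>x v. Y.sw (V \<otimes>\<^sub>B X) (\<lambda>w b. btens A V X w (ract X x b)) (\<rho> v))
      \<in> bimod_hom A (X \<otimes>\<^sub>B V) (V \<otimes>\<^sub>B X)"
  proof (rule blift_bimod_hom[OF X VB VX(1) brd_bbal[OF X]])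
    fix a x v assume a: "a \<in> carrier A" and x: "x \<in> carrier X" and v: "v \<in> carrier V"
    have "Y.sw (V \<otimes>\<^sub>B X) (\<lambda>w b. btens A V X w (ract X (lact X a x) b)) (\<rho> v) =
       Y.sw (V \<otimes>\<^sub>B X) (\<lambda>w b. btens A V X (ract V w a) (ract X x b)) (\<rho> v)"
      by (rule Y.sw_cong) (use VB X a x in \<open>simp add: b_lact_ract btens_balanced\<close>)
    also have "\<dots> = Y.sw (V \<otimes>\<^sub>B X) (\<lambda>w b. btens A V X (lact V a w) (ract X x b)) (\<rho> v)"
      by (rule Y.sw_lact_left[OF VX(2) brd_kbal[OF X x] v a, symmetric])
    also have "\<dots> = Y.sw (V \<otimes>\<^sub>B X) (\<lambda>w b. lact (V \<otimes>\<^sub>B X) a (btens A V X w (ract X x b))) (\<rho> v)"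
      by (rule Y.sw_cong) (use VB X a x in \<open>simp add: lact_btens\<close>)
    also have "\<dots> = lact (V \<otimes>\<^sub>B X) a (Y.sw (V \<otimes>\<^sub>B X) (\<lambda>w b. btens A V X w (ract X x b)) (\<rho> v))"
      by (rule Y.sw_comp[OF VX(2) VX(2) lact_addhom[OF VX(1) a] brd_kbal[OF X x] v, symmetric])
    finally show "Y.sw (V \<otimes>\<^sub>B X) (\<lambda>w b. btens A V X w (ract X (lact X a x) b)) (\<rho> v) =
       lact (V \<otimes>\<^sub>B X) a (Y.sw (V \<otimes>\<^sub>B X) (\<lambda>w b. btens A V X w (ract X x b)) (\<rho> v))" .
    have "Y.sw (V \<otimes>\<^sub>B X) (\<lambda>w b. btens A V X w (ract X x b)) (\<rho> (ract V v a)) =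
       Y.sw (V \<otimes>\<^sub>B X) (\<lambda>w b. btens A V X w (ract X x (b \<otimes>\<^bsub>A\<^esub> a))) (\<rho> v)"
      by (rule Y.sw_ract[OF VX(2) brd_kbal[OF X x] v a])
    also have "\<dots> = Y.sw (V \<otimes>\<^sub>B X) (\<lambda>w b. ract (V \<otimes>\<^sub>B X) (btens A V X w (ract X x b)) a) (\<rho> v)"
      by (rule Y.sw_cong) (use VB X a x in \<open>simp add: ract_btens b_ract_mult\<close>)
    also have "\<dots> = ract (V \<otimes>\<^sub>B X) (Y.sw (V \<otimes>\<^sub>B X) (\<lambda>w b. btens A V X w (ract X x b)) (\<rho> v)) a"
      by (rule Y.sw_comp[OF VX(2) VX(2) ract_addhom[OF VX(1) a] brd_kbal[OF X x] v, symmetric])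
    finally show "Y.sw (V \<otimes>\<^sub>B X) (\<lambda>w b. btens A V X w (ract X x b)) (\<rho> (ract V v a)) =
       ract (V \<otimes>\<^sub>B X) (Y.sw (V \<otimes>\<^sub>B X) (\<lambda>w b. btens A V X w (ract X x b)) (\<rho> v)) a" .
  qed
  then show ?thesis using X by (simp add: brd_def)
qed

lemma brd_braids: "X \<in> B \<Longrightarrow> braids V \<rho> X (brd V \<rho> X)"
  by (simp add: braids_def brd_hom brd_btens)

lemma brd_natural:
  assumes X: "X \<in> B" and Y: "Y \<in> B" and f: "f \<in> bimod_hom A X Y"
  shows "compose (carrier (X \<otimes>\<^sub>B V)) (tm V V X Y (\<lambda>v\<in>carrier V. v) f) (brd V \<rho> X) =
      compose (carrier (X \<otimes>\<^sub>B V)) (brd V \<rho> Y) (tm X Y V V f (\<lambda>v\<in>carrier V. v))"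
proof (rule btensor_bimod_hom_eqI[OF X VB])
  have tVf: "tm V V X Y (\<lambda>v\<in>carrier V. v) f \<in> bimod_hom A (V \<otimes>\<^sub>B X) (V \<otimes>\<^sub>B Y)"
    by (rule tm_hom) (use VB X Y f id_hom in simp_all)
  have tfV: "tm X Y V V f (\<lambda>v\<in>carrier V. v) \<in> bimod_hom A (X \<otimes>\<^sub>B V) (Y \<otimes>\<^sub>B V)"
    by (rule tm_hom) (use VB X Y f id_hom in simp_all)
  show "compose (carrier (X \<otimes>\<^sub>B V)) (tm V V X Y (\<lambda>v\<in>carrier V. v) f) (brd V \<rho> X) \<in> bimod_hom A (X \<otimes>\<^sub>B V) (V \<otimes>\<^sub>B Y)"
    by (rule comp_hom[OF _ _ _ brd_hom tVf]) (use VB X Y in simp_all)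
  show "compose (carrier (X \<otimes>\<^sub>B V)) (brd V \<rho> Y) (tm X Y V V f (\<lambda>v\<in>carrier V. v)) \<in> bimod_hom A (X \<otimes>\<^sub>B V) (V \<otimes>\<^sub>B Y)"
    by (rule comp_hom[OF _ _ _ tfV brd_hom]) (use VB X Y in simp_all)
  fix x v assume x: "x \<in> carrier X" and v: "v \<in> carrier V"
  note fD = bimod_homD[OF f]
  have "tm V V X Y (\<lambda>v\<in>carrier V. v) f (Y.sw (V \<otimes>\<^sub>B X) (\<lambda>w b. btens A V X w (ract X x b)) (\<rho> v)) =
     Y.sw (V \<otimes>\<^sub>B Y) (\<lambda>w b. tm V V X Y (\<lambda>v\<in>carrier V. v) f (btens A V X w (ract X x b))) (\<rho> v)"
    by (rule Y.sw_comp[OF _ _ bimod_homD(1)[OF tVf] brd_kbal[OF X x] v]) (use VB X Y in simp_all)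
  also have "\<dots> = Y.sw (V \<otimes>\<^sub>B Y) (\<lambda>w b. btens A V Y w (ract Y (f x) b)) (\<rho> v)"
    by (rule Y.sw_cong) (use VB X Y f x in \<open>simp add: tm_btens id_hom fD\<close>)
  finally show "compose (carrier (X \<otimes>\<^sub>B V)) (tm V V X Y (\<lambda>v\<in>carrier V. v) f) (brd V \<rho> X) (btens A X V x v) =
      compose (carrier (X \<otimes>\<^sub>B V)) (brd V \<rho> Y) (tm X Y V V f (\<lambda>v\<in>carrier V. v)) (btens A X V x v)"
    using VB X Y f x v by (simp add: compose_eq brd_btens tm_btens id_hom fD)
qed

text \<open>In V \<otimes> A over A everything moves to the left of the tensor sign: v[0] \<otimes>
  a v[1] = v[0] (a v[1]) \<otimes> 1, and v[0] (a v[1]) is the left action a v.\<close>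

lemma brd_unit:
  "brd V \<rho> R = compose (carrier (R \<otimes>\<^sub>B V)) (runiti V) (lunit (bimod_moncat k A) V)"
proof (rule btensor_bimod_hom_eqI[OF regular_bimodule VB brd_hom[OF regular_bimodule]])
  show "compose (carrier (R \<otimes>\<^sub>B V)) (runiti V) (lunit (bimod_moncat k A) V) \<in> bimod_hom A (R \<otimes>\<^sub>B V) (V \<otimes>\<^sub>B R)"
    by (rule comp_hom[OF _ _ _ lunit_hom runiti_hom]) (simp_all add: VB)
  fix a v assume "a \<in> carrier R" and v: "v \<in> carrier V"
  then have a: "a \<in> carrier A" by simp
  have "Y.sw (V \<otimes>\<^sub>B R) (\<lambda>w b. btens A V R w (ract R a b)) (\<rho> v) =
     Y.sw (V \<otimes>\<^sub>B R) (\<lambda>w b. runiti V (ract V w (a \<otimes>\<^bsub>A\<^esub> b))) (\<rho> v)"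
    by (rule Y.sw_cong) (use VB a in \<open>simp add: runiti_def btens_R[symmetric] Y.ract_closed\<close>)
  also have "\<dots> = runiti V (Y.la a v)"
    unfolding Y.la_def by (rule Y.sw_comp[symmetric]) (use VB a v bimod_homD(1)[OF runiti_hom[OF VB]] in simp_all)
  finally show "brd V \<rho> R (btens A R V a v) =
      compose (carrier (R \<otimes>\<^sub>B V)) (runiti V) (lunit (bimod_moncat k A) V) (btens A R V a v)"
    using VB a v by (simp add: compose_eq brd_btens lunit_btens Y.lact_eq_la)
qed

text \<open>Scalars pass from w to x and from x to y by balancing over A, and are brought behind
  each element by centrality.\<close>

lemma brd_trilinear:
  assumes X: "X \<in> B" and Y: "Y \<in> B" and x: "x \<in> carrier X" and y: "y \<in> carrier Y"
  shows "Y.trilinear (V \<otimes>\<^sub>B (X \<otimes>\<^sub>B Y)) (\<lambda>w a b. btens A V (X \<otimes>\<^sub>B Y) w (btens A X Y (ract X x a) (ract Y y b)))"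
proof -
  interpret X: alg_bimodule k A X by (rule bimod[OF X])
  interpret Y': alg_bimodule k A Y by (rule bimod[OF Y])
  have 1: "btens A V (X \<otimes>\<^sub>B Y) (c \<odot>\<^bsub>kmod A V\<^esub> w) (btens A X Y (ract X x a) (ract Y y b)) =
      btens A V (X \<otimes>\<^sub>B Y) w (btens A X Y (ract X x (c \<odot>\<^bsub>A\<^esub> a)) (ract Y y b))"
    if "c \<in> carrier k" "w \<in> carrier V" "a \<in> carrier A" "b \<in> carrier A" for c w a b
  proof -
    have "btens A V (X \<otimes>\<^sub>B Y) (c \<odot>\<^bsub>kmod A V\<^esub> w) (btens A X Y (ract X x a) (ract Y y b)) =
        btens A V (X \<otimes>\<^sub>B Y) w (lact (X \<otimes>\<^sub>B Y) (c \<odot>\<^bsub>A\<^esub> \<one>\<^bsub>A\<^esub>) (btens A X Y (ract X x a) (ract Y y b)))"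
      unfolding Y.kmod_smult by (rule btens_balanced) (use that VB X Y x y in simp_all)
    also have "lact (X \<otimes>\<^sub>B Y) (c \<odot>\<^bsub>A\<^esub> \<one>\<^bsub>A\<^esub>) (btens A X Y (ract X x a) (ract Y y b)) =
        btens A X Y (lact X (c \<odot>\<^bsub>A\<^esub> \<one>\<^bsub>A\<^esub>) (ract X x a)) (ract Y y b)"
      by (rule lact_btens) (use that VB X Y x y in simp_all)
    also have "lact X (c \<odot>\<^bsub>A\<^esub> \<one>\<^bsub>A\<^esub>) (ract X x a) = ract X x (c \<odot>\<^bsub>A\<^esub> a)"
      using that X x by (simp add: X.central X.kmod_smult[symmetric] X.ract_smult_right)
    finally show ?thesis .
  qed
  have 2: "btens A X Y (ract X x (c \<odot>\<^bsub>A\<^esub> a)) (ract Y y b) = btens A X Y (ract X x a) (ract Y y (c \<odot>\<^bsub>A\<^esub> b))"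
    if "c \<in> carrier k" "a \<in> carrier A" "b \<in> carrier A" for c a b
  proof -
    have "ract X x (c \<odot>\<^bsub>A\<^esub> a) = ract X (ract X x a) (c \<odot>\<^bsub>A\<^esub> \<one>\<^bsub>A\<^esub>)"
      using that x by (simp add: X.kmod_smult[symmetric] X.ract_smult_right)
    also have "btens A X Y \<dots> (ract Y y b) = btens A X Y (ract X x a) (lact Y (c \<odot>\<^bsub>A\<^esub> \<one>\<^bsub>A\<^esub>) (ract Y y b))"
      by (rule btens_balanced) (use that X Y x y in simp_all)
    also have "lact Y (c \<odot>\<^bsub>A\<^esub> \<one>\<^bsub>A\<^esub>) (ract Y y b) = ract Y y (c \<odot>\<^bsub>A\<^esub> b)"
      using that Y y by (simp add: Y'.central Y'.kmod_smult[symmetric] Y'.ract_smult_right)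
    finally show ?thesis .
  qed
  show ?thesis
    using VB X Y x y
    by (simp add: Y.trilinear_def b_adds btens_add_left btens_add_right 1 2)
qed

text \<open>Evaluated at x \<otimes> y \<otimes> v, multiplicativity is coassociativity: v[0][0]
  \<otimes> x v[0][1] \<otimes> y v[1] becomes v[0] \<otimes> x \<otimes> y v[1].\<close>

lemma brd_hexagon:
  assumes X: "X \<in> B" and Y: "Y \<in> B"
  shows "brd V \<rho> (X \<otimes>\<^sub>B Y) = hexagon V X Y (brd V \<rho> X) (brd V \<rho> Y)"
proof (rule btensor3_eqI[OF X Y VB brd_hom hexagon_hom[OF VB X Y brd_hom brd_hom]])
  fix x y v assume x: "x \<in> carrier X" and y: "y \<in> carrier Y" and v: "v \<in> carrier V"
  let ?Z = "V \<otimes>\<^sub>B (X \<otimes>\<^sub>B Y)"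
  have Z: "abelian_group ?Z" using VB X Y by simp
  have "hexagon V X Y (brd V \<rho> X) (brd V \<rho> Y) (btens A (X \<otimes>\<^sub>B Y) V (btens A X Y x y) v) =
      Y.sw ?Z (\<lambda>w b. Y.sw ?Z (\<lambda>w' b'. asc V X Y (btens A (V \<otimes>\<^sub>B X) Y (btens A V X w' (ract X x b')) (ract Y y b))) (\<rho> w)) (\<rho> v)"
    unfolding hexagon_btens[OF VB X Y brd_hom[OF X] brd_hom[OF Y] x y v]
    by (rule hexagon_inner[OF VB X Y Z _ brd_braids[OF X] brd_braids[OF Y] x y v bimod_homD(1)[OF asc_hom[OF VB X Y]]]) simp
  also have "\<dots> = Y.sw ?Z (\<lambda>w b. Y.sw ?Z (\<lambda>w' b'. btens A V (X \<otimes>\<^sub>B Y) w' (btens A X Y (ract X x b') (ract Y y b))) (\<rho> w)) (\<rho> v)"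
    by (intro Y.sw_cong) (use VB X Y x y in \<open>simp add: asc_btens\<close>)
  also have "\<dots> = Y.sw ?Z (\<lambda>w b. btens A V (X \<otimes>\<^sub>B Y) w (btens A X Y (ract X x \<one>\<^bsub>A\<^esub>) (ract Y y b))) (\<rho> v)"
    by (rule Y.sw_coassoc[OF Z brd_trilinear[OF X Y x y] v])
  also have "\<dots> = Y.sw ?Z (\<lambda>w b. btens A V (X \<otimes>\<^sub>B Y) w (ract (X \<otimes>\<^sub>B Y) (btens A X Y x y) b)) (\<rho> v)"
    by (rule Y.sw_cong) (use X Y x y in \<open>simp add: ract_btens b_ract_one\<close>)
  finally show "brd V \<rho> (X \<otimes>\<^sub>B Y) (btens A (X \<otimes>\<^sub>B Y) V (btens A X Y x y) v) =
      hexagon V X Y (brd V \<rho> X) (brd V \<rho> Y) (btens A (X \<otimes>\<^sub>B Y) V (btens A X Y x y) v)"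
    using X Y x y v by (simp add: brd_btens)
qed (use X Y in simp_all)

lemma brd_whb: "brd V \<rho> \<in> weak_half_braidings (bimod_moncat k A) V"
  unfolding whb_iff[OF VB]
  by (intro conjI ballI brd_natural brd_unit brd_hexagon PiE_I brd_hom) (simp_all add: brd_def)

end

lemma jP_ract:
  assumes W: "W \<in> B" and t: "t \<in> carrier (W \<otimes>\<^sub>B P)" and c: "c \<in> carrier A"
  shows "jP W (ract (W \<otimes>\<^sub>B P) t c) = swV W (VA W) (\<lambda>w b. tV W w (b \<otimes>\<^bsub>A\<^esub> c)) (jP W t)"
proof (rule WP_addhom_eqI[OF W t])
  interpret W: alg_bimodule k A W by (rule bimod[OF W])
  have WP: "W \<otimes>\<^sub>B P \<in> B" using W by simp
  have bal: "W.bal (VA W) (\<lambda>w b. tV W w (b \<otimes>\<^bsub>A\<^esub> c))"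
    by (rule W.balI) (use c in \<open>simp_all add: W.all_simps\<close>)
  show "(\<lambda>t. jP W (ract (W \<otimes>\<^sub>B P) t c)) \<in> addhom (W \<otimes>\<^sub>B P) (VA W)"
    using hom_compose[OF ract_addhom[OF WP c] jP_hom[OF W]] by (simp add: o_def)
  have "W.sw (VA W) (\<lambda>w b. tV W w (b \<otimes>\<^bsub>A\<^esub> c)) \<in> addhom (VA W) (VA W)"
    by (rule klift_addhom) (use c in simp_all)
  from hom_compose[OF jP_hom[OF W] this]
  show "(\<lambda>t. W.sw (VA W) (\<lambda>w b. tV W w (b \<otimes>\<^bsub>A\<^esub> c)) (jP W t)) \<in> addhom (W \<otimes>\<^sub>B P) (VA W)"
    by (simp add: o_def)
  show "jP W (ract (W \<otimes>\<^sub>B P) (btens A W P w (tA a b)) c) =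
      W.sw (VA W) (\<lambda>w b. tV W w (b \<otimes>\<^bsub>A\<^esub> c)) (jP W (btens A W P w (tA a b)))"
    if "w \<in> carrier W" "a \<in> carrier A" "b \<in> carrier A" for w a b
    using that W c bal by (simp add: ract_btens jP_btens)
qed

lemma jP_lact:
  assumes W: "W \<in> B" and t: "t \<in> carrier (W \<otimes>\<^sub>B P)" and c: "c \<in> carrier A"
  shows "jP W (lact (W \<otimes>\<^sub>B P) c t) = swV W (VA W) (\<lambda>w b. tV W (lact W c w) b) (jP W t)"
proof (rule WP_addhom_eqI[OF W t])
  interpret W: alg_bimodule k A W by (rule bimod[OF W])
  have WP: "W \<otimes>\<^sub>B P \<in> B" using W by simp
  have bal: "W.bal (VA W) (\<lambda>w b. tV W (lact W c w) b)"
    by (rule W.balI) (use c in \<open>simp_all add: W.all_simps\<close>)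
  show "(\<lambda>t. jP W (lact (W \<otimes>\<^sub>B P) c t)) \<in> addhom (W \<otimes>\<^sub>B P) (VA W)"
    using hom_compose[OF lact_addhom[OF WP c] jP_hom[OF W]] by (simp add: o_def)
  have "W.sw (VA W) (\<lambda>w b. tV W (lact W c w) b) \<in> addhom (VA W) (VA W)"
    by (rule klift_addhom) (use bal in simp_all)
  from hom_compose[OF jP_hom[OF W] this]
  show "(\<lambda>t. W.sw (VA W) (\<lambda>w b. tV W (lact W c w) b) (jP W t)) \<in> addhom (W \<otimes>\<^sub>B P) (VA W)"
    by (simp add: o_def)
  show "jP W (lact (W \<otimes>\<^sub>B P) c (btens A W P w (tA a b))) =
      W.sw (VA W) (\<lambda>w b. tV W (lact W c w) b) (jP W (btens A W P w (tA a b)))"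
    if "w \<in> carrier W" "a \<in> carrier A" "b \<in> carrier A" for w a b
    using that W c bal by (simp add: lact_btens jP_btens b_lact_ract)
qed

lemma swV_smult:
  assumes W: "W \<in> B" and t: "t \<in> carrier (VA W)" and c: "c \<in> carrier k"
  shows "swV W (VA W) (\<lambda>w b. tV W w (b \<otimes>\<^bsub>A\<^esub> (c \<odot>\<^bsub>A\<^esub> \<one>\<^bsub>A\<^esub>))) t = c \<odot>\<^bsub>VA W\<^esub> t"
proof -
  interpret W: alg_bimodule k A W by (rule bimod[OF W])
  show ?thesis
    unfolding ktensor_smult[OF W.kmod_module W.A_module c]
    by (rule W.sw_cong) (use c in \<open>simp add: ktens_balanced smult_mult_right\<close>)
qed

lemma jP_smult:
  assumes W: "W \<in> B" and t: "t \<in> carrier (W \<otimes>\<^sub>B P)" and c: "c \<in> carrier k"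
  shows "jP W (c \<odot>\<^bsub>kmod A (W \<otimes>\<^sub>B P)\<^esub> t) = c \<odot>\<^bsub>VA W\<^esub> jP W t"
proof -
  have "c \<odot>\<^bsub>kmod A (W \<otimes>\<^sub>B P)\<^esub> t = ract (W \<otimes>\<^sub>B P) t (c \<odot>\<^bsub>A\<^esub> \<one>\<^bsub>A\<^esub>)"
    by (simp add: kmod_def)
  then show ?thesis
    using assms addhom_closed[OF jP_hom[OF W] t] by (simp add: jP_ract swV_smult)
qed

section \<open>Coactions from half-braidings\<close>

definition cact :: "'u bimod \<Rightarrow> ('u bimod \<Rightarrow> 'u \<Rightarrow> 'u) \<Rightarrow> 'u \<Rightarrow> 'u" where
  "cact V c = (\<lambda>v\<in>carrier V. jP V (c P (btens A P V uP v)))"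

context
  fixes V c assumes VB: "V \<in> B" and whb: "c \<in> weak_half_braidings (bimod_moncat k A) V"
begin

interpretation V: alg_bimodule k A V by (rule bimod[OF VB])

lemma c_hom: "X \<in> B \<Longrightarrow> c X \<in> bimod_hom A (X \<otimes>\<^sub>B V) (V \<otimes>\<^sub>B X)"
  using whb unfolding whb_iff[OF VB] by blast

lemma c_natural:
  "\<lbrakk>X \<in> B; Y \<in> B; f \<in> bimod_hom A X Y\<rbrakk> \<Longrightarrow>
    compose (carrier (X \<otimes>\<^sub>B V)) (tm V V X Y (\<lambda>v\<in>carrier V. v) f) (c X) =
    compose (carrier (X \<otimes>\<^sub>B V)) (c Y) (tm X Y V V f (\<lambda>v\<in>carrier V. v))"
  using whb unfolding whb_iff[OF VB] by blast

lemma c_unit: "c R = compose (carrier (R \<otimes>\<^sub>B V)) (runiti V) (lunit (bimod_moncat k A) V)"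
  using whb unfolding whb_iff[OF VB] by blast

lemma c_hexagon: "\<lbrakk>X \<in> B; Y \<in> B\<rbrakk> \<Longrightarrow> c (X \<otimes>\<^sub>B Y) = hexagon V X Y (c X) (c Y)"
  using whb unfolding whb_iff[OF VB] by blast

lemmas cP = bimod_homD[OF c_hom[OF P_bimodule]]

lemma uPv [simp]: "v \<in> carrier V \<Longrightarrow> btens A P V uP v \<in> carrier (P \<otimes>\<^sub>B V)"
  by (simp add: VB)

lemma cact_eq: "v \<in> carrier V \<Longrightarrow> cact V c v = jP V (c P (btens A P V uP v))"
  by (simp add: cact_def)

lemma cact_closed [simp]: "v \<in> carrier V \<Longrightarrow> cact V c v \<in> carrier V.MA"
  using addhom_closed[OF jP_hom[OF VB] cP(3)[OF uPv]] by (simp add: cact_eq)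

text \<open>Naturality along \<open>fP X x\<close>, which takes the generator to x, makes the value
  of c at x \<otimes> v the image of its value at the generator of \<open>P\<close> tensored with v.
  By \<open>jP_recover\<close> that image is v[0] \<otimes> x v[1] for the coaction read off at
  \<open>P\<close>.\<close>

lemma c_braids:
  assumes X: "X \<in> B"
  shows "braids V (cact V c) X (c X)"
  unfolding braids_def
proof (intro conjI ballI c_hom X)
  fix x v assume x: "x \<in> carrier X" and v: "v \<in> carrier V"
  note f = fP_hom[OF X x]
  have "compose (carrier (P \<otimes>\<^sub>B V)) (tm V V P X (\<lambda>v\<in>carrier V. v) (fP X x)) (c P) (btens A P V uP v) =
    compose (carrier (P \<otimes>\<^sub>B V)) (c X) (tm P X V V (fP X x) (\<lambda>v\<in>carrier V. v)) (btens A P V uP v)"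
    using c_natural[OF P_bimodule X f] by simp
  then have "tm V V P X (\<lambda>v\<in>carrier V. v) (fP X x) (c P (btens A P V uP v)) = c X (btens A X V x v)"
    using VB X x v f by (simp add: compose_eq tm_btens id_hom fP_uP)
  then show "c X (btens A X V x v) = V.sw (V \<otimes>\<^sub>B X) (\<lambda>w b. btens A V X w (ract X x b)) (cact V c v)"
    using jP_recover[OF VB X f cP(3)[OF uPv[OF v]]] v by (simp add: cact_eq fP_uP X x)
qed

lemma c_btens:
  "\<lbrakk>X \<in> B; x \<in> carrier X; v \<in> carrier V\<rbrakk> \<Longrightarrow>
    c X (btens A X V x v) = V.sw (V \<otimes>\<^sub>B X) (\<lambda>w b. btens A V X w (ract X x b)) (cact V c v)"
  using c_braids[of X] by (simp add: braids_def)

text \<open>The axioms of the coaction move an element of A past the generator, which then becomes a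
  tensor x \<otimes> y; this is the value of the braiding there.\<close>

lemma jP_c_tA:
  assumes x: "x \<in> carrier A" and y: "y \<in> carrier A" and v: "v \<in> carrier V"
  shows "jP V (c P (btens A P V (tA x y) v)) = V.sw V.MA (\<lambda>w b. V.tens (ract V w x) (y \<otimes>\<^bsub>A\<^esub> b)) (cact V c v)"
proof -
  have p: "tA x y \<in> carrier P" using x y by simp
  have "jP V (c P (btens A P V (tA x y) v)) =
      V.sw V.MA (\<lambda>w b. jP V (btens A V P w (ract P (tA x y) b))) (cact V c v)"
    unfolding c_btens[OF P_bimodule p v]
    by (rule swV_comp[OF VB _ _ jP_hom[OF VB] btens_kbal[OF VB P_bimodule p]]) (use VB v in simp_all)
  also have "\<dots> = V.sw V.MA (\<lambda>w b. V.tens (ract V w x) (y \<otimes>\<^bsub>A\<^esub> b)) (cact V c v)"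
    by (rule V.sw_cong) (use VB x y in \<open>simp add: jP_btens\<close>)
  finally show ?thesis .
qed

lemma cact_ract:
  assumes v: "v \<in> carrier V" and a: "a \<in> carrier A"
  shows "cact V c (ract V v a) = V.sw V.MA (\<lambda>w b. V.tens w (b \<otimes>\<^bsub>A\<^esub> a)) (cact V c v)"
proof -
  have "btens A P V uP (ract V v a) = ract (P \<otimes>\<^sub>B V) (btens A P V uP v) a"
    using VB v a by (simp add: ract_btens)
  then show ?thesis
    using VB v a cP(3)[OF uPv] by (simp add: cact_eq V.ract_closed cP(5) jP_ract)
qed

lemma cact_klinear: "cact V c \<in> klinear k (kmod A V) V.MA"
proof (rule klinearI)
  show "cact V c \<in> extensional (carrier (kmod A V))"
    by (simp add: cact_def)
  fix v w assume "v \<in> carrier (kmod A V)" "w \<in> carrier (kmod A V)"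
  then show "cact V c (v \<oplus>\<^bsub>kmod A V\<^esub> w) = cact V c v \<oplus>\<^bsub>V.MA\<^esub> cact V c w"
    using VB cP(3)[OF uPv] addhom_add[OF jP_hom[OF VB]]
    by (simp add: cact_eq btens_add_right cP(4))
next
  fix r v assume "r \<in> carrier k" "v \<in> carrier (kmod A V)"
  then show "cact V c (r \<odot>\<^bsub>kmod A V\<^esub> v) = r \<odot>\<^bsub>V.MA\<^esub> cact V c v"
    using VB by (simp add: V.kmod_smult cact_ract swV_smult)
qed simp

text \<open>The braiding at the unit object takes 1 \<otimes> v to v \<otimes> 1 by the unit axiom
  and to v[0] \<otimes> v[1] by \<open>c_braids\<close>; the right unit constraint sends these to v
  and to v[0] v[1].\<close>

lemma cact_counit:
  assumes v: "v \<in> carrier V"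
  shows "V.sw V (\<lambda>w a. ract V w a) (cact V c v) = v"
proof -
  let ?r = "runit (bimod_moncat k A) V"
  have r: "?r \<in> bimod_hom A (V \<otimes>\<^sub>B R) V"
    using runit_inverse[OF VB] by (simp add: inverse_arrows_def)
  have ra: "?r (btens A V R w a) = ract V w a" if "w \<in> carrier V" "a \<in> carrier A" for w a
    using that VB by (simp add: runit_def runit_bbal)
  have one: "\<one>\<^bsub>A\<^esub> \<in> carrier R" by simp
  have "?r (c R (btens A R V \<one>\<^bsub>A\<^esub> v)) = V.sw V (\<lambda>w b. ?r (btens A V R w (ract R \<one>\<^bsub>A\<^esub> b))) (cact V c v)"
    unfolding c_btens[OF regular_bimodule one v]
    by (rule swV_comp[OF VB _ _ bimod_homD(1)[OF r] btens_kbal[OF VB regular_bimodule one]]) (use VB v in simp_all)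
  also have "\<dots> = V.sw V (\<lambda>w a. ract V w a) (cact V c v)"
    by (rule V.sw_cong) (simp add: ra)
  finally show ?thesis
    unfolding c_unit using VB v by (simp add: compose_eq lunit_btens runiti_def ra V.lact_one V.ract_one)
qed

text \<open>Multiplicativity at the pair \<open>P\<close>, \<open>P\<close>, applied to two
  generators and v. Braiding in two steps yields \<rho>(v[0]) \<otimes> v[1], braiding in one step
  yields v[0] \<otimes> 1 \<otimes> v[1], and both are read in (V \<otimes> A) \<otimes> A.\<close>

lemma cact_coassoc:
  assumes v: "v \<in> carrier V"
  shows "V.sw V.MAA (\<lambda>w b. ktens k V.MA A (cact V c w) b) (cact V c v) =
    V.sw V.MAA (\<lambda>w b. ktens k V.MA A (V.tens w \<one>\<^bsub>A\<^esub>) b) (cact V c v)"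
proof -
  have VP: "V \<otimes>\<^sub>B P \<in> B" using VB by simp
  have PP: "P \<otimes>\<^sub>B P \<in> B" by simp
  interpret VP: alg_bimodule k A "V \<otimes>\<^sub>B P" by (rule bimod[OF VP])
  \<comment> \<open>The comparison map \<open>jP\<close> is applied twice: first (V \<otimes> P)
    \<otimes> P goes to (V \<otimes> P) \<otimes> A, and then \<open>?l\<close> continues to (V
    \<otimes> A) \<otimes> A.\<close>
  let ?l = "klift k (kmod A (V \<otimes>\<^sub>B P)) A V.MAA (\<lambda>s b. ktens k V.MA A (jP V s) b)"
  let ?h = "\<lambda>t. ?l (jP (V \<otimes>\<^sub>B P) t)"
  note jc = addhom_closed[OF jP_hom[OF VB]] and ja = addhom_add[OF jP_hom[OF VB]]
  have lb: "VP.bal V.MAA (\<lambda>s b. ktens k V.MA A (jP V s) b)"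
    by (rule VP.balI) (use VB in \<open>simp_all add: jc ja jP_smult V.tens_simps\<close>)
  have "?l \<in> addhom (VA (V \<otimes>\<^sub>B P)) V.MAA"
    by (rule klift_addhom) (simp_all add: lb)
  from hom_compose[OF jP_hom[OF VP] this]
  have h: "?h \<in> addhom ((V \<otimes>\<^sub>B P) \<otimes>\<^sub>B P) V.MAA" by (simp add: o_def)
  have h_btens: "?h (btens A (V \<otimes>\<^sub>B P) P (btens A V P w (tA \<one>\<^bsub>A\<^esub> a)) (tA \<one>\<^bsub>A\<^esub> b)) = ktens k V.MA A (V.tens w a) b"
    if "w \<in> carrier V" "a \<in> carrier A" "b \<in> carrier A" for w a b
    using that VB by (simp add: jP_btens[OF VP] lb VP.ract_one) (simp add: jP_btens V.ract_one)
  let ?u = "btens A P P uP uP"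
  have u: "?u \<in> carrier (P \<otimes>\<^sub>B P)" by simp
  let ?H = "hexagon V P P (c P) (c P)"
  \<comment> \<open>The last reassociation of the composite is cancelled, since
    \<open>hexagon_inner\<close> describes what precedes it.\<close>
  have "asci V P P (?H (btens A (P \<otimes>\<^sub>B P) V ?u v)) =
      tm (P \<otimes>\<^sub>B V) (V \<otimes>\<^sub>B P) P P (c P) (\<lambda>y\<in>carrier P. y) (asci P V P (btens A P (V \<otimes>\<^sub>B P) uP (c P (btens A P V uP v))))"
    (is "_ = ?t")
  proof -
    have t: "?t \<in> carrier ((V \<otimes>\<^sub>B P) \<otimes>\<^sub>B P)"
      using VB v cP(3)[OF uPv[OF v]]
      by (intro bimod_homD(3)[OF tm_hom] bimod_homD(3)[OF asci_hom] btens_closed id_hom c_hom) simp_all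
    have "compose (carrier ((V \<otimes>\<^sub>B P) \<otimes>\<^sub>B P)) (asci V P P) (asc V P P) ?t = ?t"
      using asc_inverse[OF VB P_bimodule P_bimodule] t by (simp add: inverse_arrows_def)
    then show ?thesis
      unfolding hexagon_btens[OF VB P_bimodule P_bimodule c_hom[OF P_bimodule] c_hom[OF P_bimodule] uP_closed uP_closed v]
      using t by (simp add: compose_eq)
  qed
  then have "?h (asci V P P (?H (btens A (P \<otimes>\<^sub>B P) V ?u v))) =
      V.sw V.MAA (\<lambda>w b. V.sw V.MAA (\<lambda>w' b'. ?h (btens A (V \<otimes>\<^sub>B P) P (btens A V P w' (ract P uP b')) (ract P uP b))) (cact V c w)) (cact V c v)"
    using hexagon_inner[OF VB P_bimodule P_bimodule V.MAA_abelian _ c_braids[OF P_bimodule] c_braids[OF P_bimodule]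
        uP_closed uP_closed v h] by simp
  also have "\<dots> = V.sw V.MAA (\<lambda>w b. V.sw V.MAA (\<lambda>w' b'. ktens k V.MA A (V.tens w' b') b) (cact V c w)) (cact V c v)"
    by (intro V.sw_cong) (simp add: h_btens)
  also have "\<dots> = V.sw V.MAA (\<lambda>w b. ktens k V.MA A (cact V c w) b) (cact V c v)"
  proof (rule V.sw_cong)
    fix w b assume w: "w \<in> carrier V" and b: "b \<in> carrier A"
    have t: "(\<lambda>t. ktens k V.MA A t b) \<in> addhom V.MA V.MAA"
      by (rule addhomI) (use b in \<open>simp_all add: ktens_add_left\<close>)
    have "ktens k V.MA A (V.sw V.MA (\<lambda>w b. V.tens w b) (cact V c w)) b =
        V.sw V.MAA (\<lambda>w' b'. ktens k V.MA A (V.tens w' b') b) (cact V c w)"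
      by (rule swV_comp[OF VB _ _ t]) (use w in \<open>simp_all add: ktens_is_balanced\<close>)
    then show "V.sw V.MAA (\<lambda>w' b'. ktens k V.MA A (V.tens w' b') b) (cact V c w) = ktens k V.MA A (cact V c w) b"
      using w by (simp add: klift_ktens_id)
  qed
  finally have "V.sw V.MAA (\<lambda>w b. ktens k V.MA A (cact V c w) b) (cact V c v) =
      ?h (asci V P P (c (P \<otimes>\<^sub>B P) (btens A (P \<otimes>\<^sub>B P) V ?u v)))"
    using c_hexagon[OF P_bimodule P_bimodule] by simp
  also have "\<dots> = V.sw V.MAA (\<lambda>w b. ?h (asci V P P (btens A V (P \<otimes>\<^sub>B P) w (ract (P \<otimes>\<^sub>B P) ?u b)))) (cact V c v)"
  proof -
    have ha: "(\<lambda>t. ?h (asci V P P t)) \<in> addhom (V \<otimes>\<^sub>B (P \<otimes>\<^sub>B P)) V.MAA"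
      using hom_compose[OF bimod_homD(1)[OF asci_hom[OF VB P_bimodule P_bimodule]] h] by (simp add: o_def)
    show ?thesis
      unfolding c_btens[OF PP u v]
      by (rule swV_comp[OF VB _ _ ha btens_kbal[OF VB PP u]]) (use VB v in simp_all)
  qed
  \<comment> \<open>Acting by b on the pair of generators changes only its last tensor factor, so
    the first copy of \<open>P\<close> contributes the 1 in the middle.\<close>
  also have "\<dots> = V.sw V.MAA (\<lambda>w b. ktens k V.MA A (V.tens w \<one>\<^bsub>A\<^esub>) b) (cact V c v)"
    by (rule V.sw_cong) (use VB in \<open>simp add: ract_btens asci_btens h_btens\<close>)
  finally show ?thesis .
qed

text \<open>In \<open>P\<close> the generator satisfies (1 \<otimes> 1) a = 1 \<otimes> a, so
  balance over A turns the generator tensored with a v into 1 \<otimes> a tensored with v, which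
  gives left linearity. It also satisfies a (1 \<otimes> 1) = a \<otimes> 1, so left linearity of
  the braiding at \<open>P\<close> gives the exchange law.\<close>

lemma cact_yd: "cact V c \<in> yetter_drinfeld_coactions k A V"
proof -
  have "cact V c \<in> coactions k A V"
    unfolding coactions_def Let_def
    by (intro CollectI conjI ballI cact_klinear cact_counit cact_coassoc cact_ract)
  then show ?thesis
    unfolding yetter_drinfeld_coactions_def Let_def
  proof (intro CollectI conjI ballI)
    fix a v assume a: "a \<in> carrier A" and v: "v \<in> carrier V"
    have "btens A P V uP (lact V a v) = btens A P V (tA \<one>\<^bsub>A\<^esub> a) v"
      using VB a v btens_balanced[OF P_bimodule VB uP_closed a v] by simp
    then have "cact V c (lact V a v) = V.sw V.MA (\<lambda>w b. V.tens (ract V w \<one>\<^bsub>A\<^esub>) (a \<otimes>\<^bsub>A\<^esub> b)) (cact V c v)"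
      using a v by (simp add: cact_eq[of "lact V a v"] V.lact_closed jP_c_tA)
    also have "\<dots> = V.sw V.MA (\<lambda>w b. V.tens w (a \<otimes>\<^bsub>A\<^esub> b)) (cact V c v)"
      by (rule V.sw_cong) (simp add: V.ract_one)
    finally show "cact V c (lact V a v) = V.sw V.MA (\<lambda>w b. V.tens w (a \<otimes>\<^bsub>A\<^esub> b)) (cact V c v)" .
    have "V.sw V.MA (\<lambda>w b. V.tens (lact V a w) b) (cact V c v) = jP V (lact (V \<otimes>\<^sub>B P) a (c P (btens A P V uP v)))"
      using VB a v cP(3)[OF uPv[OF v]] by (simp add: jP_lact cact_eq)
    also have "\<dots> = jP V (c P (btens A P V (tA a \<one>\<^bsub>A\<^esub>) v))"
      using VB a v uPv[OF v] by (simp add: cP(6)[symmetric] lact_btens)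
    also have "\<dots> = V.sw V.MA (\<lambda>w b. V.tens (ract V w a) (\<one>\<^bsub>A\<^esub> \<otimes>\<^bsub>A\<^esub> b)) (cact V c v)"
      using a v by (simp add: jP_c_tA)
    also have "\<dots> = V.sw V.MA (\<lambda>w b. V.tens (ract V w a) b) (cact V c v)"
      by (rule V.sw_cong) simp
    finally show "V.sw V.MA (\<lambda>w b. V.tens (lact V a w) b) (cact V c v) =
        V.sw V.MA (\<lambda>w b. V.tens (ract V w a) b) (cact V c v)" .
  qed
qed

text \<open>By \<open>c_braids\<close> the given half-braiding already satisfies the formula that
  defines \<open>brd\<close>; extensionality of the family over the objects settles the
  rest.\<close>

lemma brd_cact: "brd V (cact V c) = c"
proof (rule extensionalityI[of _ B])
  fix X assume X: "X \<in> B"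
  show "brd V (cact V c) X = c X"
    by (rule btensor_bimod_hom_eqI[OF X VB brd_hom[OF VB cact_yd X] c_hom[OF X]])
      (simp add: brd_btens[OF VB cact_yd X] c_btens[OF X])
next
  show "c \<in> extensional B"
    using whb unfolding whb_iff[OF VB] by (simp add: PiE_def)
qed (simp add: brd_def)

end

lemma cact_brd:
  assumes V: "V \<in> B" and rho: "\<rho> \<in> yetter_drinfeld_coactions k A V"
  shows "cact V (brd V \<rho>) = \<rho>"
proof -
  interpret Y: yetter_drinfeld k A V \<rho> by (rule yetter_drinfeldI[OF V rho])
  show ?thesis
  proof (rule extensionalityI[of _ "carrier V"])
    fix v assume v: "v \<in> carrier V"
    have "cact V (brd V \<rho>) v = Y.sw Y.MA (\<lambda>w b. jP V (btens A V P w (ract P uP b))) (\<rho> v)"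
      unfolding cact_eq[OF V brd_whb[OF V rho] v] brd_btens[OF V rho P_bimodule uP_closed v]
      by (rule swV_comp[OF V _ _ jP_hom[OF V] btens_kbal[OF V P_bimodule uP_closed]]) (use V v in simp_all)
    also have "\<dots> = Y.sw Y.MA (\<lambda>w b. Y.tens w b) (\<rho> v)"
      by (rule Y.sw_cong) (use V in \<open>simp add: jP_btens Y.ract_one\<close>)
    finally show "cact V (brd V \<rho>) v = \<rho> v"
      using v by (simp add: Y.rho_eq_sw)
  qed (simp_all add: cact_def Y.rho_extensional)
qed

section \<open>Invertibility of the half-braidings\<close>

context
  fixes V \<rho> assumes VB: "V \<in> B" and rho: "\<rho> \<in> yetter_drinfeld_coactions k A V"
begin

interpretation Y: yetter_drinfeld k A V \<rho> by (rule yetter_drinfeldI[OF VB rho])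

lemma brdi_kbal:
  assumes X: "X \<in> B" and x: "x \<in> carrier X"
  shows "Y.bal (X \<otimes>\<^sub>B V) (\<lambda>w b. btens A X V (lact X b x) w)"
proof -
  interpret X: alg_bimodule k A X by (rule bimod[OF X])
  show ?thesis
  proof (rule Y.balI)
    fix w r b assume w: "w \<in> carrier V" and r: "r \<in> carrier k" and b: "b \<in> carrier A"
    have "btens A X V (lact X b x) (r \<odot>\<^bsub>kmod A V\<^esub> w) = btens A X V (lact X b x) (lact V (r \<odot>\<^bsub>A\<^esub> \<one>\<^bsub>A\<^esub>) w)"
      using r w by (simp add: Y.kmod_smult Y.central)
    also have "\<dots> = btens A X V (ract X (lact X b x) (r \<odot>\<^bsub>A\<^esub> \<one>\<^bsub>A\<^esub>)) w"
      by (rule btens_balanced[symmetric]) (use VB X x w r b in simp_all)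
    also have "ract X (lact X b x) (r \<odot>\<^bsub>A\<^esub> \<one>\<^bsub>A\<^esub>) = lact X (r \<odot>\<^bsub>A\<^esub> b) x"
      using X x r b by (simp add: X.kmod_smult[symmetric] X.lact_smult_left)
    finally show "btens A X V (lact X b x) (r \<odot>\<^bsub>kmod A V\<^esub> w) = btens A X V (lact X (r \<odot>\<^bsub>A\<^esub> b) x) w" .
  qed (use VB X x in \<open>simp_all add: btens_add_left btens_add_right b_adds\<close>)
qed

text \<open>The inverse half-braiding \<open>v \<otimes> x \<mapsto> v\<^sub>[\<^sub>1\<^sub>] x \<otimes> v\<^sub>[\<^sub>0\<^sub>]\<close>.\<close>

definition brdi where
  "brdi X = lift V X (X \<otimes>\<^sub>B V) (\<lambda>v x. Y.sw (X \<otimes>\<^sub>B V) (\<lambda>w b. btens A X V (lact X b x) w) (\<rho> v))"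

context
  fixes X assumes X: "X \<in> B"
begin

lemma XV [simp]: "X \<otimes>\<^sub>B V \<in> B" "abelian_group (X \<otimes>\<^sub>B V)" "V \<otimes>\<^sub>B X \<in> B" "abelian_group (V \<otimes>\<^sub>B X)"
  using VB X by simp_all

text \<open>For the inverse the roles of the axioms shift: balance over A is now right linearity of
  \<rho>, as v a \<otimes> x goes to v[1] a x \<otimes> v[0].\<close>

lemma brdi_bbal:
  "bbal V X (X \<otimes>\<^sub>B V) (\<lambda>v x. Y.sw (X \<otimes>\<^sub>B V) (\<lambda>w b. btens A X V (lact X b x) w) (\<rho> v))"
proof (rule bbalI)
  fix v x x' assume x: "x \<in> carrier X" "x' \<in> carrier X" and v: "v \<in> carrier V"
  have "Y.sw (X \<otimes>\<^sub>B V) (\<lambda>w b. btens A X V (lact X b (x \<oplus>\<^bsub>X\<^esub> x')) w) (\<rho> v) =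
     Y.sw (X \<otimes>\<^sub>B V) (\<lambda>w b. btens A X V (lact X b x) w \<oplus>\<^bsub>X \<otimes>\<^sub>B V\<^esub> btens A X V (lact X b x') w) (\<rho> v)"
    by (rule Y.sw_cong) (use VB X x in \<open>simp add: b_adds btens_add_left\<close>)
  then show "Y.sw (X \<otimes>\<^sub>B V) (\<lambda>w b. btens A X V (lact X b (x \<oplus>\<^bsub>X\<^esub> x')) w) (\<rho> v) =
     Y.sw (X \<otimes>\<^sub>B V) (\<lambda>w b. btens A X V (lact X b x) w) (\<rho> v) \<oplus>\<^bsub>X \<otimes>\<^sub>B V\<^esub>
     Y.sw (X \<otimes>\<^sub>B V) (\<lambda>w b. btens A X V (lact X b x') w) (\<rho> v)"
    using X x v by (simp add: klift_plus brdi_kbal)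
next
  fix v r x assume x: "x \<in> carrier X" and r: "r \<in> carrier A" and v: "v \<in> carrier V"
  have "Y.sw (X \<otimes>\<^sub>B V) (\<lambda>w b. btens A X V (lact X b x) w) (\<rho> (ract V v r)) =
      Y.sw (X \<otimes>\<^sub>B V) (\<lambda>w b. btens A X V (lact X (b \<otimes>\<^bsub>A\<^esub> r) x) w) (\<rho> v)"
    by (rule Y.sw_ract) (use X x r v brdi_kbal in simp_all)
  also have "\<dots> = Y.sw (X \<otimes>\<^sub>B V) (\<lambda>w b. btens A X V (lact X b (lact X r x)) w) (\<rho> v)"
    by (rule Y.sw_cong) (use X x r in \<open>simp add: b_lact_mult\<close>)
  finally show "Y.sw (X \<otimes>\<^sub>B V) (\<lambda>w b. btens A X V (lact X b x) w) (\<rho> (ract V v r)) =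
      Y.sw (X \<otimes>\<^sub>B V) (\<lambda>w b. btens A X V (lact X b (lact X r x)) w) (\<rho> v)" .
qed (use X brdi_kbal in \<open>simp_all add: Y.sw_closed Y.sw_rho_add\<close>)

lemma brdi_btens:
  "\<lbrakk>v \<in> carrier V; x \<in> carrier X\<rbrakk> \<Longrightarrow>
    brdi X (btens A V X v x) = Y.sw (X \<otimes>\<^sub>B V) (\<lambda>w b. btens A X V (lact X b x) w) (\<rho> v)"
  by (simp add: brdi_def brdi_bbal VB X)

text \<open>Left linearity comes from left linearity of \<rho>. For right linearity, v[1] x a
  \<otimes> v[0] = v[1] x \<otimes> a v[0], and the exchange law replaces a v[0] by v[0] a.\<close>

lemma brdi_hom: "brdi X \<in> bimod_hom A (V \<otimes>\<^sub>B X) (X \<otimes>\<^sub>B V)"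
  unfolding brdi_def
proof (rule blift_bimod_hom[OF VB X XV(1) brdi_bbal])
  fix a v x assume a: "a \<in> carrier A" and x: "x \<in> carrier X" and v: "v \<in> carrier V"
  have "Y.sw (X \<otimes>\<^sub>B V) (\<lambda>w b. btens A X V (lact X b x) w) (\<rho> (lact V a v)) =
     Y.sw (X \<otimes>\<^sub>B V) (\<lambda>w b. btens A X V (lact X (a \<otimes>\<^bsub>A\<^esub> b) x) w) (\<rho> v)"
    by (rule Y.sw_lact[OF XV(2) brdi_kbal[OF X x] v a])
  also have "\<dots> = Y.sw (X \<otimes>\<^sub>B V) (\<lambda>w b. lact (X \<otimes>\<^sub>B V) a (btens A X V (lact X b x) w)) (\<rho> v)"
    by (rule Y.sw_cong) (use VB X a x in \<open>simp add: lact_btens b_lact_mult\<close>)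
  also have "\<dots> = lact (X \<otimes>\<^sub>B V) a (Y.sw (X \<otimes>\<^sub>B V) (\<lambda>w b. btens A X V (lact X b x) w) (\<rho> v))"
    by (rule Y.sw_comp[OF XV(2) XV(2) lact_addhom[OF XV(1) a] brdi_kbal[OF X x] v, symmetric])
  finally show "Y.sw (X \<otimes>\<^sub>B V) (\<lambda>w b. btens A X V (lact X b x) w) (\<rho> (lact V a v)) =
     lact (X \<otimes>\<^sub>B V) a (Y.sw (X \<otimes>\<^sub>B V) (\<lambda>w b. btens A X V (lact X b x) w) (\<rho> v))" .
  have "Y.sw (X \<otimes>\<^sub>B V) (\<lambda>w b. btens A X V (lact X b (ract X x a)) w) (\<rho> v) =
     Y.sw (X \<otimes>\<^sub>B V) (\<lambda>w b. btens A X V (lact X b x) (lact V a w)) (\<rho> v)"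
    by (rule Y.sw_cong) (use VB X a x in \<open>simp add: b_lact_ract[symmetric] btens_balanced\<close>)
  also have "\<dots> = Y.sw (X \<otimes>\<^sub>B V) (\<lambda>w b. btens A X V (lact X b x) (ract V w a)) (\<rho> v)"
    by (rule Y.sw_lact_left[OF XV(2) brdi_kbal[OF X x] v a])
  also have "\<dots> = Y.sw (X \<otimes>\<^sub>B V) (\<lambda>w b. ract (X \<otimes>\<^sub>B V) (btens A X V (lact X b x) w) a) (\<rho> v)"
    by (rule Y.sw_cong) (use VB X a x in \<open>simp add: ract_btens\<close>)
  also have "\<dots> = ract (X \<otimes>\<^sub>B V) (Y.sw (X \<otimes>\<^sub>B V) (\<lambda>w b. btens A X V (lact X b x) w) (\<rho> v)) a"
    by (rule Y.sw_comp[OF XV(2) XV(2) ract_addhom[OF XV(1) a] brdi_kbal[OF X x] v, symmetric])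
  finally show "Y.sw (X \<otimes>\<^sub>B V) (\<lambda>w b. btens A X V (lact X b (ract X x a)) w) (\<rho> v) =
     ract (X \<otimes>\<^sub>B V) (Y.sw (X \<otimes>\<^sub>B V) (\<lambda>w b. btens A X V (lact X b x) w) (\<rho> v)) a" .
qed

lemma smult_b:
  assumes "r \<in> carrier k" "a \<in> carrier A" "x \<in> carrier X"
  shows "lact X (r \<odot>\<^bsub>A\<^esub> a) x = lact X (r \<odot>\<^bsub>A\<^esub> \<one>\<^bsub>A\<^esub>) (lact X a x)"
    and "ract X x (r \<odot>\<^bsub>A\<^esub> a) = lact X (r \<odot>\<^bsub>A\<^esub> \<one>\<^bsub>A\<^esub>) (ract X x a)"
proof -
  interpret X: alg_bimodule k A X by (rule bimod[OF X])
  show "lact X (r \<odot>\<^bsub>A\<^esub> a) x = lact X (r \<odot>\<^bsub>A\<^esub> \<one>\<^bsub>A\<^esub>) (lact X a x)"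
    "ract X x (r \<odot>\<^bsub>A\<^esub> a) = lact X (r \<odot>\<^bsub>A\<^esub> \<one>\<^bsub>A\<^esub>) (ract X x a)"
    using assms X by (simp_all add: X.central X.kmod_smult[symmetric] X.lact_smult_left X.ract_smult_right X.lact_one)
qed

lemma lact_smult_one:
  "\<lbrakk>r \<in> carrier k; a \<in> carrier A; y \<in> carrier X\<rbrakk> \<Longrightarrow>
    lact X a (lact X (r \<odot>\<^bsub>A\<^esub> \<one>\<^bsub>A\<^esub>) y) = lact X (r \<odot>\<^bsub>A\<^esub> \<one>\<^bsub>A\<^esub>) (lact X a y)"
  by (simp add: X b_lact_mult[symmetric] smult_mult_left smult_mult_right)

text \<open>v \<otimes> x goes to v[1] x \<otimes> v[0] and on to v[0][0] \<otimes> v[1] x v[0][1].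
  Coassociativity leaves v[0] \<otimes> v[1] x = v[0] v[1] \<otimes> x, and the counit gives v
  \<otimes> x.\<close>

lemma brd_brdi:
  assumes v: "v \<in> carrier V" and x: "x \<in> carrier X"
  shows "brd V \<rho> X (brdi X (btens A V X v x)) = btens A V X v x"
proof -
  have "brd V \<rho> X (brdi X (btens A V X v x)) =
      Y.sw (V \<otimes>\<^sub>B X) (\<lambda>w b. brd V \<rho> X (btens A X V (lact X b x) w)) (\<rho> v)"
    unfolding brdi_btens[OF v x]
    by (rule Y.sw_comp[OF XV(2) XV(4) bimod_homD(1)[OF brd_hom[OF VB rho X]] brdi_kbal[OF X x] v])
  also have "\<dots> = Y.sw (V \<otimes>\<^sub>B X) (\<lambda>w b. Y.sw (V \<otimes>\<^sub>B X) (\<lambda>w' b'. btens A V X w' (ract X (lact X b x) b')) (\<rho> w)) (\<rho> v)"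
    by (rule Y.sw_cong) (use X x in \<open>simp add: brd_btens[OF VB rho]\<close>)
  also have "\<dots> = Y.sw (V \<otimes>\<^sub>B X) (\<lambda>w b. btens A V X w (ract X (lact X b x) \<one>\<^bsub>A\<^esub>)) (\<rho> v)"
  proof (rule Y.sw_coassoc[OF XV(4) _ v])
    have "btens A V X (r \<odot>\<^bsub>kmod A V\<^esub> w) (ract X (lact X b x) a) = btens A V X w (ract X (lact X b x) (r \<odot>\<^bsub>A\<^esub> a))"
      "ract X (lact X b x) (r \<odot>\<^bsub>A\<^esub> a) = ract X (lact X (r \<odot>\<^bsub>A\<^esub> b) x) a"
      if "r \<in> carrier k" "w \<in> carrier V" "a \<in> carrier A" "b \<in> carrier A" for r w a b
    proof -
      show "btens A V X (r \<odot>\<^bsub>kmod A V\<^esub> w) (ract X (lact X b x) a) = btens A V X w (ract X (lact X b x) (r \<odot>\<^bsub>A\<^esub> a))"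
        using that x X VB btens_balanced[OF VB X, of w "r \<odot>\<^bsub>A\<^esub> \<one>\<^bsub>A\<^esub>" "ract X (lact X b x) a"]
        by (simp add: Y.kmod_smult smult_b(2)[of r a])
      show "ract X (lact X b x) (r \<odot>\<^bsub>A\<^esub> a) = ract X (lact X (r \<odot>\<^bsub>A\<^esub> b) x) a"
        using that x X by (simp add: smult_b(2)[of r a] smult_b(1)[of r b] b_lact_ract lact_smult_one)
    qed
    then show "Y.trilinear (V \<otimes>\<^sub>B X) (\<lambda>w' b' b. btens A V X w' (ract X (lact X b x) b'))"
      using VB X x by (simp add: Y.trilinear_def btens_add_left btens_add_right b_adds)
  qed
  also have "\<dots> = Y.sw (V \<otimes>\<^sub>B X) (\<lambda>w b. btens A V X (ract V w b) x) (\<rho> v)"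
    by (rule Y.sw_cong) (use VB X x in \<open>simp add: b_ract_one btens_balanced\<close>)
  also have "\<dots> = btens A V X (Y.sw V (\<lambda>w b. ract V w b) (\<rho> v)) x"
    by (rule Y.sw_comp[OF _ XV(4) btens_left_addhom[OF VB X x] _ v, symmetric]) simp_all
  finally show ?thesis using v by (simp add: Y.counit)
qed

text \<open>x \<otimes> v goes to v[0] \<otimes> x v[1] and on to v[0][1] x v[1] \<otimes> v[0][0],
  which is x v[1] \<otimes> v[0] by coassociativity. Balancing turns v[1] into a left action on
  v[0], and the result v[1] v[0] still has to be recognized as v.\<close>

lemma brdi_brd:
  assumes v: "v \<in> carrier V" and x: "x \<in> carrier X"
  shows "brdi X (brd V \<rho> X (btens A X V x v)) = btens A X V x v"
proof -
  have "brdi X (brd V \<rho> X (btens A X V x v)) =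
      Y.sw (X \<otimes>\<^sub>B V) (\<lambda>w b. brdi X (btens A V X w (ract X x b))) (\<rho> v)"
    unfolding brd_btens[OF VB rho X x v]
    by (rule Y.sw_comp[OF XV(4) XV(2) bimod_homD(1)[OF brdi_hom] brd_kbal[OF VB rho X x] v])
  also have "\<dots> = Y.sw (X \<otimes>\<^sub>B V) (\<lambda>w b. Y.sw (X \<otimes>\<^sub>B V) (\<lambda>w' b'. btens A X V (lact X b' (ract X x b)) w') (\<rho> w)) (\<rho> v)"
    by (rule Y.sw_cong) (use X x in \<open>simp add: brdi_btens\<close>)
  also have "\<dots> = Y.sw (X \<otimes>\<^sub>B V) (\<lambda>w b. btens A X V (lact X \<one>\<^bsub>A\<^esub> (ract X x b)) w) (\<rho> v)"
  proof (rule Y.sw_coassoc[OF XV(2) _ v])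
    have "btens A X V (lact X a (ract X x b)) (r \<odot>\<^bsub>kmod A V\<^esub> w) = btens A X V (lact X (r \<odot>\<^bsub>A\<^esub> a) (ract X x b)) w"
      "lact X (r \<odot>\<^bsub>A\<^esub> a) (ract X x b) = lact X a (ract X x (r \<odot>\<^bsub>A\<^esub> b))"
      if "r \<in> carrier k" "w \<in> carrier V" "a \<in> carrier A" "b \<in> carrier A" for r w a b
    proof -
      show "btens A X V (lact X a (ract X x b)) (r \<odot>\<^bsub>kmod A V\<^esub> w) = btens A X V (lact X (r \<odot>\<^bsub>A\<^esub> a) (ract X x b)) w"
        using brdi_kbal[OF X, of "ract X x b"] that X x by (simp add: balanced_def)
      show "lact X (r \<odot>\<^bsub>A\<^esub> a) (ract X x b) = lact X a (ract X x (r \<odot>\<^bsub>A\<^esub> b))"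
        using that x X by (simp add: smult_b(2)[of r b] smult_b(1)[of r a] lact_smult_one)
    qed
    then show "Y.trilinear (X \<otimes>\<^sub>B V) (\<lambda>w' b' b. btens A X V (lact X b' (ract X x b)) w')"
      using VB X x by (simp add: Y.trilinear_def btens_add_left btens_add_right b_adds)
  qed
  also have "\<dots> = Y.sw (X \<otimes>\<^sub>B V) (\<lambda>w b. btens A X V x (Y.la b w)) (\<rho> v)"
    by (rule Y.sw_cong) (use VB X x in \<open>simp add: b_lact_one btens_balanced Y.lact_eq_la\<close>)
  also have "\<dots> = btens A X V x (Y.sw V (\<lambda>w b. Y.la b w) (\<rho> v))"
    by (rule Y.sw_comp[OF _ XV(2) btens_right_addhom[OF X VB x] _ v, symmetric])
      (auto intro!: Y.balI simp: Y.la_simps)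
  \<comment> \<open>Unfolded, the left action of v[1] on v[0] is v[0][0] (v[1] v[0][1]);
    coassociativity turns the last factor into 1, and the counit applies to what remains.\<close>
  also have "Y.sw V (\<lambda>w b. Y.la b w) (\<rho> v) = Y.sw V (\<lambda>w b. ract V w (b \<otimes>\<^bsub>A\<^esub> \<one>\<^bsub>A\<^esub>)) (\<rho> v)"
    unfolding Y.la_def
    by (rule Y.sw_coassoc[OF _ _ v])
      (auto simp: Y.trilinear_def Y.ract_simps Y.mult_simps)
  also have "\<dots> = Y.sw V (\<lambda>w b. ract V w b) (\<rho> v)"
    by (rule Y.sw_cong) simp
  finally show ?thesis using v by (simp add: Y.counit)
qed

lemma brd_iso: "iso_arrow (bimod_moncat k A) (X \<otimes>\<^sub>B V) (V \<otimes>\<^sub>B X) (brd V \<rho> X)"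
  unfolding iso_arrow_def inverse_arrows_def moncat_simps
proof (intro exI[of _ "brdi X"] conjI brdi_hom brd_hom VB rho X)
  note b = brd_hom[OF VB rho X]
  show "compose (carrier (X \<otimes>\<^sub>B V)) (brdi X) (brd V \<rho> X) = (\<lambda>x\<in>carrier (X \<otimes>\<^sub>B V). x)"
    by (rule btensor_bimod_hom_eqI[OF X VB comp_hom[OF _ _ _ b brdi_hom] id_hom])
      (use VB X in \<open>simp_all add: compose_eq brdi_brd\<close>)
  show "compose (carrier (V \<otimes>\<^sub>B X)) (brd V \<rho> X) (brdi X) = (\<lambda>x\<in>carrier (V \<otimes>\<^sub>B X). x)"
    by (rule btensor_bimod_hom_eqI[OF VB X comp_hom[OF _ _ _ brdi_hom b] id_hom])
      (use VB X in \<open>simp_all add: compose_eq brd_brdi\<close>)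
qed

end

end

lemma wrc_simps [simp]:
  "Obj (weak_right_center (bimod_moncat k A)) =
     {(V, c). V \<in> B \<and> c \<in> weak_half_braidings (bimod_moncat k A) V}"
  "Hom (weak_right_center (bimod_moncat k A)) (V, c) (V', c') =
     {f \<in> bimod_hom A V V'. \<forall>X\<in>B.
        compose (carrier (X \<otimes>\<^sub>B V)) (tm V V' X X f (\<lambda>x\<in>carrier X. x)) (c X) =
        compose (carrier (X \<otimes>\<^sub>B V)) (c' X) (tm X X V V' (\<lambda>x\<in>carrier X. x) f)}"
  "Cmp (weak_right_center (bimod_moncat k A)) Q R' S g f = compose (carrier (fst Q)) g f"
  "Idn (weak_right_center (bimod_moncat k A)) Q = (\<lambda>x\<in>carrier (fst Q). x)"
  by (simp_all add: weak_right_center_def)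

text \<open>Each weak half-braiding is \<open>brd\<close> of the coaction read off from it, and
  therefore has \<open>brdi\<close> as an inverse at every object. The two centers are thus equal
  and not merely isomorphic.\<close>

lemma right_center_eq: "right_center (bimod_moncat k A) = weak_right_center (bimod_moncat k A)"
proof -
  have "iso_arrow (bimod_moncat k A) (X \<otimes>\<^sub>B V) (V \<otimes>\<^sub>B X) (c X)"
    if "V \<in> B" "c \<in> weak_half_braidings (bimod_moncat k A) V" "X \<in> B" for V c X
    using brd_iso[OF that(1) cact_yd[OF that(1,2)] that(3)] brd_cact[OF that(1,2)] by simp
  then have "Obj (right_center (bimod_moncat k A)) = Obj (weak_right_center (bimod_moncat k A))"
    by (auto simp: right_center_def)
  then show ?thesis
    by (simp add: right_center_def)
qed

text \<open>At x \<otimes> v both composites evaluate the expression w \<otimes> x b, one at (f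
  \<otimes> A)(\<rho> v) and the other at \<sigma>(f v). So compatibility with the coactions
  suffices; conversely, at the generator of \<open>P\<close> the argument can be recovered.\<close>

lemma hom_braiding_iff:
  assumes V: "V \<in> B" "\<rho> \<in> yetter_drinfeld_coactions k A V"
    and W: "W \<in> B" "\<sigma> \<in> yetter_drinfeld_coactions k A W"
    and f: "f \<in> bimod_hom A V W"
  shows "(\<forall>X\<in>B. compose (carrier (X \<otimes>\<^sub>B V)) (tm V W X X f (\<lambda>x\<in>carrier X. x)) (brd V \<rho> X) =
        compose (carrier (X \<otimes>\<^sub>B V)) (brd W \<sigma> X) (tm X X V W (\<lambda>x\<in>carrier X. x) f)) \<longleftrightarrow>
     preserves_coaction k A (V, \<rho>) (W, \<sigma>) f"
proof -
  interpret V: yetter_drinfeld k A V \<rho> by (rule yetter_drinfeldI[OF V])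
  interpret W: yetter_drinfeld k A W \<sigma> by (rule yetter_drinfeldI[OF W])
  have fr: "f \<in> rmod_hom A V W" using f by (simp add: bimod_hom_def)
  note fD = bimod_homD[OF f]
  note fA = ktensor_map_id_right[OF V.kmod_module W.kmod_module V.A_module
      rmod_hom_klinear[OF V.alg_right_module_axioms W.alg_right_module_axioms fr]]
  let ?fA = "ktensor_map k (kmod A V) (kmod A W) A A f (\<lambda>a. a)"
  have fX_hom: "tm V W X X f (\<lambda>x\<in>carrier X. x) \<in> bimod_hom A (V \<otimes>\<^sub>B X) (W \<otimes>\<^sub>B X)"
    "tm X X V W (\<lambda>x\<in>carrier X. x) f \<in> bimod_hom A (X \<otimes>\<^sub>B V) (X \<otimes>\<^sub>B W)" if "X \<in> B" for X
    by (rule tm_hom; use V W f id_hom that in simp)+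
  have left: "tm V W X X f (\<lambda>x\<in>carrier X. x) (brd V \<rho> X (btens A X V x v)) =
      W.sw (W \<otimes>\<^sub>B X) (\<lambda>w b. btens A W X w (ract X x b)) (?fA (\<rho> v))"
    if X: "X \<in> B" and x: "x \<in> carrier X" and v: "v \<in> carrier V" for X x v
  proof -
    have "tm V W X X f (\<lambda>x\<in>carrier X. x) (brd V \<rho> X (btens A X V x v)) =
        V.sw (W \<otimes>\<^sub>B X) (\<lambda>w b. tm V W X X f (\<lambda>x\<in>carrier X. x) (btens A V X w (ract X x b))) (\<rho> v)"
      unfolding brd_btens[OF V X x v]
      by (rule V.sw_comp[OF _ _ bimod_homD(1)[OF fX_hom(1)[OF X]] brd_kbal[OF V X x] v]) (use V W X in simp_all)
    also have "\<dots> = V.sw (W \<otimes>\<^sub>B X) (\<lambda>w b. W.sw (W \<otimes>\<^sub>B X) (\<lambda>w b. btens A W X w (ract X x b)) (W.tens (f w) b)) (\<rho> v)"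
      by (rule V.sw_cong) (use V W X x f fD(3) in \<open>simp add: tm_btens id_hom btens_kbal\<close>)
    also have "\<dots> = W.sw (W \<otimes>\<^sub>B X) (\<lambda>w b. btens A W X w (ract X x b)) (?fA (\<rho> v))"
      unfolding fA(3)
      by (rule V.sw_comp[OF W.MA_abelian _ _ fA(4) v, symmetric])
        (use W X x in \<open>auto intro!: klift_addhom btens_kbal\<close>)
    finally show ?thesis .
  qed
  have right: "brd W \<sigma> X (tm X X V W (\<lambda>x\<in>carrier X. x) f (btens A X V x v)) =
      W.sw (W \<otimes>\<^sub>B X) (\<lambda>w b. btens A W X w (ract X x b)) (\<sigma> (f v))"
    if X: "X \<in> B" and x: "x \<in> carrier X" and v: "v \<in> carrier V" for X x v
    using V W X x v f fD(3) by (simp add: tm_btens id_hom brd_btens)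
  show ?thesis
  proof
    assume *: "\<forall>X\<in>B. compose (carrier (X \<otimes>\<^sub>B V)) (tm V W X X f (\<lambda>x\<in>carrier X. x)) (brd V \<rho> X) =
        compose (carrier (X \<otimes>\<^sub>B V)) (brd W \<sigma> X) (tm X X V W (\<lambda>x\<in>carrier X. x) f)"
    have "\<sigma> (f v) = ?fA (\<rho> v)" if v: "v \<in> carrier V" for v
    proof -
      have "compose (carrier (P \<otimes>\<^sub>B V)) (tm V W P P f (\<lambda>x\<in>carrier P. x)) (brd V \<rho> P) (btens A P V uP v) =
        compose (carrier (P \<otimes>\<^sub>B V)) (brd W \<sigma> P) (tm P P V W (\<lambda>x\<in>carrier P. x) f) (btens A P V uP v)"
        by (rule fun_cong[OF bspec[OF * P_bimodule]])
      then have eq: "W.sw (W \<otimes>\<^sub>B P) (\<lambda>w b. btens A W P w (ract P uP b)) (?fA (\<rho> v)) =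
         W.sw (W \<otimes>\<^sub>B P) (\<lambda>w b. btens A W P w (ract P uP b)) (\<sigma> (f v))"
        using left[OF P_bimodule uP_closed v] right[OF P_bimodule uP_closed v] V v
        by (simp add: compose_eq)
      \<comment> \<open>At the generator the expression is w \<otimes> (1 \<otimes> b), which
        \<open>jP\<close> takes back to w \<otimes> b.\<close>
      have j: "jP W (W.sw (W \<otimes>\<^sub>B P) (\<lambda>w b. btens A W P w (ract P uP b)) t) = t" if t: "t \<in> carrier W.MA" for t
      proof -
        have "jP W (W.sw (W \<otimes>\<^sub>B P) (\<lambda>w b. btens A W P w (ract P uP b)) t) =
            W.sw W.MA (\<lambda>w b. jP W (btens A W P w (ract P uP b))) t"
          by (rule swV_comp[OF W(1) _ _ jP_hom[OF W(1)] btens_kbal[OF W(1) P_bimodule uP_closed] t])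
            (use W in simp_all)
        also have "\<dots> = W.sw W.MA (\<lambda>w b. W.tens w b) t"
          by (rule W.sw_cong) (use W in \<open>simp add: jP_btens W.ract_one\<close>)
        finally show ?thesis using t by (simp add: klift_ktens_id)
      qed
      have "?fA (\<rho> v) \<in> carrier W.MA" "\<sigma> (f v) \<in> carrier W.MA"
        using klinearD(3)[OF fA(1) V.rho_closed[OF v]] fD(3)[OF v] by simp_all
      then show ?thesis using j arg_cong[OF eq, of "jP W"] by simp
    qed
    then show "preserves_coaction k A (V, \<rho>) (W, \<sigma>) f"
      by (simp add: preserves_coaction_def)
  next
    assume *: "preserves_coaction k A (V, \<rho>) (W, \<sigma>) f"
    show "\<forall>X\<in>B. compose (carrier (X \<otimes>\<^sub>B V)) (tm V W X X f (\<lambda>x\<in>carrier X. x)) (brd V \<rho> X) =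
        compose (carrier (X \<otimes>\<^sub>B V)) (brd W \<sigma> X) (tm X X V W (\<lambda>x\<in>carrier X. x) f)"
    proof
      fix X assume X: "X \<in> B"
      show "compose (carrier (X \<otimes>\<^sub>B V)) (tm V W X X f (\<lambda>x\<in>carrier X. x)) (brd V \<rho> X) =
        compose (carrier (X \<otimes>\<^sub>B V)) (brd W \<sigma> X) (tm X X V W (\<lambda>x\<in>carrier X. x) f)"
      proof (rule btensor_bimod_hom_eqI[OF X V(1) comp_hom[OF _ _ _ brd_hom[OF V X] fX_hom(1)[OF X]]
            comp_hom[OF _ _ _ fX_hom(2)[OF X] brd_hom[OF W X]]])
        fix x v assume x: "x \<in> carrier X" and v: "v \<in> carrier V"
        then show "compose (carrier (X \<otimes>\<^sub>B V)) (tm V W X X f (\<lambda>x\<in>carrier X. x)) (brd V \<rho> X) (btens A X V x v) =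
          compose (carrier (X \<otimes>\<^sub>B V)) (brd W \<sigma> X) (tm X X V W (\<lambda>x\<in>carrier X. x) f) (btens A X V x v)"
          using * V X left[OF X x v] right[OF X x v] by (simp add: compose_eq preserves_coaction_def)
      qed (use V W X in simp_all)
    qed
  qed
qed

end

lemma yetter_drinfeld_center_iso:
  fixes k :: "('k, 'c) ring_scheme" and A :: "('k, 'u::infinite) module"
  assumes A: "assoc_algebra k A"
  shows "isomorphic_categories (yetter_drinfeld_category k A) (weak_right_center (bimod_moncat k A))"
    and "category (weak_right_center (bimod_moncat k A))"
    and "right_center (bimod_moncat k A) = weak_right_center (bimod_moncat k A)"
proof -
  interpret alg k A using A by (simp add: alg_def)
  let ?Y = "yetter_drinfeld_category k A" and ?W = "weak_right_center (bimod_moncat k A)"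
  let ?Fo = "\<lambda>(V, \<rho>). (V, brd V \<rho>)" and ?Go = "\<lambda>(V, c). (V, cact V c)"
  have ObjY: "Obj ?Y = {(V, \<rho>). V \<in> B \<and> \<rho> \<in> yetter_drinfeld_coactions k A V}"
    and HomY: "Hom ?Y (V, \<rho>) (W, \<sigma>) = {f \<in> bimod_hom A V W. preserves_coaction k A (V, \<rho>) (W, \<sigma>) f}" for V W \<rho> \<sigma>
    by (simp_all add: yetter_drinfeld_category_def)
  have hyps: "category ?Y" by (rule comodule_yetter_drinfeld_iso(2)[OF A])
  have Fo: "?Fo Q \<in> Obj ?W" "?Go (?Fo Q) = Q" if "Q \<in> Obj ?Y" for Q
    using that by (auto simp: ObjY brd_whb cact_brd)
  have Go: "?Go Q \<in> Obj ?Y" "?Fo (?Go Q) = Q" if "Q \<in> Obj ?W" for Q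
    using that by (auto simp: ObjY cact_yd brd_cact)
  have Hom: "Hom ?W (?Fo Q) (?Fo S) = Hom ?Y Q S" if "Q \<in> Obj ?Y" "S \<in> Obj ?Y" for Q S
    using that hom_braiding_iff by (auto simp: ObjY HomY)
  have Cmp: "Cmp ?W (?Fo Q) (?Fo S) (?Fo T) g f = Cmp ?Y Q S T g f" for Q S T f g
    by (cases Q) (simp add: yetter_drinfeld_category_def)
  have Idn: "Idn ?W (?Fo Q) = Idn ?Y Q" for Q
    by (cases Q) (simp add: yetter_drinfeld_category_def)
  show "isomorphic_categories ?Y ?W"
    by (rule isomorphic_transport[where Fo = ?Fo and Go = ?Go]) (assumption | rule hyps Fo Go Hom Cmp Idn)+
  show "category ?W"
    by (rule category_transport[where C = ?Y and Fo = ?Fo and Go = ?Go]) (assumption | rule hyps Fo Go Hom Cmp Idn)+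
  show "right_center (bimod_moncat k A) = ?W"
    by (rule right_center_eq)
qed

section \<open>Faithfully flat descent\<close>

lemma (in abelian_group) minus_eq_zero_iff:
  assumes "x \<in> carrier G" "y \<in> carrier G"
  shows "x \<ominus> y = \<zero> \<longleftrightarrow> x = y"
proof
  assume "x \<ominus> y = \<zero>"
  moreover have "(x \<ominus> y) \<oplus> y = x"
    using assms by (simp add: minus_eq a_assoc l_neg)
  ultimately show "x = y" using assms by simp
qed (use assms in \<open>simp add: minus_eq r_neg\<close>)

lemma addhom_minus_fun:
  assumes M: "abelian_group M" and N: "abelian_group N" and f: "f \<in> addhom M N" and g: "g \<in> addhom M N"
  shows "(\<lambda>x. f x \<ominus>\<^bsub>N\<^esub> g x) \<in> addhom M N"
proof (rule addhomI)
  interpret N: abelian_group N by fact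
  note fD = addhom_closed[OF f] addhom_add[OF f] and gD = addhom_closed[OF g] addhom_add[OF g]
  show "f x \<ominus>\<^bsub>N\<^esub> g x \<in> carrier N" if "x \<in> carrier M" for x
    using that fD gD by simp
  show "f (x \<oplus>\<^bsub>M\<^esub> y) \<ominus>\<^bsub>N\<^esub> g (x \<oplus>\<^bsub>M\<^esub> y) = (f x \<ominus>\<^bsub>N\<^esub> g x) \<oplus>\<^bsub>N\<^esub> (f y \<ominus>\<^bsub>N\<^esub> g y)"
    if "x \<in> carrier M" "y \<in> carrier M" for x y
    using that fD gD by (simp add: N.minus_eq N.minus_add N.add_add_comm)
qed

lemma klinear_minus:
  assumes M: "Module.module k M" and N: "Module.module k N" and f: "f \<in> klinear k M N" and g: "g \<in> klinear k M N"
  shows "(\<lambda>x\<in>carrier M. f x \<ominus>\<^bsub>N\<^esub> g x) \<in> klinear k M N"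
proof -
  interpret M: Module.module k M by fact
  interpret N: Module.module k N by fact
  note h = addhom_minus_fun[OF module_abelian_group[OF M] module_abelian_group[OF N] klinearD(1)[OF f] klinearD(1)[OF g]]
  show ?thesis
    by (rule klinearI)
      (use addhom_closed[OF h] addhom_add[OF h] klinearD[OF f] klinearD[OF g] in
        \<open>simp_all add: N.minus_eq N.smult_r_distr N.smult_r_minus\<close>)
qed

lemma kernel_module:
  assumes M: "Module.module k M" and N: "Module.module k N" and d: "d \<in> klinear k M N"
  shows "Module.module k (M\<lparr>carrier := {x \<in> carrier M. d x = \<zero>\<^bsub>N\<^esub>}\<rparr>)"
proof -
  interpret M: Module.module k M by fact
  interpret N: Module.module k N by fact
  have ab: "abelian_group M" "abelian_group N" by unfold_locales
  have d0: "d \<zero>\<^bsub>M\<^esub> = \<zero>\<^bsub>N\<^esub>"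
    by (rule addhom_zero[OF ab klinearD(1)[OF d]])
  have dm: "d (\<ominus>\<^bsub>M\<^esub> x) = \<zero>\<^bsub>N\<^esub>" if "x \<in> carrier M" "d x = \<zero>\<^bsub>N\<^esub>" for x
    using klinearD(4)[OF d that(1), of "\<ominus>\<^bsub>M\<^esub> x"] that klinearD(3)[OF d, of "\<ominus>\<^bsub>M\<^esub> x"]
    by (simp add: M.r_neg d0)
  show ?thesis
  proof (rule Module.moduleI)
    show "abelian_group (M\<lparr>carrier := {x \<in> carrier M. d x = \<zero>\<^bsub>N\<^esub>}\<rparr>)"
    proof (rule abelian_groupI)
      fix x assume "x \<in> carrier (M\<lparr>carrier := {x \<in> carrier M. d x = \<zero>\<^bsub>N\<^esub>}\<rparr>)"
      then show "\<exists>y\<in>carrier (M\<lparr>carrier := {x \<in> carrier M. d x = \<zero>\<^bsub>N\<^esub>}\<rparr>).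
          y \<oplus>\<^bsub>M\<lparr>carrier := {x \<in> carrier M. d x = \<zero>\<^bsub>N\<^esub>}\<rparr>\<^esub> x = \<zero>\<^bsub>M\<lparr>carrier := {x \<in> carrier M. d x = \<zero>\<^bsub>N\<^esub>}\<rparr>\<^esub>"
        by (intro bexI[of _ "\<ominus>\<^bsub>M\<^esub> x"]) (auto simp: dm M.l_neg)
    qed (auto simp: d0 klinearD(4)[OF d] M.a_ac)
  qed (auto simp: klinearD(5)[OF d] M.smult_l_distr M.smult_r_distr M.smult_assoc1 intro: M.R.is_cring)
qed

text \<open>Injectivity of \<open>M \<rightarrow> N\<close> is exactness of \<open>0 \<rightarrow> M \<rightarrow> N\<close>, where \<open>0\<close> is taken to be the zero submodule
  of \<open>M\<close>.\<close>

lemma zero_module: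
  fixes M :: "('k, 'u) module"
  assumes M: "Module.module k M"
  shows "Module.module k (M\<lparr>carrier := {\<zero>\<^bsub>M\<^esub>}\<rparr>)"
proof -
  interpret M: Module.module k M by fact
  have "(\<lambda>x\<in>carrier M. x) \<in> klinear k M M"
    by (rule klinearI) auto
  from kernel_module[OF M M this] have "Module.module k (M\<lparr>carrier := {x \<in> carrier M. (\<lambda>x\<in>carrier M. x) x = \<zero>\<^bsub>M\<^esub>}\<rparr>)" .
  moreover have "{x \<in> carrier M. (\<lambda>x\<in>carrier M. x) x = \<zero>\<^bsub>M\<^esub>} = {\<zero>\<^bsub>M\<^esub>}" by auto
  ultimately show ?thesis by simp
qed

lemma addhom_inj_on:
  assumes M: "abelian_group M" and N: "abelian_group N" and f: "f \<in> addhom M N"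
    and ker: "\<And>x. \<lbrakk>x \<in> carrier M; f x = \<zero>\<^bsub>N\<^esub>\<rbrakk> \<Longrightarrow> x = \<zero>\<^bsub>M\<^esub>"
  shows "inj_on f (carrier M)"
proof (rule inj_onI)
  interpret M: abelian_group M by fact
  interpret N: abelian_group N by fact
  fix x y assume x: "x \<in> carrier M" and y: "y \<in> carrier M" and eq: "f x = f y"
  have "f (x \<ominus>\<^bsub>M\<^esub> y) = \<zero>\<^bsub>N\<^esub>"
    using addhom_minus[OF M N f x y] addhom_closed[OF f] x y eq N.r_neg by (simp add: N.minus_eq)
  then have "x \<ominus>\<^bsub>M\<^esub> y = \<zero>\<^bsub>M\<^esub>" using ker x y by simp
  then show "x = y" using x y by (simp add: M.minus_eq_zero_iff)
qed

lemma ktens_zero_left: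
  fixes M N :: "('k, 'u::infinite) module"
  assumes M: "Module.module k M" and N: "Module.module k N" and y: "y \<in> carrier N"
  shows "ktens k M N \<zero>\<^bsub>M\<^esub> y = \<zero>\<^bsub>ktensor k M N\<^esub>"
proof -
  have "(\<lambda>x. ktens k M N x y) \<in> addhom M (ktensor k M N)"
    by (rule addhomI) (use M N y in \<open>simp_all add: ktens_add_left\<close>)
  from addhom_zero[OF module_abelian_group[OF M] ktensor_abelian_group[OF M N] this] show ?thesis .
qed

text \<open>Pure tensors with left factor 0 vanish, so the tensored zero module again has image
  zero. Exactness of the two sequences then says that the two kernels are trivial, and faithful
  flatness passes between these statements in both directions.\<close>

lemma flat_injective:
  fixes k :: "('k, 'c) ring_scheme" and A M N :: "('k, 'u::infinite) module"
  assumes flat: "faithfully_flat k A" and M: "Module.module k M" and N: "Module.module k N"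
    and f: "f \<in> klinear k M N"
  shows "(\<forall>x\<in>carrier M. f x = \<zero>\<^bsub>N\<^esub> \<longrightarrow> x = \<zero>\<^bsub>M\<^esub>) \<longleftrightarrow>
    (\<forall>t\<in>carrier (ktensor k M A). ktensor_map k M N A A f (\<lambda>a. a) t = \<zero>\<^bsub>ktensor k N A\<^esub> \<longrightarrow> t = \<zero>\<^bsub>ktensor k M A\<^esub>)"
proof -
  let ?O = "M\<lparr>carrier := {\<zero>\<^bsub>M\<^esub>}\<rparr>" and ?z = "\<lambda>x\<in>{\<zero>\<^bsub>M\<^esub>}. x"
  have A: "Module.module k A" using flat by (simp add: faithfully_flat_def)
  have O: "Module.module k ?O" by (rule zero_module[OF M])
  interpret M: Module.module k M by fact
  interpret N: Module.module k N by fact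
  interpret MA: Module.module k "ktensor k M A" by (rule ktensor_module[OF M A])
  interpret NA: Module.module k "ktensor k N A" by (rule ktensor_module[OF N A])
  have ab: "abelian_group M" "abelian_group N" "abelian_group (ktensor k M A)" "abelian_group (ktensor k N A)" by unfold_locales
  have z: "?z \<in> klinear k ?O M" by (rule klinearI) auto
  note zA = ktensor_map_id_right[OF O M A z] and fA = ktensor_map_id_right[OF M N A f]
  have z0: "ktensor_map k ?O M A A ?z (\<lambda>a. a) t = \<zero>\<^bsub>ktensor k M A\<^esub>" if "t \<in> carrier (ktensor k ?O A)" for t
  proof (rule ktensor_addhom_eqI[OF O A that klinearD(1)[OF zA(1)]])
    show "(\<lambda>_. \<zero>\<^bsub>ktensor k M A\<^esub>) \<in> addhom (ktensor k ?O A) (ktensor k M A)"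
      by (rule addhomI) simp_all
    show "ktensor_map k ?O M A A ?z (\<lambda>a. a) (ktens k ?O A x y) = \<zero>\<^bsub>ktensor k M A\<^esub>"
      if "x \<in> carrier ?O" "y \<in> carrier A" for x y
      using that by (simp add: zA(2) ktens_zero_left[OF M A])
  qed
  have "ktensor_map k ?O M A A ?z (\<lambda>a. a) ` carrier (ktensor k ?O A) = {\<zero>\<^bsub>ktensor k M A\<^esub>}"
    using z0 abelian_monoid.zero_closed[OF abelian_group.axioms(1)[OF ktensor_abelian_group[OF O A]]] by force
  moreover have "f \<zero>\<^bsub>M\<^esub> = \<zero>\<^bsub>N\<^esub>" "ktensor_map k M N A A f (\<lambda>a. a) \<zero>\<^bsub>ktensor k M A\<^esub> = \<zero>\<^bsub>ktensor k N A\<^esub>"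
    using addhom_zero[OF ab(1,2) klinearD(1)[OF f]] addhom_zero[OF ab(3,4) klinearD(1)[OF fA(1)]] by simp_all
  moreover have "exact_at ?O M N ?z f \<longleftrightarrow>
      exact_at (ktensor k ?O A) (ktensor k M A) (ktensor k N A)
        (ktensor_map k ?O M A A ?z (\<lambda>a. a)) (ktensor_map k M N A A f (\<lambda>a. a))"
    using flat O M N z f unfolding faithfully_flat_def by blast
  moreover have singleton: "{z} = {x \<in> S. P x} \<longleftrightarrow> (\<forall>x\<in>S. P x \<longrightarrow> x = z)"
    if "z \<in> S" "P z" for z :: 'u and S P
    using that by auto
  ultimately show ?thesis
    by (simp add: exact_at_def singleton)
qed

lemma klinear_iso_arrow:
  assumes M: "Module.module k M" and N: "Module.module k N" and f: "f \<in> klinear k M N"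
    and bij: "bij_betw f (carrier M) (carrier N)"
  shows "iso_arrow (module_category k) M N f"
proof -
  define g where "g = (\<lambda>y\<in>carrier N. inv_into (carrier M) f y)"
  interpret M: Module.module k M by fact
  interpret N: Module.module k N by fact
  have gf: "g (f x) = x" if "x \<in> carrier M" for x
    using that bij klinearD(3)[OF f that] by (simp add: g_def bij_betw_def)
  have ex: "\<exists>x\<in>carrier M. y = f x" if "y \<in> carrier N" for y
    using that bij by (auto simp: bij_betw_def)
  have g: "g \<in> klinear k N M"
  proof (rule klinearI)
    show "g y \<in> carrier M" if "y \<in> carrier N" for y using ex[OF that] gf by auto
    show "g (y \<oplus>\<^bsub>N\<^esub> y') = g y \<oplus>\<^bsub>M\<^esub> g y'" if y: "y \<in> carrier N" "y' \<in> carrier N" for y y'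
    proof -
      obtain x x' where x: "x \<in> carrier M" "y = f x" and x': "x' \<in> carrier M" "y' = f x'"
        using ex[OF y(1)] ex[OF y(2)] by blast
      then show ?thesis using gf[OF x(1)] gf[OF x'(1)] gf[of "x \<oplus>\<^bsub>M\<^esub> x'"] klinearD(4)[OF f x(1) x'(1)] by simp
    qed
    show "g (c \<odot>\<^bsub>N\<^esub> y) = c \<odot>\<^bsub>M\<^esub> g y" if c: "c \<in> carrier k" and y: "y \<in> carrier N" for c y
    proof -
      obtain x where x: "x \<in> carrier M" "y = f x" using ex[OF y] by blast
      then show ?thesis using gf[OF x(1)] gf[of "c \<odot>\<^bsub>M\<^esub> x"] klinearD(5)[OF f c x(1)] c by simp
    qed
  qed (simp add: g_def)
  have "compose (carrier M) g f = (\<lambda>x\<in>carrier M. x)"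
    using gf unfolding compose_def by (intro restrict_ext) auto
  moreover have "compose (carrier N) f g = (\<lambda>y\<in>carrier N. y)"
  proof -
    have "f (g y) = y" if "y \<in> carrier N" for y
      using ex[OF that] by (auto simp: gf)
    then show ?thesis
      unfolding compose_def by (intro restrict_ext)
  qed
  ultimately have "inverse_arrows (module_category k) M N f g"
    using f g by (simp add: inverse_arrows_def module_category_def)
  then show ?thesis unfolding iso_arrow_def by (rule exI[of _ g])
qed

lemma module_category:
  fixes k :: "('k, 'c) ring_scheme"
  shows "category (module_category k :: (('k, 'u) module, 'u \<Rightarrow> 'u) cat)"
  unfolding module_category_def
proof (rule concrete_category; clarsimp)
  show "f \<in> carrier M \<rightarrow>\<^sub>E carrier N" if "f \<in> klinear k M N" for M N :: "('k, 'u) module" and f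
    using klinearD[OF that] by (simp add: PiE_def)
  show "(\<lambda>x\<in>carrier M. x) \<in> klinear k M M" if "Module.module k M" for M :: "('k, 'u) module"
  proof -
    interpret Module.module k M by fact
    show ?thesis by (rule klinearI) auto
  qed
  show "compose (carrier L) g f \<in> klinear k L N"
    if "Module.module k L" "f \<in> klinear k L M" "g \<in> klinear k M N" for L M N :: "('k, 'u) module" and f g
  proof -
    interpret L: Module.module k L by fact
    show ?thesis
      by (rule klinearI) (use klinearD[OF that(2)] klinearD[OF that(3)] in \<open>simp_all add: compose_def\<close>)
  qed
qed

section \<open>Coinvariants and the counit of the adjunction\<close>

context coaction
begin

text \<open>Faithful flatness is phrased by exactness, so the equalizer of \<rho> and v -> v
  \<otimes> 1 is presented as the kernel of their difference.\<close>

definition dif where "dif = (\<lambda>v\<in>carrier V. \<rho> v \<ominus>\<^bsub>MA\<^esub> v \<boxtimes> \<one>\<^bsub>A\<^esub>)"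

lemma tens_one_klinear: "(\<lambda>v\<in>carrier V. v \<boxtimes> \<one>\<^bsub>A\<^esub>) \<in> klinear k (kmod A V) MA"
  by (rule klinearI) (use M.smult_closed in \<open>simp_all add: tens_simps\<close>)

lemma dif_klinear: "dif \<in> klinear k (kmod A V) MA"
proof -
  have "dif = (\<lambda>v\<in>carrier (kmod A V). \<rho> v \<ominus>\<^bsub>MA\<^esub> (\<lambda>v\<in>carrier V. v \<boxtimes> \<one>\<^bsub>A\<^esub>) v)"
    by (auto simp: dif_def)
  then show ?thesis
    using klinear_minus[OF kmod_module MA_module rho_klinear tens_one_klinear] by simp
qed

lemma dif_zero: "v \<in> carrier V \<Longrightarrow> dif v = \<zero>\<^bsub>MA\<^esub> \<longleftrightarrow> \<rho> v = v \<boxtimes> \<one>\<^bsub>A\<^esub>"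
  by (simp add: dif_def abelian_group.minus_eq_zero_iff[OF MA_abelian])

definition coinv :: "('k, 'u) module" where
  "coinv = (kmod A V)\<lparr>carrier := {v \<in> carrier V. \<rho> v = v \<boxtimes> \<one>\<^bsub>A\<^esub>}\<rparr>"

lemma coinv_carrier: "carrier coinv = {v \<in> carrier V. \<rho> v = v \<boxtimes> \<one>\<^bsub>A\<^esub>}"
  by (simp add: coinv_def)

lemma coinv_simps [simp]: "ring.add coinv = ring.add V" "ring.zero coinv = ring.zero V"
  by (simp_all add: coinv_def)

lemma coinv_smult: "c \<odot>\<^bsub>coinv\<^esub> v = c \<odot>\<^bsub>kmod A V\<^esub> v"
  by (simp add: coinv_def)

lemma coinv_module [simp]: "Module.module k coinv"
proof -
  have "{v \<in> carrier (kmod A V). dif v = \<zero>\<^bsub>MA\<^esub>} = {v \<in> carrier V. \<rho> v = v \<boxtimes> \<one>\<^bsub>A\<^esub>}"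
    by (auto simp: dif_zero)
  then show ?thesis
    using kernel_module[OF kmod_module MA_module dif_klinear] by (simp add: coinv_def)
qed

abbreviation difA where "difA \<equiv> ktensor_map k (kmod A V) MA A A dif (\<lambda>a. a)"

lemmas difA = ktensor_map_id_right[OF kmod_module MA_module A_module dif_klinear]

text \<open>The sequence \<open>V \<rightarrow> V \<otimes> A \<rightarrow> V \<otimes> A \<otimes> A\<close> is split exact, without any flatness.\<close>

lemma rho_image: "\<rho> ` carrier V = {t \<in> carrier MA. difA t = \<zero>\<^bsub>MAA\<^esub>}"
proof (intro equalityI subsetI)
  interpret MAA: abelian_group MAA by simp
  fix t assume "t \<in> \<rho> ` carrier V"
  then obtain v where v: "v \<in> carrier V" and t: "t = \<rho> v" by blast
  have "difA (\<rho> v) = sw MAA (\<lambda>w a. ktens k MA A (dif w) a) (\<rho> v)"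
    by (simp add: difA(3))
  moreover have "sw MAA (\<lambda>w a. ktens k MA A (dif w) a) (\<rho> v) \<oplus>\<^bsub>MAA\<^esub> sw MAA (\<lambda>w a. ktens k MA A (w \<boxtimes> \<one>\<^bsub>A\<^esub>) a) (\<rho> v) =
      sw MAA (\<lambda>w a. ktens k MA A (dif w) a \<oplus>\<^bsub>MAA\<^esub> ktens k MA A (w \<boxtimes> \<one>\<^bsub>A\<^esub>) a) (\<rho> v)"
    using v difA(4) tens_one_tens_bal by (simp add: klift_plus)
  moreover have "\<dots> = sw MAA (\<lambda>w a. ktens k MA A (\<rho> w) a) (\<rho> v)"
  proof (rule sw_cong)
    fix w a assume w: "w \<in> carrier V" and a: "a \<in> carrier A"
    interpret MA: abelian_group MA by simp
    have "dif w \<oplus>\<^bsub>MA\<^esub> w \<boxtimes> \<one>\<^bsub>A\<^esub> = \<rho> w"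
      using w by (simp add: dif_def MA.minus_eq MA.a_assoc MA.l_neg)
    then show "ktens k MA A (dif w) a \<oplus>\<^bsub>MAA\<^esub> ktens k MA A (w \<boxtimes> \<one>\<^bsub>A\<^esub>) a = ktens k MA A (\<rho> w) a"
      using w a klinearD(3)[OF dif_klinear, of w] ktens_add_left[of k MA A "dif w" "w \<boxtimes> \<one>\<^bsub>A\<^esub>" a] by simp
  qed
  moreover have "\<dots> = sw MAA (\<lambda>w a. ktens k MA A (w \<boxtimes> \<one>\<^bsub>A\<^esub>) a) (\<rho> v)"
    using coaction v by (simp add: coactions_def Let_def)
  moreover have "sw MAA (\<lambda>w a. ktens k MA A (w \<boxtimes> \<one>\<^bsub>A\<^esub>) a) (\<rho> v) \<in> carrier MAA"
      "sw MAA (\<lambda>w a. ktens k MA A (dif w) a) (\<rho> v) \<in> carrier MAA"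
    using v tens_one_tens_bal difA(4) by (simp_all add: sw_closed)
  ultimately have "difA (\<rho> v) = \<zero>\<^bsub>MAA\<^esub>"
    by simp
  then show "t \<in> {t \<in> carrier MA. difA t = \<zero>\<^bsub>MAA\<^esub>}" using t v by simp
next
  interpret MA: abelian_group MA by simp
  fix t assume "t \<in> {t \<in> carrier MA. difA t = \<zero>\<^bsub>MAA\<^esub>}"
  then have t: "t \<in> carrier MA" and t0: "difA t = \<zero>\<^bsub>MAA\<^esub>" by auto
  \<comment> \<open>The splitting: \<open>?m\<close> is the action V \<otimes> A -> V and
    \<open>?mu\<close> multiplies the last two factors. On v \<otimes> a, applying
    \<open>?mu\<close> after \<open>difA\<close> gives \<rho>(v) a - v \<otimes> a = \<rho>(v a) - v
    \<otimes> a, so a kernel element t is \<rho> of its image under \<open>?m\<close>.\<close>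
  let ?m = "sw V (\<lambda>w a. ract V w a)"
  let ?mu = "klift k MA A MA (\<lambda>s a. sw MA (\<lambda>w b. w \<boxtimes> (b \<otimes>\<^bsub>A\<^esub> a)) s)"
  have "trilinear MA (\<lambda>w b a. w \<boxtimes> (b \<otimes>\<^bsub>A\<^esub> a))"
    by (simp add: trilinear_def tens_simps mult_simps)
  note mu_bal = trilinear_sw_balanced[OF MA_abelian this]
  have mu_hom: "?mu \<in> addhom MAA MA" by (rule klift_addhom) (simp_all add: mu_bal)
  have m_hom: "?m \<in> addhom MA V" by (rule klift_addhom) simp_all
  have "(\<lambda>v. \<rho> v) \<in> addhom V MA" by (rule addhomI) (simp_all add: rho_add)
  from hom_compose[OF m_hom this] have rm: "(\<lambda>t. \<rho> (?m t)) \<in> addhom MA MA" by (simp add: o_def)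
  have mu_dif: "?mu (difA t) = \<rho> (?m t) \<ominus>\<^bsub>MA\<^esub> t"
  proof (rule ktensor_addhom_eqI[OF kmod_module A_module t])
    show "(\<lambda>t. ?mu (difA t)) \<in> addhom MA MA"
      using hom_compose[OF klinearD(1)[OF difA(1)] mu_hom] by (simp add: o_def)
    show "(\<lambda>t. \<rho> (?m t) \<ominus>\<^bsub>MA\<^esub> t) \<in> addhom MA MA"
      by (rule addhom_minus_fun[OF _ _ rm]) (auto intro: addhomI)
    fix v a assume v: "v \<in> carrier (kmod A V)" and a: "a \<in> carrier A"
    then have v: "v \<in> carrier V" by simp
    have h: "sw MA (\<lambda>w b. w \<boxtimes> (b \<otimes>\<^bsub>A\<^esub> a)) \<in> addhom MA MA"
      by (rule klift_addhom) (simp_all add: a)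
    have "?mu (difA (v \<boxtimes> a)) = sw MA (\<lambda>w b. w \<boxtimes> (b \<otimes>\<^bsub>A\<^esub> a)) (dif v)"
      using v a klinearD(3)[OF dif_klinear, of v] by (simp add: difA(2) mu_bal)
    also have "\<dots> = \<rho> (ract V v a) \<ominus>\<^bsub>MA\<^esub> v \<boxtimes> a"
      using v a addhom_minus[OF MA_abelian MA_abelian h, of "\<rho> v" "v \<boxtimes> \<one>\<^bsub>A\<^esub>"]
      by (simp add: dif_def rho_ract)
    finally show "?mu (difA (v \<boxtimes> a)) = \<rho> (?m (v \<boxtimes> a)) \<ominus>\<^bsub>MA\<^esub> v \<boxtimes> a"
      using v a by simp
  qed
  have "?mu \<zero>\<^bsub>MAA\<^esub> = \<zero>\<^bsub>MA\<^esub>"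
    by (rule addhom_zero[OF MAA_abelian MA_abelian mu_hom])
  then have "\<rho> (?m t) \<ominus>\<^bsub>MA\<^esub> t = \<zero>\<^bsub>MA\<^esub>"
    by (simp only: mu_dif[symmetric] t0)
  then have "\<rho> (?m t) = t"
    by (simp only: MA.minus_eq_zero_iff[OF addhom_closed[OF rm t] t])
  moreover have "?m t \<in> carrier V" by (rule addhom_closed[OF m_hom t])
  ultimately show "t \<in> \<rho> ` carrier V" by force
qed

lemma rho_injective: "\<lbrakk>v \<in> carrier V; w \<in> carrier V; \<rho> v = \<rho> w\<rbrakk> \<Longrightarrow> v = w"
  using counit by metis

abbreviation CA where "CA \<equiv> ktensor k coinv A"

lemma CA_abelian [simp]: "abelian_group CA" by (simp add: ktensor_abelian_group)

definition eps where "eps = klift k coinv A V (\<lambda>w a. ract V w a)"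

lemma eps_bal: "kbalanced k coinv A V (\<lambda>w a. ract V w a)"
  by (rule kbalancedI) (auto simp: coinv_carrier coinv_smult ract_simps)

lemma eps_addhom: "eps \<in> addhom CA V"
  unfolding eps_def by (rule klift_addhom) (simp_all add: eps_bal)

lemma eps_extensional: "eps \<in> extensional (carrier CA)"
  unfolding eps_def by (rule klift_extensional) (simp_all add: eps_bal)

lemma eps_tens: "\<lbrakk>w \<in> carrier coinv; a \<in> carrier A\<rbrakk> \<Longrightarrow> eps (ktens k coinv A w a) = ract V w a"
  by (simp add: eps_def eps_bal)

text \<open>The coinvariants are the kernel of \<open>dif\<close>, so flatness embeds
  \<open>CA\<close> into V \<otimes> A with image the kernel of \<open>difA\<close>, which is
  \<rho>(V) by the split sequence. Following \<open>eps\<close> by \<rho> gives this very embedding,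
  because \<rho>(w a) = w \<otimes> a for coinvariant w, and \<rho> is injective by the
  counit.\<close>

lemma eps_bij:
  assumes flat: "faithfully_flat k A"
  shows "bij_betw eps (carrier CA) (carrier V)"
proof -
  let ?i = "\<lambda>w\<in>carrier coinv. w"
  let ?iA = "ktensor_map k coinv (kmod A V) A A ?i (\<lambda>a. a)"
  have i: "?i \<in> klinear k coinv (kmod A V)"
  proof -
    interpret C: Module.module k coinv by simp
    show ?thesis
      by (rule klinearI) (use C.smult_closed C.add.m_closed in \<open>auto simp: coinv_carrier coinv_smult\<close>)
  qed
  note iA = ktensor_map_id_right[OF coinv_module kmod_module A_module i]
  have "exact_at coinv (kmod A V) MA ?i dif"
    using dif_zero by (auto simp: exact_at_def coinv_carrier image_iff)
  then have "exact_at CA MA MAA ?iA difA"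
    using flat i dif_klinear kmod_module MA_module coinv_module unfolding faithfully_flat_def by blast
  then have img: "?iA ` carrier CA = \<rho> ` carrier V"
    by (simp add: exact_at_def rho_image)
  have "\<forall>w\<in>carrier coinv. ?i w = \<zero>\<^bsub>kmod A V\<^esub> \<longrightarrow> w = \<zero>\<^bsub>coinv\<^esub>" by simp
  then have inj: "\<forall>t\<in>carrier CA. ?iA t = \<zero>\<^bsub>MA\<^esub> \<longrightarrow> t = \<zero>\<^bsub>CA\<^esub>"
    unfolding flat_injective[OF flat coinv_module kmod_module i] .
  have iA_inj: "inj_on ?iA (carrier CA)"
    by (rule addhom_inj_on[OF CA_abelian MA_abelian klinearD(1)[OF iA(1)]]) (use inj in blast)
  have rho_eps: "\<rho> (eps s) = ?iA s" if s: "s \<in> carrier CA" for s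
  proof (rule ktensor_addhom_eqI[OF coinv_module A_module s])
    have "\<rho> \<in> addhom V MA" by (rule addhomI) (simp_all add: rho_add)
    from hom_compose[OF eps_addhom this] show "(\<lambda>s. \<rho> (eps s)) \<in> addhom CA MA" by (simp add: o_def)
    show "?iA \<in> addhom CA MA" by (rule klinearD(1)[OF iA(1)])
    fix w a assume w: "w \<in> carrier coinv" and a: "a \<in> carrier A"
    have w': "w \<in> carrier V" "\<rho> w = w \<boxtimes> \<one>\<^bsub>A\<^esub>" using w by (simp_all add: coinv_carrier)
    have "\<rho> (ract V w a) = w \<boxtimes> (\<one>\<^bsub>A\<^esub> \<otimes>\<^bsub>A\<^esub> a)"
      using w' a by (simp add: rho_ract del: l_one)
    then show "\<rho> (eps (ktens k coinv A w a)) = ?iA (ktens k coinv A w a)"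
      using w a by (simp add: eps_tens iA(2))
  qed
  show ?thesis
    unfolding bij_betw_def
  proof (intro conjI equalityI subsetI inj_onI)
    fix s s' assume "s \<in> carrier CA" "s' \<in> carrier CA" "eps s = eps s'"
    then show "s = s'" using rho_eps[of s] rho_eps[of s'] iA_inj by (auto dest: inj_onD)
  next
    fix v assume "v \<in> eps ` carrier CA"
    then show "v \<in> carrier V" using addhom_closed[OF eps_addhom] by auto
  next
    fix v assume v: "v \<in> carrier V"
    then have "\<rho> v \<in> ?iA ` carrier CA" using img by blast
    then obtain s where s: "s \<in> carrier CA" "\<rho> v = ?iA s" by blast
    have "v = eps s"
      by (rule rho_injective[OF v addhom_closed[OF eps_addhom s(1)] trans[OF s(2) rho_eps[OF s(1), symmetric]]])
    then show "v \<in> eps ` carrier CA" using s(1) by (rule image_eqI)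
  qed
qed

end

lemma (in coaction_hom) inverse_hom:
  assumes bij: "bij_betw f (carrier V) (carrier W)"
  defines "g \<equiv> (\<lambda>w\<in>carrier W. inv_into (carrier V) f w)"
  shows "g \<in> rmod_hom A W V" "preserves_coaction k A (W, \<rho>') (V, \<rho>) g"
    and "compose (carrier V) g f = (\<lambda>v\<in>carrier V. v)" "compose (carrier W) f g = (\<lambda>w\<in>carrier W. w)"
proof -
  have gf: "g (f v) = v" if "v \<in> carrier V" for v
    using that bij f_simps(1)[OF that] by (simp add: g_def bij_betw_def)
  have ex: "\<exists>v\<in>carrier V. w = f v" if "w \<in> carrier W" for w
    using that bij by (auto simp: bij_betw_def)
  show g: "g \<in> rmod_hom A W V"
  proof (rule rmod_homI)
    show "g \<in> extensional (carrier W)" by (simp add: g_def)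
    show "g w \<in> carrier V" if "w \<in> carrier W" for w using ex[OF that] gf by auto
    show "g (w \<oplus>\<^bsub>W\<^esub> w') = g w \<oplus>\<^bsub>V\<^esub> g w'" if w: "w \<in> carrier W" "w' \<in> carrier W" for w w'
    proof -
      obtain v v' where v: "v \<in> carrier V" "w = f v" and v': "v' \<in> carrier V" "w' = f v'"
        using ex[OF w(1)] ex[OF w(2)] by blast
      then show ?thesis
        using gf[OF v(1)] gf[OF v'(1)] gf[of "v \<oplus>\<^bsub>V\<^esub> v'"] f_simps(2)[OF v(1) v'(1)] by simp
    qed
    show "g (ract W w a) = ract V (g w) a" if w: "w \<in> carrier W" and a: "a \<in> carrier A" for w a
    proof -
      obtain v where v: "v \<in> carrier V" "w = f v" using ex[OF w] by blast
      then show ?thesis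
        using gf[OF v(1)] gf[OF V.ract_closed[OF v(1) a]] f_simps(3)[OF v(1) a] by simp
    qed
  qed
  note gA = ktensor_map_id_right[OF W.kmod_module V.kmod_module V.A_module
      rmod_hom_klinear[OF W.alg_right_module_axioms V.alg_right_module_axioms g]]
  have "\<rho> (g w) = W.sw V.MA (\<lambda>w b. V.tens (g w) b) (\<rho>' w)" if w: "w \<in> carrier W" for w
  proof -
    obtain v where v: "v \<in> carrier V" "w = f v" using ex[OF w] by blast
    have "W.sw V.MA (\<lambda>w b. V.tens (g w) b) (\<rho>' (f v)) = V.sw V.MA (\<lambda>w b. V.tens (g (f w)) b) (\<rho> v)"
      by (rule sw_f[OF V.MA_abelian gA(4) v(1)])
    also have "\<dots> = V.sw V.MA (\<lambda>w b. V.tens w b) (\<rho> v)"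
      by (rule V.sw_cong) (simp add: gf)
    finally show ?thesis using v gf by (simp add: V.rho_eq_sw)
  qed
  then show "preserves_coaction k A (W, \<rho>') (V, \<rho>) g"
    using preserves_coaction_alt[OF W.alg_right_module_axioms V.alg_right_module_axioms g] by simp
  show "compose (carrier V) g f = (\<lambda>v\<in>carrier V. v)"
    using gf unfolding compose_def by (intro restrict_ext) auto
  have "f (g w) = w" if "w \<in> carrier W" for w
    using ex[OF that] by (auto simp: gf)
  then show "compose (carrier W) f g = (\<lambda>w\<in>carrier W. w)"
    unfolding compose_def by (intro restrict_ext)
qed

lemma comodule_category_simps [simp]:
  "Obj (comodule_category k A) = {(V, \<rho>). V \<in> right_modules A \<and> \<rho> \<in> coactions k A V}"
  "Hom (comodule_category k A) (V, \<rho>) (W, \<sigma>) = {f \<in> rmod_hom A V W. preserves_coaction k A (V, \<rho>) (W, \<sigma>) f}"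
  "Cmp (comodule_category k A) Q R S g f = compose (carrier (fst Q)) g f"
  "Idn (comodule_category k A) Q = (\<lambda>x\<in>carrier (fst Q). x)"
  by (simp_all add: comodule_category_def)

lemma module_category_simps [simp]:
  "Obj (module_category k) = {M. Module.module k M}"
  "Hom (module_category k) = klinear k"
  "Cmp (module_category k) Q R S g f = compose (carrier Q) g f"
  "Idn (module_category k) Q = (\<lambda>x\<in>carrier Q. x)"
  by (simp_all add: module_category_def)

section \<open>Comodules induced from modules over the ground ring\<close>

context alg
begin

definition ind :: "('k, 'u) module \<Rightarrow> 'u rmod" where
  "ind N = \<lparr> carrier = carrier (ktensor k N A), mult = undefined, one = undefined,
     ring.zero = ring.zero (ktensor k N A), ring.add = ring.add (ktensor k N A),
     ract = (\<lambda>t\<in>carrier (ktensor k N A). \<lambda>c\<in>carrier A.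
       klift k N A (ktensor k N A) (\<lambda>n b. ktens k N A n (b \<otimes>\<^bsub>A\<^esub> c)) t) \<rparr>"

text \<open>The coaction n \<otimes> a -> (n \<otimes> 1) \<otimes> a. The target is built from
  \<open>kmod A (ind N)\<close>, as \<open>coactions\<close> requires, and not from
  \<open>ktensor k N A\<close>.\<close>

definition indco :: "('k, 'u) module \<Rightarrow> 'u \<Rightarrow> 'u" where
  "indco N = klift k N A (ktensor k (kmod A (ind N)) A)
     (\<lambda>n a. ktens k (kmod A (ind N)) A (ktens k N A n \<one>\<^bsub>A\<^esub>) a)"

lemma ind_simps [simp]:
  "carrier (ind N) = carrier (ktensor k N A)" "ring.add (ind N) = ring.add (ktensor k N A)"
  "ring.zero (ind N) = ring.zero (ktensor k N A)"
  by (simp_all add: ind_def)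

context
  fixes N :: "('k, 'u) module"
  assumes N [simp]: "Module.module k N"
begin

abbreviation NA where "NA \<equiv> ktensor k N A"
abbreviation tN where "tN n a \<equiv> ktens k N A n a"

lemma NA_module [simp]: "Module.module k NA" by (simp add: ktensor_module)
lemma NA_abelian [simp]: "abelian_group NA" by (simp add: ktensor_abelian_group)

lemma ind_bal: "c \<in> carrier A \<Longrightarrow> kbalanced k N A NA (\<lambda>n b. tN n (b \<otimes>\<^bsub>A\<^esub> c))"
  by (rule kbalancedI) (simp_all add: tA_simps)

lemma ind_ract: "\<lbrakk>t \<in> carrier NA; c \<in> carrier A\<rbrakk> \<Longrightarrow> ract (ind N) t c = klift k N A NA (\<lambda>n b. tN n (b \<otimes>\<^bsub>A\<^esub> c)) t"
  by (simp add: ind_def)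

lemma ind_ract_tN [simp]:
  "\<lbrakk>n \<in> carrier N; b \<in> carrier A; c \<in> carrier A\<rbrakk> \<Longrightarrow> ract (ind N) (tN n b) c = tN n (b \<otimes>\<^bsub>A\<^esub> c)"
  by (simp add: ind_ract ind_bal)

lemma ind_ract_closed: "\<lbrakk>t \<in> carrier NA; c \<in> carrier A\<rbrakk> \<Longrightarrow> ract (ind N) t c \<in> carrier NA"
  by (simp add: ind_ract ind_bal)

lemma ind_ract_add:
  assumes "s \<in> carrier NA" "t \<in> carrier NA" "c \<in> carrier A"
  shows "ract (ind N) (s \<oplus>\<^bsub>NA\<^esub> t) c = ract (ind N) s c \<oplus>\<^bsub>NA\<^esub> ract (ind N) t c"
proof -
  have "s \<oplus>\<^bsub>NA\<^esub> t \<in> carrier NA"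
    using assms abelian_monoid.a_closed[OF abelian_group.axioms(1)[OF NA_abelian]] by blast
  then show ?thesis using assms by (simp add: ind_ract ind_bal klift_add)
qed

lemma ind_right_module: "ind N \<in> right_modules A"
proof -
  note cl = ind_ract_closed ind_ract_add
  note add4 = abelian_monoid.add_add_comm[OF abelian_group.axioms(1)[OF NA_abelian]]
  have ab: "abelian_group (ind N)"
    using NA_abelian abelian_group_cong[of "ind N" NA] by simp
  have "right_module_axioms A (ind N)"
  proof (rule right_module_axioms.intro, unfold ind_simps, goal_cases)
    case (3 t a b)
    show ?case
      by (rule ktensor_induct[OF N A_mod 3(1)]) (use 3 in \<open>simp_all add: tA_simps cl add4\<close>)
  next
    case (4 t a b)
    show ?case
      by (rule ktensor_induct[OF N A_mod 4(1)]) (use 4 in \<open>simp_all add: m_assoc cl\<close>)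
  next
    case (5 t)
    show ?case
      by (rule ktensor_induct[OF N A_mod 5]) (simp_all add: cl)
  qed (simp_all add: cl)
  then have rm: "right_module A (ind N)"
    using ab by (simp add: right_module_def ring_axioms)
  have "ract (ind N) \<in> carrier (ind N) \<rightarrow>\<^sub>E carrier A \<rightarrow>\<^sub>E carrier (ind N)"
    by (intro PiE_I; use ind_ract_closed in \<open>auto simp: ind_def\<close>)
  then show ?thesis
    using rm ktensor_add_PiE[OF N A_mod] by (simp add: right_modules_def normal_rmod_def) (simp add: ind_def)
qed

interpretation G: alg_right_module k A "ind N"
  by (rule right_modules_alg[OF assoc_algebra_axioms ind_right_module])

text \<open>N \<otimes> A carries scalars in two ways, from the tensor product and through its right
  action by A. They agree on the carrier because a scalar crosses the tensor sign.\<close>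

lemma ind_smult: "\<lbrakk>c \<in> carrier k; t \<in> carrier NA\<rbrakk> \<Longrightarrow> c \<odot>\<^bsub>kmod A (ind N)\<^esub> t = c \<odot>\<^bsub>NA\<^esub> t"
  unfolding ktensor_smult[OF N A_mod]
  by (simp add: G.kmod_smult ind_ract)
    (rule fun_cong[OF klift_cong], auto simp: ktens_balanced smult_mult_right)

lemma indco_bal: "kbalanced k N A G.MA (\<lambda>n a. G.tens (tN n \<one>\<^bsub>A\<^esub>) a)"
proof (rule kbalancedI)
  show "G.tens (tN (n \<oplus>\<^bsub>N\<^esub> n') \<one>\<^bsub>A\<^esub>) a = G.tens (tN n \<one>\<^bsub>A\<^esub>) a \<oplus>\<^bsub>G.MA\<^esub> G.tens (tN n' \<one>\<^bsub>A\<^esub>) a"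
    if "n \<in> carrier N" "n' \<in> carrier N" "a \<in> carrier A" for n n' a
    using that G.tens_add_left[of "tN n \<one>\<^bsub>A\<^esub>" "tN n' \<one>\<^bsub>A\<^esub>" a] by (simp add: ktens_add_left)
  show "G.tens (tN (c \<odot>\<^bsub>N\<^esub> n) \<one>\<^bsub>A\<^esub>) a = G.tens (tN n \<one>\<^bsub>A\<^esub>) (c \<odot>\<^bsub>A\<^esub> a)"
    if "n \<in> carrier N" "c \<in> carrier k" "a \<in> carrier A" for n c a
    using that by (simp add: ktens_smult_left ktens_smult_right ind_smult[symmetric])
qed (simp_all add: ktens_add_right)

lemma indco_tN: "\<lbrakk>n \<in> carrier N; a \<in> carrier A\<rbrakk> \<Longrightarrow> indco N (tN n a) = G.tens (tN n \<one>\<^bsub>A\<^esub>) a"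
  by (simp add: indco_def indco_bal)

lemma indco_addhom: "indco N \<in> addhom NA G.MA"
  unfolding indco_def by (rule klift_addhom) (simp_all add: indco_bal)

lemmas indco_closed = addhom_closed[OF indco_addhom] and indco_add = addhom_add[OF indco_addhom]

lemma indco_klinear: "indco N \<in> klinear k (kmod A (ind N)) G.MA"
proof (rule klinearI)
  show "indco N \<in> extensional (carrier (kmod A (ind N)))"
    using klift_extensional[OF N A_mod G.MA_abelian indco_bal] by (simp add: indco_def)
  fix c t assume c: "c \<in> carrier k" and "t \<in> carrier (kmod A (ind N))"
  then have t: "t \<in> carrier NA" by simp
  have "indco N \<in> klinear k NA G.MA"
    unfolding indco_def
    by (rule klift_klinear) (simp_all add: indco_bal ktens_balanced[symmetric] ktens_smult_left ind_smult[symmetric])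
  then show "indco N (c \<odot>\<^bsub>kmod A (ind N)\<^esub> t) = c \<odot>\<^bsub>G.MA\<^esub> indco N t"
    using c t by (simp add: ind_smult klinearD(5))
qed (simp_all add: indco_closed indco_add)

lemma sw_indco_addhom:
  assumes "abelian_group Z" "G.bal Z \<phi>"
  shows "(\<lambda>t. G.sw Z \<phi> (indco N t)) \<in> addhom NA Z"
  using hom_compose[OF indco_addhom klift_addhom[OF G.kmod_module A_mod assms]] by (simp add: o_def)

lemma sw_indco_tN:
  assumes "abelian_group Z" "G.bal Z \<phi>" "n \<in> carrier N" "a \<in> carrier A"
  shows "G.sw Z \<phi> (indco N (tN n a)) = \<phi> (tN n \<one>\<^bsub>A\<^esub>) a"
  using assms by (simp add: indco_tN)

text \<open>Every axiom is additive in the tensor and is checked at n \<otimes> a; for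
  coassociativity both sides are ((n \<otimes> 1) \<otimes> 1) \<otimes> a.\<close>

lemma indco_coaction: "indco N \<in> coactions k A (ind N)"
  unfolding coactions_def Let_def
proof (intro CollectI conjI ballI indco_klinear, unfold ind_simps)
  note eqI = ktensor_addhom_eqI[OF N A_mod]
  fix t assume t: "t \<in> carrier NA"
  show "G.sw (ind N) (\<lambda>w a. ract (ind N) w a) (indco N t) = t"
    using t
  proof (rule eqI[where g = "\<lambda>t. t"])
    show "(\<lambda>t. G.sw (ind N) (\<lambda>w a. ract (ind N) w a) (indco N t)) \<in> addhom NA (ind N)"
      by (rule sw_indco_addhom) simp_all
    show "(\<lambda>t. t) \<in> addhom NA (ind N)" by (rule addhomI) simp_all
  qed (simp add: indco_tN)
  have b1: "G.bal G.MAA (\<lambda>w a. ktens k G.MA A (indco N w) a)"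
    by (rule G.balI)
      (use klinearD(4,5)[OF indco_klinear] in \<open>simp_all add: indco_closed ktens_add_left ktens_add_right ktens_balanced\<close>)
  have b2: "G.bal G.MAA (\<lambda>w a. ktens k G.MA A (G.tens w \<one>\<^bsub>A\<^esub>) a)"
    by (rule G.balI) (use G.tens_add_left in \<open>simp_all add: ktens_add_left ktens_add_right ktens_smult_left ktens_smult_right\<close>)
  show "G.sw G.MAA (\<lambda>w a. ktens k G.MA A (indco N w) a) (indco N t) =
      G.sw G.MAA (\<lambda>w a. ktens k G.MA A (G.tens w \<one>\<^bsub>A\<^esub>) a) (indco N t)"
    using t by (rule eqI[OF _ sw_indco_addhom[OF _ b1] sw_indco_addhom[OF _ b2]])
      (simp_all add: sw_indco_tN b1 b2 indco_tN)
  fix a assume a: "a \<in> carrier A"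
  have "(\<lambda>t. ract (ind N) t a) \<in> addhom NA NA"
    by (rule addhomI) (use a in \<open>simp_all add: ind_ract_closed ind_ract_add\<close>)
  from hom_compose[OF this indco_addhom]
  have h: "(\<lambda>t. indco N (ract (ind N) t a)) \<in> addhom NA G.MA" by (simp add: o_def)
  show "indco N (ract (ind N) t a) = G.sw G.MA (\<lambda>w b. G.tens w (b \<otimes>\<^bsub>A\<^esub> a)) (indco N t)"
    using t by (rule eqI[OF _ h sw_indco_addhom])
      (use a in \<open>simp_all add: indco_tN\<close>)
qed

lemma ind_coaction: "coaction k A (ind N) (indco N)"
  by (rule comodule_coaction[OF assoc_algebra_axioms ind_right_module indco_coaction])

interpretation G: coaction k A "ind N" "indco N" by (rule ind_coaction)

definition eta :: "'u \<Rightarrow> 'u" where "eta = (\<lambda>n\<in>carrier N. tN n \<one>\<^bsub>A\<^esub>)"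

lemma eta_eq: "n \<in> carrier N \<Longrightarrow> eta n = tN n \<one>\<^bsub>A\<^esub>"
  by (simp add: eta_def)

lemma eta_klinear: "eta \<in> klinear k N (kmod A (ind N))"
proof -
  interpret N: Module.module k N by (rule N)
  show ?thesis
    by (rule klinearI) (simp_all add: eta_def ktens_add_left ktens_smult_left ind_smult)
qed

lemma eta_coinv: "n \<in> carrier N \<Longrightarrow> eta n \<in> carrier G.coinv"
  by (simp add: eta_def G.coinv_carrier indco_tN)

text \<open>This uses that exactness is reflected. Tensored with A, the sequence N -> N \<otimes> A
  -> (N \<otimes> A) \<otimes> A becomes the split sequence of the induced comodule, which is exact;
  so the original sequence is exact, and its kernel consists of the coinvariants. Injectivity
  descends likewise, since a coaction is injective.\<close>

lemma eta_bij:
  assumes flat: "faithfully_flat k A"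
  shows "bij_betw eta (carrier N) (carrier G.coinv)"
proof -
  note eA = ktensor_map_id_right[OF N G.kmod_module A_mod eta_klinear]
  let ?eA = "ktensor_map k N (kmod A (ind N)) A A eta (\<lambda>a. a)"
  \<comment> \<open>Tensoring \<open>eta\<close> with A gives the induced coaction itself, as both
    take n \<otimes> a to (n \<otimes> 1) \<otimes> a.\<close>
  have eq: "?eA t = indco N t" if t: "t \<in> carrier NA" for t
    by (rule ktensor_addhom_eqI[OF N A_mod t klinearD(1)[OF eA(1)] indco_addhom])
      (use eA(2) in \<open>simp add: indco_tN eta_eq\<close>)
  have "exact_at N (kmod A (ind N)) G.MA eta G.dif \<longleftrightarrow> exact_at NA G.MA G.MAA ?eA G.difA"
    using flat N G.kmod_module G.MA_module eta_klinear G.dif_klinear unfolding faithfully_flat_def by blast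
  moreover have "?eA ` carrier NA = indco N ` carrier NA"
    using eq by (rule image_cong[OF refl])
  ultimately have img: "eta ` carrier N = {t \<in> carrier NA. G.dif t = \<zero>\<^bsub>G.MA\<^esub>}"
    using G.rho_image by (simp add: exact_at_def)
  have "\<forall>t\<in>carrier NA. ?eA t = \<zero>\<^bsub>G.MA\<^esub> \<longrightarrow> t = \<zero>\<^bsub>NA\<^esub>"
  proof (intro ballI impI)
    fix t assume t: "t \<in> carrier NA" and t0: "?eA t = \<zero>\<^bsub>G.MA\<^esub>"
    have z: "\<zero>\<^bsub>NA\<^esub> \<in> carrier NA"
      using abelian_monoid.zero_closed[OF abelian_group.axioms(1)[OF NA_abelian]] .
    have "indco N t = indco N \<zero>\<^bsub>NA\<^esub>"
      unfolding eq[OF t, symmetric] t0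
      by (rule addhom_zero[OF NA_abelian G.MA_abelian indco_addhom, symmetric])
    then show "t = \<zero>\<^bsub>NA\<^esub>"
      by (rule G.rho_injective[unfolded ind_simps, OF t z])
  qed
  then have ker: "\<forall>n\<in>carrier N. eta n = \<zero>\<^bsub>kmod A (ind N)\<^esub> \<longrightarrow> n = \<zero>\<^bsub>N\<^esub>"
    unfolding flat_injective[OF flat N G.kmod_module eta_klinear] by simp
  have "inj_on eta (carrier N)"
    by (rule addhom_inj_on[OF module_abelian_group[OF N] module_abelian_group[OF G.kmod_module] klinearD(1)[OF eta_klinear]])
      (use ker in blast)
  moreover have "eta ` carrier N = carrier G.coinv"
    unfolding img using G.dif_zero by (auto simp: G.coinv_carrier)
  ultimately show ?thesis by (simp add: bij_betw_def)
qed

end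

section \<open>Functoriality of induction and of coinvariants\<close>

abbreviation tmap where "tmap N N' h \<equiv> ktensor_map k N N' A A h (\<lambda>a. a)"

lemma ktensor_klinear_eqI:
  assumes "Module.module k N" "f \<in> extensional (carrier (ktensor k N A))" "g \<in> extensional (carrier (ktensor k N A))"
    and "f \<in> addhom (ktensor k N A) Z" "g \<in> addhom (ktensor k N A) Z"
    and "\<And>n a. \<lbrakk>n \<in> carrier N; a \<in> carrier A\<rbrakk> \<Longrightarrow> f (ktens k N A n a) = g (ktens k N A n a)"
  shows "f = g"
  by (rule extensionalityI[OF assms(2,3)]) (rule ktensor_addhom_eqI[OF assms(1) A_mod _ assms(4,5,6)])

lemma tmap_hom:
  assumes N: "Module.module k N" and N': "Module.module k N'" and h: "h \<in> klinear k N N'"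
  shows "tmap N N' h \<in> rmod_hom A (ind N) (ind N')"
    and "preserves_coaction k A (ind N, indco N) (ind N', indco N') (tmap N N' h)"
proof -
  interpret G: coaction k A "ind N" "indco N" by (rule ind_coaction[OF N])
  interpret G': coaction k A "ind N'" "indco N'" by (rule ind_coaction[OF N'])
  note tm = ktensor_map_id_right[OF N N' A_mod h]
  note tc = klinearD(3)[OF tm(1)] and ta = klinearD(4)[OF tm(1)]
  show r: "tmap N N' h \<in> rmod_hom A (ind N) (ind N')"
  proof (rule rmod_homI, unfold ind_simps)
    fix t a assume t: "t \<in> carrier (ktensor k N A)" and a: "a \<in> carrier A"
    show "tmap N N' h (ract (ind N) t a) = ract (ind N') (tmap N N' h t) a"
      by (rule ktensor_induct[OF N A_mod t])
        (use a N N' tm(2) klinearD(3)[OF h] tc ta in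
          \<open>simp_all add: ind_ract_closed ind_ract_add\<close>)
  qed (use klinearD(2)[OF tm(1)] tc ta in simp_all)
  note rA = ktensor_map_id_right[OF G.kmod_module G'.kmod_module A_mod
      rmod_hom_klinear[OF G.alg_right_module_axioms G'.alg_right_module_axioms r]]
  have "indco N' (tmap N N' h t) = G.sw G'.MA (\<lambda>w b. G'.tens (tmap N N' h w) b) (indco N t)"
    if t: "t \<in> carrier (ktensor k N A)" for t
  proof (rule ktensor_addhom_eqI[OF N A_mod t])
    show "(\<lambda>t. indco N' (tmap N N' h t)) \<in> addhom (ktensor k N A) G'.MA"
      using hom_compose[OF klinearD(1)[OF tm(1)] indco_addhom[OF N']] by (simp add: o_def)
    show "(\<lambda>t. G.sw G'.MA (\<lambda>w b. G'.tens (tmap N N' h w) b) (indco N t)) \<in> addhom (ktensor k N A) G'.MA"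
      by (rule sw_indco_addhom[OF N G'.MA_abelian rA(4)])
    fix n a assume n: "n \<in> carrier N" and a: "a \<in> carrier A"
    show "indco N' (tmap N N' h (ktens k N A n a)) =
        G.sw G'.MA (\<lambda>w b. G'.tens (tmap N N' h w) b) (indco N (ktens k N A n a))"
      using n a klinearD(3)[OF h n]
      by (simp add: sw_indco_tN[OF N G'.MA_abelian rA(4)] tm(2) indco_tN[OF N'])
  qed
  then show "preserves_coaction k A (ind N, indco N) (ind N', indco N') (tmap N N' h)"
    using preserves_coaction_alt[OF G.alg_right_module_axioms G'.alg_right_module_axioms r] by simp
qed

lemma tmap_id:
  assumes N: "Module.module k N"
  shows "tmap N N (\<lambda>n\<in>carrier N. n) = (\<lambda>t\<in>carrier (ktensor k N A). t)"
proof -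
  interpret N: Module.module k N by (rule N)
  have h: "(\<lambda>n\<in>carrier N. n) \<in> klinear k N N" by (rule klinearI) auto
  note tm = ktensor_map_id_right[OF N N A_mod h]
  show ?thesis
  proof (rule ktensor_klinear_eqI[OF N klinearD(2)[OF tm(1)] _ klinearD(1)[OF tm(1)]])
    interpret NA: Module.module k "ktensor k N A" by (rule NA_module[OF N])
    show "(\<lambda>t\<in>carrier (ktensor k N A). t) \<in> addhom (ktensor k N A) (ktensor k N A)"
      by (rule addhomI) simp_all
  qed (use N in \<open>simp_all add: tm(2)\<close>)
qed

lemma tmap_comp:
  assumes N: "Module.module k N" and N': "Module.module k N'" and N'': "Module.module k N''"
    and h: "h \<in> klinear k N N'" and g: "g \<in> klinear k N' N''"
  shows "tmap N N'' (compose (carrier N) g h) = compose (carrier (ktensor k N A)) (tmap N' N'' g) (tmap N N' h)"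
proof -
  interpret N: Module.module k N by (rule N)
  interpret NA: Module.module k "ktensor k N A" by (rule NA_module[OF N])
  have gh: "compose (carrier N) g h \<in> klinear k N N''"
    by (rule klinearI) (use klinearD[OF h] klinearD[OF g] in \<open>simp_all add: compose_def\<close>)
  note th = ktensor_map_id_right[OF N N' A_mod h] and tg = ktensor_map_id_right[OF N' N'' A_mod g]
    and tgh = ktensor_map_id_right[OF N N'' A_mod gh]
  show ?thesis
  proof (rule ktensor_klinear_eqI[OF N klinearD(2)[OF tgh(1)] _ klinearD(1)[OF tgh(1)]])
    show "compose (carrier (ktensor k N A)) (tmap N' N'' g) (tmap N N' h) \<in> addhom (ktensor k N A) (ktensor k N'' A)"
      by (rule addhomI) (use klinearD(3,4)[OF th(1)] klinearD(3,4)[OF tg(1)] in \<open>simp_all add: compose_def\<close>)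
    show "tmap N N'' (compose (carrier N) g h) (ktens k N A n a) =
        compose (carrier (ktensor k N A)) (tmap N' N'' g) (tmap N N' h) (ktens k N A n a)"
      if "n \<in> carrier N" "a \<in> carrier A" for n a
      using that N klinearD(3)[OF h] by (simp add: tgh(2) th(2) tg(2) compose_eq)
  qed simp
qed

lemma coinv_hom:
  assumes V: "coaction k A V \<rho>" and W: "coaction k A W \<sigma>"
    and f: "f \<in> rmod_hom A V W" "preserves_coaction k A (V, \<rho>) (W, \<sigma>) f"
  shows "(\<lambda>v\<in>carrier (coaction.coinv k A V \<rho>). f v) \<in> klinear k (coaction.coinv k A V \<rho>) (coaction.coinv k A W \<sigma>)"
proof -
  interpret coaction_hom k A V \<rho> W \<sigma> f
    using V W f by (simp add: coaction_hom_def coaction_hom_axioms_def)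
  interpret C: Module.module k V.coinv by (rule V.coinv_module)
  have fc: "f v \<in> carrier W.coinv" if v: "v \<in> carrier V.coinv" for v
  proof -
    have v: "v \<in> carrier V" "\<rho> v = V.tens v \<one>\<^bsub>A\<^esub>" using v by (simp_all add: V.coinv_carrier)
    have "\<sigma> (f v) = W.sw W.MA (\<lambda>w b. W.tens w b) (\<sigma> (f v))"
      using v by (simp add: W.rho_eq_sw f_simps)
    also have "\<dots> = V.sw W.MA (\<lambda>w b. W.tens (f w) b) (V.tens v \<one>\<^bsub>A\<^esub>)"
      using sw_f[OF W.MA_abelian ktens_is_balanced[OF W.kmod_module W.A_module] v(1)] v by simp
    also have "\<dots> = W.tens (f v) \<one>\<^bsub>A\<^esub>"
      using v bal_f[OF ktens_is_balanced[OF W.kmod_module W.A_module]] by simp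
    finally show ?thesis using v by (simp add: W.coinv_carrier f_simps)
  qed
  have sub: "v \<in> carrier V" if "v \<in> carrier V.coinv" for v using that by (simp add: V.coinv_carrier)
  show ?thesis
  proof (rule klinearI)
    fix v w assume v: "v \<in> carrier V.coinv" and w: "w \<in> carrier V.coinv"
    have "v \<oplus>\<^bsub>V\<^esub> w \<in> carrier V.coinv" using C.add.m_closed[OF v w] by simp
    then show "(\<lambda>v\<in>carrier V.coinv. f v) (v \<oplus>\<^bsub>V.coinv\<^esub> w) =
        (\<lambda>v\<in>carrier V.coinv. f v) v \<oplus>\<^bsub>W.coinv\<^esub> (\<lambda>v\<in>carrier V.coinv. f v) w"
      using v w sub by (simp add: f_simps)
  next
    fix c v assume c: "c \<in> carrier k" and v: "v \<in> carrier V.coinv"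
    have "c \<odot>\<^bsub>kmod A V\<^esub> v \<in> carrier V.coinv" using C.smult_closed[OF c v] by (simp add: V.coinv_smult)
    then show "(\<lambda>v\<in>carrier V.coinv. f v) (c \<odot>\<^bsub>V.coinv\<^esub> v) = c \<odot>\<^bsub>W.coinv\<^esub> (\<lambda>v\<in>carrier V.coinv. f v) v"
      using c v sub by (simp add: f_smult V.coinv_smult W.coinv_smult)
  qed (simp_all add: fc)
qed

text \<open>For coinvariant w right linearity of \<rho> gives \<rho>(w a) = w \<otimes> a, and the
  induced coaction of w \<otimes> a, mapped along the counit, is the same element.\<close>

lemma eps_hom:
  assumes "coaction k A V \<rho>"
  shows "coaction.eps k A V \<rho> \<in> rmod_hom A (ind (coaction.coinv k A V \<rho>)) V"
    and "preserves_coaction k A (ind (coaction.coinv k A V \<rho>), indco (coaction.coinv k A V \<rho>)) (V, \<rho>) (coaction.eps k A V \<rho>)"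
proof -
  interpret V: coaction k A V \<rho> by fact
  let ?C = "V.coinv"
  note C = V.coinv_module
  interpret G: coaction k A "ind ?C" "indco ?C" by (rule ind_coaction[OF C])
  note ec = addhom_closed[OF V.eps_addhom] and ea = addhom_add[OF V.eps_addhom]
  have sub: "v \<in> carrier V" "\<rho> v = V.tens v \<one>\<^bsub>A\<^esub>" if "v \<in> carrier ?C" for v
    using that by (simp_all add: V.coinv_carrier)
  show r: "V.eps \<in> rmod_hom A (ind ?C) V"
  proof (rule rmod_homI, unfold ind_simps)
    fix t a assume t: "t \<in> carrier V.CA" and a: "a \<in> carrier A"
    show "V.eps (ract (ind ?C) t a) = ract V (V.eps t) a"
      by (rule ktensor_induct[OF C A_mod t])
        (use a sub ec ea in \<open>simp_all add: ind_ract_closed ind_ract_add V.eps_tens V.ract_mult V.ract_add_left\<close>)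
  qed (use V.eps_extensional ec ea in simp_all)
  note rA = ktensor_map_id_right[OF G.kmod_module V.kmod_module A_mod
      rmod_hom_klinear[OF G.alg_right_module_axioms V.alg_right_module_axioms r]]
  have "\<rho> (V.eps t) = G.sw V.MA (\<lambda>w b. V.tens (V.eps w) b) (indco ?C t)"
    if t: "t \<in> carrier V.CA" for t
  proof (rule ktensor_addhom_eqI[OF C A_mod t])
    have "\<rho> \<in> addhom V V.MA" by (rule addhomI) (simp_all add: V.rho_add)
    from hom_compose[OF V.eps_addhom this]
    show "(\<lambda>t. \<rho> (V.eps t)) \<in> addhom V.CA V.MA" by (simp add: o_def)
    show "(\<lambda>t. G.sw V.MA (\<lambda>w b. V.tens (V.eps w) b) (indco ?C t)) \<in> addhom V.CA V.MA"
      by (rule sw_indco_addhom[OF C V.MA_abelian rA(4)])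
    fix n a assume n: "n \<in> carrier ?C" and a: "a \<in> carrier A"
    then show "\<rho> (V.eps (ktens k ?C A n a)) = G.sw V.MA (\<lambda>w b. V.tens (V.eps w) b) (indco ?C (ktens k ?C A n a))"
      using sub[OF n]
      by (simp add: sw_indco_tN[OF C V.MA_abelian rA(4)] V.eps_tens V.ract_one V.rho_ract)
  qed
  then show "preserves_coaction k A (ind ?C, indco ?C) (V, \<rho>) V.eps"
    using preserves_coaction_alt[OF G.alg_right_module_axioms V.alg_right_module_axioms r] by simp
qed

end

text \<open>Starting from modules, the unit N -> coinvariants of N \<otimes> A and the counit
  (coinvariants of V) \<otimes> A -> V have the directions that \<open>equivalent_categories\<close>
  prescribes, so neither has to be inverted.\<close>

theorem flat_descent_equivalence:
  fixes k :: "('k, 'c) ring_scheme" and A :: "('k, 'u::infinite) module"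
  assumes A: "assoc_algebra k A" and flat: "faithfully_flat k A"
  shows "equivalent_categories (module_category k :: (('k, 'u) module, 'u \<Rightarrow> 'u) cat) (comodule_category k A)"
proof -
  interpret alg k A using A by (simp add: alg_def)
  let ?M = "module_category k :: (('k, 'u) module, 'u \<Rightarrow> 'u) cat" and ?C = "comodule_category k A"
  let ?Go = "\<lambda>N. (ind N, indco N)" and ?Gm = "\<lambda>N N' h. tmap N N' h"
  let ?Fo = "\<lambda>(V, \<rho>). coaction.coinv k A V \<rho>"
  let ?Fm = "\<lambda>Q S f. \<lambda>v\<in>carrier (?Fo Q). f v"
  note co = comodule_coaction[OF assoc_algebra_axioms]
  have G: "cat_functor ?M ?C ?Go ?Gm"
    unfolding cat_functor_def cat_functor_axioms_def
    by (simp add: module_category comodule_category A ind_right_module indco_coaction tmap_hom tmap_id tmap_comp)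
  have F: "cat_functor ?C ?M ?Fo ?Fm"
  proof (intro cat_functor.intro cat_functor_axioms.intro module_category comodule_category A)
    show "?Fo Q \<in> Obj ?M" if "Q \<in> Obj ?C" for Q
      using that co by (auto simp: coaction.coinv_module)
    show "?Fm Q S f \<in> Hom ?M (?Fo Q) (?Fo S)" if "Q \<in> Obj ?C" "S \<in> Obj ?C" "f \<in> Hom ?C Q S" for Q S f
      using that by (auto intro!: coinv_hom co)
    show "?Fm Q Q (Idn ?C Q) = Idn ?M (?Fo Q)" if "Q \<in> Obj ?C" for Q
      using that co by (auto simp: coaction.coinv_carrier intro!: restrict_ext)
    show "?Fm Q T (Cmp ?C Q S T g f) = Cmp ?M (?Fo Q) (?Fo S) (?Fo T) (?Fm S T g) (?Fm Q S f)"
      if Q: "Q \<in> Obj ?C" and S: "S \<in> Obj ?C" and f: "f \<in> Hom ?C Q S" for Q S T f g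
    proof -
      obtain V \<rho> W \<sigma> where QS: "Q = (V, \<rho>)" "S = (W, \<sigma>)" by (cases Q, cases S)
      have V: "coaction k A V \<rho>" and W: "coaction k A W \<sigma>" using Q S co by (auto simp: QS)
      have f': "f v \<in> carrier (coaction.coinv k A W \<sigma>)" if "v \<in> carrier (coaction.coinv k A V \<rho>)" for v
        using klinearD(3)[OF coinv_hom[OF V W, of f] that] f that by (simp add: QS)
      show ?thesis
        using f' coaction.coinv_carrier[OF V] by (auto simp: QS compose_def intro!: restrict_ext)
    qed
  qed
  have eta: "natural_isomorphism ?M ?M (\<lambda>N. N) (\<lambda>N N' h. h) (\<lambda>N. ?Fo (?Go N))
      (\<lambda>N N' h. ?Fm (?Go N) (?Go N') (?Gm N N' h)) eta"
    unfolding natural_isomorphism_def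
  proof (intro conjI ballI)
    fix N assume "N \<in> Obj ?M"
    then have N: "Module.module k N" by simp
    interpret G: coaction k A "ind N" "indco N" by (rule ind_coaction[OF N])
    have "eta N \<in> klinear k N G.coinv"
      using eta_klinear[OF N] eta_coinv[OF N] klinearD[OF eta_klinear[OF N]]
      by (intro klinearI) (simp_all add: G.coinv_smult)
    from klinear_iso_arrow[OF N G.coinv_module this eta_bij[OF N flat]]
    show "iso_arrow ?M N (?Fo (?Go N)) (eta N)" by simp
  next
    fix N N' h assume "N \<in> Obj ?M" "N' \<in> Obj ?M" "h \<in> Hom ?M N N'"
    then have N: "Module.module k N" and N': "Module.module k N'" and h: "h \<in> klinear k N N'" by simp_all
    have "tmap N N' h (eta N n) = eta N' (h n)" if "n \<in> carrier N" for n
      using that klinearD(3)[OF h that] ktensor_map_ktens[OF N N' A_mod h that, of "\<one>\<^bsub>A\<^esub>"]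
      by (simp add: eta_eq[OF N] eta_eq[OF N'])
    then show "Cmp ?M N (?Fo (?Go N)) (?Fo (?Go N')) (?Fm (?Go N) (?Go N') (?Gm N N' h)) (eta N) =
        Cmp ?M N N' (?Fo (?Go N')) (eta N') h"
      using eta_coinv[OF N] by (auto simp: compose_def intro!: restrict_ext)
  qed
  have eps: "natural_isomorphism ?C ?C (\<lambda>Q. ?Go (?Fo Q)) (\<lambda>Q S f. ?Gm (?Fo Q) (?Fo S) (?Fm Q S f))
      (\<lambda>Q. Q) (\<lambda>Q S f. f) (\<lambda>(V, \<rho>). coaction.eps k A V \<rho>)"
    unfolding natural_isomorphism_def
  proof (intro conjI ballI)
    fix Q assume "Q \<in> Obj ?C"
    then obtain V \<rho> where Q: "Q = (V, \<rho>)" and V: "V \<in> right_modules A" "\<rho> \<in> coactions k A V" by auto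
    interpret V: coaction k A V \<rho> by (rule co[OF V])
    interpret e: coaction_hom k A "ind V.coinv" "indco V.coinv" V \<rho> V.eps
      by (simp add: coaction_hom_def coaction_hom_axioms_def V.coaction_axioms ind_coaction
          eps_hom[OF V.coaction_axioms])
    have "bij_betw V.eps (carrier (ind V.coinv)) (carrier V)"
      using V.eps_bij[OF flat] by simp
    from e.inverse_hom[OF this] e.hom e.pres
    have "iso_arrow ?C (ind V.coinv, indco V.coinv) (V, \<rho>) V.eps"
      unfolding iso_arrow_def inverse_arrows_def by auto
    then show "iso_arrow ?C (?Go (?Fo Q)) Q ((\<lambda>(V, \<rho>). coaction.eps k A V \<rho>) Q)"
      by (simp add: Q)
  next
    fix Q S f assume "Q \<in> Obj ?C" "S \<in> Obj ?C" and f: "f \<in> Hom ?C Q S"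
    then obtain V \<rho> W \<sigma> where Q: "Q = (V, \<rho>)" and S: "S = (W, \<sigma>)"
      and V: "V \<in> right_modules A" "\<rho> \<in> coactions k A V" and W: "W \<in> right_modules A" "\<sigma> \<in> coactions k A W"
      by auto
    interpret V: coaction k A V \<rho> by (rule co[OF V])
    interpret W: coaction k A W \<sigma> by (rule co[OF W])
    have f: "f \<in> rmod_hom A V W" "preserves_coaction k A (V, \<rho>) (W, \<sigma>) f" using f by (simp_all add: Q S)
    let ?f = "\<lambda>v\<in>carrier V.coinv. f v"
    note fr = coinv_hom[OF V.coaction_axioms W.coaction_axioms f]
    note tm = ktensor_map_id_right[OF V.coinv_module W.coinv_module A_mod fr]
    have "f (V.eps t) = W.eps (tmap V.coinv W.coinv ?f t)" if t: "t \<in> carrier V.CA" for t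
    proof (rule ktensor_addhom_eqI[OF V.coinv_module A_mod t])
      show "(\<lambda>t. f (V.eps t)) \<in> addhom V.CA W"
        using hom_compose[OF V.eps_addhom rmod_homD(1)[OF f(1)]] by (simp add: o_def)
      show "(\<lambda>t. W.eps (tmap V.coinv W.coinv ?f t)) \<in> addhom V.CA W"
        using hom_compose[OF klinearD(1)[OF tm(1)] W.eps_addhom] by (simp add: o_def)
      fix v a assume v: "v \<in> carrier V.coinv" and a: "a \<in> carrier A"
      then have "v \<in> carrier V" by (simp add: V.coinv_carrier)
      then show "f (V.eps (ktens k V.coinv A v a)) = W.eps (tmap V.coinv W.coinv ?f (ktens k V.coinv A v a))"
        using v a klinearD(3)[OF fr v] by (simp add: V.eps_tens W.eps_tens tm(2) rmod_homD(5)[OF f(1)])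
    qed
    then show "Cmp ?C (?Go (?Fo Q)) Q S f ((\<lambda>(V, \<rho>). coaction.eps k A V \<rho>) Q) =
        Cmp ?C (?Go (?Fo Q)) (?Go (?Fo S)) S ((\<lambda>(V, \<rho>). coaction.eps k A V \<rho>) S)
          (?Gm (?Fo Q) (?Fo S) (?Fm Q S f))"
      by (auto simp: Q S compose_def intro!: restrict_ext)
  qed
  show ?thesis
    unfolding equivalent_categories_def using G F eta eps by blast
qed

theorem theorem2p10:
  fixes k :: "('k, 'c) ring_scheme"
    and A :: "('k, 'u::infinite) module"
  assumes "cring k" and "assoc_algebra k A"
  shows "isomorphic_categories (descent_category k A) (yetter_drinfeld_category k A) \<and>
         isomorphic_categories (yetter_drinfeld_category k A) (comodule_category k A) \<and>
         isomorphic_categories (comodule_category k A) (weak_right_center (bimod_moncat k A)) \<and>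
         isomorphic_categories (weak_right_center (bimod_moncat k A)) (right_center (bimod_moncat k A)) \<and>
         (faithfully_flat k A \<longrightarrow>
            equivalent_categories (descent_category k A) (module_category k :: (('k, 'u) module, 'u \<Rightarrow> 'u) cat) \<and>
            equivalent_categories (yetter_drinfeld_category k A) (module_category k :: (('k, 'u) module, 'u \<Rightarrow> 'u) cat) \<and>
            equivalent_categories (comodule_category k A) (module_category k :: (('k, 'u) module, 'u \<Rightarrow> 'u) cat) \<and>
            equivalent_categories (weak_right_center (bimod_moncat k A)) (module_category k :: (('k, 'u) module, 'u \<Rightarrow> 'u) cat) \<and>
            equivalent_categories (right_center (bimod_moncat k A)) (module_category k :: (('k, 'u) module, 'u \<Rightarrow> 'u) cat))"
proof -
  note A = assms(2)
  note iso_trans = isomorphic_categories_trans and iso_sym = isomorphic_categories_sym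
  note YC = iso_sym[OF comodule_yetter_drinfeld_iso(1)[OF A]]
  note DY = iso_sym[OF yetter_drinfeld_descent_iso[OF A]]
  note CW = iso_trans[OF comodule_yetter_drinfeld_iso(1)[OF A] yetter_drinfeld_center_iso(1)[OF A]]
  \<comment> \<open>The two center categories coincide, so reflexivity is enough.\<close>
  have WR: "isomorphic_categories (weak_right_center (bimod_moncat k A)) (right_center (bimod_moncat k A))"
    unfolding yetter_drinfeld_center_iso(3)[OF A]
    by (rule isomorphic_categories_refl[OF yetter_drinfeld_center_iso(2)[OF A]])
  \<comment> \<open>Descent is established for comodules, where it takes its simplest form, and
    carried to the other four categories along the isomorphisms.\<close>
  have "equivalent_categories (comodule_category k A) (module_category k :: (('k, 'u) module, 'u \<Rightarrow> 'u) cat)"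
    if "faithfully_flat k A"
    by (rule equivalent_categories_sym[OF flat_descent_equivalence[OF A that]])
  note equiv = isomorphic_equivalent_categories[OF _ this]
  show ?thesis
    using YC DY CW WR equiv[OF iso_trans[OF DY YC]] equiv[OF YC] equiv[OF iso_sym[OF CW]]
      equiv[OF iso_sym[OF iso_trans[OF CW WR]]]
      equiv[OF isomorphic_categories_refl[OF comodule_category[OF A]]]
    by (intro conjI impI)
qed

end
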